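(* Let $0<p,\theta\le\infty$, $L\in\mathbb N$ with $L>1/p$ (where $L=1$ additionally requires $p<\infty$), and $\mathbf r\in\mathbb R^d$ with $\mathbf r>1/p$ componentwise. Then for all $f\in S^{\mathbf r}_{p,\theta}B(\mathbb T^d)$ $$\|f|S^{\mathbf r}_{p,\theta}B(\mathbb T^d)\|\asymp\Big(\sum_{\mathbf j\in\mathbb N_0^d}2^{\theta\,\mathbf r\cdot\mathbf j}\|q^L_{\mathbf j}[f]\|_{L_p(\mathbb T^d)}^\theta\Big)^{1/\theta}$$ (supremum if $\theta=\infty$), with constants independent of $f$.
   Context: $\mathbb T^d$ is $[-\pi,\pi]^d$ with opposite points identified. Function spaces: an admissible system $(\varphi_j)_{j\ge0}\subset C_0^\infty(\mathbb R)$ satisfies $\mathrm{supp}\,\varphi_0\subset[-A,A]$, $\mathrm{supp}\,\varphi_j\subset\{B2^j\le|\xi|\le C2^j\}$ ($j\ge1$), $\sup_{\xi,j}2^{jr}|D^r\varphi_j(\xi)|<\infty$ for all $r$, $\sum_j\varphi_j\equiv1$; $\delta_{\mathbf j}[f]=\sum_{\mathbf k}\varphi_{j_1}(k_1)\cdots\varphi_{j_d}(k_d)\hat f(\mathbf k)e^{i\mathbf k\cdot\mathbf x}$; $\|f|S^{\mathbf r}_{p,\theta}B\|=(\sum_{\mathbf j}2^{\theta\mathbf r\cdot\mathbf j}\|\delta_{\mathbf j}[f]\|_{L_p}^\theta)^{1/\theta}$ (sup if $\theta=\infty$). For $\mathbf r>1/p$ elements are continuous functions, to which $q^L_{\mathbf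 j}$ is applied. Kernels: $\mathrm{sinc}(x)=\sin x/x$, $\mathrm{sinc}(0)=1$; for $L\ge2$, $K^L(x)=\prod_{\ell=1}^L\mathrm{sinc}(2^{-\ell}x)$ and $K^L_{\pi,j}(x)=\sum_{k\in\mathbb Z}K^L(2^j(x+2\pi k))$; for $L=1$, $K^1_{\pi,0}\equiv1$, $K^1_{\pi,j}(x)=2^{-j}\sum_{k=-2^{j-1}}^{2^{j-1}-1}e^{ikx}$. With $U_0=\{0\}$, $U_j=\{-2^{j-1},\dots,2^{j-1}-1\}$, $I^L_j[f](x)=\sum_{u\in U_j}f(2\pi u/2^j)K^L_{\pi,j}(x-2\pi u/2^j)$; $\eta^L_0=I^L_0$, $\eta^L_j=I^L_j-I^L_{j-1}$ ($j\ge1$); $q^L_{\mathbf j}[f]=(\eta^L_{j_1}\otimes\cdots\otimes\eta^L_{j_d})f$, the $i$-th factor acting in the $i$-th variable. *)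

theory Defs
  imports "HOL-Analysis.Analysis" "HOL-Probability.Essential_Supremum"
begin

definition enn_powr :: "ennreal \<Rightarrow> real \<Rightarrow> ennreal" where
  "enn_powr x t = (if x = \<infinity> then \<infinity> else ennreal (enn2real x powr t))"

definition torus :: "(real^'d) set" where
  "torus = {x. \<forall>i. -pi \<le> x $ i \<and> x $ i \<le> pi}"

definition periodic_fun :: "(real^'d \<Rightarrow> complex) \<Rightarrow> bool" where
  "periodic_fun f \<longleftrightarrow> (\<forall>x i. f (x + axis i (2 * pi)) = f x)"

definition Lp_norm :: "ennreal \<Rightarrow> (real^'d \<Rightarrow> complex) \<Rightarrow> ennreal" where
  "Lp_norm p g =
    (if p = \<infinity> then esssup (lebesgue_on torus) (\<lambda>x. ennreal (norm (g x)))
     else enn_powr (\<integral>\<^sup>+ x. ennreal (norm (g x) powr enn2real p) \<partial>(lebesgue_on torus))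
                   (1 / enn2real p))"

definition seq_norm :: "ennreal \<Rightarrow> (nat^'d \<Rightarrow> ennreal) \<Rightarrow> ennreal" where
  "seq_norm \<theta> a =
    (if \<theta> = \<infinity> then (SUP j. a j)
     else enn_powr (\<Sum>\<^sub>\<infinity> j. enn_powr (a j) (enn2real \<theta>)) (1 / enn2real \<theta>))"

definition rdot :: "real^'d \<Rightarrow> nat^'d \<Rightarrow> real" where
  "rdot r j = (\<Sum>i\<in>UNIV. r $ i * real (j $ i))"

definition admissible :: "(nat \<Rightarrow> real \<Rightarrow> real) \<Rightarrow> bool" where
  "admissible \<phi> \<longleftrightarrow>
     (\<forall>j n x. (deriv ^^ n) (\<phi> j) differentiable (at x)) \<and>
     (\<exists>A B C. 0 < A \<and> 0 < B \<and> 0 < C \<and>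
        (\<forall>\<xi>. \<phi> 0 \<xi> \<noteq> 0 \<longrightarrow> \<bar>\<xi>\<bar> \<le> A) \<and>
        (\<forall>j \<xi>. j \<ge> 1 \<longrightarrow> \<phi> j \<xi> \<noteq> 0 \<longrightarrow> B * 2 ^ j \<le> \<bar>\<xi>\<bar> \<and> \<bar>\<xi>\<bar> \<le> C * 2 ^ j)) \<and>
     (\<forall>n. \<exists>M. \<forall>j \<xi>. 2 ^ (j * n) * \<bar>(deriv ^^ n) (\<phi> j) \<xi>\<bar> \<le> M) \<and>
     (\<forall>\<xi>. (\<lambda>j. \<phi> j \<xi>) sums 1)"

definition idot :: "int^'d \<Rightarrow> real^'d \<Rightarrow> real" where
  "idot k x = (\<Sum>i\<in>UNIV. real_of_int (k $ i) * x $ i)"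

definition fourier_coeff :: "(real^'d \<Rightarrow> complex) \<Rightarrow> int^'d \<Rightarrow> complex" where
  "fourier_coeff f k =
     (1 / (2 * pi) ^ CARD('d)) * integral torus (\<lambda>x. f x * cis (- idot k x))"

definition delta :: "(nat \<Rightarrow> real \<Rightarrow> real) \<Rightarrow> nat^'d \<Rightarrow> (real^'d \<Rightarrow> complex) \<Rightarrow> real^'d \<Rightarrow> complex" where
  "delta \<phi> j f x =
     (\<Sum>\<^sub>\<infinity> k. complex_of_real (\<Prod>i\<in>UNIV. \<phi> (j $ i) (real_of_int (k $ i)))
              * fourier_coeff f k * cis (idot k x))"

definition besov_norm :: "(nat \<Rightarrow> real \<Rightarrow> real) \<Rightarrow> real^'d \<Rightarrow> ennreal \<Rightarrow> ennreal
    \<Rightarrow> (real^'d \<Rightarrow> complex) \<Rightarrow> ennreal" where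
  "besov_norm \<phi> r p \<theta> f =
     seq_norm \<theta> (\<lambda>j. ennreal (2 powr rdot r j) * Lp_norm p (delta \<phi> j f))"

text \<open>Elements of S^r_{p,\<theta>}B(T^d) for r > 1/p: continuous periodic functions of finite norm.\<close>
definition besov_space :: "(nat \<Rightarrow> real \<Rightarrow> real) \<Rightarrow> real^'d \<Rightarrow> ennreal \<Rightarrow> ennreal
    \<Rightarrow> (real^'d \<Rightarrow> complex) set" where
  "besov_space \<phi> r p \<theta> =
     {f. continuous_on UNIV f \<and> periodic_fun f \<and> besov_norm \<phi> r p \<theta> f < \<infinity>}"

definition sinc_fn :: "real \<Rightarrow> real" where
  "sinc_fn x = (if x = 0 then 1 else sin x / x)"

definition KL :: "nat \<Rightarrow> real \<Rightarrow> real" where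
  "KL L x = (\<Prod>l=1..L. sinc_fn (x / 2 ^ l))"

definition Kpi :: "nat \<Rightarrow> nat \<Rightarrow> real \<Rightarrow> complex" where
  "Kpi L j x =
     (if L = 1 then
        (if j = 0 then 1
         else (1 / 2 ^ j) * (\<Sum>k\<in>{- (2 ^ (j - 1))..2 ^ (j - 1) - 1 :: int}. cis (real_of_int k * x)))
      else complex_of_real (\<Sum>\<^sub>\<infinity> k::int. KL L (2 ^ j * (x + 2 * pi * real_of_int k))))"

definition Uset :: "nat \<Rightarrow> int set" where
  "Uset j = (if j = 0 then {0} else {- (2 ^ (j - 1))..2 ^ (j - 1) - 1})"

definition interp :: "nat \<Rightarrow> nat \<Rightarrow> (real \<Rightarrow> complex) \<Rightarrow> real \<Rightarrow> complex" where
  "interp L j g x =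
     (\<Sum>u\<in>Uset j. g (2 * pi * real_of_int u / 2 ^ j) * Kpi L j (x - 2 * pi * real_of_int u / 2 ^ j))"

definition eta :: "nat \<Rightarrow> nat \<Rightarrow> (real \<Rightarrow> complex) \<Rightarrow> real \<Rightarrow> complex" where
  "eta L j g = (if j = 0 then interp L 0 g else (\<lambda>x. interp L j g x - interp L (j - 1) g x))"

definition apply_in :: "'d::finite \<Rightarrow> ((real \<Rightarrow> complex) \<Rightarrow> real \<Rightarrow> complex)
    \<Rightarrow> (real^'d \<Rightarrow> complex) \<Rightarrow> real^'d \<Rightarrow> complex" where
  "apply_in i T f x = T (\<lambda>t. f (\<chi> k. if k = i then t else x $ k)) (x $ i)"

text \<open>Tensor product eta_{j_1} \<otimes> ... \<otimes> eta_{j_d}, i-th factor acting in i-th variable.\<close>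
definition qL :: "nat \<Rightarrow> nat^'d::enum \<Rightarrow> (real^'d::enum \<Rightarrow> complex) \<Rightarrow> real^'d::enum \<Rightarrow> complex" where
  "qL L j f = foldr (\<lambda>i g. apply_in i (eta L (j $ i)) g) Enum.enum f"

definition q_norm :: "nat \<Rightarrow> real^'d::enum \<Rightarrow> ennreal \<Rightarrow> ennreal
    \<Rightarrow> (real^'d::enum \<Rightarrow> complex) \<Rightarrow> ennreal" where
  "q_norm L r p \<theta> f = seq_norm \<theta> (\<lambda>j. ennreal (2 powr rdot r j) * Lp_norm p (qL L j f))"

end

theory Submission
  imports Defs "HOL-Complex_Analysis.Complex_Analysis" "HOL-Probability.Sinc_Integral"
begin

text \<open>Both inequalities follow from one statement about almost diagonal operators.  The function is
  expanded as \<open>f = \<Sum>\<^sub>m \<delta>\<^sub>m f\<close>, respectively \<open>f = \<Sum>\<^sub>j q\<^sub>j f\<close>, and the other operator is applied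
  termwise.  Since \<open>\<eta>\<^sub>j\<close> annihilates trigonometric polynomials of low degree and \<open>\<phi>\<^sub>m\<close> vanishes on low
  frequencies, only the terms with \<open>j \<le> m + c\<close>, respectively \<open>m \<le> j + c\<close>, survive, and on polynomials
  of degree \<open>N \<ge> 2\<^sup>j\<close> both operators have \<open>L\<^sub>p\<close> (quasi-)norm \<open>O((N / 2\<^sup>j)\<^sup>1\<^sup>/\<^sup>p)\<close> in each variable.
  As \<open>r > 1/p\<close>, the weights \<open>2\<^sup>r\<^sup>j\<close> turn this growth into geometric decay off the diagonal.

  For \<open>L \<ge> 2\<close> the norm bound combines the decay of order \<open>L > 1/p\<close> of the kernel with an inequality
  of Peetre type for trigonometric polynomials; for \<open>L = 1\<close> and \<open>p > 1\<close> it rests on the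
  theorem of M. Riesz.\<close>

text \<open>For p < 1 neither the triangle inequality nor Young's inequality holds in L_p.
  Convolutions are therefore bounded pointwise, and the margin r - 1/p is divided into three equal
  shares: two pay for summing a series in the quasi-norm, one for the outer sequence norm. This is
  why cubes of the off-diagonal weights occur, and it treats all p and \<theta> alike. For L = 1 the
  kernel decays too slowly to be summed absolutely. The interpolants for L = 1 and L = 2 share their
  samples, so the former arises from the latter by folding aliased frequencies back, which costs
  only projections onto half lines of frequencies. The Lebesgue constants for L = 1 are unbounded,
  so sup-norm stability cannot be the reason for f being the sum of its pieces q_j f. The lower
  estimate uses convergence of Fourier coefficients instead: the frequency weights of the kernels
  lie in [0, 1], so a coefficient of an interpolant never exceeds the largest sample, and each
  \<delta>_m reads only finitely many coefficients.\<close>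

definition tspan :: "'k set \<Rightarrow> ('k \<Rightarrow> 'a \<Rightarrow> complex) \<Rightarrow> ('a \<Rightarrow> complex) set" where
  "tspan K E = {g. \<exists>c. g = (\<lambda>x. \<Sum>k\<in>K. c k * E k x)}"

lemma tspanI: "(\<And>x. g x = (\<Sum>k\<in>K. c k * E k x)) \<Longrightarrow> g \<in> tspan K E"
  unfolding tspan_def by blast

lemma tspanE:
  assumes "g \<in> tspan K E"
  obtains c where "g = (\<lambda>x. \<Sum>k\<in>K. c k * E k x)"
  using assms unfolding tspan_def by blast

lemma tspan_add:
  assumes "f \<in> tspan K E" "g \<in> tspan K E"
  shows "(\<lambda>x. f x + g x) \<in> tspan K E"
proof -
  obtain a b where "f = (\<lambda>x. \<Sum>k\<in>K. a k * E k x)" "g = (\<lambda>x. \<Sum>k\<in>K. b k * E k x)"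
    using assms by (blast elim: tspanE)
  then show ?thesis
    by (intro tspanI[where c = "\<lambda>k. a k + b k"]) (simp add: sum.distrib algebra_simps)
qed

lemma tspan_cmult:
  assumes "f \<in> tspan K E"
  shows "(\<lambda>x. a * f x) \<in> tspan K E"
proof -
  obtain c where "f = (\<lambda>x. \<Sum>k\<in>K. c k * E k x)"
    using assms by (blast elim: tspanE)
  then show ?thesis
    by (intro tspanI[where c = "\<lambda>k. a * c k"]) (simp add: sum_distrib_left mult_ac)
qed

lemma tspan_zero: "(\<lambda>x. 0) \<in> tspan K E"
  by (rule tspanI[where c = "\<lambda>_. 0"]) simp

lemma tspan_sum:
  assumes "\<And>i. i \<in> I \<Longrightarrow> f i \<in> tspan K E"
  shows "(\<lambda>x. \<Sum>i\<in>I. f i x) \<in> tspan K E"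
  using assms
proof (induction I rule: infinite_finite_induct)
  case (insert i I)
  then show ?case using tspan_add[of "f i" K E "\<lambda>x. \<Sum>i\<in>I. f i x"] by simp
qed (simp_all add: tspan_zero)

lemma tspan_base:
  assumes "finite K" "k \<in> K"
  shows "E k \<in> tspan K E"
proof (rule tspanI[where c = "\<lambda>l. if l = k then 1 else 0"])
  fix x
  have "(\<Sum>l\<in>K. (if l = k then 1 else 0) * E l x) = (\<Sum>l\<in>K. if l = k then E l x else 0)"
    by (intro sum.cong) auto
  then show "E k x = (\<Sum>l\<in>K. (if l = k then 1 else 0) * E l x)"
    using assms by simp
qed

lemma tspan_mono:
  assumes "finite L" "K \<subseteq> L"
  shows "tspan K E \<subseteq> tspan L E"
proof
  fix g assume "g \<in> tspan K E"
  then obtain c where g: "g = (\<lambda>x. \<Sum>k\<in>K. c k * E k x)" by (blast elim: tspanE)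
  show "g \<in> tspan L E"
    unfolding g by (intro tspan_sum tspan_cmult tspan_base) (use assms in auto)
qed

lemma tspan_mult:
  assumes "f \<in> tspan K E" "g \<in> tspan L E"
    and "\<And>k l. k \<in> K \<Longrightarrow> l \<in> L \<Longrightarrow> (\<lambda>x. E k x * E l x) \<in> tspan M E"
  shows "(\<lambda>x. f x * g x) \<in> tspan M E"
proof -
  obtain a b where f: "f = (\<lambda>x. \<Sum>k\<in>K. a k * E k x)" and g: "g = (\<lambda>x. \<Sum>k\<in>L. b k * E k x)"
    using assms by (blast elim: tspanE)
  have "(\<lambda>x. \<Sum>k\<in>K. \<Sum>l\<in>L. (a k * b l) * (E k x * E l x)) \<in> tspan M E"
    by (intro tspan_sum tspan_cmult assms(3))
  moreover have "(\<lambda>x. f x * g x) = (\<lambda>x. \<Sum>k\<in>K. \<Sum>l\<in>L. (a k * b l) * (E k x * E l x))"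
    unfolding f g sum_product by (simp add: mult_ac)
  ultimately show ?thesis by simp
qed

section \<open>Trigonometric polynomials of bounded degree in one and in several variables\<close>

definition tp :: "nat \<Rightarrow> (real \<Rightarrow> complex) set" where
  "tp N = tspan {-int N..int N} (\<lambda>k t. cis (real_of_int k * t))"

definition freq_box :: "('d::finite \<Rightarrow> nat) \<Rightarrow> (int^'d) set" where
  "freq_box N = {k. \<forall>i. \<bar>k $ i\<bar> \<le> int (N i)}"

text \<open>The degree is bounded separately in each variable, because the dyadic levels of a
  multi-index differ from one coordinate to the next.\<close>

definition TP :: "('d::finite \<Rightarrow> nat) \<Rightarrow> (real^'d \<Rightarrow> complex) set" where
  "TP N = tspan (freq_box N) (\<lambda>k x. cis (idot k x))"

lemma freq_box_image:
  "freq_box N = vec_lambda ` (PiE UNIV (\<lambda>i::'d::finite. {-int (N i)..int (N i)}))"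
proof (intro set_eqI iffI)
  fix k assume "k \<in> freq_box N"
  then show "k \<in> vec_lambda ` (PiE UNIV (\<lambda>i::'d. {-int (N i)..int (N i)}))"
    by (intro image_eqI[where x = "vec_nth k"])
       (auto simp: freq_box_def PiE_def extensional_def abs_le_iff vec_nth_inverse minus_le_iff)
qed (auto simp: freq_box_def PiE_def abs_le_iff minus_le_iff Pi_iff)

lemma finite_freq_box: "finite (freq_box N)"
  unfolding freq_box_image by (intro finite_imageI finite_PiE) auto

lemma card_freq_box: "real (card (freq_box N)) \<le> (\<Prod>i\<in>UNIV. 2 * real (N i) + 1)"
proof -
  have "card (freq_box N) \<le> card (PiE UNIV (\<lambda>i::'a. {-int (N i)..int (N i)}))"
    unfolding freq_box_image by (intro card_image_le finite_PiE) auto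
  also have "\<dots> = (\<Prod>i\<in>UNIV. card {-int (N i)..int (N i)})"
    by (simp add: card_PiE)
  finally have "real (card (freq_box N)) \<le> real (\<Prod>i\<in>UNIV. card {-int (N i)..int (N i)})"
    by linarith
  also have "\<dots> = (\<Prod>i\<in>UNIV. 2 * real (N i) + 1)"
    unfolding of_nat_prod by (intro prod.cong) auto
  finally show ?thesis .
qed

lemma idot_add_right: "idot k (x + y) = idot k x + idot k y"
  by (simp add: idot_def algebra_simps sum.distrib)

lemma idot_add_left: "idot (k + l) x = idot k x + idot l x"
  by (simp add: idot_def algebra_simps sum.distrib)

lemma idot_minus_left: "idot (- k) x = - idot k x"
  by (simp add: idot_def sum_negf)

lemma idot_zero_left: "idot 0 x = 0"
  by (simp add: idot_def)

lemma idot_axis: "idot k (axis i t) = real_of_int (k $ i) * t"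
proof -
  have "idot k (axis i t) = (\<Sum>j\<in>UNIV. if j = i then real_of_int (k $ i) * t else 0)"
    unfolding idot_def by (intro sum.cong) (auto simp: axis_def)
  then show ?thesis by simp
qed

lemma cis_idot_periodic: "cis (idot k (x + axis i (2 * pi))) = cis (idot k x)"
proof -
  have "cis (real_of_int (k $ i) * (2 * pi)) = 1"
    using cis_multiple_2pi[of "real_of_int (k $ i)"] by (simp add: mult_ac)
  then show ?thesis
    by (simp add: idot_add_right idot_axis flip: cis_mult)
qed

lemma cis_int_periodic: "cis (real_of_int k * (t + 2 * pi)) = cis (real_of_int k * t)"
proof -
  have "cis (real_of_int k * (2 * pi)) = 1"
    using cis_multiple_2pi[of "real_of_int k"] by (simp add: mult_ac)
  then show ?thesis
    by (simp add: distrib_left flip: cis_mult)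
qed

lemma continuous_on_idot [continuous_intros]:
  "continuous_on S f \<Longrightarrow> continuous_on S (\<lambda>x. idot k (f x))"
  unfolding idot_def by (intro continuous_intros)

lemmas tp_add = tspan_add[of _ "{-int N..int N}" "\<lambda>k t. cis (real_of_int k * t)" for N, folded tp_def]
lemmas tp_cmult = tspan_cmult[of _ "{-int N..int N}" "\<lambda>k t. cis (real_of_int k * t)" for N, folded tp_def]
lemmas tp_sum = tspan_sum[of _ _ "{-int N..int N}" "\<lambda>k t. cis (real_of_int k * t)" for N, folded tp_def]
lemmas TP_add = tspan_add[of _ "freq_box N" "\<lambda>k x. cis (idot k x)" for N, folded TP_def]
lemmas TP_cmult = tspan_cmult[of _ "freq_box N" "\<lambda>k x. cis (idot k x)" for N, folded TP_def]
lemmas TP_sum = tspan_sum[of _ _ "freq_box N" "\<lambda>k x. cis (idot k x)" for N, folded TP_def]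

lemma tp_cis: "\<bar>k\<bar> \<le> int N \<Longrightarrow> (\<lambda>t. cis (real_of_int k * t)) \<in> tp N"
  unfolding tp_def by (rule tspan_base) auto

lemma TP_cis: "k \<in> freq_box N \<Longrightarrow> (\<lambda>x. cis (idot k x)) \<in> TP N"
  unfolding TP_def by (rule tspan_base[OF finite_freq_box])

lemma tp_mono: "N \<le> M \<Longrightarrow> g \<in> tp N \<Longrightarrow> g \<in> tp M"
  unfolding tp_def by (rule tspan_mono[THEN subsetD, rotated 2]) auto

lemma TP_mono: "(\<And>i. N i \<le> M i) \<Longrightarrow> g \<in> TP N \<Longrightarrow> g \<in> TP M"
  unfolding TP_def
proof (rule tspan_mono[THEN subsetD, rotated 2])
  assume "\<And>i. N i \<le> M i"
  then show "freq_box N \<subseteq> freq_box M"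
    unfolding freq_box_def by (auto intro: order_trans simp: of_nat_mono)
qed (auto simp: finite_freq_box)

lemma tp_mult: "f \<in> tp N \<Longrightarrow> g \<in> tp M \<Longrightarrow> (\<lambda>t. f t * g t) \<in> tp (N + M)"
  unfolding tp_def
proof (erule tspan_mult, assumption)
  fix k l assume "k \<in> {- int N..int N}" "l \<in> {- int M..int M}"
  then have "\<bar>k + l\<bar> \<le> int (N + M)" by auto
  from tp_cis[OF this] show "(\<lambda>x. cis (real_of_int k * x) * cis (real_of_int l * x))
      \<in> tspan {- int (N + M)..int (N + M)} (\<lambda>k t. cis (real_of_int k * t))"
    by (simp add: cis_mult distrib_right tp_def)
qed

lemma TP_mult:
  assumes "f \<in> TP N" "g \<in> TP M"
  shows "(\<lambda>x. f x * g x) \<in> TP (\<lambda>i. N i + M i)"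
  using assms unfolding TP_def
proof (rule tspan_mult)
  fix k l assume kl: "k \<in> freq_box N" "l \<in> freq_box M"
  have "k + l \<in> freq_box (\<lambda>i. N i + M i)"
    unfolding freq_box_def
  proof (intro CollectI allI)
    fix i
    have "\<bar>k $ i\<bar> \<le> int (N i)" "\<bar>l $ i\<bar> \<le> int (M i)" using kl by (auto simp: freq_box_def)
    then show "\<bar>(k + l) $ i\<bar> \<le> int (N i + M i)" by simp
  qed
  then show "(\<lambda>x. cis (idot k x) * cis (idot l x))
      \<in> tspan (freq_box (\<lambda>i. N i + M i)) (\<lambda>k x. cis (idot k x))"
    using TP_cis[of "k + l" "\<lambda>i. N i + M i"] by (simp add: cis_mult idot_add_left TP_def)
qed

lemma tp_const: "(\<lambda>t. a) \<in> tp N"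
  using tp_cmult[OF tp_cis[of 0 N], of a] by simp

lemma TP_const: "(\<lambda>t. a) \<in> TP N"
  using TP_cmult[OF TP_cis[of 0 N], of a] by (simp add: freq_box_def idot_zero_left)

lemma tp_power: "f \<in> tp N \<Longrightarrow> (\<lambda>t. f t ^ n) \<in> tp (n * N)"
proof (induction n)
  case (Suc n)
  then show ?case using tp_mult[of f N "\<lambda>t. f t ^ n" "n * N"] by simp
qed (simp add: tp_const)

lemma TP_power: "f \<in> TP N \<Longrightarrow> (\<lambda>t. f t ^ n) \<in> TP (\<lambda>i. n * N i)"
proof (induction n)
  case (Suc n)
  then show ?case using TP_mult[of f N "\<lambda>t. f t ^ n" "\<lambda>i. n * N i"] by simp
qed (simp add: TP_const)

lemma tp_shift:
  assumes "g \<in> tp N"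
  shows "(\<lambda>t. g (t + s)) \<in> tp N"
proof -
  obtain c where g: "g = (\<lambda>x. \<Sum>k\<in>{-int N..int N}. c k * cis (real_of_int k * x))"
    using assms unfolding tp_def by (blast elim: tspanE)
  have "(\<lambda>t. \<Sum>k\<in>{-int N..int N}. (c k * cis (real_of_int k * s)) * cis (real_of_int k * t)) \<in> tp N"
    by (intro tp_sum tp_cmult tp_cis) auto
  also have "(\<lambda>t. \<Sum>k\<in>{-int N..int N}. (c k * cis (real_of_int k * s)) * cis (real_of_int k * t)) = (\<lambda>t. g (t + s))"
    unfolding g by (intro ext sum.cong) (auto simp: distrib_left mult_ac simp flip: cis_mult)
  finally show ?thesis .
qed

lemma tp_continuous: "g \<in> tp N \<Longrightarrow> continuous_on S g"
  unfolding tp_def by (erule tspanE) (auto intro!: continuous_intros)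

lemma TP_continuous: "g \<in> TP N \<Longrightarrow> continuous_on S g"
  unfolding TP_def by (erule tspanE) (auto intro!: continuous_intros)

lemma tp_periodic: "g \<in> tp N \<Longrightarrow> g (t + 2 * pi) = g t"
  unfolding tp_def by (erule tspanE) (simp add: cis_int_periodic)

lemma TP_periodic: "g \<in> TP N \<Longrightarrow> periodic_fun g"
  unfolding TP_def periodic_fun_def by (erule tspanE) (simp add: cis_idot_periodic)

section \<open>Integrals of periodic functions\<close>

text \<open>Cut the cell at height \<open>u \<bullet> b - t\<close>. The lower piece, shifted by
  \<open>t\<close>, fills the part above \<open>l \<bullet> b + t\<close>; the upper piece, shifted
  by \<open>t - \<tau>\<close>, which changes nothing by periodicity, fills the part below.\<close>

lemma integral_periodic_shift_aux:
  fixes F :: "'a::euclidean_space \<Rightarrow> 'b::banach"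
  assumes cont: "continuous_on UNIV F" and b: "b \<in> Basis"
    and per: "\<And>x. F (x + \<tau> *\<^sub>R b) = F x"
    and \<tau>: "u \<bullet> b - l \<bullet> b = \<tau>" and t: "0 \<le> t" "t \<le> \<tau>"
  shows "integral (cbox l u) (\<lambda>x. F (x + t *\<^sub>R b)) = integral (cbox l u) F"
proof -
  define e where "e = u \<bullet> b - t"
  define u1 where "u1 = (\<Sum>i\<in>Basis. (if i = b then min (u\<bullet>b) e else u\<bullet>i) *\<^sub>R i)"
  define l1 where "l1 = (\<Sum>i\<in>Basis. (if i = b then max (l\<bullet>b) e else l\<bullet>i) *\<^sub>R i)"
  have S1: "cbox l u \<inter> {x. x \<bullet> b \<le> e} = cbox l u1"
    and S2: "cbox l u \<inter> {x. x \<bullet> b \<ge> e} = cbox l1 u"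
    using interval_split[OF b] unfolding u1_def l1_def by blast+
  have int: "f integrable_on cbox p q" if "continuous_on UNIV f" for f :: "'a \<Rightarrow> 'b" and p q
    using that by (intro integrable_continuous) (auto intro: continuous_on_subset)
  have split: "integral (cbox p q) f = integral (cbox p q \<inter> {x. x \<bullet> b \<le> c}) f + integral (cbox p q \<inter> {x. x \<bullet> b \<ge> c}) f"
    if f: "continuous_on UNIV f" for f :: "'a \<Rightarrow> 'b" and p q c
  proof (rule integral_unique, rule has_integral_split[OF _ _ b])
    show "(f has_integral integral (cbox p q \<inter> {x. x \<bullet> b \<le> c}) f) (cbox p q \<inter> {x. x \<bullet> b \<le> c})"
      "(f has_integral integral (cbox p q \<inter> {x. x \<bullet> b \<ge> c}) f) (cbox p q \<inter> {x. x \<bullet> b \<ge> c})"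
      unfolding interval_split[OF b] by (intro integrable_integral int f)+
  qed
  have shift: "integral (cbox p q) (\<lambda>x. F (x + v)) = integral (cbox (p + v) (q + v)) F" for p q v
    using integral_shift_cbox_plus[of p q F v] by (simp add: o_def add.commute)
  have trans: "x \<in> cbox (p + v) (q + v) \<longleftrightarrow> x - v \<in> cbox p q" for x v p q :: 'a
    by (auto simp: mem_box algebra_simps)
  have contF: "continuous_on UNIV (\<lambda>x. F (x + v))" for v
    by (rule continuous_on_compose2[OF cont]) (auto intro!: continuous_intros)
  have mem_iff: "x \<in> cbox p q \<longleftrightarrow>
      (\<forall>i\<in>Basis - {b}. p \<bullet> i \<le> x \<bullet> i \<and> x \<bullet> i \<le> q \<bullet> i) \<and> p \<bullet> b \<le> x \<bullet> b \<and> x \<bullet> b \<le> q \<bullet> b" for x p q :: 'a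
    using b by (auto simp: mem_box)
  have inner_b: "(x - s *\<^sub>R b) \<bullet> b = x \<bullet> b - s" for x s
    using b by (simp add: inner_diff_left)
  have inner_other: "(x - s *\<^sub>R b) \<bullet> i = x \<bullet> i" if "i \<in> Basis - {b}" for x s i
    using b that by (auto simp: inner_diff_left inner_Basis)
  have mem1: "x - v \<in> cbox l u \<inter> {x. x \<bullet> b \<le> e} \<longleftrightarrow> x \<in> cbox l u \<inter> {x. x \<bullet> b \<ge> l \<bullet> b + t}"
    if "v = t *\<^sub>R b" for x v
    using t \<tau> unfolding that e_def Int_iff mem_Collect_eq mem_iff inner_b by (auto simp: inner_other)
  have mem2: "x - v \<in> cbox l u \<inter> {x. x \<bullet> b \<ge> e} \<longleftrightarrow> x \<in> cbox l u \<inter> {x. x \<bullet> b \<le> l \<bullet> b + t}"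
    if "v = (t - \<tau>) *\<^sub>R b" for x v
    using t \<tau> unfolding that e_def Int_iff mem_Collect_eq mem_iff inner_b by (auto simp: inner_other)
  have F_eq: "(\<lambda>x. F (x + t *\<^sub>R b)) = (\<lambda>x. F (x + (t - \<tau>) *\<^sub>R b))"
  proof
    fix x show "F (x + t *\<^sub>R b) = F (x + (t - \<tau>) *\<^sub>R b)"
      using per[of "x + (t - \<tau>) *\<^sub>R b"] by (simp add: algebra_simps)
  qed
  have "integral (cbox l u1) (\<lambda>x. F (x + t *\<^sub>R b)) = integral (cbox l u \<inter> {x. x \<bullet> b \<ge> l \<bullet> b + t}) F"
    unfolding shift using mem1[OF refl] unfolding S1
    by (intro arg_cong2[where f = integral] set_eqI refl) (simp only: trans)
  moreover have "integral (cbox l1 u) (\<lambda>x. F (x + t *\<^sub>R b)) =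
      integral (cbox l u \<inter> {x. x \<bullet> b \<le> l \<bullet> b + t}) F"
    unfolding F_eq shift using mem2[OF refl] unfolding S2
    by (intro arg_cong2[where f = integral] set_eqI refl) (simp only: trans)
  ultimately show ?thesis
    using split[OF contF[of "t *\<^sub>R b"], of l u e] split[OF cont, of l u "l \<bullet> b + t"]
    unfolding S1 S2 by simp
qed

lemma periodic_int_multiple:
  fixes F :: "'a::real_vector \<Rightarrow> 'b"
  assumes per: "\<And>x. F (x + v) = F x"
  shows "F (x + real_of_int n *\<^sub>R v) = F x"
proof -
  have nat: "F (x + real m *\<^sub>R v) = F x" for m x
  proof (induction m)
    case (Suc m)
    then show ?case using per[of "x + real m *\<^sub>R v"] by (simp add: algebra_simps)
  qed simp
  show ?thesis
  proof (cases "n \<ge> 0")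
    case True
    then show ?thesis using nat[of x "nat n"] by simp
  next
    case False
    then show ?thesis using nat[of "x + real_of_int n *\<^sub>R v" "nat (- n)"]
      by (simp add: algebra_simps)
  qed
qed

lemma integral_periodic_shift:
  fixes F :: "'a::euclidean_space \<Rightarrow> 'b::banach"
  assumes cont: "continuous_on UNIV F" and b: "b \<in> Basis"
    and per: "\<And>x. F (x + \<tau> *\<^sub>R b) = F x"
    and \<tau>: "u \<bullet> b - l \<bullet> b = \<tau>" and pos: "0 < \<tau>"
  shows "integral (cbox l u) (\<lambda>x. F (x + t *\<^sub>R b)) = integral (cbox l u) F"
proof -
  define n where "n = \<lfloor>t / \<tau>\<rfloor>"
  define s where "s = t - real_of_int n * \<tau>"
  have s: "0 \<le> s" "s \<le> \<tau>"
    using floor_divide_lower[OF pos, of t] floor_divide_upper[OF pos, of t]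
    unfolding s_def n_def by (simp_all add: algebra_simps)
  have "F (x + t *\<^sub>R b) = F (x + s *\<^sub>R b)" for x
    using periodic_int_multiple[of F "\<tau> *\<^sub>R b" "x + s *\<^sub>R b" n, OF per]
    by (simp add: s_def algebra_simps)
  then show ?thesis
    using integral_periodic_shift_aux[OF cont b per \<tau> s] by simp
qed

lemma integral_period_shift:
  fixes F :: "real \<Rightarrow> 'b::banach"
  assumes "continuous_on UNIV F" "\<And>x. F (x + 2 * pi) = F x"
  shows "integral {-pi..pi} (\<lambda>x. F (x + t)) = integral {-pi..pi} F"
  using integral_periodic_shift[of F 1 "2 * pi" pi "-pi" t] assms by simp

text \<open>A shift by half a wavelength reverses the sign of the integrand, whereas the integral
  over a period does not see a shift; hence it equals its own negative. The torus version shifts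
  along one coordinate with nonzero frequency.\<close>

lemma integral_cis_int:
  "integral {-pi..pi} (\<lambda>t. cis (real_of_int k * t)) = (if k = 0 then 2 * pi else 0)"
proof (cases "k = 0")
  case False
  define s where "s = pi / real_of_int k"
  have "cis (real_of_int k * (t + s)) = - cis (real_of_int k * t)" for t
    using False by (simp add: s_def distrib_left flip: cis_mult)
  moreover have "integral {-pi..pi} (\<lambda>t. cis (real_of_int k * (t + s))) = integral {-pi..pi} (\<lambda>t. cis (real_of_int k * t))"
    by (rule integral_period_shift) (auto intro!: continuous_intros simp: cis_int_periodic)
  ultimately show ?thesis using False by simp
qed (simp add: scaleR_conv_of_real)

definition torus_lo :: "real^'d" where "torus_lo = (\<chi> i. -pi)"
definition torus_hi :: "real^'d" where "torus_hi = (\<chi> i. pi)"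

lemma torus_eq_cbox: "(torus :: (real^'d::finite) set) = cbox torus_lo torus_hi"
  unfolding torus_def torus_lo_def torus_hi_def
  by (auto simp: mem_box Basis_vec_def inner_axis)

lemma content_torus: "measure lborel (torus :: (real^'d::finite) set) = (2 * pi) ^ CARD('d)"
proof -
  have "cbox torus_lo torus_hi \<noteq> ({} :: (real^'d) set)"
    by (simp add: interval_eq_empty_cart torus_lo_def torus_hi_def not_less)
  then show ?thesis
    unfolding torus_eq_cbox by (simp add: content_cbox_cart torus_lo_def torus_hi_def)
qed

lemma compact_torus: "compact torus"
  unfolding torus_eq_cbox by simp

lemma integrable_on_torus:
  fixes f :: "real^'d::finite \<Rightarrow> 'b::banach"
  shows "continuous_on UNIV f \<Longrightarrow> f integrable_on torus"
  unfolding torus_eq_cbox by (intro integrable_continuous) (auto intro: continuous_on_subset)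

lemma integral_torus_shift:
  fixes F :: "real^'d::finite \<Rightarrow> 'b::banach"
  assumes "continuous_on UNIV F" "\<And>x. F (x + axis i (2 * pi)) = F x"
  shows "integral torus (\<lambda>x. F (x + axis i t)) = integral torus F"
proof -
  have ax: "axis i s = s *\<^sub>R (axis i 1 :: real^'d)" for s
    by (simp add: axis_def vec_eq_iff)
  show ?thesis
    unfolding torus_eq_cbox ax[of t]
    by (rule integral_periodic_shift[where \<tau> = "2 * pi"])
       (use assms in \<open>auto simp: ax[of "2 * pi"] inner_axis torus_lo_def torus_hi_def Basis_vec_def\<close>)
qed

lemma integral_torus_cis_idot:
  "integral torus (\<lambda>x. cis (idot k x)) = (if k = 0 then (2 * pi) ^ CARD('d) else 0)"
  for k :: "int^'d::finite"
proof (cases "k = 0")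
  case True
  then show ?thesis
    using content_torus[where 'd = 'd] by (simp add: idot_zero_left torus_eq_cbox scaleR_conv_of_real)
next
  case False
  then obtain i where i: "k $ i \<noteq> 0" by (auto simp: vec_eq_iff)
  define s where "s = pi / real_of_int (k $ i)"
  have "cis (idot k (x + axis i s)) = - cis (idot k x)" for x
    using i by (simp add: s_def idot_add_right idot_axis flip: cis_mult)
  moreover have "integral torus (\<lambda>x. cis (idot k (x + axis i s))) = integral torus (\<lambda>x. cis (idot k x))"
    by (rule integral_torus_shift) (auto intro!: continuous_intros simp: cis_idot_periodic)
  ultimately show ?thesis using False by simp
qed

abbreviation pint :: "(real \<Rightarrow> 'b::banach) \<Rightarrow> 'b" where
  "pint F \<equiv> integral {-pi..pi} F"

lemma pint_le:
  fixes f g :: "real \<Rightarrow> real"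
  assumes "continuous_on UNIV f" "continuous_on UNIV g" "\<And>x. f x \<le> g x"
  shows "pint f \<le> pint g"
  by (intro Henstock_Kurzweil_Integration.integral_le integrable_continuous_real)
     (use assms in \<open>auto intro: continuous_on_subset\<close>)

lemma pint_nonneg:
  fixes f :: "real \<Rightarrow> real"
  assumes "continuous_on UNIV f" "\<And>x. 0 \<le> f x"
  shows "0 \<le> pint f"
  by (intro Henstock_Kurzweil_Integration.integral_nonneg integrable_continuous_real)
     (use assms in \<open>auto intro: continuous_on_subset\<close>)

lemma pint_norm_le:
  fixes f :: "real \<Rightarrow> 'b::banach"
  assumes "continuous_on UNIV f" "continuous_on UNIV g" "\<And>x. norm (f x) \<le> g x"
  shows "norm (pint f) \<le> pint g"
  by (intro Henstock_Kurzweil_Integration.integral_norm_bound_integral integrable_continuous_real)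
     (use assms in \<open>auto intro: continuous_on_subset\<close>)

lemma pint_sum:
  fixes f :: "'i \<Rightarrow> real \<Rightarrow> 'b::banach"
  assumes "finite I" "\<And>i. i \<in> I \<Longrightarrow> continuous_on UNIV (f i)"
  shows "pint (\<lambda>x. \<Sum>i\<in>I. f i x) = (\<Sum>i\<in>I. pint (f i))"
  by (intro Henstock_Kurzweil_Integration.integral_sum integrable_continuous_real)
     (use assms in \<open>auto intro: continuous_on_subset\<close>)

lemma pint_add:
  fixes f :: "real \<Rightarrow> 'b::banach"
  assumes "continuous_on UNIV f" "continuous_on UNIV g"
  shows "pint (\<lambda>x. f x + g x) = pint f + pint g"
  by (intro Henstock_Kurzweil_Integration.integral_add integrable_continuous_real)
     (use assms in \<open>auto intro: continuous_on_subset\<close>)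

lemma torus_int_sum:
  fixes f :: "'i \<Rightarrow> real^'d::finite \<Rightarrow> 'b::banach"
  assumes "finite I" "\<And>i. i \<in> I \<Longrightarrow> continuous_on UNIV (f i)"
  shows "integral torus (\<lambda>x. \<Sum>i\<in>I. f i x) = (\<Sum>i\<in>I. integral torus (f i))"
  by (intro Henstock_Kurzweil_Integration.integral_sum integrable_on_torus) (use assms in auto)

lemma torus_int_le:
  fixes f g :: "real^'d::finite \<Rightarrow> real"
  assumes "continuous_on UNIV f" "continuous_on UNIV g" "\<And>x. f x \<le> g x"
  shows "integral torus f \<le> integral torus g"
  by (intro Henstock_Kurzweil_Integration.integral_le integrable_on_torus) (use assms in auto)

lemma torus_int_nonneg:
  fixes f :: "real^'d::finite \<Rightarrow> real"
  assumes "continuous_on UNIV f" "\<And>x. 0 \<le> f x"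
  shows "0 \<le> integral torus f"
  by (intro Henstock_Kurzweil_Integration.integral_nonneg integrable_on_torus) (use assms in auto)

lemma torus_int_norm_le:
  fixes f :: "real^'d::finite \<Rightarrow> 'b::banach"
  assumes "continuous_on UNIV f" "continuous_on UNIV g" "\<And>x. x \<in> torus \<Longrightarrow> norm (f x) \<le> g x"
  shows "norm (integral torus f) \<le> integral torus g"
  by (intro Henstock_Kurzweil_Integration.integral_norm_bound_integral integrable_on_torus) (use assms in auto)

lemma continuous_on_norm_powr [continuous_intros]:
  assumes "continuous_on S g" "0 < p"
  shows "continuous_on S (\<lambda>t. norm (g t) powr p)"
  by (intro continuous_on_powr' continuous_intros) (use assms in auto)

section \<open>Fourier coefficients and inequalities of Nikolskii type\<close>

lemma tp_coeff:
  fixes c :: "int \<Rightarrow> complex"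
  assumes "\<bar>k\<bar> \<le> int N"
  shows "pint (\<lambda>t. (\<Sum>l\<in>{-int N..int N}. c l * cis (real_of_int l * t)) * cis (- (real_of_int k * t))) = 2 * complex_of_real pi * c k"
proof -
  have "pint (\<lambda>t. (\<Sum>l\<in>{-int N..int N}. c l * cis (real_of_int l * t)) * cis (- (real_of_int k * t)))
      = pint (\<lambda>t. \<Sum>l\<in>{-int N..int N}. c l * cis (real_of_int (l - k) * t))"
    by (simp add: sum_distrib_right mult.assoc cis_mult left_diff_distrib)
  also have "\<dots> = (\<Sum>l\<in>{-int N..int N}. pint (\<lambda>t. c l * cis (real_of_int (l - k) * t)))"
    by (intro pint_sum continuous_intros) auto
  also have "\<dots> = (\<Sum>l\<in>{-int N..int N}. if l = k then 2 * complex_of_real pi * c k else 0)"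
    by (intro sum.cong refl) (simp only: Henstock_Kurzweil_Integration.integral_mult_right integral_cis_int, simp)
  also have "\<dots> = 2 * complex_of_real pi * c k" using assms by (auto simp: abs_le_iff)
  finally show ?thesis .
qed

lemma tp_coeff_bound:
  assumes "\<bar>k\<bar> \<le> int N" and g: "g = (\<lambda>t. \<Sum>l\<in>{-int N..int N}. c l * cis (real_of_int l * t))"
  shows "2 * pi * norm (c k) \<le> pint (\<lambda>t. norm (g t))"
proof -
  have "norm (pint (\<lambda>t. g t * cis (- (real_of_int k * t)))) \<le> pint (\<lambda>t. norm (g t))"
    by (intro pint_norm_le) (auto simp: g norm_mult intro!: continuous_intros)
  then show ?thesis using tp_coeff[OF assms(1), of c] by (simp add: g norm_mult)
qed

lemma TP_coeff:
  fixes c :: "int^'d::finite \<Rightarrow> complex"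
  assumes "finite K"
  shows "fourier_coeff (\<lambda>x. \<Sum>l\<in>K. c l * cis (idot l x)) k = (if k \<in> K then c k else 0)"
proof -
  have "integral torus (\<lambda>x. (\<Sum>l\<in>K. c l * cis (idot l x)) * cis (- idot k x))
      = integral torus (\<lambda>x. \<Sum>l\<in>K. c l * cis (idot (l - k) x))"
    by (simp add: sum_distrib_right mult.assoc cis_mult diff_conv_add_uminus idot_add_left idot_minus_left del: add_uminus_conv_diff)
  also have "\<dots> = (\<Sum>l\<in>K. integral torus (\<lambda>x. c l * cis (idot (l - k) x)))"
    by (intro torus_int_sum continuous_intros) (use assms in auto)
  also have "\<dots> = (\<Sum>l\<in>K. if l = k then (2 * complex_of_real pi) ^ CARD('d) * c k else 0)"
    by (intro sum.cong refl) (simp only: Henstock_Kurzweil_Integration.integral_mult_right integral_torus_cis_idot, simp)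
  also have "\<dots> = (if k \<in> K then (2 * complex_of_real pi) ^ CARD('d) * c k else 0)" using assms by auto
  finally show ?thesis unfolding fourier_coeff_def by simp
qed

lemma fourier_coeff_L1:
  fixes f :: "real^'d::finite \<Rightarrow> complex"
  assumes "continuous_on UNIV f"
  shows "(2 * pi) ^ CARD('d) * norm (fourier_coeff f k) \<le> integral torus (\<lambda>x. norm (f x))"
proof -
  have "norm (integral torus (\<lambda>x. f x * cis (- idot k x))) \<le> integral torus (\<lambda>x. norm (f x))"
    by (intro torus_int_norm_le continuous_intros assms) (simp add: norm_mult)
  then show ?thesis
    by (simp add: fourier_coeff_def norm_mult norm_divide norm_power)
qed

lemma integral_torus_const: "integral torus (\<lambda>x::real^'d::finite. c::real) = (2 * pi) ^ CARD('d) * c"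
  using content_torus[where 'd = 'd] by (simp add: torus_eq_cbox)

lemma fourier_coeff_sup:
  fixes f :: "real^'d::finite \<Rightarrow> complex"
  assumes "continuous_on UNIV f" "\<And>x. norm (f x) \<le> S"
  shows "norm (fourier_coeff f k) \<le> S"
proof -
  have "integral torus (\<lambda>x. norm (f x)) \<le> integral torus (\<lambda>x::real^'d. S)"
    by (intro torus_int_le continuous_intros assms)
  then have "(2 * pi) ^ CARD('d) * norm (fourier_coeff f k) \<le> (2 * pi) ^ CARD('d) * S"
    using fourier_coeff_L1[OF assms(1), of k] integral_torus_const[of S, where 'd = 'd] by linarith
  then show ?thesis by simp
qed

text \<open>This upgrades an \<open>L\<^sub>k\<close>-\<open>L\<^sub>\<infinity>\<close> inequality for powers to exponents below \<open>k\<close>: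
  one factor \<open>S\<^sup>k\<^sup>-\<^sup>p\<close> of the supremum \<open>S\<close> is split off and cancelled.\<close>

lemma sup_power_trick:
  fixes h :: "'a \<Rightarrow> complex" and p D Jk Jp :: real
  assumes "0 < p" "p \<le> real k" "0 < k" "0 \<le> D" "0 \<le> Jp"
    and bdd: "\<And>x. norm (h x) \<le> B"
    and up: "\<And>x. norm (h x) ^ k \<le> D * Jk"
    and low: "\<And>S. 0 \<le> S \<Longrightarrow> (\<And>x. norm (h x) \<le> S) \<Longrightarrow> Jk \<le> S powr (real k - p) * Jp"
  shows "norm (h x) powr p \<le> D * Jp"
proof -
  define S where "S = (SUP x. norm (h x))"
  have bd: "bdd_above (range (\<lambda>x. norm (h x)))" using bdd by (auto intro!: bdd_aboveI)
  have le: "norm (h x) \<le> S" for x unfolding S_def by (rule cSUP_upper[OF _ bd]) simp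
  have S0: "0 \<le> S" using le[of undefined] norm_ge_zero order_trans by blast
  show ?thesis
  proof (cases "S = 0")
    case True
    then have "norm (h x) = 0" using le[of x] by simp
    then show ?thesis using assms(4,5) by simp
  next
    case False
    then have Sp: "0 < S" using S0 by simp
    have DJ: "0 \<le> D * Jk" using up[of undefined] by (meson norm_ge_zero order_trans zero_le_power)
    have "norm (h x) \<le> root k (D * Jk)" for x
      using up[of x] \<open>0 < k\<close> by (metis norm_ge_zero real_root_le_iff real_root_power_cancel)
    then have "S \<le> root k (D * Jk)" unfolding S_def by (intro cSUP_least) auto
    then have "S ^ k \<le> root k (D * Jk) ^ k" using S0 by (intro power_mono)
    then have "S ^ k \<le> D * Jk" using DJ \<open>0 < k\<close> by simp
    also have "\<dots> \<le> D * (S powr (real k - p) * Jp)"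
      by (intro mult_left_mono low S0 le assms)
    finally have "S powr real k \<le> S powr (real k - p) * (D * Jp)"
      using Sp by (simp add: powr_realpow mult_ac)
    then have "S powr (real k - p) * S powr p \<le> S powr (real k - p) * (D * Jp)"
      by (simp flip: powr_add)
    then have "S powr p \<le> D * Jp" using Sp by simp
    moreover have "norm (h x) powr p \<le> S powr p" by (intro powr_mono2) (use le assms in auto)
    ultimately show ?thesis by linarith
  qed
qed

lemma norm_power_le_sup:
  fixes z :: complex
  assumes "0 < p" "p \<le> real k" "0 < k" "norm z \<le> S"
  shows "norm z ^ k \<le> S powr (real k - p) * norm z powr p"
proof (cases "z = 0")
  case False
  then have "norm z ^ k = norm z powr (real k - p) * norm z powr p"
    by (simp add: powr_realpow flip: powr_add)
  also have "\<dots> \<le> S powr (real k - p) * norm z powr p"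
    by (intro mult_right_mono powr_mono2) (use assms in auto)
  finally show ?thesis .
qed (use assms in \<open>auto simp: zero_power\<close>)

lemma tp_bounded:
  assumes "g \<in> tp N"
  obtains B where "\<And>t. norm (g t) \<le> B"
proof -
  obtain c where g: "g = (\<lambda>x. \<Sum>k\<in>{-int N..int N}. c k * cis (real_of_int k * x))"
    using assms unfolding tp_def by (blast elim: tspanE)
  have "norm (g t) \<le> (\<Sum>k\<in>{-int N..int N}. norm (c k))" for t
    unfolding g by (rule sum_norm_le) (simp add: norm_mult)
  then show ?thesis using that by blast
qed

lemma TP_bounded:
  assumes "g \<in> TP N"
  obtains B where "\<And>t. norm (g t) \<le> B"
proof -
  obtain c where g: "g = (\<lambda>x. \<Sum>k\<in>freq_box N. c k * cis (idot k x))"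
    using assms unfolding TP_def by (blast elim: tspanE)
  have "norm (g t) \<le> (\<Sum>k\<in>freq_box N. norm (c k))" for t
    unfolding g by (rule sum_norm_le) (simp add: norm_mult)
  then show ?thesis using that by blast
qed

text \<open>The supremum is at most the sum of the moduli of the \<open>2 * N + 1\<close>
  coefficients, each of which is bounded by the L_1 norm; the gain of \<open>1 / (2 * pi)\<close> is
  given away.\<close>

lemma nikolskii_tp_L1:
  assumes "g \<in> tp N"
  shows "norm (g t) \<le> (2 * real N + 1) * pint (\<lambda>t. norm (g t))"
proof -
  obtain c where g: "g = (\<lambda>x. \<Sum>k\<in>{-int N..int N}. c k * cis (real_of_int k * x))"
    using assms unfolding tp_def by (blast elim: tspanE)
  have "norm (g t) \<le> (\<Sum>k\<in>{-int N..int N}. norm (c k))"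
    unfolding g by (rule sum_norm_le) (simp add: norm_mult)
  also have "\<dots> \<le> (\<Sum>k\<in>{-int N..int N}. pint (\<lambda>t. norm (g t)))"
  proof (intro sum_mono)
    fix k assume "k \<in> {-int N..int N}"
    then have "2 * pi * norm (c k) \<le> pint (\<lambda>t. norm (g t))"
      by (intro tp_coeff_bound[OF _ g]) auto
    moreover have "1 * norm (c k) \<le> (2 * pi) * norm (c k)"
      by (intro mult_right_mono) (use pi_ge_two in auto)
    ultimately show "norm (c k) \<le> pint (\<lambda>t. norm (g t))" by linarith
  qed
  finally show ?thesis by simp
qed

lemma nikolskii_TP_L1:
  fixes g :: "real^'d::finite \<Rightarrow> complex"
  assumes "g \<in> TP N"
  shows "norm (g t) \<le> (\<Prod>i\<in>UNIV. 2 * real (N i) + 1) * integral torus (\<lambda>x. norm (g x))"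
proof -
  have cont: "continuous_on UNIV g" by (rule TP_continuous[OF assms])
  obtain c where g: "g = (\<lambda>x. \<Sum>k\<in>freq_box N. c k * cis (idot k x))"
    using assms unfolding TP_def by (blast elim: tspanE)
  have nn: "0 \<le> integral torus (\<lambda>x. norm (g x))"
    by (intro torus_int_nonneg continuous_intros cont) auto
  have one: "1 \<le> (2 * pi) ^ CARD('d)" using pi_ge_two by (intro one_le_power) linarith
  have "norm (g t) \<le> (\<Sum>k\<in>freq_box N. norm (c k))"
    unfolding g by (rule sum_norm_le) (simp add: norm_mult)
  also have "\<dots> \<le> (\<Sum>k\<in>freq_box N. integral torus (\<lambda>x. norm (g x)))"
  proof (intro sum_mono)
    fix k assume "k \<in> freq_box N"
    then have "fourier_coeff g k = c k" unfolding g by (simp add: TP_coeff finite_freq_box)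
    then have "(2 * pi) ^ CARD('d) * norm (c k) \<le> integral torus (\<lambda>x. norm (g x))"
      using fourier_coeff_L1[OF cont, of k] by simp
    moreover have "1 * norm (c k) \<le> (2 * pi) ^ CARD('d) * norm (c k)"
      by (intro mult_right_mono one) auto
    ultimately show "norm (c k) \<le> integral torus (\<lambda>x. norm (g x))" by linarith
  qed
  also have "\<dots> = real (card (freq_box N)) * integral torus (\<lambda>x. norm (g x))" by simp
  also have "\<dots> \<le> (\<Prod>i\<in>UNIV. 2 * real (N i) + 1) * integral torus (\<lambda>x. norm (g x))"
    by (intro mult_right_mono card_freq_box nn)
  finally show ?thesis .
qed

text \<open>The L_1 inequality is applied to \<open>g ^ k\<close> with \<open>k\<close> the ceiling
  of \<open>p\<close>, a polynomial of degree \<open>k * N\<close>; \<open>sup_power_trick\<close>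
  then lowers the exponent from \<open>k\<close> to \<open>p\<close>. Small and large exponents are
  covered alike.\<close>

lemma nikolskii_tp:
  assumes "0 < p"
  shows "\<exists>C>0. \<forall>N. \<forall>g\<in>tp N. \<forall>t. norm (g t) powr p \<le> C * (real N + 1) * pint (\<lambda>t. norm (g t) powr p)"
proof -
  define k where "k = nat \<lceil>p\<rceil>"
  have k: "0 < k" "p \<le> real k" using assms unfolding k_def by linarith+
  have "norm (g t) powr p \<le> (2 * real (k * N) + 1) * pint (\<lambda>t. norm (g t) powr p)" if g: "g \<in> tp N" for N g t
  proof -
    obtain B where B: "\<And>t. norm (g t) \<le> B" using tp_bounded[OF g] by blast
    have cont: "continuous_on UNIV g" by (rule tp_continuous[OF g])
    show ?thesis
    proof (rule sup_power_trick[OF assms k(2,1) _ _ B])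
      show "0 \<le> pint (\<lambda>t. norm (g t) powr p)"
        by (intro pint_nonneg continuous_intros cont assms) auto
      show "norm (g x) ^ k \<le> (2 * real (k * N) + 1) * pint (\<lambda>t. norm (g t) ^ k)" for x
        using nikolskii_tp_L1[OF tp_power[OF g, of k], of x] by (simp add: norm_power)
      fix S assume "0 \<le> S" "\<And>x. norm (g x) \<le> S"
      then have "pint (\<lambda>t. norm (g t) ^ k) \<le> pint (\<lambda>t. S powr (real k - p) * norm (g t) powr p)"
        by (intro pint_le continuous_intros cont assms norm_power_le_sup k) auto
      then show "pint (\<lambda>t. norm (g t) ^ k) \<le> S powr (real k - p) * pint (\<lambda>t. norm (g t) powr p)"
        by simp
    qed simp
  qed note * = this
  have "(2 * real (k * N) + 1) \<le> (2 * real k + 1) * (real N + 1)" for N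
    by (simp add: algebra_simps)
  then have "(2 * real (k * N) + 1) * pint (\<lambda>t. norm (g t) powr p) \<le> (2 * real k + 1) * (real N + 1) * pint (\<lambda>t. norm (g t) powr p)"
    if "g \<in> tp N" for N and g :: "real \<Rightarrow> complex"
    by (intro mult_right_mono pint_nonneg continuous_intros tp_continuous[OF that] assms) auto
  from order_trans[OF * this] show ?thesis
    by (intro exI[of _ "2 * real k + 1"] conjI allI ballI) auto
qed

lemma nikolskii_TP:
  assumes "0 < p"
  shows "\<exists>C>0. \<forall>N::'d::finite \<Rightarrow> nat. \<forall>g\<in>TP N. \<forall>x.
    norm (g x) powr p \<le> C * (\<Prod>i\<in>UNIV. real (N i) + 1) * integral torus (\<lambda>x. norm (g x) powr p)"
proof -
  define k where "k = nat \<lceil>p\<rceil>"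
  have k: "0 < k" "p \<le> real k" using assms unfolding k_def by linarith+
  have "norm (g t) powr p \<le> (\<Prod>i\<in>UNIV. 2 * real (k * N i) + 1) * integral torus (\<lambda>t. norm (g t) powr p)"
    if g: "g \<in> TP N" for N :: "'d \<Rightarrow> nat" and g t
  proof -
    obtain B where B: "\<And>t. norm (g t) \<le> B" using TP_bounded[OF g] by blast
    have cont: "continuous_on UNIV g" by (rule TP_continuous[OF g])
    show ?thesis
    proof (rule sup_power_trick[OF assms k(2,1) _ _ B])
      show "0 \<le> integral torus (\<lambda>t. norm (g t) powr p)"
        by (intro torus_int_nonneg continuous_intros cont assms) auto
      show "norm (g x) ^ k \<le> (\<Prod>i\<in>UNIV. 2 * real (k * N i) + 1) * integral torus (\<lambda>t. norm (g t) ^ k)" for x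
        using nikolskii_TP_L1[OF TP_power[OF g, of k], of x] by (simp add: norm_power)
      fix S assume "0 \<le> S" "\<And>x. norm (g x) \<le> S"
      then have "integral torus (\<lambda>t. norm (g t) ^ k) \<le> integral torus (\<lambda>t. S powr (real k - p) * norm (g t) powr p)"
        by (intro torus_int_le continuous_intros cont assms norm_power_le_sup k) auto
      then show "integral torus (\<lambda>t. norm (g t) ^ k) \<le> S powr (real k - p) * integral torus (\<lambda>t. norm (g t) powr p)"
        by simp
    qed (auto intro!: prod_nonneg)
  qed note * = this
  have "(\<Prod>i\<in>UNIV. 2 * real (k * N i) + 1) \<le> (\<Prod>i\<in>UNIV. (2 * real k + 1) * (real (N i) + 1))" for N :: "'d \<Rightarrow> nat"
    by (intro prod_mono) (auto simp: algebra_simps)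
  then have le: "(\<Prod>i\<in>UNIV. 2 * real (k * N i) + 1) \<le> (2 * real k + 1) ^ CARD('d) * (\<Prod>i\<in>UNIV. real (N i) + 1)" for N :: "'d \<Rightarrow> nat"
    by (simp add: prod.distrib)
  have "(\<Prod>i\<in>UNIV. 2 * real (k * N i) + 1) * integral torus (\<lambda>t. norm (g t) powr p)
      \<le> (2 * real k + 1) ^ CARD('d) * (\<Prod>i\<in>UNIV. real (N i) + 1) * integral torus (\<lambda>t. norm (g t) powr p)"
    if "g \<in> TP N" for N :: "'d \<Rightarrow> nat" and g
    by (intro mult_right_mono le torus_int_nonneg continuous_intros TP_continuous[OF that] assms) auto
  from order_trans[OF * this] show ?thesis
    by (intro exI[of _ "(2 * real k + 1) ^ CARD('d)"] conjI allI ballI) auto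
qed

section \<open>Uniqueness of Fourier coefficients\<close>

text \<open>If \<open>h x0\<close> were positive, the powers of \<open>q\<close> would concentrate
  the integral at \<open>x0\<close>: on a small box the integrand is at least
  \<open>h0 * \<rho> ^ n\<close>, elsewhere in the neighbourhood \<open>U\<close> it is nonnegative,
  and outside \<open>U\<close> it is of order \<open>\<eta> ^ n\<close> with
  \<open>\<eta> < \<rho>\<close>. For large \<open>n\<close> the integral would be positive.\<close>

lemma peak_function_nonpos:
  fixes h q :: "'a::euclidean_space \<Rightarrow> real"
  assumes h: "continuous_on (cbox l u) h" and q: "continuous_on (cbox l u) q"
    and x0: "x0 \<in> box l u" "q x0 = 1" and q1: "\<And>x. x \<in> cbox l u \<Longrightarrow> x \<noteq> x0 \<Longrightarrow> \<bar>q x\<bar> < 1"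
    and int0: "\<And>n. integral (cbox l u) (\<lambda>x. h x * q x ^ n) = 0"
  shows "h x0 \<le> 0"
proof (rule ccontr)
  assume "\<not> h x0 \<le> 0"
  define h0 where "h0 = h x0 / 2"
  have h0: "0 < h0" "h0 < h x0" using \<open>\<not> h x0 \<le> 0\<close> by (auto simp: h0_def)
  have x0c: "x0 \<in> cbox l u" using x0 box_subset_cbox by blast
  have "isCont h x0" "isCont q x0"
    using continuous_on_interior h q x0 by (metis interior_cbox)+
  then have lim: "(h \<longlongrightarrow> h x0) (nhds x0)" "(q \<longlongrightarrow> q x0) (nhds x0)"
    unfolding isCont_def tendsto_at_iff_tendsto_nhds by auto
  have near: "\<forall>\<^sub>F x in nhds x0. h0 < h x" "\<And>a. a < 1 \<Longrightarrow> \<forall>\<^sub>F x in nhds x0. a < q x"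
    using order_tendstoD(1)[OF lim(1) h0(2)] order_tendstoD(1)[OF lim(2)] x0(2) by auto
  have "\<forall>\<^sub>F x in nhds x0. x \<in> box l u" using x0 by (intro eventually_nhds_in_open) auto
  then have "\<forall>\<^sub>F x in nhds x0. h0 < h x \<and> 0 < q x \<and> x \<in> box l u"
    using near(1) near(2)[of 0] by (auto simp: eventually_conj_iff)
  then obtain U where U: "open U" "x0 \<in> U" "\<And>x. x \<in> U \<Longrightarrow> h0 < h x \<and> 0 < q x \<and> x \<in> box l u"
    unfolding eventually_nhds by blast
  have "\<exists>\<eta>. 0 < \<eta> \<and> \<eta> < 1 \<and> (\<forall>x\<in>cbox l u - U. \<bar>q x\<bar> \<le> \<eta>)"
  proof (cases "cbox l u - U = {}")
    case True
    then show ?thesis by (intro exI[of _ "1/2"]) auto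
  next
    case False
    have "compact (cbox l u - U)" using U by (simp add: compact_diff)
    moreover have "continuous_on (cbox l u - U) (\<lambda>x. \<bar>q x\<bar>)"
      by (intro continuous_intros continuous_on_subset[OF q]) auto
    ultimately obtain y where y: "y \<in> cbox l u - U" "\<forall>x\<in>cbox l u - U. \<bar>q x\<bar> \<le> \<bar>q y\<bar>"
      using continuous_attains_sup[OF _ False] by blast
    have "\<bar>q y\<bar> < 1" using y U q1[of y] by auto
    then show ?thesis using y
      by (intro exI[of _ "max (1/2) \<bar>q y\<bar>"]) (auto simp: le_max_iff_disj)
  qed
  then obtain \<eta> where \<eta>: "0 < \<eta>" "\<eta> < 1" "\<And>x. x \<in> cbox l u - U \<Longrightarrow> \<bar>q x\<bar> \<le> \<eta>" by blast
  \<comment> \<open>Any value strictly between \<open>\<eta>\<close> and 1 serves: below 1 it is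
    exceeded by \<open>q\<close> near \<open>x0\<close>, and the quotient with \<open>\<eta>\<close>
    is larger than 1.\<close>
  define \<rho> where "\<rho> = (1 + \<eta>) / 2"
  have \<rho>: "\<eta> < \<rho>" "\<rho> < 1" using \<eta> by (auto simp: \<rho>_def)
  have "\<forall>\<^sub>F x in nhds x0. \<rho> < q x \<and> x \<in> U"
    using near(2)[OF \<rho>(2)] eventually_nhds_in_open[OF U(1,2)] by (auto simp: eventually_conj_iff)
  then obtain V where V: "open V" "x0 \<in> V" "\<And>x. x \<in> V \<Longrightarrow> \<rho> < q x \<and> x \<in> U"
    unfolding eventually_nhds by blast
  obtain a b where ab: "cbox a b \<subseteq> V" "x0 \<in> box a b" "\<forall>i\<in>Basis. a \<bullet> i < b \<bullet> i"
    using open_contains_cbox[OF V(1,2)] by blast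
  define v where "v = measure lborel (cbox a b)"
  have v: "0 < v" unfolding v_def using ab(3) by (simp add: content_cbox_cases less_imp_le prod_pos)
  have "compact (h ` cbox l u)" by (rule compact_continuous_image[OF h]) simp
  then obtain M where M: "\<And>x. x \<in> cbox l u \<Longrightarrow> \<bar>h x\<bar> \<le> M"
    using compact_imp_bounded bounded_iff by (metis (no_types, lifting) image_eqI real_norm_def)
  have M0: "0 \<le> M" using M[OF x0c] by linarith
  define W where "W = measure lborel (cbox l u)"
  have sub: "cbox a b \<subseteq> cbox l u" using ab V U box_subset_cbox by (meson subset_eq)
  have bound: "h0 * \<rho> ^ n * v \<le> M * \<eta> ^ n * W" for n
  proof -
    have ptw: "(if x \<in> cbox a b then h0 * \<rho> ^ n else 0) - M * \<eta> ^ n \<le> h x * q x ^ n" if "x \<in> cbox l u" for x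
    proof -
      have M\<eta>: "0 \<le> M * \<eta> ^ n" using M0 \<eta> by simp
      consider "x \<in> cbox a b" | "x \<in> U" "x \<notin> cbox a b" | "x \<notin> U" by blast
      then show ?thesis
      proof cases
        case 1
        then have "x \<in> V" "x \<in> U" using ab V by auto
        then have "h0 * \<rho> ^ n \<le> h x * q x ^ n"
          using V(3)[of x] U(3)[of x] h0 \<rho> \<eta> by (intro mult_mono power_mono) auto
        then show ?thesis using 1 M\<eta> by simp
      next
        case 2
        then have "0 \<le> h x * q x ^ n" using U(3)[of x] h0 by simp
        then show ?thesis using 2 M\<eta> by simp
      next
        case 3
        then have "\<bar>h x * q x ^ n\<bar> \<le> M * \<eta> ^ n"
          unfolding abs_mult power_abs using M[OF that] \<eta>(3)[of x] that
          by (intro mult_mono power_mono) auto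
        moreover have "x \<notin> cbox a b" using 3 ab V by auto
        ultimately show ?thesis by (simp add: abs_le_iff)
      qed
    qed
    have ind: "((\<lambda>x. if x \<in> cbox a b then h0 * \<rho> ^ n else 0) has_integral (h0 * \<rho> ^ n * v)) (cbox l u)"
    proof -
      have "((\<lambda>x. h0 * \<rho> ^ n) has_integral (v *\<^sub>R (h0 * \<rho> ^ n))) (cbox a b)"
        unfolding v_def by (rule has_integral_const)
      then have "((\<lambda>x. if x \<in> cbox a b then h0 * \<rho> ^ n else 0) has_integral (v *\<^sub>R (h0 * \<rho> ^ n))) (cbox l u)"
        by (rule has_integral_restrict_closed_subinterval[OF _ sub])
      then show ?thesis by (simp add: mult_ac)
    qed
    have const: "((\<lambda>x. M * \<eta> ^ n) has_integral (W *\<^sub>R (M * \<eta> ^ n))) (cbox l u)"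
      unfolding W_def by (rule has_integral_const)
    have "(\<lambda>x. h x * q x ^ n) integrable_on cbox l u"
      by (intro integrable_continuous continuous_intros h q)
    then have "((\<lambda>x. h x * q x ^ n) has_integral 0) (cbox l u)"
      using int0[of n] by (metis has_integral_integral)
    from has_integral_le[OF has_integral_diff[OF ind const] this ptw]
    show ?thesis by (simp add: mult_ac)
  qed
  have "1 < \<rho> / \<eta>" using \<rho> \<eta> by simp
  then obtain n where n: "M * W / (h0 * v) < (\<rho> / \<eta>) ^ n" using real_arch_pow by blast
  have "M * W / (h0 * v) < \<rho> ^ n / \<eta> ^ n" using n by (simp add: power_divide)
  then have "M * \<eta> ^ n * W < h0 * \<rho> ^ n * v"
    using h0 v \<eta> by (simp add: field_simps)
  with bound[of n] show False by linarith
qed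

text \<open>The preceding lemma is used for the real part of \<open>cnj (g x0) * g x\<close>, whose
  value at \<open>x0\<close> is the square of the modulus of \<open>g x0\<close> and therefore
  cannot be nonpositive unless it is 0. Boundary points follow by continuity.\<close>

lemma vanish_if_peak_functions:
  fixes g :: "'a::euclidean_space \<Rightarrow> complex"
  assumes g: "continuous_on (cbox l u) g" and ne: "box l u \<noteq> {}"
    and peak: "\<And>x0. x0 \<in> box l u \<Longrightarrow> \<exists>q. continuous_on (cbox l u) q \<and> q x0 = (1::real) \<and>
        (\<forall>x\<in>cbox l u. x \<noteq> x0 \<longrightarrow> \<bar>q x\<bar> < 1) \<and> (\<forall>n. integral (cbox l u) (\<lambda>x. g x * complex_of_real (q x) ^ n) = 0)"
    and x: "x \<in> cbox l u"
  shows "g x = 0"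
proof -
  have "g x0 = 0" if x0: "x0 \<in> box l u" for x0
  proof -
    obtain q where q: "continuous_on (cbox l u) q" "q x0 = 1" "\<And>x. x\<in>cbox l u \<Longrightarrow> x \<noteq> x0 \<Longrightarrow> \<bar>q x\<bar> < 1"
      "\<And>n. integral (cbox l u) (\<lambda>x. g x * complex_of_real (q x) ^ n) = 0"
      using peak[OF x0] by blast
    define a where "a = cnj (g x0)"
    have "Re (a * g x0) \<le> 0"
    proof (rule peak_function_nonpos[OF _ q(1) x0 q(2,3)])
      show "continuous_on (cbox l u) (\<lambda>x. Re (a * g x))" by (intro continuous_intros g)
      fix n
      have int: "(\<lambda>x. g x * complex_of_real (q x) ^ n) integrable_on cbox l u"
        by (intro integrable_continuous continuous_intros g q)
      have bl: "bounded_linear (\<lambda>z. Re (a * z))"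
        by (rule bounded_linear_compose[OF bounded_linear_Re bounded_linear_mult_right])
      have "integral (cbox l u) (\<lambda>x. Re (a * g x) * q x ^ n)
          = integral (cbox l u) ((\<lambda>z. Re (a * z)) \<circ> (\<lambda>x. g x * complex_of_real (q x) ^ n))"
        by (intro arg_cong2[where f = integral] ext refl)
           (simp add: o_def algebra_simps flip: of_real_power)
      also have "\<dots> = Re (a * integral (cbox l u) (\<lambda>x. g x * complex_of_real (q x) ^ n))"
        by (rule integral_linear[OF int bl])
      also have "\<dots> = 0" using q(4)[of n] by simp
      finally show "integral (cbox l u) (\<lambda>x. Re (a * g x) * q x ^ n) = 0" .
    qed auto
    then show ?thesis
      unfolding a_def by (simp add: complex_mult_cnj mult.commute[of "cnj _"] flip: of_real_add)
         (metis complex_eq_0 order_antisym sum_power2_ge_zero)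
  qed
  then show ?thesis
    using continuous_constant_on_closure[of "box l u" g 0 x] g x closure_box[OF ne] by auto
qed

lemma cos_less_1:
  assumes "s \<noteq> 0" "\<bar>s\<bar> < 2 * pi"
  shows "cos s < 1"
proof -
  have "sin (s / 2) \<noteq> 0"
  proof (cases "s > 0")
    case True
    then show ?thesis using sin_gt_zero[of "s/2"] assms by auto
  next
    case False
    then show ?thesis using sin_gt_zero[of "-s/2"] assms by auto
  qed
  moreover have "cos s = 1 - 2 * (sin (s/2))\<^sup>2" using cos_double_sin[of "s/2"] by simp
  ultimately show ?thesis by simp
qed

text \<open>The peak function \<open>(1 + cos (t - x0)) / 2\<close> is a trigonometric polynomial,
  so all its powers are orthogonal to \<open>g\<close>. Peaks are taken at interior points only: a
  peak at one end of the interval would also be attained at the other end.\<close>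

lemma fourier_unique_1:
  assumes g: "continuous_on {-pi..pi} g"
    and 0: "\<And>k::int. pint (\<lambda>t. g t * cis (real_of_int k * t)) = 0" and t: "t \<in> {-pi..pi}"
  shows "g t = (0::complex)"
proof (rule vanish_if_peak_functions[of "-pi" pi])
  fix x0 assume x0: "x0 \<in> box (-pi) pi"
  define q where "q = (\<lambda>t. (1 + cos (t - x0)) / 2)"
  have qtp: "(\<lambda>t. complex_of_real (q t)) \<in> tp 1"
  proof -
    have "(\<lambda>t. 1/2 + (cis (-x0) / 4 * cis (real_of_int 1 * t) + cis x0 / 4 * cis (real_of_int (-1) * t))) \<in> tp 1"
      by (intro tp_add tp_const tp_cmult tp_cis) auto
    also have "(\<lambda>t. 1/2 + (cis (-x0) / 4 * cis (real_of_int 1 * t) + cis x0 / 4 * cis (real_of_int (-1) * t))) = (\<lambda>t. complex_of_real (q t))"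
      by (auto simp: q_def complex_eq_iff cos_diff field_simps)
    finally show ?thesis .
  qed
  show "\<exists>q. continuous_on (cbox (-pi) pi) q \<and> q x0 = (1::real) \<and>
        (\<forall>x\<in>cbox (-pi) pi. x \<noteq> x0 \<longrightarrow> \<bar>q x\<bar> < 1) \<and> (\<forall>n. integral (cbox (-pi) pi) (\<lambda>x. g x * complex_of_real (q x) ^ n) = 0)"
  proof (intro exI[of _ q] conjI ballI impI allI)
    show "continuous_on (cbox (-pi) pi) q" unfolding q_def by (intro continuous_intros) auto
    show "q x0 = 1" by (simp add: q_def)
    fix x :: real assume "x \<in> cbox (-pi) pi" "x \<noteq> x0"
    then have "cos (x - x0) < 1" using x0 by (intro cos_less_1) auto
    moreover have "\<bar>(1 + c) / 2\<bar> < 1" if "c < 1" "-1 \<le> c" for c :: real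
      using that by (auto simp: abs_if)
    ultimately show "\<bar>q x\<bar> < 1" unfolding q_def by (metis cos_ge_minus_one)
  next
    fix n
    obtain c where c: "(\<lambda>t. complex_of_real (q t) ^ n) = (\<lambda>x. \<Sum>k\<in>{-int (n*1)..int (n*1)}. c k * cis (real_of_int k * x))"
      using tp_power[OF qtp, of n] unfolding tp_def by (blast elim: tspanE)
    have "pint (\<lambda>x. g x * complex_of_real (q x) ^ n) = pint (\<lambda>x. \<Sum>k\<in>{-int n..int n}. c k * (g x * cis (real_of_int k * x)))"
      using fun_cong[OF c] by (simp add: sum_distrib_left mult_ac)
    also have "\<dots> = (\<Sum>k\<in>{-int n..int n}. pint (\<lambda>x. c k * (g x * cis (real_of_int k * x))))"
      by (intro Henstock_Kurzweil_Integration.integral_sum integrable_continuous_real continuous_intros g) auto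
    also have "\<dots> = 0" using 0 by simp
    finally show "integral (cbox (-pi) pi) (\<lambda>x. g x * complex_of_real (q x) ^ n) = 0" by simp
  qed
qed (use g t pi_gt_zero in \<open>auto simp del: pi_gt_zero simp: not_le\<close>)

lemma fourier_unique_torus:
  fixes g :: "real^'d::finite \<Rightarrow> complex"
  assumes g: "continuous_on UNIV g"
    and 0: "\<And>k. fourier_coeff g k = 0" and t: "t \<in> torus"
  shows "g t = 0"
proof (rule vanish_if_peak_functions[of torus_lo torus_hi])
  show "continuous_on (cbox torus_lo torus_hi) g" using g continuous_on_subset by blast
  show "box torus_lo torus_hi \<noteq> ({} :: (real^'d) set)"
    by (simp add: interval_eq_empty_cart torus_lo_def torus_hi_def not_less not_le)
  show "t \<in> cbox torus_lo torus_hi" using t by (simp add: torus_eq_cbox)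
  fix x0 :: "real^'d" assume x0: "x0 \<in> box torus_lo torus_hi"
  have x0i: "-pi < x0 $ i" "x0 $ i < pi" for i
    using x0 by (auto simp: mem_box_cart torus_lo_def torus_hi_def)
  \<comment> \<open>The average of the coordinatewise peaks: it falls below 1 as soon as a single
    coordinate differs from that of \<open>x0\<close>.\<close>
  define q where "q = (\<lambda>t::real^'d. (\<Sum>i\<in>UNIV. (1 + cos (t $ i - x0 $ i)) / 2) / real CARD('d))"
  have qtp: "(\<lambda>t. complex_of_real (q t)) \<in> TP (\<lambda>_. 1)"
  proof -
    have idot1: "idot (axis i s) t = real_of_int s * t $ i" for i :: 'd and s t
    proof -
      have "idot (axis i s) t = (\<Sum>j\<in>UNIV. if j = i then real_of_int s * t $ i else 0)"
        unfolding idot_def by (intro sum.cong) (auto simp: axis_def)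
      then show ?thesis by simp
    qed
    have "(\<lambda>t. 1 / of_nat CARD('d) * (\<Sum>i\<in>UNIV. 1/2 + (cis (-x0$i) / 4 * cis (idot (axis i 1) t) + cis (x0$i) / 4 * cis (idot (axis i (-1)) t)))) \<in> TP (\<lambda>_::'d. 1)"
      by (intro TP_add TP_const TP_cmult TP_cis TP_sum) (auto simp: freq_box_def axis_def)
    also have "(\<lambda>t. 1 / of_nat CARD('d) * (\<Sum>i\<in>UNIV. 1/2 + (cis (-x0$i) / 4 * cis (idot (axis i 1) t) + cis (x0$i) / 4 * cis (idot (axis i (-1)) t)))) = (\<lambda>t. complex_of_real (q t))"
      unfolding q_def idot1 of_real_divide of_real_sum
      by (intro ext, simp, intro arg_cong2[where f = "(/)"] sum.cong refl)
         (auto simp: complex_eq_iff cos_diff field_simps)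
    finally show ?thesis .
  qed
  show "\<exists>q. continuous_on (cbox torus_lo torus_hi) q \<and> q x0 = (1::real) \<and>
        (\<forall>x\<in>cbox torus_lo torus_hi. x \<noteq> x0 \<longrightarrow> \<bar>q x\<bar> < 1) \<and>
        (\<forall>n. integral (cbox torus_lo torus_hi) (\<lambda>x. g x * complex_of_real (q x) ^ n) = 0)"
  proof (intro exI[of _ q] conjI ballI impI allI)
    show "continuous_on (cbox torus_lo torus_hi) q" unfolding q_def by (intro continuous_intros) auto
    show "q x0 = 1" by (simp add: q_def)
    fix x :: "real^'d" assume x: "x \<in> cbox torus_lo torus_hi" "x \<noteq> x0"
    then obtain i where i: "x $ i \<noteq> x0 $ i" by (auto simp: vec_eq_iff)
    have "-pi \<le> x $ i" "x $ i \<le> pi" using x by (auto simp: mem_box_cart torus_lo_def torus_hi_def)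
    then have "cos (x $ i - x0 $ i) < 1" using x0i[of i] i by (intro cos_less_1) auto
    then have "(\<Sum>i\<in>UNIV. (1 + cos (x $ i - x0 $ i)) / 2) < (\<Sum>i\<in>(UNIV::'d set). 1)"
      by (intro sum_strict_mono_ex1) auto
    then have "q x < 1" by (simp add: q_def divide_simps)
    moreover have "0 \<le> 1 + cos s" for s :: real using cos_ge_minus_one[of s] by linarith
    then have "0 \<le> q x" unfolding q_def by (intro divide_nonneg_nonneg sum_nonneg) auto
    ultimately show "\<bar>q x\<bar> < 1" by simp
  next
    fix n
    obtain c where c: "(\<lambda>t. complex_of_real (q t) ^ n) = (\<lambda>x. \<Sum>k\<in>freq_box (\<lambda>i. n * 1). c k * cis (idot k x))"
      using TP_power[OF qtp, of n] unfolding TP_def by (blast elim: tspanE)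
    have 1: "integral torus (\<lambda>x. g x * cis (idot k x)) = 0" for k
      using 0[of "-k"] by (simp add: fourier_coeff_def idot_minus_left)
    have "integral torus (\<lambda>x. g x * complex_of_real (q x) ^ n) = integral torus (\<lambda>x. \<Sum>k\<in>freq_box (\<lambda>i. n * 1). c k * (g x * cis (idot k x)))"
      using fun_cong[OF c] by (simp add: sum_distrib_left mult_ac)
    also have "\<dots> = (\<Sum>k\<in>freq_box (\<lambda>i. n * 1). integral torus (\<lambda>x. c k * (g x * cis (idot k x))))"
      by (intro torus_int_sum continuous_intros g finite_freq_box)
    also have "\<dots> = 0" using 1 by simp
    finally show "integral (cbox torus_lo torus_hi) (\<lambda>x. g x * complex_of_real (q x) ^ n) = 0"
      by (simp add: torus_eq_cbox)
  qed
qed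

section \<open>Pointwise estimates for trigonometric polynomials\<close>

text \<open>A periodic substitute for \<open>1 + n |t|\<close>.\<close>

definition wt :: "real \<Rightarrow> real \<Rightarrow> real" where
  "wt n t = 1 + n * \<bar>sin (t / 2)\<bar>"

lemma wt_ge_1: "0 \<le> n \<Longrightarrow> 1 \<le> wt n t"
  by (simp add: wt_def)

lemma wt_pos: "0 \<le> n \<Longrightarrow> 0 < wt n t"
  using wt_ge_1[of n t] by linarith

lemma wt_minus: "wt n (- t) = wt n t"
  by (simp add: wt_def)

lemma wt_commute: "wt n (x - y) = wt n (y - x)"
  using wt_minus[of n "x - y"] by simp

lemma wt_periodic: "wt n (t + 2 * pi) = wt n t"
proof -
  have "(t + 2 * pi) / 2 = t / 2 + pi" by simp
  then show ?thesis unfolding wt_def by (simp only: sin_periodic_pi abs_minus_cancel)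
qed

lemma continuous_on_wt [continuous_intros]:
  fixes f :: "'a::t2_space \<Rightarrow> real"
  shows
  "continuous_on S f \<Longrightarrow> continuous_on S (\<lambda>x. wt n (f x))"
  unfolding wt_def
  by (intro continuous_on_add continuous_on_const continuous_on_mult continuous_on_rabs
      continuous_on_sin continuous_on_divide) auto

lemma continuous_on_wt_powr [continuous_intros]:
  fixes f :: "'a::t2_space \<Rightarrow> real"
  assumes "0 \<le> n" "continuous_on S f"
  shows "continuous_on S (\<lambda>x. wt n (f x) powr a)"
proof -
  have "wt n s \<noteq> 0" for s using wt_pos[OF assms(1), of s] by simp
  then show ?thesis by (intro continuous_intros assms) auto
qed

lemma continuous_on_norm_wt:
  fixes h :: "'a::t2_space \<Rightarrow> real"
  assumes "0 < p" "0 \<le> n" "continuous_on S g" "continuous_on S h"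
  shows "continuous_on S (\<lambda>z. norm (g z) powr p * wt n (h z) powr a)"
  by (intro continuous_on_mult continuous_on_norm_powr continuous_on_wt_powr assms)

lemma wt_add_le:
  assumes "0 \<le> n" "n \<le> N"
  shows "wt n (s + t) \<le> wt n s * wt N t"
proof -
  have "\<bar>sin ((s + t) / 2)\<bar> \<le> \<bar>sin (s / 2) * cos (t / 2)\<bar> + \<bar>cos (s / 2) * sin (t / 2)\<bar>"
    unfolding add_divide_distrib sin_add by (rule abs_triangle_ineq)
  also have "\<dots> \<le> \<bar>sin (s / 2)\<bar> * 1 + 1 * \<bar>sin (t / 2)\<bar>"
    unfolding abs_mult by (intro add_mono mult_mono) auto
  finally have "n * \<bar>sin ((s + t) / 2)\<bar> \<le> n * (\<bar>sin (s / 2)\<bar> + \<bar>sin (t / 2)\<bar>)"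
    using assms(1) by (intro mult_left_mono) auto
  moreover have "n * \<bar>sin (t/2)\<bar> \<le> N * \<bar>sin (t/2)\<bar>" using assms by (intro mult_right_mono) auto
  moreover have "0 \<le> (n * \<bar>sin (s / 2)\<bar>) * (N * \<bar>sin (t / 2)\<bar>)" using assms by simp
  ultimately show ?thesis unfolding wt_def by (simp add: algebra_simps)
qed

text \<open>Decay around one point at the fine scale \<open>N\<close> is exchanged for decay around
  another point at the coarser scale \<open>n\<close>, at the price of the weight of their distance.
  This is \<open>wt_add_le\<close> read backwards.\<close>

lemma wt_powr_neg_le:
  assumes "0 \<le> n" "n \<le> N" "0 \<le> a"
  shows "wt N t powr (- a) \<le> wt n s powr a * wt n (s + t) powr (- a)"
proof -
  have p: "0 < wt n s" "0 < wt n (s + t)" "0 < wt N t" using assms by (auto intro!: wt_pos)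
  have "wt n (s + t) powr a \<le> (wt n s * wt N t) powr a"
    by (intro powr_mono2 wt_add_le assms) (use p in auto)
  then have "wt n (s + t) powr a \<le> wt n s powr a * wt N t powr a"
    using p by (simp add: powr_mult)
  then show ?thesis using p by (simp add: powr_minus field_simps)
qed

text \<open>A crude constant obtained in two cases: the mean value theorem with cosine at least 1/2
  up to \<open>pi / 3\<close>, and monotonicity with sine at least 1/2 beyond, where
  \<open>x / 4\<close> is below 1/2.\<close>

lemma sin_ge_quarter:
  assumes "0 \<le> x" "x \<le> pi / 2"
  shows "x / 4 \<le> sin x"
proof (cases "x \<le> pi / 3")
  case True
  show ?thesis
  proof (cases "x = 0")
    case False
    then obtain z where z: "0 < z" "z < x" "sin x - sin 0 = (x - 0) * cos z"
      using MVT2[of 0 x sin cos] assms DERIV_sin by auto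
    have "cos (pi / 3) \<le> cos z" using z True by (intro cos_monotone_0_pi_le) auto
    then have "x * (1 / 2) \<le> x * cos z" using assms by (intro mult_left_mono) (auto simp: cos_60)
    then show ?thesis using z assms by simp
  qed simp
next
  case False
  have "sin (pi / 6) \<le> sin x" using False assms by (intro sin_monotone_2pi_le) auto
  then show ?thesis using assms pi_less_4 by (simp add: sin_30)
qed

lemma abs_sin_half_ge:
  assumes "\<bar>t\<bar> \<le> pi"
  shows "\<bar>t\<bar> / 8 \<le> \<bar>sin (t / 2)\<bar>"
proof -
  have "\<bar>t\<bar> / 2 / 4 \<le> sin (\<bar>t\<bar> / 2)" using assms by (intro sin_ge_quarter) auto
  then show ?thesis by (cases "t \<ge> 0") auto
qed

text \<open>The weight is compared with \<open>1 + n * \<bar>t\<bar> / 8\<close>, for which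
  \<open>F\<close> is an explicit antiderivative of the power; each half period contributes at most
  \<open>8 / (n * (a - 1))\<close>.\<close>

lemma pint_wt_powr:
  assumes a: "1 < a" and n: "0 < n"
  shows "pint (\<lambda>t. wt n t powr (- a)) \<le> 16 / (a - 1) / n"
proof -
  define F where "F = (\<lambda>t. - (8 / (n * (a - 1))) * (1 + n * t / 8) powr (1 - a))"
  define f where "f = (\<lambda>t. (1 + n * t / 8) powr (- a))"
  have pos: "0 < 1 + n * t / 8" if "t \<in> {0..pi}" for t using that n by (auto intro: add_pos_nonneg)
  have "(f has_integral F pi - F 0) {0..pi}"
  proof (rule fundamental_theorem_of_calculus)
    fix t assume t: "t \<in> {0..pi}"
    have "(F has_real_derivative f t) (at t)"
    proof -
      have "((\<lambda>t. 1 + n * t / 8) has_real_derivative n / 8) (at t)"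
        by (auto intro!: derivative_eq_intros)
      from DERIV_cmult[OF DERIV_fun_powr[OF this pos[OF t], of "1 - a"], of "- (8 / (n * (a - 1)))"]
      have "(F has_real_derivative - (8 / (n * (a - 1))) * ((1 - a) * (1 + n * t / 8) powr (1 - a - of_nat 1) * (n / 8))) (at t)"
        unfolding F_def .
      moreover have "- (8 / (n * (a - 1))) * ((1 - a) * X * (n / 8)) = X" for X
        using n a by (simp add: field_simps)
      ultimately show ?thesis unfolding f_def by simp
    qed
    then show "(F has_vector_derivative f t) (at t within {0..pi})"
      by (simp add: has_real_derivative_iff_has_vector_derivative has_vector_derivative_at_within)
  qed simp
  then have If: "(f has_integral F pi - F 0) {0..pi}" .
  have "F pi - F 0 \<le> 8 / (n * (a - 1))" using a n by (simp add: F_def)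
  have le: "wt n t powr (- a) \<le> f \<bar>t\<bar>" if "\<bar>t\<bar> \<le> pi" for t
    unfolding f_def
  proof (rule powr_mono2')
    show "0 < 1 + n * \<bar>t\<bar> / 8" using n by (auto intro: add_pos_nonneg)
    have "n * (\<bar>t\<bar> / 8) \<le> n * \<bar>sin (t / 2)\<bar>" using n abs_sin_half_ge[OF that] by (intro mult_left_mono) auto
    then show "1 + n * \<bar>t\<bar> / 8 \<le> wt n t" by (simp add: wt_def)
  qed (use a in auto)
  have contw: "continuous_on S (\<lambda>t. wt n t powr (- a))" for S
    using n by (intro continuous_intros) auto
  have i1: "integral {0..pi} (\<lambda>t. wt n t powr (- a)) \<le> F pi - F 0"
    unfolding integral_unique[OF If, symmetric]
  proof (rule Henstock_Kurzweil_Integration.integral_le)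
    show "f integrable_on {0..pi}" using If by (rule has_integral_integrable)
    show "(\<lambda>t. wt n t powr (- a)) integrable_on {0..pi}" by (intro integrable_continuous_real contw)
    show "wt n t powr (- a) \<le> f t" if "t \<in> {0..pi}" for t using le[of t] that by simp
  qed
  have "integral {-pi..0} (\<lambda>t. wt n t powr (- a)) = integral {0..pi} (\<lambda>t. wt n t powr (- a))"
    using Henstock_Kurzweil_Integration.integral_reflect_real[of pi 0 "\<lambda>t. wt n t powr (- a)"] by (simp add: wt_minus)
  moreover have "pint (\<lambda>t. wt n t powr (- a)) = integral {-pi..0} (\<lambda>t. wt n t powr (- a)) + integral {0..pi} (\<lambda>t. wt n t powr (- a))"
    by (intro Henstock_Kurzweil_Integration.integral_combine[symmetric] integrable_continuous_real contw) auto
  ultimately have "pint (\<lambda>t. wt n t powr (- a)) \<le> 2 * (8 / (n * (a - 1)))"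
    using i1 \<open>F pi - F 0 \<le> _\<close> by linarith
  then show ?thesis using a n by (simp add: mult.commute)
qed

lemma pint_wt_shift:
  assumes "0 \<le> n"
  shows "pint (\<lambda>x. wt n (x - y) powr a) = pint (\<lambda>x. wt n x powr a)"
  using integral_period_shift[of "\<lambda>x. wt n x powr a" "- y"] assms
  by (simp add: wt_periodic continuous_intros)

section \<open>Sums over the interpolation nodes\<close>

lemma integral_equal_cells:
  fixes F :: "real \<Rightarrow> real"
  assumes "continuous_on UNIV F" "0 \<le> h"
  shows "(\<Sum>i<m. integral {a + real i * h..a + real (Suc i) * h} F) = integral {a..a + real m * h} F"
proof (induction m)
  case (Suc m)
  have "integral {a..a + real (Suc m) * h} F = integral {a..a + real m * h} F + integral {a + real m * h..a + real (Suc m) * h} F"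
    using assms by (intro Henstock_Kurzweil_Integration.integral_combine[symmetric] integrable_continuous_real)
      (auto intro: continuous_on_subset simp: algebra_simps)
  then show ?case using Suc by simp
qed simp

definition U0 :: "nat \<Rightarrow> int" where "U0 j = (if j = 0 then 0 else - (2 ^ (j - 1)))"

lemma Uset_eq: "Uset j = {U0 j..<U0 j + 2 ^ j}"
  by (cases j) (auto simp: Uset_def U0_def)

lemma sum_Uset: "(\<Sum>u\<in>Uset j. f u) = (\<Sum>i<2^j. f (U0 j + int i))"
proof (rule sum.reindex_bij_witness[of _ "\<lambda>i. U0 j + int i" "\<lambda>u. nat (u - U0 j)"])
  fix u assume "u \<in> Uset j"
  then have "U0 j \<le> u" "u < U0 j + 2 ^ j" by (auto simp: Uset_eq)
  then show "nat (u - U0 j) \<in> {..<2^j}" by (simp add: nat_less_iff)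
qed (auto simp: Uset_eq)

lemma finite_Uset [simp]: "finite (Uset j)"
  by (simp add: Uset_eq)

lemma card_Uset: "card (Uset j) = 2 ^ j"
  by (simp add: Uset_eq nat_power_eq)

definition node :: "nat \<Rightarrow> int \<Rightarrow> real" where
  "node j u = 2 * pi * real_of_int u / 2 ^ j"

text \<open>A Riemann sum estimate. Over a cell of length \<open>h = 2 * pi / n\<close> the power of
  the weight changes by at most the factor \<open>(1 + pi) powr a\<close>, so each term is bounded
  by a multiple of the mean over its cell; the cells tile one period.\<close>

lemma sum_wt_nodes:
  assumes a: "1 < a"
  shows "\<exists>C>0. \<forall>j x. (\<Sum>u\<in>Uset j. wt (2 ^ j) (x - node j u) powr (- a)) \<le> C"
proof -
  define C where "C = (1 + pi) powr a * (16 / (a - 1)) / (2 * pi)"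
  have "(\<Sum>u\<in>Uset j. wt (2 ^ j) (x - node j u) powr (- a)) \<le> C" for j x
  proof -
    define n :: real where "n = 2 ^ j"
    have n: "1 \<le> n" by (simp add: n_def)
    define h where "h = 2 * pi / n"
    have h: "0 < h" using n by (simp add: h_def)
    define y where "y = node j (U0 j)"
    define F where "F = (\<lambda>t. wt n (x - t) powr (- a))"
    have contF: "continuous_on S F" for S unfolding F_def using n by (intro continuous_intros) auto
    have perF: "F (t + 2 * pi) = F t" for t
      unfolding F_def using wt_periodic[of n "x - (t + 2 * pi)"] by (simp add: algebra_simps)
    have node: "node j (U0 j + int i) = y + real i * h" for i
      by (simp add: node_def y_def h_def n_def add_divide_distrib algebra_simps)
    have cell: "wt n (x - (y + real i * h)) powr (- a) \<le>
        (1 + pi) powr a / h * integral {y + real i * h..y + real (Suc i) * h} F" for i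
    proof -
      let ?s = "y + real i * h"
      have Suc_eq: "y + real (Suc i) * h = ?s + h" by (simp add: algebra_simps)
      have "wt n (x - ?s) powr (- a) \<le> (1 + pi) powr a * F t" if t: "t \<in> {?s..?s + h}" for t
      proof -
        have "wt n (t - ?s) \<le> 1 + pi"
        proof -
          have "\<bar>sin ((t - ?s) / 2)\<bar> \<le> \<bar>(t - ?s) / 2\<bar>" by (rule abs_sin_x_le_abs_x)
          also have "\<dots> \<le> h / 2" using t by auto
          finally have "n * \<bar>sin ((t - ?s) / 2)\<bar> \<le> n * (h / 2)" using n by (intro mult_left_mono) auto
          then show ?thesis using n by (simp add: wt_def h_def)
        qed
        then have "wt n (t - ?s) powr a \<le> (1 + pi) powr a"
          using a n wt_ge_1[of n "t - ?s"] by (intro powr_mono2) auto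
        moreover have "wt n (x - ?s) powr (- a) \<le> wt n (?s - t) powr a * wt n (x - t) powr (- a)"
          using wt_powr_neg_le[of n n a "x - ?s" "?s - t"] n a by simp
        ultimately show ?thesis unfolding F_def wt_commute[of n t]
          by (meson mult_right_mono order_trans powr_ge_zero)
      qed
      then have "integral {?s..?s + h} (\<lambda>t. wt n (x - ?s) powr (- a)) \<le> integral {?s..?s + h} (\<lambda>t. (1 + pi) powr a * F t)"
        by (intro Henstock_Kurzweil_Integration.integral_le integrable_continuous_real continuous_intros contF) auto
      then have "h * wt n (x - ?s) powr (- a) \<le> (1 + pi) powr a * integral {?s..?s + h} F"
        using h by simp
      then show ?thesis using h unfolding Suc_eq by (simp add: field_simps)
    qed
    have "(\<Sum>u\<in>Uset j. wt (2 ^ j) (x - node j u) powr (- a)) = (\<Sum>i<2^j. wt n (x - (y + real i * h)) powr (- a))"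
      unfolding sum_Uset node n_def ..
    also have "\<dots> \<le> (\<Sum>i<2^j. (1 + pi) powr a / h * integral {y + real i * h..y + real (Suc i) * h} F)"
      by (intro sum_mono cell)
    also have "\<dots> = (1 + pi) powr a / h * (\<Sum>i<2^j. integral {y + real i * h..y + real (Suc i) * h} F)"
      by (simp only: sum_distrib_left)
    also have "\<dots> = (1 + pi) powr a / h * integral {y..y + real (2^j) * h} F"
      using h by (subst integral_equal_cells[OF contF]) auto
    also have "real (2 ^ j) * h = 2 * pi" by (simp add: h_def n_def)
    also have "integral {y..y + 2 * pi} F = pint (\<lambda>t. F (t + (y + pi)))"
      using integral_shift_real_ivl[of y "y + pi" "y + 2 * pi" F] by (simp add: algebra_simps)
    also have "\<dots> = pint F" by (rule integral_period_shift[OF contF perF])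
    also have "\<dots> = pint (\<lambda>t. wt n t powr (- a))"
      unfolding F_def wt_commute[of n x] using n by (intro pint_wt_shift) auto
    also have "(1 + pi) powr a / h * \<dots> \<le> (1 + pi) powr a / h * (16 / (a - 1) / n)"
      using h n a by (intro mult_left_mono pint_wt_powr) auto
    also have "\<dots> = C" using n by (simp add: C_def h_def)
    finally show ?thesis .
  qed
  moreover have "1 + pi \<noteq> 0" using pi_gt_zero by linarith
  then have "0 < C" using a unfolding C_def by (auto intro!: divide_pos_pos mult_pos_pos)
  ultimately show ?thesis by blast
qed

section \<open>Localisation by bump polynomials\<close>

lemma norm_cis_minus_1: "norm (cis t - 1) = 2 * \<bar>sin (t / 2)\<bar>"
  using dist_exp_i_1[of t] by (simp add: cis_conv_exp)

text \<open>The bump is the \<open>b\<close>-th power of a normalised one-sided Dirichlet kernel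
  \<open>D\<close>. The trivial bound gives modulus at most 1 and the geometric sum gives
  \<open>M * \<bar>sin (t / 2)\<bar> * norm (D t) \<le> 1\<close>; adding the two yields the
  numerator 2.\<close>

lemma tp_bump:
  assumes M: "1 \<le> M"
  shows "\<exists>e\<in>tp (b * M). e 0 = 1 \<and> (\<forall>t. norm (e t) \<le> (2 / wt (real M) t) ^ b)"
proof -
  define D where "D = (\<lambda>t. 1 / of_nat M * (\<Sum>k<M. cis (real_of_int (int k) * t)))"
  have D: "D \<in> tp M" unfolding D_def by (intro tp_cmult tp_sum tp_cis) auto
  have bound: "norm (D t) \<le> 2 / wt (real M) t" for t
  proof -
    have "norm (\<Sum>k<M. cis (real_of_int (int k) * t)) \<le> (\<Sum>k<M. 1)"
      by (rule sum_norm_le) simp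
    then have 1: "norm (D t) \<le> 1" using M by (simp add: D_def norm_mult norm_divide field_simps)
    have "(\<Sum>k<M. cis (real_of_int (int k) * t)) = (\<Sum>k<M. cis t ^ k)"
      by (simp add: Complex.DeMoivre)
    then have "(cis t - 1) * (of_nat M * D t) = cis t ^ M - 1"
      using M by (simp add: D_def power_diff_1_eq)
    then have "norm (cis t - 1) * (real M * norm (D t)) = norm (cis t ^ M - 1)"
      by (metis norm_mult norm_of_nat)
    also have "\<dots> \<le> norm (cis t ^ M) + norm (1::complex)" by (rule norm_triangle_ineq4)
    also have "\<dots> = 2" by (simp add: norm_power)
    finally have "\<bar>sin (t / 2)\<bar> * (real M * norm (D t)) \<le> 1" unfolding norm_cis_minus_1 by simp
    with 1 have "norm (D t) * wt (real M) t \<le> 2" by (simp add: wt_def algebra_simps)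
    then show ?thesis using wt_pos[of "real M" t] by (simp add: field_simps)
  qed
  show ?thesis
  proof (intro bexI[of _ "\<lambda>t. D t ^ b"] conjI allI tp_power D)
    show "D 0 ^ b = 1" using M by (simp add: D_def)
    show "norm (D t ^ b) \<le> (2 / wt (real M) t) ^ b" for t
      unfolding norm_power by (intro power_mono bound) auto
  qed
qed

text \<open>Multiplying by a bump polynomial concentrated at \<open>x\<close> localises the Nikolskii inequality.\<close>

lemma tp_local_bound:
  assumes p: "0 < p" and A: "0 < A"
  shows "\<exists>C>0. \<forall>N\<ge>1. \<forall>g\<in>tp N. \<forall>x.
    norm (g x) powr p \<le> C * real N * pint (\<lambda>y. norm (g y) powr p * wt (real N) (x - y) powr (- A))"
proof -
  \<comment> \<open>The bump decays with order \<open>b\<close>; after raising to the power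
    \<open>p\<close> this has to be at least \<open>A\<close>.\<close>
  define b where "b = nat \<lceil>A / p\<rceil>"
  have b: "A \<le> real b * p" using p unfolding b_def
    by (metis divide_le_eq real_nat_ceiling_ge)
  obtain C where C: "0 < C" and nik: "\<And>N g t. g \<in> tp N \<Longrightarrow>
      norm (g t) powr p \<le> C * (real N + 1) * pint (\<lambda>t. norm (g t) powr p)"
    using nikolskii_tp[OF p] by blast
  define C' where "C' = C * (real b + 2) * 2 powr (real b * p)"
  have "norm (g x) powr p \<le> C' * real N * pint (\<lambda>y. norm (g y) powr p * wt (real N) (x - y) powr (- A))"
    if N: "1 \<le> N" and g: "g \<in> tp N" for N g x
  proof -
    obtain e where e: "e \<in> tp (b * N)" "e 0 = 1" "\<And>t. norm (e t) \<le> (2 / wt (real N) t) ^ b"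
      using tp_bump[OF N, of b] by blast
    define h where "h = (\<lambda>y. g y * e (y + - x))"
    have h: "h \<in> tp (N + b * N)" unfolding h_def by (intro tp_mult g tp_shift e)
    have cg: "continuous_on S g" for S by (rule tp_continuous[OF g])
    have "norm (g x) powr p = norm (h x) powr p" by (simp add: h_def e)
    also have "\<dots> \<le> C * (real (N + b * N) + 1) * pint (\<lambda>t. norm (h t) powr p)" by (rule nik[OF h])
    also have "\<dots> \<le> C * ((real b + 2) * real N) * pint (\<lambda>t. norm (h t) powr p)"
      using C N by (intro mult_right_mono mult_left_mono pint_nonneg continuous_intros p tp_continuous[OF h])
         (auto simp: algebra_simps)
    also have "pint (\<lambda>t. norm (h t) powr p) \<le> pint (\<lambda>y. 2 powr (real b * p) * (norm (g y) powr p * wt (real N) (x - y) powr (- A)))"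
    proof (intro pint_le continuous_on_norm_powr continuous_on_mult_left continuous_on_norm_wt
        continuous_on_diff continuous_on_const continuous_on_id tp_continuous[OF h] p cg)
      fix y
      have w: "1 \<le> wt (real N) (x - y)" by (rule wt_ge_1) simp
      have "norm (e (y + - x)) powr p \<le> ((2 / wt (real N) (x - y)) ^ b) powr p"
        using e(3)[of "y + - x"] p wt_commute[of "real N" y x] by (intro powr_mono2) auto
      also have "\<dots> = (2 / wt (real N) (x - y)) powr (real b * p)"
        using w by (simp add: powr_powr flip: powr_realpow)
      also have "\<dots> = 2 powr (real b * p) * wt (real N) (x - y) powr (- (real b * p))"
        using w by (simp add: powr_divide powr_minus_divide)
      also have "\<dots> \<le> 2 powr (real b * p) * wt (real N) (x - y) powr (- A)"
        using w b by (intro mult_left_mono powr_mono) auto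
      finally have "norm (g y) powr p * norm (e (y + - x)) powr p \<le> norm (g y) powr p * (2 powr (real b * p) * wt (real N) (x - y) powr (- A))"
        by (intro mult_left_mono) auto
      then show "norm (h y) powr p \<le> 2 powr (real b * p) * (norm (g y) powr p * wt (real N) (x - y) powr (- A))"
        by (simp add: h_def norm_mult powr_mult mult_ac)
    qed auto
    also have "pint (\<lambda>y. 2 powr (real b * p) * (norm (g y) powr p * wt (real N) (x - y) powr (- A))) =
        2 powr (real b * p) * pint (\<lambda>y. norm (g y) powr p * wt (real N) (x - y) powr (- A))"
      by (rule Henstock_Kurzweil_Integration.integral_mult_right)
    finally show ?thesis using C N by (simp add: C'_def mult_ac)
  qed
  moreover have "0 < C'" using C by (simp add: C'_def)
  ultimately show ?thesis by blast
qed

lemma continuous_on_pint_param: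
  fixes f :: "real \<Rightarrow> real \<Rightarrow> 'b::banach"
  assumes "continuous_on UNIV (\<lambda>(x, t). f x t)"
  shows "continuous_on S (\<lambda>x. pint (f x))"
  using integral_continuous_on_param[of S "-pi" pi f] continuous_on_subset[OF assms] by auto

lemma pint_swap:
  fixes f :: "real \<Rightarrow> real \<Rightarrow> 'b::banach"
  assumes "continuous_on UNIV (\<lambda>(x, t). f x t)"
  shows "pint (\<lambda>x. pint (f x)) = pint (\<lambda>y. pint (\<lambda>x. f x y))"
  using integral_swap_continuous[of "-pi" "-pi" pi pi f] continuous_on_subset[OF assms] by auto

text \<open>A majorant in the style of Peetre's maximal function, but continuous.\<close>

lemma tp_peetre:
  assumes p: "0 < p" and A: "1 < A"
  shows "\<exists>C>0. \<forall>N n g. 1 \<le> N \<longrightarrow> 0 < n \<longrightarrow> n \<le> real N \<longrightarrow> g \<in> tp N \<longrightarrow>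
    (\<exists>G. continuous_on UNIV G \<and> (\<forall>x. 0 \<le> G x) \<and> (\<forall>x y. norm (g y) powr p \<le> wt n (x - y) powr A * G x) \<and>
      pint G \<le> C * (real N / n) * pint (\<lambda>t. norm (g t) powr p))"
proof -
  obtain C where C: "0 < C" and loc: "\<And>N g x. 1 \<le> N \<Longrightarrow> g \<in> tp N \<Longrightarrow>
    norm (g x) powr p \<le> C * real N * pint (\<lambda>y. norm (g y) powr p * wt (real N) (x - y) powr (- A))"
    using tp_local_bound[OF p, of A] A by auto
  define C' where "C' = C * (16 / (A - 1))"
  have "\<exists>G. continuous_on UNIV G \<and> (\<forall>x. 0 \<le> G x) \<and> (\<forall>x y. norm (g y) powr p \<le> wt n (x - y) powr A * G x) \<and>
      pint G \<le> C' * (real N / n) * pint (\<lambda>t. norm (g t) powr p)"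
    if N: "1 \<le> N" and n: "0 < n" "n \<le> real N" and g: "g \<in> tp N" for N n g
  proof -
    have cg: "continuous_on S g" for S by (rule tp_continuous[OF g])
    define f where "f = (\<lambda>x z. norm (g z) powr p * wt n (x - z) powr (- A))"
    have cf: "continuous_on UNIV (\<lambda>(x, z). f x z)"
      unfolding f_def case_prod_beta using n
      by (intro continuous_on_norm_wt p continuous_on_compose2[OF cg] continuous_intros) auto
    have cfx: "continuous_on UNIV (f x)" for x
      unfolding f_def using n by (intro continuous_on_norm_wt continuous_intros p cg) auto
    \<comment> \<open>A convolution of the \<open>p\<close>-th power of \<open>norm (g z)\<close>
      with a weight at scale \<open>n\<close>. The pointwise bound comes from the local inequality
      at \<open>y\<close>, recentred at \<open>x\<close>; in the integral of \<open>G\<close> the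
      weight contributes \<open>1 / n\<close>, which explains the factor
      \<open>real N / n\<close>.\<close>
    define G where "G = (\<lambda>x. C * real N * pint (f x))"
    have fpos: "0 \<le> f x z" for x z by (simp add: f_def)
    have G0: "0 \<le> G x" for x unfolding G_def using C by (intro mult_nonneg_nonneg pint_nonneg cfx fpos) auto
    have cG: "continuous_on UNIV G" unfolding G_def
      by (intro continuous_intros continuous_on_pint_param cf)
    have ptw: "norm (g y) powr p \<le> wt n (x - y) powr A * G x" for x y
    proof -
      have "norm (g y) powr p \<le> C * real N * pint (\<lambda>z. norm (g z) powr p * wt (real N) (y - z) powr (- A))"
        by (rule loc[OF N g])
      also have "\<dots> \<le> C * real N * pint (\<lambda>z. wt n (x - y) powr A * f x z)"
      proof (intro mult_left_mono pint_le continuous_on_norm_wt continuous_on_mult_left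
          continuous_on_diff continuous_on_const continuous_on_id cg p cfx)
        fix z
        have "wt (real N) (y - z) powr (- A) \<le> wt n (x - y) powr A * wt n (x - z) powr (- A)"
          using wt_powr_neg_le[of n "real N" A "y - z" "x - y"] n A by simp
        then have "norm (g z) powr p * wt (real N) (y - z) powr (- A) \<le> norm (g z) powr p * (wt n (x - y) powr A * wt n (x - z) powr (- A))"
          by (intro mult_left_mono) auto
        then show "norm (g z) powr p * wt (real N) (y - z) powr (- A) \<le> wt n (x - y) powr A * f x z"
          by (simp add: f_def mult_ac)
      qed (use C in auto)
      finally show ?thesis by (simp add: G_def mult_ac)
    qed
    have "pint G = C * real N * pint (\<lambda>x. pint (f x))" by (simp add: G_def)
    also have "\<dots> = C * real N * pint (\<lambda>z. pint (\<lambda>x. f x z))" by (simp add: pint_swap[OF cf])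
    also have "\<dots> = C * real N * pint (\<lambda>z. norm (g z) powr p * pint (\<lambda>x. wt n x powr (- A)))"
      using n by (simp add: f_def pint_wt_shift)
    also have "\<dots> = C * real N * (pint (\<lambda>z. norm (g z) powr p) * pint (\<lambda>x. wt n x powr (- A)))" by simp
    also have "\<dots> \<le> C * real N * (pint (\<lambda>z. norm (g z) powr p) * (16 / (A - 1) / n))"
      using C by (intro mult_left_mono pint_wt_powr A n pint_nonneg continuous_intros cg p) auto
    also have "\<dots> = C' * (real N / n) * pint (\<lambda>t. norm (g t) powr p)" by (simp add: C'_def)
    finally show ?thesis using cG G0 ptw by blast
  qed
  moreover have "0 < C'" using C A by (simp add: C'_def)
  ultimately show ?thesis by blast
qed

section \<open>Fourier multipliers from an admissible system\<close>

definition bdiff :: "(real \<Rightarrow> real) \<Rightarrow> real \<Rightarrow> real" where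
  "bdiff g x = g x - g (x - 1)"

lemma has_real_derivative_shift:
  assumes "\<And>x. g differentiable (at x)"
  shows "((\<lambda>x. g (x - 1)) has_real_derivative deriv g (x - 1)) (at x)"
proof -
  have "(g has_real_derivative deriv g (x - 1)) (at (x - 1))"
    using assms by (simp add: DERIV_deriv_iff_real_differentiable)
  then show ?thesis using DERIV_shift[of g "deriv g (x - 1)" x "-1"] by simp
qed

lemma deriv_bdiff:
  assumes "\<And>x. g differentiable (at x)"
  shows "(bdiff g has_real_derivative bdiff (deriv g) x) (at x)"
proof -
  have "(g has_real_derivative deriv g x) (at x)"
    using assms by (simp add: DERIV_deriv_iff_real_differentiable)
  from DERIV_diff[OF this has_real_derivative_shift[OF assms]] show ?thesis
    unfolding bdiff_def by (simp add: bdiff_def[abs_def])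
qed

lemma funpow_deriv_bdiff:
  assumes "\<And>n x. (deriv ^^ n) g differentiable (at x)"
  shows "(deriv ^^ n) (bdiff g) = bdiff ((deriv ^^ n) g)"
proof (induction n)
  case (Suc n)
  have "deriv (bdiff ((deriv ^^ n) g)) = bdiff (deriv ((deriv ^^ n) g))"
    by (intro ext DERIV_imp_deriv deriv_bdiff assms)
  then show ?case using Suc by simp
qed simp

text \<open>Differences commute with derivatives, and the mean value theorem replaces one difference
  by one derivative. The sampled symbols thus inherit the bounds on the derivatives in an admissible
  system.\<close>

lemma funpow_bdiff_le:
  assumes "\<And>n x. (deriv ^^ n) g differentiable (at x)" "\<And>x. \<bar>(deriv ^^ b) g x\<bar> \<le> M"
  shows "\<bar>(bdiff ^^ b) g x\<bar> \<le> M"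
  using assms
proof (induction b arbitrary: g)
  case (Suc b)
  have diff: "(deriv ^^ n) g differentiable (at x)" for n x by (rule Suc.prems)
  have "\<bar>(bdiff ^^ b) (bdiff g) x\<bar> \<le> M"
  proof (rule Suc.IH)
    fix n x
    have "bdiff ((deriv ^^ n) g) differentiable (at x)"
      using deriv_bdiff[OF diff] real_differentiable_def by blast
    then show "(deriv ^^ n) (bdiff g) differentiable (at x)"
      by (simp add: funpow_deriv_bdiff[OF diff])
  next
    fix x
    let ?h = "(deriv ^^ b) g"
    have "(?h has_real_derivative deriv ?h y) (at y)" for y
      using diff by (simp add: DERIV_deriv_iff_real_differentiable)
    then obtain z where "?h x - ?h (x - 1) = (x - (x - 1)) * deriv ?h z"
      using MVT2[of "x - 1" x ?h "deriv ?h"] by auto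
    then have "bdiff ?h x = (deriv ^^ Suc b) g z" by (simp add: bdiff_def)
    then show "\<bar>(deriv ^^ b) (bdiff g) x\<bar> \<le> M"
      using Suc.prems(2)[of z] by (simp add: funpow_deriv_bdiff[OF diff])
  qed
  then show ?case by (simp add: funpow_swap1)
qed simp

lemma summation_by_parts_cis:
  fixes f :: "int \<Rightarrow> real"
  assumes "\<And>k. k \<notin> {l..u} \<Longrightarrow> f k = 0"
  shows "(1 - cis t) * (\<Sum>k\<in>{l..u}. of_real (f k) * cis (of_int k * t))
    = (\<Sum>k\<in>{l..u+1}. of_real (f k - f (k - 1)) * cis (of_int k * t))"
proof -
  have 1: "(\<Sum>k\<in>{l..u+1}. of_real (f k) * cis (of_int k * t)) = (\<Sum>k\<in>{l..u}. of_real (f k) * cis (of_int k * t))"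
    by (rule sum.mono_neutral_right) (use assms in auto)
  have "(\<Sum>k\<in>{l..u+1}. of_real (f (k - 1)) * cis (of_int k * t)) = (\<Sum>k\<in>{l-1..u}. of_real (f k) * cis (of_int (k + 1) * t))"
    by (rule sum.reindex_bij_witness[of _ "\<lambda>k. k + 1" "\<lambda>k. k - 1"]) auto
  also have "\<dots> = (\<Sum>k\<in>{l..u}. of_real (f k) * cis (of_int (k + 1) * t))"
    by (rule sum.mono_neutral_right) (use assms in auto)
  also have "\<dots> = cis t * (\<Sum>k\<in>{l..u}. of_real (f k) * cis (of_int k * t))"
  proof -
    have "cis (of_int (k + 1) * t) = cis t * cis (of_int k * t)" for k :: int
      by (simp add: cis_mult distrib_right add.commute)
    then show ?thesis by (simp add: sum_distrib_left mult_ac)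
  qed
  finally show ?thesis using 1 by (simp add: algebra_simps sum_subtractf)
qed

text \<open>Each summation by parts lengthens the index range by one at its upper end. The vanishing
  of the differences outside the range is proved along with the identity because the next summation
  by parts requires it.\<close>

lemma summation_by_parts_cis_funpow:
  fixes g :: "real \<Rightarrow> real"
  assumes "\<And>k::int. k \<notin> {l..u} \<Longrightarrow> g (of_int k) = 0"
  shows "(1 - cis t) ^ b * (\<Sum>k\<in>{l..u}. of_real (g (of_int k)) * cis (of_int k * t))
    = (\<Sum>k\<in>{l..u + int b}. of_real ((bdiff ^^ b) g (of_int k)) * cis (of_int k * t))
    \<and> (\<forall>k::int. k \<notin> {l..u + int b} \<longrightarrow> (bdiff ^^ b) g (of_int k) = 0)"
proof (induction b)
  case (Suc b)
  let ?f = "\<lambda>k::int. (bdiff ^^ b) g (of_int k)"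
  have f0: "?f k = 0" if "k \<notin> {l..u + int b}" for k using Suc that by blast
  have "(1 - cis t) ^ Suc b * (\<Sum>k\<in>{l..u}. of_real (g (of_int k)) * cis (of_int k * t))
      = (1 - cis t) * (\<Sum>k\<in>{l..u + int b}. of_real (?f k) * cis (of_int k * t))"
    using Suc by (simp add: mult.assoc)
  also have "\<dots> = (\<Sum>k\<in>{l..u + int b + 1}. of_real (?f k - ?f (k - 1)) * cis (of_int k * t))"
    by (rule summation_by_parts_cis) (rule f0)
  finally have A: "(1 - cis t) ^ Suc b * (\<Sum>k\<in>{l..u}. of_real (g (of_int k)) * cis (of_int k * t))
      = (\<Sum>k\<in>{l..u + int b + 1}. of_real (?f k - ?f (k - 1)) * cis (of_int k * t))" .
  have eqf: "(bdiff ^^ Suc b) g (of_int k) = ?f k - ?f (k - 1)" for k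
    by (simp add: bdiff_def)
  have eqs: "{l..u + int (Suc b)} = {l..u + int b + 1}" by simp
  have "?f k - ?f (k - 1) = 0" if "k \<notin> {l..u + int b + 1}" for k
    using f0[of k] f0[of "k - 1"] that by auto
  with A show ?case unfolding eqf eqs by blast
qed (use assms in auto)

lemma admissible_support:
  assumes "admissible \<phi>"
  obtains D :: nat and B :: real where "1 \<le> D" "0 < B"
    "\<And>m \<xi>. \<phi> m \<xi> \<noteq> 0 \<Longrightarrow> \<bar>\<xi>\<bar> \<le> real D * 2 ^ m"
    "\<And>m \<xi>. 1 \<le> m \<Longrightarrow> \<phi> m \<xi> \<noteq> 0 \<Longrightarrow> B * 2 ^ m \<le> \<bar>\<xi>\<bar>"
proof -
  obtain A B C where ABC: "0 < A" "0 < B" "0 < C" "\<And>\<xi>. \<phi> 0 \<xi> \<noteq> 0 \<Longrightarrow> \<bar>\<xi>\<bar> \<le> A"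
    "\<And>j \<xi>. 1 \<le> j \<Longrightarrow> \<phi> j \<xi> \<noteq> 0 \<Longrightarrow> B * 2 ^ j \<le> \<bar>\<xi>\<bar> \<and> \<bar>\<xi>\<bar> \<le> C * 2 ^ j"
    using assms unfolding admissible_def by blast
  define D where "D = nat \<lceil>max A C\<rceil> + 1"
  have D: "A \<le> real D" "C \<le> real D" unfolding D_def by linarith+
  show thesis
  proof
    show "1 \<le> D" by (simp add: D_def)
    show "0 < B" by fact
    show "\<bar>\<xi>\<bar> \<le> real D * 2 ^ m" if "\<phi> m \<xi> \<noteq> 0" for m \<xi>
    proof (cases "m = 0")
      case True
      then show ?thesis using ABC(4)[of \<xi>] that D by simp
    next
      case False
      then have "\<bar>\<xi>\<bar> \<le> C * 2 ^ m" using ABC(5)[of m \<xi>] that by simp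
      also have "\<dots> \<le> real D * 2 ^ m" using D by (intro mult_right_mono) auto
      finally show ?thesis .
    qed
    show "B * 2 ^ m \<le> \<bar>\<xi>\<bar>" if "1 \<le> m" "\<phi> m \<xi> \<noteq> 0" for m \<xi> using ABC(5)[OF that] by blast
  qed
qed

text \<open>Counting the at most \<open>(2 * real D + 1) * 2 ^ m\<close> frequencies gives the size
  of the kernel. A \<open>b\<close>-fold summation by parts, with differences of order
  \<open>2 powr (- real (m * b))\<close>, gives the same size for the kernel times
  \<open>(2 ^ m * \<bar>sin (t / 2)\<bar>) ^ b\<close>. The two add up to the power of the
  weight.\<close>

lemma multiplier_kernel_bound:
  assumes adm: "admissible \<phi>"
    and supp: "\<And>m \<xi>. \<phi> m \<xi> \<noteq> 0 \<Longrightarrow> \<bar>\<xi>\<bar> \<le> real D * 2 ^ m"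
  shows "\<exists>C>0. \<forall>m T t. D * 2 ^ m \<le> T \<longrightarrow>
    norm (\<Sum>k\<in>{-int T..int T}. complex_of_real (\<phi> m (of_int k)) * cis (of_int k * t)) \<le> C * 2 ^ m * wt (2 ^ m) t powr (- real b)"
proof -
  obtain M0 where M0: "\<And>j \<xi>. \<bar>\<phi> j \<xi>\<bar> \<le> M0"
    using adm unfolding admissible_def by (metis funpow_0 mult.left_neutral mult_0_right power_0)
  obtain M where M: "\<And>j \<xi>. 2 ^ (j * b) * \<bar>(deriv ^^ b) (\<phi> j) \<xi>\<bar> \<le> M"
    using adm unfolding admissible_def by blast
  have M00: "0 \<le> M0" using M0 abs_ge_zero order_trans by blast
  have MM0: "0 \<le> M" using M[of 0 0] by (meson abs_ge_zero mult_nonneg_nonneg order_trans zero_le_numeral zero_le_power)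
  \<comment> \<open>The bracket adds the constants of the two estimates, \<open>2 ^ b\<close> comes
    from \<open>(1 + x) ^ b \<le> 2 ^ b * (1 + x ^ b)\<close>, and the final 1 secures
    positivity.\<close>
  define C where "C = 2 ^ b * ((2 * real D + 1) * M0 + (2 * real D + real b + 1) * M) + 1"
  have "norm (\<Sum>k\<in>{-int T..int T}. complex_of_real (\<phi> m (of_int k)) * cis (of_int k * t)) \<le> C * 2 ^ m * wt (2 ^ m) t powr (- real b)"
    if T: "D * 2 ^ m \<le> T" for m T t
  proof -
    define R where "R = int (D * 2 ^ m)"
    define \<Phi> where "\<Phi> = (\<Sum>k\<in>{-R..R}. complex_of_real (\<phi> m (of_int k)) * cis (of_int k * t))"
    have out: "\<phi> m (of_int k) = 0" if "k \<notin> {-R..R}" for k :: int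
    proof (rule ccontr)
      assume "\<phi> m (of_int k) \<noteq> 0"
      from supp[OF this] have "real_of_int \<bar>k\<bar> \<le> real_of_int R" by (simp add: R_def)
      then show False using that by (auto simp: abs_le_iff)
    qed
    have eq: "(\<Sum>k\<in>{-int T..int T}. complex_of_real (\<phi> m (of_int k)) * cis (of_int k * t)) = \<Phi>"
      unfolding \<Phi>_def
    proof (rule sum.mono_neutral_right)
      have "R \<le> int T" using T unfolding R_def by (intro of_nat_mono)
      then show "{-R..R} \<subseteq> {-int T..int T}" by auto
    qed (use out in auto)
    have R1: "real (nat (2 * R + 1)) \<le> (2 * real D + 1) * 2 ^ m" by (simp add: R_def algebra_simps)
    have b1: "norm \<Phi> \<le> (2 * real D + 1) * M0 * 2 ^ m"
    proof -
      have "norm \<Phi> \<le> (\<Sum>k\<in>{-R..R}. M0)" unfolding \<Phi>_def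
        by (rule sum_norm_le) (simp add: norm_mult M0)
      also have "\<dots> = real (nat (2 * R + 1)) * M0" by (simp add: algebra_simps)
      also have "\<dots> \<le> ((2 * real D + 1) * 2 ^ m) * M0" by (intro mult_right_mono R1 M00)
      finally show ?thesis by (simp add: mult_ac)
    qed
    have b2: "(2 ^ m * \<bar>sin (t / 2)\<bar>) ^ b * norm \<Phi> \<le> (2 * real D + real b + 1) * M * 2 ^ m"
    proof -
      have smooth: "(deriv ^^ n) (\<phi> m) differentiable (at x)" for n x
        using adm unfolding admissible_def by blast
      have d: "\<bar>(bdiff ^^ b) (\<phi> m) x\<bar> \<le> M / 2 ^ (m * b)" for x
        by (rule funpow_bdiff_le[OF smooth]) (use M[of m] in \<open>simp add: field_simps\<close>)
      have eqb: "(1 - cis t) ^ b * \<Phi> = (\<Sum>k\<in>{-R..R + int b}. of_real ((bdiff ^^ b) (\<phi> m) (of_int k)) * cis (of_int k * t))"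
        unfolding \<Phi>_def using summation_by_parts_cis_funpow[of "-R" R "\<phi> m" t b, OF out] by blast
      have "norm ((1 - cis t) ^ b * \<Phi>) \<le> (\<Sum>k\<in>{-R..R + int b}. M / 2 ^ (m * b))"
        unfolding eqb by (rule sum_norm_le) (simp add: norm_mult d)
      also have "\<dots> = real (nat (2 * R + 1 + int b)) * (M / 2 ^ (m * b))" by (simp add: algebra_simps)
      also have "\<dots> \<le> ((2 * real D + real b + 1) * 2 ^ m) * (M / 2 ^ (m * b))"
      proof (intro mult_right_mono)
        have "1 + real b * 1 \<le> 2 ^ m + real b * 2 ^ m" by (intro add_mono mult_left_mono) auto
        then show "real (nat (2 * R + 1 + int b)) \<le> (2 * real D + real b + 1) * 2 ^ m"
          by (simp add: R_def algebra_simps nat_add_distrib nat_mult_distrib)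
      qed (use MM0 in auto)
      finally have "(2 * \<bar>sin (t/2)\<bar>) ^ b * norm \<Phi> * 2 ^ (m * b) \<le> (2 * real D + real b + 1) * 2 ^ m * M"
        by (simp add: norm_mult norm_power norm_minus_commute[of 1] norm_cis_minus_1 field_simps)
      moreover have "(2 ^ m * \<bar>sin (t / 2)\<bar>) ^ b * norm \<Phi> \<le> (2 * \<bar>sin (t/2)\<bar>) ^ b * norm \<Phi> * 2 ^ (m * b)"
      proof -
        have "\<bar>sin (t / 2)\<bar> ^ b \<le> (2 * \<bar>sin (t/2)\<bar>) ^ b" by (intro power_mono) auto
        then have "\<bar>sin (t / 2)\<bar> ^ b * (norm \<Phi> * 2 ^ (m * b)) \<le> (2 * \<bar>sin (t/2)\<bar>) ^ b * (norm \<Phi> * 2 ^ (m * b))"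
          by (intro mult_right_mono) auto
        moreover have "(2 ^ m * \<bar>sin (t / 2)\<bar>) ^ b = 2 ^ (m * b) * \<bar>sin (t / 2)\<bar> ^ b"
          by (simp add: power_mult_distrib power_mult)
        ultimately show ?thesis by (simp only: mult_ac)
      qed
      ultimately show ?thesis by (simp add: mult_ac)
    qed
    have wb: "wt (2 ^ m) t ^ b \<le> 2 ^ b * (1 + (2 ^ m * \<bar>sin (t / 2)\<bar>) ^ b)"
    proof -
      let ?x = "2 ^ m * \<bar>sin (t / 2)\<bar>"
      have "(1 + ?x) ^ b \<le> (2 * max 1 ?x) ^ b" by (intro power_mono) auto
      also have "\<dots> = 2 ^ b * max 1 ?x ^ b" by (simp add: power_mult_distrib)
      also have "\<dots> \<le> 2 ^ b * (1 + ?x ^ b)" by (intro mult_left_mono) (auto simp: max_def)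
      finally show ?thesis by (simp add: wt_def)
    qed
    have "wt (2 ^ m) t ^ b * norm \<Phi> \<le> 2 ^ b * (1 + (2 ^ m * \<bar>sin (t / 2)\<bar>) ^ b) * norm \<Phi>"
      by (intro mult_right_mono wb) auto
    also have "\<dots> = 2 ^ b * (norm \<Phi> + (2 ^ m * \<bar>sin (t / 2)\<bar>) ^ b * norm \<Phi>)" by (simp add: algebra_simps)
    also have "\<dots> \<le> 2 ^ b * ((2 * real D + 1) * M0 * 2 ^ m + (2 * real D + real b + 1) * M * 2 ^ m)"
      by (intro mult_left_mono add_mono b1 b2) auto
    also have "\<dots> \<le> C * 2 ^ m" by (simp add: C_def algebra_simps)
    finally have "wt (2 ^ m) t ^ b * norm \<Phi> \<le> C * 2 ^ m" .
    then show ?thesis unfolding eq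
      using wt_pos[of "2 ^ m" t] by (simp add: powr_minus powr_realpow field_simps)
  qed
  moreover have "0 < C" using M00 MM0 unfolding C_def by (intro add_nonneg_pos mult_nonneg_nonneg add_nonneg_nonneg) auto
  ultimately show ?thesis by blast
qed

lemma tp_convolution:
  fixes a c :: "int \<Rightarrow> complex"
  shows "pint (\<lambda>y. (\<Sum>k\<in>{-int T..int T}. c k * cis (of_int k * y)) * (\<Sum>k\<in>{-int T..int T}. a k * cis (of_int k * (t - y))))
     = 2 * pi * (\<Sum>k\<in>{-int T..int T}. a k * c k * cis (of_int k * t))"
proof -
  let ?g = "\<lambda>y. \<Sum>k\<in>{-int T..int T}. c k * cis (of_int k * y)"
  have "pint (\<lambda>y. ?g y * (\<Sum>k\<in>{-int T..int T}. a k * cis (of_int k * (t - y))))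
      = pint (\<lambda>y. \<Sum>k\<in>{-int T..int T}. (a k * cis (of_int k * t)) * (?g y * cis (- (of_int k * y))))"
  proof -
    have "cis (of_int k * (t - y)) = cis (of_int k * t) * cis (- (of_int k * y))" for k :: int and y
      by (simp add: cis_mult right_diff_distrib)
    then show ?thesis by (simp add: sum_distrib_left mult_ac)
  qed
  also have "\<dots> = (\<Sum>k\<in>{-int T..int T}. pint (\<lambda>y. (a k * cis (of_int k * t)) * (?g y * cis (- (of_int k * y)))))"
    by (intro pint_sum continuous_intros) auto
  also have "\<dots> = (\<Sum>k\<in>{-int T..int T}. (a k * cis (of_int k * t)) * (2 * pi * c k))"
    by (intro sum.cong refl)
       (simp only: Henstock_Kurzweil_Integration.integral_mult_right, subst tp_coeff, auto)
  finally show ?thesis by (simp add: sum_distrib_left mult_ac)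
qed

text \<open>The coefficients are padded by zeros up to \<open>T\<close>, so that the convolution
  kernel may contain all the frequencies of \<phi>_m; the decay estimate is for the complete kernel,
  not for its truncation at degree \<open>N\<close>.\<close>

lemma multiplier_representation:
  fixes c :: "int \<Rightarrow> complex" and g h :: "real \<Rightarrow> complex"
  assumes supp: "\<And>m \<xi>. \<phi> m \<xi> \<noteq> 0 \<Longrightarrow> \<bar>\<xi>\<bar> \<le> real D * 2 ^ m"
    and g: "g = (\<lambda>t. \<Sum>k\<in>{-int N..int N}. c k * cis (of_int k * t))"
    and h: "h = (\<lambda>t. \<Sum>k\<in>{-int N..int N}. complex_of_real (\<phi> m (of_int k)) * c k * cis (of_int k * t))"
    and T: "N \<le> T"
  shows "2 * pi * h t = pint (\<lambda>y. g y * (\<Sum>k\<in>{-int T..int T}. complex_of_real (\<phi> m (of_int k)) * cis (of_int k * (t - y))))"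
proof -
  define c' where "c' = (\<lambda>k. if \<bar>k\<bar> \<le> int N then c k else 0)"
  have g': "g = (\<lambda>t. \<Sum>k\<in>{-int T..int T}. c' k * cis (of_int k * t))" unfolding g
    by (intro ext sum.mono_neutral_cong_left) (use T in \<open>auto simp: c'_def\<close>)
  have h': "h = (\<lambda>t. \<Sum>k\<in>{-int T..int T}. complex_of_real (\<phi> m (of_int k)) * c' k * cis (of_int k * t))" unfolding h
    by (intro ext sum.mono_neutral_cong_left) (use T in \<open>auto simp: c'_def\<close>)
  show ?thesis unfolding g' h' tp_convolution ..
qed

text \<open>In the convolution, \<open>norm (g y)\<close> is replaced by
  \<open>wt n (t - y) powr (2 / p) * G t powr (1 / p)\<close> with the majorant \<open>G\<close> of
  \<open>tp_peetre\<close>. Since \<open>b\<close> exceeds \<open>2 / p + 1\<close>, the kernel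
  absorbs the weight and remains integrable. What is left is a pointwise bound by \<open>G\<close>,
  valid also for p < 1, and \<open>N / 2 ^ m\<close> is inherited from the integral of
  \<open>G\<close>.\<close>

lemma multiplier_bound_p:
  assumes adm: "admissible \<phi>" and p: "0 < p"
  shows "\<exists>C>0. \<forall>m N. \<forall>c :: int \<Rightarrow> complex. 2 ^ m \<le> N \<longrightarrow>
    pint (\<lambda>t. norm (\<Sum>k\<in>{-int N..int N}. complex_of_real (\<phi> m (of_int k)) * c k * cis (of_int k * t)) powr p)
    \<le> C * (real N / 2 ^ m) * pint (\<lambda>t. norm (\<Sum>k\<in>{-int N..int N}. c k * cis (of_int k * t)) powr p)"
proof -
  obtain D B where D: "\<And>m \<xi>. \<phi> m \<xi> \<noteq> 0 \<Longrightarrow> \<bar>\<xi>\<bar> \<le> real D * 2 ^ m"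
    using admissible_support[OF adm] by metis
  define b where "b = nat \<lceil>2 / p\<rceil> + 2"
  have b: "1 < real b - 2 / p" unfolding b_def by linarith
  obtain K where K: "0 < K" "\<And>m T t. D * 2 ^ m \<le> T \<Longrightarrow>
    norm (\<Sum>k\<in>{-int T..int T}. complex_of_real (\<phi> m (of_int k)) * cis (of_int k * t)) \<le> K * 2 ^ m * wt (2 ^ m) t powr (- real b)"
    using multiplier_kernel_bound[OF adm D, of b] by blast
  obtain P where P: "0 < P" "\<And>N n g. 1 \<le> N \<Longrightarrow> 0 < n \<Longrightarrow> n \<le> real N \<Longrightarrow> g \<in> tp N \<Longrightarrow>
    (\<exists>G. continuous_on UNIV G \<and> (\<forall>x. 0 \<le> G x) \<and> (\<forall>x y. norm (g y) powr p \<le> wt n (x - y) powr 2 * G x) \<and>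
      pint G \<le> P * (real N / n) * pint (\<lambda>t. norm (g t) powr p))"
    using tp_peetre[OF p, of 2] by auto
  define E where "E = K * (16 / (real b - 2 / p - 1))"
  have E: "0 < E" using K b by (simp add: E_def)
  have "pint (\<lambda>t. norm (\<Sum>k\<in>{-int N..int N}. complex_of_real (\<phi> m (of_int k)) * c k * cis (of_int k * t)) powr p)
    \<le> (E powr p * P) * (real N / 2 ^ m) * pint (\<lambda>t. norm (\<Sum>k\<in>{-int N..int N}. c k * cis (of_int k * t)) powr p)"
    if N: "2 ^ m \<le> N" for m N and c :: "int \<Rightarrow> complex"
  proof -
    define n :: real where "n = 2 ^ m"
    have n: "0 < n" "n \<le> real N" "1 \<le> N" using N unfolding n_def
      by (auto simp: numeral_power_le_of_nat_cancel_iff intro: order_trans[OF _ N])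
    define g where "g = (\<lambda>t. \<Sum>k\<in>{-int N..int N}. c k * cis (of_int k * t))"
    define h where "h = (\<lambda>t. \<Sum>k\<in>{-int N..int N}. complex_of_real (\<phi> m (of_int k)) * c k * cis (of_int k * t))"
    have gtp: "g \<in> tp N" unfolding g_def by (intro tp_sum tp_cmult tp_cis) auto
    have htp: "h \<in> tp N" unfolding h_def by (intro tp_sum tp_cmult tp_cis) auto
    obtain G where G: "continuous_on UNIV G" "\<And>x. 0 \<le> G x" "\<And>x y. norm (g y) powr p \<le> wt n (x - y) powr 2 * G x"
      "pint G \<le> P * (real N / n) * pint (\<lambda>t. norm (g t) powr p)"
      using P(2)[OF n(3,1,2) gtp] by blast
    define T where "T = max N (D * 2 ^ m)"
    define \<Phi> where "\<Phi> = (\<lambda>s. \<Sum>k\<in>{-int T..int T}. complex_of_real (\<phi> m (of_int k)) * cis (of_int k * s))"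
    have c\<Phi>: "continuous_on S (\<lambda>y. \<Phi> (t - y))" for S t unfolding \<Phi>_def by (intro continuous_intros)
    have \<Phi>: "norm (\<Phi> s) \<le> K * n * wt n s powr (- real b)" for s
      unfolding \<Phi>_def n_def by (rule K) (simp add: T_def)
    have cg: "continuous_on S g" for S by (rule tp_continuous[OF gtp])
    have ptw: "norm (h t) powr p \<le> E powr p * G t" for t
    proof -
      have gle: "norm (g y) \<le> wt n (t - y) powr (2 / p) * G t powr (1 / p)" for y
      proof -
        have "(norm (g y) powr p) powr (1 / p) \<le> (wt n (t - y) powr 2 * G t) powr (1 / p)"
          by (rule powr_mono2) (use G(3)[of y t] p in auto)
        then show ?thesis using p n G(2)[of t] wt_pos[of n "t - y"]
          by (simp add: powr_powr powr_mult)
      qed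
      have "2 * pi * norm (h t) = norm (2 * pi * h t)" by (simp add: norm_mult)
      also have "\<dots> = norm (pint (\<lambda>y. g y * \<Phi> (t - y)))"
        unfolding \<Phi>_def by (subst multiplier_representation[where \<phi> = \<phi> and m = m, OF D g_def h_def, of T]) (auto simp: T_def)
      also have "\<dots> \<le> pint (\<lambda>y. K * n * G t powr (1 / p) * wt n (y - t) powr (- (real b - 2 / p)))"
      proof (rule pint_norm_le)
        show "continuous_on UNIV (\<lambda>y. g y * \<Phi> (t - y))" by (intro continuous_intros cg c\<Phi>)
        show "continuous_on UNIV (\<lambda>y. K * n * G t powr (1 / p) * wt n (y - t) powr (- (real b - 2 / p)))"
          using n by (intro continuous_on_mult_left continuous_on_wt_powr continuous_intros) auto
        fix y
        have w: "0 < wt n (t - y)" using n by (intro wt_pos) auto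
        have "norm (g y * \<Phi> (t - y)) \<le> (wt n (t - y) powr (2 / p) * G t powr (1 / p)) * (K * n * wt n (t - y) powr (- real b))"
          unfolding norm_mult by (intro mult_mono gle \<Phi>) auto
        also have "\<dots> = K * n * G t powr (1 / p) * (wt n (t - y) powr (2 / p) * wt n (t - y) powr (- real b))" by (simp add: mult_ac)
        also have "\<dots> = K * n * G t powr (1 / p) * wt n (y - t) powr (- (real b - 2 / p))"
          by (simp add: wt_commute[of n t y] flip: powr_add)
        finally show "norm (g y * \<Phi> (t - y)) \<le> K * n * G t powr (1 / p) * wt n (y - t) powr (- (real b - 2 / p))" .
      qed
      also have "\<dots> = K * n * G t powr (1 / p) * pint (\<lambda>y. wt n y powr (- (real b - 2 / p)))"
        unfolding Henstock_Kurzweil_Integration.integral_mult_right using n by (subst pint_wt_shift) auto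
      also have "\<dots> \<le> K * n * G t powr (1 / p) * (16 / (real b - 2 / p - 1) / n)"
        using K n by (intro mult_left_mono pint_wt_powr b) auto
      also have "\<dots> = E * G t powr (1 / p)" using n by (simp add: E_def)
      finally have "2 * pi * norm (h t) \<le> E * G t powr (1 / p)" .
      moreover have "1 * norm (h t) \<le> 2 * pi * norm (h t)"
        by (intro mult_right_mono) (use pi_ge_two in auto)
      ultimately have "norm (h t) \<le> E * G t powr (1 / p)" by linarith
      then have "norm (h t) powr p \<le> (E * G t powr (1 / p)) powr p" using p by (intro powr_mono2) auto
      then show ?thesis using p E G(2)[of t] by (simp add: powr_mult powr_powr)
    qed
    have "pint (\<lambda>t. norm (h t) powr p) \<le> pint (\<lambda>t. E powr p * G t)"
      by (intro pint_le ptw continuous_on_norm_powr continuous_on_mult_left tp_continuous[OF htp] p G(1))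
    also have "\<dots> = E powr p * pint G" by simp
    also have "\<dots> \<le> E powr p * (P * (real N / n) * pint (\<lambda>t. norm (g t) powr p))"
      by (intro mult_left_mono G) auto
    finally show ?thesis unfolding g_def h_def n_def by (simp add: mult_ac)
  qed
  moreover have "0 < E powr p * P" using E P by simp
  ultimately show ?thesis by blast
qed

text \<open>Convolution with kernels whose L_1 norms are uniformly bounded; decay of order 2 is
  enough for that.\<close>

lemma multiplier_bound_sup:
  assumes adm: "admissible \<phi>"
  shows "\<exists>C>0. \<forall>m N S. \<forall>c :: int \<Rightarrow> complex. (\<forall>t. norm (\<Sum>k\<in>{-int N..int N}. c k * cis (of_int k * t)) \<le> S) \<longrightarrow>
    (\<forall>t. norm (\<Sum>k\<in>{-int N..int N}. complex_of_real (\<phi> m (of_int k)) * c k * cis (of_int k * t)) \<le> C * S)"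
proof -
  obtain D B where D: "\<And>m \<xi>. \<phi> m \<xi> \<noteq> 0 \<Longrightarrow> \<bar>\<xi>\<bar> \<le> real D * 2 ^ m"
    using admissible_support[OF adm] by metis
  obtain K where K: "0 < K" "\<And>m T t. D * 2 ^ m \<le> T \<Longrightarrow>
    norm (\<Sum>k\<in>{-int T..int T}. complex_of_real (\<phi> m (of_int k)) * cis (of_int k * t)) \<le> K * 2 ^ m * wt (2 ^ m) t powr (- real 2)"
    using multiplier_kernel_bound[OF adm D, of 2] by blast
  have "norm (\<Sum>k\<in>{-int N..int N}. complex_of_real (\<phi> m (of_int k)) * c k * cis (of_int k * t)) \<le> (16 * K) * S"
    if S: "\<And>t. norm (\<Sum>k\<in>{-int N..int N}. c k * cis (of_int k * t)) \<le> S" for m N S t and c :: "int \<Rightarrow> complex"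
  proof -
    define n :: real where "n = 2 ^ m"
    have n: "0 < n" by (simp add: n_def)
    have S0: "0 \<le> S" using S norm_ge_zero order_trans by blast
    define g where "g = (\<lambda>t. \<Sum>k\<in>{-int N..int N}. c k * cis (of_int k * t))"
    define h where "h = (\<lambda>t. \<Sum>k\<in>{-int N..int N}. complex_of_real (\<phi> m (of_int k)) * c k * cis (of_int k * t))"
    define T where "T = max N (D * 2 ^ m)"
    define \<Phi> where "\<Phi> = (\<lambda>s. \<Sum>k\<in>{-int T..int T}. complex_of_real (\<phi> m (of_int k)) * cis (of_int k * s))"
    have c\<Phi>: "continuous_on S (\<lambda>y. \<Phi> (t - y))" for S t unfolding \<Phi>_def by (intro continuous_intros)
    have cg: "continuous_on S g" for S unfolding g_def by (intro continuous_intros)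
    have \<Phi>: "norm (\<Phi> s) \<le> K * n * wt n s powr (- real 2)" for s
      unfolding \<Phi>_def n_def by (rule K) (simp add: T_def)
    have "2 * pi * norm (h t) = norm (2 * pi * h t)" by (simp add: norm_mult)
    also have "\<dots> = norm (pint (\<lambda>y. g y * \<Phi> (t - y)))"
      unfolding \<Phi>_def by (subst multiplier_representation[where \<phi> = \<phi> and m = m, OF D g_def h_def, of T]) (auto simp: T_def)
    also have "\<dots> \<le> pint (\<lambda>y. S * K * n * wt n (y - t) powr (- 2))"
    proof (rule pint_norm_le)
      show "continuous_on UNIV (\<lambda>y. g y * \<Phi> (t - y))" by (intro continuous_intros cg c\<Phi>)
      show "continuous_on UNIV (\<lambda>y. S * K * n * wt n (y - t) powr (- 2))"
        using n by (intro continuous_on_mult_left continuous_on_wt_powr continuous_intros) auto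
      fix y
      have "norm (g y * \<Phi> (t - y)) \<le> S * (K * n * wt n (t - y) powr (- real 2))"
        unfolding norm_mult using S S0 by (intro mult_mono \<Phi>) (auto simp: g_def)
      then show "norm (g y * \<Phi> (t - y)) \<le> S * K * n * wt n (y - t) powr (- 2)"
        by (simp add: wt_commute[of n t y] mult.assoc)
    qed
    also have "\<dots> = S * K * n * pint (\<lambda>y. wt n y powr (- 2))"
      unfolding Henstock_Kurzweil_Integration.integral_mult_right using n by (subst pint_wt_shift) auto
    also have "\<dots> \<le> S * K * n * (16 / (2 - 1) / n)"
      using K n S0 by (intro mult_left_mono pint_wt_powr) auto
    also have "\<dots> = 16 * K * S" using n by simp
    finally have "2 * pi * norm (h t) \<le> 16 * K * S" .
    moreover have "1 * norm (h t) \<le> 2 * pi * norm (h t)"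
      by (intro mult_right_mono) (use pi_ge_two in auto)
    ultimately show ?thesis unfolding h_def by linarith
  qed
  moreover have "0 < 16 * K" using K by simp
  ultimately show ?thesis by blast
qed

section \<open>The interpolation kernels\<close>

lemma continuous_on_sinc_fn [continuous_intros]:
  "continuous_on S f \<Longrightarrow> continuous_on S (\<lambda>x. sinc_fn (f x))"
proof -
  have "isCont sinc_fn x" for x
    using isCont_sinc[of x] by (simp add: sinc_fn_def[abs_def])
  then have "continuous_on UNIV sinc_fn" by (simp add: continuous_at_imp_continuous_on)
  then show "continuous_on S f \<Longrightarrow> continuous_on S (\<lambda>x. sinc_fn (f x))"
    using continuous_on_compose2 by blast
qed

lemma continuous_on_KL: "continuous_on S f \<Longrightarrow> continuous_on S (\<lambda>x. KL L (f x))"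
  unfolding KL_def by (intro continuous_intros) auto

lemma abs_sinc_fn_le: "\<bar>sinc_fn x\<bar> \<le> 2 / (1 + \<bar>x\<bar>)"
proof (cases "x = 0")
  case False
  have "\<bar>sin x\<bar> + \<bar>x\<bar> * \<bar>sin x\<bar> \<le> \<bar>x\<bar> + \<bar>x\<bar> * 1"
    by (intro add_mono mult_left_mono abs_sin_x_le_abs_x) auto
  then show ?thesis using False by (simp add: sinc_fn_def field_simps)
qed (simp add: sinc_fn_def)

lemma KL_decay: "\<exists>C>0. \<forall>x. \<bar>KL L x\<bar> \<le> C / (1 + \<bar>x\<bar>) ^ L"
proof -
  define C where "C = (\<Prod>l=1..L. 2 * 2 ^ l :: real)"
  have "\<bar>KL L x\<bar> \<le> C / (1 + \<bar>x\<bar>) ^ L" for x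
  proof -
    have "\<bar>KL L x\<bar> = (\<Prod>l=1..L. \<bar>sinc_fn (x / 2 ^ l)\<bar>)" by (simp add: KL_def abs_prod)
    also have "\<dots> \<le> (\<Prod>l=1..L. 2 * 2 ^ l / (1 + \<bar>x\<bar>))"
    proof (intro prod_mono conjI)
      fix l
      have "\<bar>sinc_fn (x / 2 ^ l)\<bar> \<le> 2 / (1 + \<bar>x / 2 ^ l\<bar>)" by (rule abs_sinc_fn_le)
      also have "\<dots> = 2 * 2 ^ l / (2 ^ l + \<bar>x\<bar>)" by (simp add: field_simps)
      also have "\<dots> \<le> 2 * 2 ^ l / (1 + \<bar>x\<bar>)" by (intro divide_left_mono mult_pos_pos) (auto intro: add_pos_nonneg)
      finally show "\<bar>sinc_fn (x / 2 ^ l)\<bar> \<le> 2 * 2 ^ l / (1 + \<bar>x\<bar>)" .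
    qed auto
    also have "\<dots> = C / (1 + \<bar>x\<bar>) ^ L" by (simp add: C_def prod_dividef)
    finally show ?thesis .
  qed
  moreover have "0 < C" unfolding C_def by (intro prod_pos) auto
  ultimately show ?thesis by blast
qed

text \<open>Away from \<open>v = 0\<close> the factor with \<open>l = 1\<close> alone already
  vanishes, because the sine is evaluated at a multiple of \<open>pi\<close>.\<close>

lemma KL_at_2pi_int:
  assumes "1 \<le> L"
  shows "KL L (2 * pi * of_int v) = (if v = 0 then 1 else 0)"
proof (cases "v = 0")
  case False
  have "sin (pi * real_of_int v) = 0" by simp
  then have "sinc_fn (2 * pi * of_int v / 2 ^ 1) = 0" using False by (simp add: sinc_fn_def)
  then show ?thesis using assms False unfolding KL_def by (intro trans[OF prod_zero]) (auto intro!: bexI[of _ 1])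
qed (simp add: KL_def sinc_fn_def)

lemma summable_on_int_inverse_square: "(\<lambda>v::int. 1 / (1 + \<bar>real_of_int v\<bar>) ^ 2) summable_on UNIV"
proof -
  have "summable (\<lambda>n. 1 / (1 + real n) ^ 2)"
    using inverse_power_summable[of 2, where 'a = real] summable_Suc_iff[of "\<lambda>n. inverse (real n ^ 2)"]
    by (simp add: inverse_eq_divide)
  then have nat: "(\<lambda>n. 1 / (1 + real n) ^ 2) summable_on UNIV"
    by (subst summable_on_UNIV_nonneg_real_iff) auto
  let ?f = "\<lambda>v::int. 1 / (1 + \<bar>real_of_int v\<bar>) ^ 2"
  have 1: "?f summable_on range int"
    by (subst summable_on_reindex) (use nat in \<open>auto simp: o_def\<close>)
  have 2: "?f summable_on range (\<lambda>n. - int n)"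
    by (subst summable_on_reindex) (use nat in \<open>auto simp: o_def inj_on_def\<close>)
  have "?f summable_on (range int \<union> (range (\<lambda>n. - int n) - range int))"
    by (intro summable_on_Un_disjoint 1 summable_on_subset_banach[OF 2]) auto
  moreover have "range int \<union> (range (\<lambda>n. - int n) - range int) = UNIV"
  proof (intro equalityI subsetI)
    fix v :: int
    show "v \<in> range int \<union> (range (\<lambda>n. - int n) - range int)"
      by (cases v rule: int_cases2) auto
  qed auto
  ultimately show ?thesis by simp
qed

text \<open>A majorant that is summable over the lattice, from \<open>1 + \<bar>v\<bar> \<le> (1 +
  \<bar>y\<bar>) * (1 + \<bar>y - 2 * pi * v\<bar>)\<close>. The order \<open>L\<close> is lowered
  to 2 so that one summable series serves every \<open>L\<close>.\<close>

lemma KL_lattice_bound: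
  assumes L: "2 \<le> L"
  shows "\<exists>C>0. \<forall>y v. \<bar>KL L (y - 2 * pi * real_of_int v)\<bar> \<le> C * (1 + \<bar>y\<bar>) ^ L * (1 / (1 + \<bar>real_of_int v\<bar>) ^ 2)"
proof -
  obtain C where C: "0 < C" "\<And>x. \<bar>KL L x\<bar> \<le> C / (1 + \<bar>x\<bar>) ^ L" using KL_decay by blast
  have "\<bar>KL L (y - 2 * pi * real_of_int v)\<bar> \<le> C * (1 + \<bar>y\<bar>) ^ L * (1 / (1 + \<bar>real_of_int v\<bar>) ^ 2)" for y v
  proof -
    let ?x = "y - 2 * pi * real_of_int v"
    have "1 * \<bar>real_of_int v\<bar> \<le> 2 * pi * \<bar>real_of_int v\<bar>" by (intro mult_right_mono) (use pi_ge_two in auto)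
    also have "\<dots> = \<bar>2 * pi * real_of_int v\<bar>" by (simp add: abs_mult)
    also have "\<dots> \<le> \<bar>?x\<bar> + \<bar>y\<bar>" by simp
    finally have "1 + \<bar>real_of_int v\<bar> \<le> 1 + \<bar>?x\<bar> + \<bar>y\<bar>" by simp
    also have "\<dots> \<le> (1 + \<bar>y\<bar>) * (1 + \<bar>?x\<bar>)" by (simp add: algebra_simps)
    finally have "(1 + \<bar>real_of_int v\<bar>) ^ L \<le> ((1 + \<bar>y\<bar>) * (1 + \<bar>?x\<bar>)) ^ L" by (intro power_mono) auto
    moreover have "(1 + \<bar>real_of_int v\<bar>) ^ 2 \<le> (1 + \<bar>real_of_int v\<bar>) ^ L" by (intro power_increasing L) auto
    ultimately have "(1 + \<bar>real_of_int v\<bar>) ^ 2 \<le> (1 + \<bar>y\<bar>) ^ L * (1 + \<bar>?x\<bar>) ^ L" by (simp add: power_mult_distrib)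
    then have "C / (1 + \<bar>?x\<bar>) ^ L \<le> C * (1 + \<bar>y\<bar>) ^ L * (1 / (1 + \<bar>real_of_int v\<bar>) ^ 2)"
      using C(1) by (simp add: field_simps)
    with C(2)[of ?x] show ?thesis by linarith
  qed
  with C show ?thesis by blast
qed

text \<open>\<open>KL L\<close> is the Fourier transform of an iterated average of the indicator of \<open>[-1/2, 1/2]\<close>.\<close>

definition window :: "nat \<Rightarrow> (real \<Rightarrow> real) \<Rightarrow> bool" where
  "window L \<psi> \<longleftrightarrow> continuous_on UNIV \<psi> \<and> (\<forall>\<xi>. 0 \<le> \<psi> \<xi> \<and> \<psi> \<xi> \<le> 1) \<and>
     (\<forall>\<xi>. \<bar>\<xi>\<bar> \<le> 1 / 2 ^ L \<longrightarrow> \<psi> \<xi> = 1) \<and> (\<forall>\<xi>. 1 - 1 / 2 ^ L \<le> \<bar>\<xi>\<bar> \<longrightarrow> \<psi> \<xi> = 0) \<and>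
     (\<forall>y. integral {-1..1} (\<lambda>\<xi>. \<psi> \<xi> * cis (\<xi> * y)) = complex_of_real (KL L y))"

section \<open>Construction of the frequency windows by repeated averaging\<close>

lemma continuous_on_integral_param_Icc:
  fixes f :: "real \<Rightarrow> real \<Rightarrow> 'b::banach"
  assumes "continuous_on UNIV (\<lambda>(x, t). f x t)"
  shows "continuous_on S (\<lambda>x. integral {a..b} (f x))"
  using integral_continuous_on_param[of S a b f] continuous_on_subset[OF assms] by auto

lemma integral_swap_Icc:
  fixes f :: "real \<Rightarrow> real \<Rightarrow> 'b::banach"
  assumes "continuous_on UNIV (\<lambda>(x, t). f x t)"
  shows "integral {a..b} (\<lambda>x. integral {c..d} (f x)) = integral {c..d} (\<lambda>y. integral {a..b} (\<lambda>x. f x y))"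
  using integral_swap_continuous[of a c b d f] continuous_on_subset[OF assms] by auto

text \<open>Integration by parts in closed form. It is used on each linear piece of the trapezoid
  below, and with \<open>b = 0\<close> for the transform of an interval.\<close>

lemma linear_cis_integral:
  assumes "y \<noteq> 0" "u \<le> v"
  shows "((\<lambda>\<xi>. complex_of_real (a + b * \<xi>) * cis (\<xi> * y)) has_integral
     ((a + b * v) * cis (v * y) / (\<i> * y) + b * cis (v * y) / y ^ 2) -
     ((a + b * u) * cis (u * y) / (\<i> * y) + b * cis (u * y) / y ^ 2)) {u..v}"
proof -
  define P where "P = (\<lambda>\<xi>. complex_of_real (a + b * \<xi>) * cis (\<xi> * y) / (\<i> * y) + complex_of_real b * cis (\<xi> * y) / y ^ 2)"
  have "((\<lambda>\<xi>. complex_of_real (a + b * \<xi>) * cis (\<xi> * y)) has_integral P v - P u) {u..v}"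
  proof (rule fundamental_theorem_of_calculus[OF assms(2)])
  fix \<xi> assume "\<xi> \<in> {u..v}"
  have 1: "((\<lambda>\<xi>. cis (\<xi> * y)) has_vector_derivative (\<i> * y * cis (\<xi> * y))) (at \<xi> within {u..v})"
  proof -
    have "((\<lambda>\<xi>. exp (\<i> * of_real y * of_real \<xi>)) has_vector_derivative (\<i> * of_real y) * exp (\<i> * of_real y * of_real \<xi>)) (at \<xi> within {u..v})"
      by (rule has_vector_derivative_real_field) (auto intro!: derivative_eq_intros)
    then show ?thesis by (simp add: cis_conv_exp mult_ac)
  qed
  have 2: "((\<lambda>\<xi>. complex_of_real (a + b * \<xi>)) has_vector_derivative complex_of_real b) (at \<xi> within {u..v})"
    by (auto intro!: derivative_eq_intros simp: has_vector_derivative_of_real has_real_derivative_iff_has_vector_derivative[symmetric] simp del: of_real_add)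
  have "((\<lambda>\<xi>. complex_of_real (a + b * \<xi>) * cis (\<xi> * y) / (\<i> * y) + b * cis (\<xi> * y) / y ^ 2) has_vector_derivative
     (complex_of_real (a + b * \<xi>) * (\<i> * y * cis (\<xi> * y)) + complex_of_real b * cis (\<xi> * y)) / (\<i> * y) + b * (\<i> * y * cis (\<xi> * y)) / y ^ 2) (at \<xi> within {u..v})"
    by (intro has_vector_derivative_add has_vector_derivative_divide has_vector_derivative_mult 1 2 has_vector_derivative_mult_right)
  moreover have "(complex_of_real (a + b * \<xi>) * (\<i> * y * cis (\<xi> * y)) + complex_of_real b * cis (\<xi> * y)) / (\<i> * y) + b * (\<i> * y * cis (\<xi> * y)) / y ^ 2
     = complex_of_real (a + b * \<xi>) * cis (\<xi> * y)"
    using assms by (simp add: field_simps power2_eq_square)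
  ultimately show "(P has_vector_derivative
     complex_of_real (a + b * \<xi>) * cis (\<xi> * y)) (at \<xi> within {u..v})" by (simp add: P_def)
  qed
  then show ?thesis by (simp add: P_def)
qed

text \<open>The trapezoid, equal to 1 up to 1/4 and to 0 from 3/4 on, is the average of the
  indicator of \<open>[-1/2, 1/2]\<close> over shifts by at most 1/4. The iteration starts here, and
  not at the indicator itself, because windows are required to be continuous.\<close>

lemma window_2: "window 2 (\<lambda>\<xi>. max 0 (min 1 (3/2 - 2 * \<bar>\<xi>\<bar>)))"
proof -
  define \<psi> :: "real \<Rightarrow> real" where "\<psi> = (\<lambda>\<xi>. max 0 (min 1 (3/2 - 2 * \<bar>\<xi>\<bar>)))"
  have c\<psi>: "continuous_on S \<psi>" for S unfolding \<psi>_def by (intro continuous_intros)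
  define F where "F = (\<lambda>y. integral {-1..1} (\<lambda>\<xi>. \<psi> \<xi> * cis (\<xi> * y)))"
  have ne: "F y = complex_of_real (KL 2 y)" if y: "y \<noteq> 0" for y
  proof -
    let ?f = "\<lambda>\<xi>. complex_of_real (\<psi> \<xi>) * cis (\<xi> * y)"
    let ?P = "\<lambda>a b \<xi>. complex_of_real (a + b * \<xi>) * cis (\<xi> * y) / (\<i> * y) + complex_of_real b * cis (\<xi> * y) / y ^ 2"
    have piece: "(?f has_integral ?P a b v - ?P a b u) {u..v}"
      if "u \<le> v" "\<And>\<xi>. \<xi> \<in> {u..v} \<Longrightarrow> \<psi> \<xi> = a + b * \<xi>" for a b u v
      using linear_cis_integral[OF y that(1), of a b] that(2) by (subst has_integral_cong) auto
    have "(?f has_integral ?P 0 0 (-3/4) - ?P 0 0 (-1)) {-1..-3/4}"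
      by (rule piece) (auto simp: \<psi>_def abs_if)
    moreover have "(?f has_integral ?P (3/2) 2 (-1/4) - ?P (3/2) 2 (-3/4)) {-3/4..-1/4}"
      by (rule piece) (auto simp: \<psi>_def abs_if)
    moreover have "(?f has_integral ?P 1 0 (1/4) - ?P 1 0 (-1/4)) {-1/4..1/4}"
      by (rule piece) (auto simp: \<psi>_def abs_if)
    moreover have "(?f has_integral ?P (3/2) (-2) (3/4) - ?P (3/2) (-2) (1/4)) {1/4..3/4}"
      by (rule piece) (auto simp: \<psi>_def abs_if)
    moreover have "(?f has_integral ?P 0 0 1 - ?P 0 0 (3/4)) {3/4..1}"
      by (rule piece) (auto simp: \<psi>_def abs_if)
    ultimately have "(?f has_integral ((((?P 0 0 (-3/4) - ?P 0 0 (-1)) + (?P (3/2) 2 (-1/4) - ?P (3/2) 2 (-3/4))) +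
      (?P 1 0 (1/4) - ?P 1 0 (-1/4))) + (?P (3/2) (-2) (3/4) - ?P (3/2) (-2) (1/4))) + (?P 0 0 1 - ?P 0 0 (3/4))) {-1..1}"
      by (intro has_integral_combine[where c = "3/4" and a = "-1" and b = 1]
            has_integral_combine[where c = "1/4" and a = "-1" and b = "3/4"]
            has_integral_combine[where c = "-1/4" and a = "-1" and b = "1/4"]
            has_integral_combine[where c = "-3/4" and a = "-1" and b = "-1/4"]) auto
    then have "F y = (((?P 0 0 (-3/4) - ?P 0 0 (-1)) + (?P (3/2) 2 (-1/4) - ?P (3/2) 2 (-3/4))) +
      (?P 1 0 (1/4) - ?P 1 0 (-1/4))) + (?P (3/2) (-2) (3/4) - ?P (3/2) (-2) (1/4)) + (?P 0 0 1 - ?P 0 0 (3/4))"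
      unfolding F_def by (rule integral_unique)
    also have "\<dots> = 2 * ((cis (-(y/4)) + cis (y/4)) - (cis (- (3*y/4)) + cis (3*y/4))) / y ^ 2"
      using y by (simp add: field_simps)
    also have "\<dots> = complex_of_real (4 * (cos (y/4) - cos (3*y/4)) / y ^ 2)"
      by (simp add: complex_eq_iff)
    also have "cos (y/4) - cos (3*y/4) = 2 * sin (y/2) * sin (y/4)"
      unfolding cos_diff_cos by (simp add: field_simps)
    also have "4 * (2 * sin (y/2) * sin (y/4)) / y ^ 2 = KL 2 y"
      using y by (simp add: KL_def numeral_2_eq_2 sinc_fn_def field_simps)
    finally show ?thesis .
  qed
  \<comment> \<open>The closed form divides by \<open>y\<close>; the value at 0 is recovered from
    continuity of both sides.\<close>
  have "continuous_on UNIV F"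
    unfolding F_def by (rule continuous_on_integral_param_Icc)
      (auto simp: case_prod_beta intro!: continuous_intros continuous_on_compose2[OF c\<psi>])
  then have "isCont F 0" by (simp add: continuous_on_eq_continuous_at)
  moreover have "continuous_on UNIV (\<lambda>y. complex_of_real (KL 2 y))"
    by (intro continuous_intros continuous_on_KL)
  then have "isCont (\<lambda>y. complex_of_real (KL 2 y)) 0" by (simp add: continuous_on_eq_continuous_at)
  ultimately have lim: "(F \<longlongrightarrow> F 0) (at 0)" "((\<lambda>y. complex_of_real (KL 2 y)) \<longlongrightarrow> complex_of_real (KL 2 0)) (at 0)"
    by (auto simp: isCont_def)
  have "((\<lambda>y. complex_of_real (KL 2 y)) \<longlongrightarrow> F 0) (at 0)"
    by (rule Lim_transform_eventually[OF lim(1)]) (auto simp: eventually_at_filter ne)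
  from tendsto_unique[OF _ this lim(2)] have "F 0 = complex_of_real (KL 2 0)" by simp
  with ne have F: "F y = complex_of_real (KL 2 y)" for y by (cases "y = 0") auto
  show ?thesis
    unfolding \<psi>_def[symmetric] window_def using F unfolding F_def
    by (auto simp: c\<psi>) (auto simp: \<psi>_def)
qed

lemma integral_cis_symmetric:
  "integral {-h..h} (\<lambda>s. cis (- (s * y))) = complex_of_real (2 * h * sinc_fn (h * y))" if "0 < h"
proof (cases "y = 0")
  case True
  then show ?thesis using that by (simp add: sinc_fn_def scaleR_conv_of_real)
next
  case False
  have "((\<lambda>\<xi>. complex_of_real (1 + 0 * \<xi>) * cis (\<xi> * (-y))) has_integral
     ((1 + 0 * h) * cis (h * (-y)) / (\<i> * (-y)) + 0 * cis (h * (-y)) / (-y) ^ 2) -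
     ((1 + 0 * (-h)) * cis (-h * (-y)) / (\<i> * (-y)) + 0 * cis (-h * (-y)) / (-y) ^ 2)) {-h..h}"
    using linear_cis_integral[of "-y" "-h" h 1 0] False that by simp
  then have "integral {-h..h} (\<lambda>s. cis (- (s * y))) = (cis (h * y) - cis (- (h * y))) / (\<i> * y)"
    using False by (simp add: integral_unique field_simps)
  also have "\<dots> = complex_of_real (2 * h * sinc_fn (h * y))"
    using False that by (simp add: sinc_fn_def complex_eq_iff Re_divide Im_divide power2_eq_square field_simps)
  finally show ?thesis .
qed

text \<open>Averaging over \<open>[-h, h]\<close> multiplies the Fourier transform by
  \<open>sinc_fn (h * y)\<close>, which is the next factor of the product. The plateau and the zero
  margin have width \<open>2 * h = 1 / 2 ^ L\<close>; both lose \<open>h\<close>, and exactly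
  \<open>1 / 2 ^ Suc L\<close> is left.\<close>

lemma window_Suc:
  assumes w: "window L \<psi>" and L: "2 \<le> L"
  shows "\<exists>\<psi>'. window (Suc L) \<psi>'"
proof -
  define h :: real where "h = 1 / 2 ^ Suc L"
  have h: "0 < h" "1 / 2 ^ L = 2 * h" "h \<le> 1/2" by (auto simp: h_def field_simps)
  have c\<psi>: "continuous_on S \<psi>" for S using w unfolding window_def by (metis continuous_on_subset top_greatest)
  have \<psi>01: "0 \<le> \<psi> \<xi>" "\<psi> \<xi> \<le> 1" for \<xi> using w unfolding window_def by blast+
  have \<psi>1: "\<psi> \<xi> = 1" if "\<bar>\<xi>\<bar> \<le> 2 * h" for \<xi> using w that unfolding window_def h by blast
  have \<psi>0: "\<psi> \<xi> = 0" if "1 - 2 * h \<le> \<bar>\<xi>\<bar>" for \<xi> using w that unfolding window_def h by blast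
  have FT: "integral {-1..1} (\<lambda>\<xi>. \<psi> \<xi> * cis (\<xi> * y)) = complex_of_real (KL L y)" for y
    using w unfolding window_def by blast
  define \<psi>' where "\<psi>' = (\<lambda>\<xi>. integral {-h..h} (\<lambda>s. \<psi> (\<xi> + s)) / (2 * h))"
  have cs: "continuous_on S (\<lambda>s. \<psi> (\<xi> + s))" for S \<xi>
    by (intro continuous_on_compose2[OF c\<psi>] continuous_intros) auto
  have int: "(\<lambda>s. \<psi> (\<xi> + s)) integrable_on {-h..h}" for \<xi>
    by (intro integrable_continuous_real cs)
  have c1: "continuous_on UNIV (\<lambda>\<xi>. integral {-h..h} (\<lambda>s. \<psi> (\<xi> + s)))"
    by (rule continuous_on_integral_param_Icc)
      (auto simp: case_prod_beta intro!: continuous_intros continuous_on_compose2[OF c\<psi>])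
  \<comment> \<open>After the order of integration is exchanged, the window appears shifted by
    \<open>s\<close>. As \<open>\<bar>s\<bar> \<le> h\<close> is smaller than the zero margin
    \<open>2 * h\<close>, the shifted interval still contains everything that matters.\<close>
  have FT_wide: "((\<lambda>\<xi>. \<psi> \<xi> * cis (\<xi> * y)) has_integral complex_of_real (KL L y)) {a..b}"
    if "a \<le> -1 + h" "1 - h \<le> b" for a b y
  proof -
    let ?q = "\<lambda>\<xi>. complex_of_real (\<psi> \<xi>) * cis (\<xi> * y)"
    have "(?q has_integral complex_of_real (KL L y)) {-1..1}"
      unfolding FT[symmetric] by (intro integrable_integral integrable_continuous_real continuous_intros c\<psi>)
    then have "((\<lambda>\<xi>. if \<xi> \<in> {-1..1} then ?q \<xi> else 0) has_integral complex_of_real (KL L y)) UNIV"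
      by (simp only: has_integral_restrict_UNIV)
    moreover have "(\<lambda>\<xi>. if \<xi> \<in> {-1..1} then ?q \<xi> else 0) = (\<lambda>\<xi>. if \<xi> \<in> {a..b} then ?q \<xi> else 0)"
    proof
      fix \<xi> :: real
      consider "\<bar>\<xi>\<bar> \<le> 1 - h" | "1 - h \<le> \<bar>\<xi>\<bar>" by linarith
      then show "(if \<xi> \<in> {-1..1} then ?q \<xi> else 0) = (if \<xi> \<in> {a..b} then ?q \<xi> else 0)"
      proof cases
        case 1
        then show ?thesis using that h by auto
      next
        case 2
        then have "\<psi> \<xi> = 0" using h by (intro \<psi>0) auto
        then show ?thesis by simp
      qed
    qed
    ultimately show ?thesis by (simp only: has_integral_restrict_UNIV)
  qed
  have "integral {-1..1} (\<lambda>\<xi>. \<psi>' \<xi> * cis (\<xi> * y)) = complex_of_real (KL (Suc L) y)" for y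
  proof -
    have "integral {-1..1} (\<lambda>\<xi>. complex_of_real (\<psi>' \<xi>) * cis (\<xi> * y))
        = integral {-1..1} (\<lambda>\<xi>. integral {-h..h} (\<lambda>s. \<psi> (\<xi> + s) * cis (\<xi> * y) / (2 * h)))"
    proof (intro arg_cong2[where f = integral] ext refl)
      fix \<xi>
      have "integral {-h..h} (\<lambda>s. complex_of_real (\<psi> (\<xi> + s))) = complex_of_real (integral {-h..h} (\<lambda>s. \<psi> (\<xi> + s)))"
        using integral_linear[OF int bounded_linear_of_real] by (simp add: o_def)
      then show "complex_of_real (\<psi>' \<xi>) * cis (\<xi> * y) = integral {-h..h} (\<lambda>s. \<psi> (\<xi> + s) * cis (\<xi> * y) / (2 * h))"
        by (simp add: \<psi>'_def)
    qed
    also have "\<dots> = integral {-h..h} (\<lambda>s. integral {-1..1} (\<lambda>\<xi>. \<psi> (\<xi> + s) * cis (\<xi> * y) / (2 * h)))"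
      by (rule integral_swap_Icc)
        (use h in \<open>auto simp: case_prod_beta intro!: continuous_intros continuous_on_compose2[OF c\<psi>]\<close>)
    also have "\<dots> = integral {-h..h} (\<lambda>s. cis (- (s * y)) * (complex_of_real (KL L y) / (2 * h)))"
    proof (rule Henstock_Kurzweil_Integration.integral_cong)
      fix s assume s: "s \<in> {-h..h}"
      have "((\<lambda>\<xi>. \<psi> \<xi> * cis (\<xi> * y)) has_integral complex_of_real (KL L y)) {-1 + s..1 + s}"
        by (rule FT_wide) (use s in auto)
      from has_integral_shift_real_ivl[OF this, of s]
      have "((\<lambda>\<xi>. \<psi> (\<xi> + s) * cis ((\<xi> + s) * y)) has_integral complex_of_real (KL L y)) {-1..1}" by simp
      from has_integral_mult_right[OF this, of "cis (- (s * y)) / (2 * h)"]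
      have "((\<lambda>\<xi>. \<psi> (\<xi> + s) * (cis (- (s * y)) * cis ((\<xi> + s) * y)) / (2 * h)) has_integral cis (- (s * y)) * (complex_of_real (KL L y) / (2 * h))) {-1..1}"
        by (simp add: mult_ac)
      then have "((\<lambda>\<xi>. \<psi> (\<xi> + s) * cis (\<xi> * y) / (2 * h)) has_integral cis (- (s * y)) * (complex_of_real (KL L y) / (2 * h))) {-1..1}"
        by (simp add: cis_mult distrib_right)
      then show "integral {-1..1} (\<lambda>\<xi>. \<psi> (\<xi> + s) * cis (\<xi> * y) / (2 * h)) = cis (- (s * y)) * (complex_of_real (KL L y) / (2 * h))"
        by (rule integral_unique)
    qed
    also have "\<dots> = complex_of_real (sinc_fn (h * y) * KL L y)"
      unfolding Henstock_Kurzweil_Integration.integral_mult_left integral_cis_symmetric[OF h(1)] using h by simp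
    also have "sinc_fn (h * y) * KL L y = KL (Suc L) y"
      by (simp add: KL_def h_def mult.commute)
    finally show ?thesis .
  qed
  moreover have "\<psi>' \<xi> = 1" if "\<bar>\<xi>\<bar> \<le> h" for \<xi>
  proof -
    have "integral {-h..h} (\<lambda>s. \<psi> (\<xi> + s)) = integral {-h..h} (\<lambda>s. 1::real)"
      by (rule Henstock_Kurzweil_Integration.integral_cong, rule \<psi>1) (use that in auto)
    then show ?thesis using h by (simp add: \<psi>'_def)
  qed
  moreover have "\<psi>' \<xi> = 0" if "1 - h \<le> \<bar>\<xi>\<bar>" for \<xi>
  proof -
    have "integral {-h..h} (\<lambda>s. \<psi> (\<xi> + s)) = integral {-h..h} (\<lambda>s. 0::real)"
      by (rule Henstock_Kurzweil_Integration.integral_cong, rule \<psi>0) (use that in auto)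
    then show ?thesis using h by (simp add: \<psi>'_def)
  qed
  moreover have "0 \<le> \<psi>' \<xi>" for \<xi>
    unfolding \<psi>'_def using h by (intro divide_nonneg_nonneg Henstock_Kurzweil_Integration.integral_nonneg int \<psi>01) auto
  moreover have "\<psi>' \<xi> \<le> 1" for \<xi>
  proof -
    have "integral {-h..h} (\<lambda>s. \<psi> (\<xi> + s)) \<le> integral {-h..h} (\<lambda>s. 1)"
      by (intro Henstock_Kurzweil_Integration.integral_le int \<psi>01) auto
    then show ?thesis using h by (simp add: \<psi>'_def)
  qed
  moreover have "continuous_on UNIV \<psi>'"
    unfolding \<psi>'_def using h by (intro continuous_intros c1) auto
  ultimately have "window (Suc L) \<psi>'" unfolding window_def h_def by blast
  then show ?thesis by blast
qed

lemma window_exists: "2 \<le> L \<Longrightarrow> \<exists>\<psi>. window L \<psi>"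
proof (induction L rule: dec_induct)
  case base
  then show ?case using window_2 by blast
next
  case (step L)
  then show ?case using window_Suc by blast
qed

section \<open>Lattice sums, aliasing, and the Fourier coefficients of the periodic kernels\<close>

lemma infsum_finite_sum:
  fixes f :: "'i \<Rightarrow> 'a \<Rightarrow> 'b::{topological_comm_monoid_add,t2_space}"
  assumes "\<And>i. i \<in> I \<Longrightarrow> f i summable_on A"
  shows "infsum (\<lambda>x. \<Sum>i\<in>I. f i x) A = (\<Sum>i\<in>I. infsum (f i) A)"
proof -
  have "((\<lambda>x. \<Sum>i\<in>I. f i x) has_sum (\<Sum>i\<in>I. infsum (f i) A)) A"
    using assms
  proof (induction I rule: infinite_finite_induct)
    case (insert i I)
    then show ?case by (simp add: has_sum_add has_sum_infsum)
  qed simp_all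
  then show ?thesis by (rule infsumI)
qed

lemma infsum_complex_of_real: "infsum (\<lambda>x. complex_of_real (f x)) A = complex_of_real (infsum f A)"
proof (rule infsum_bounded_linear_strong)
  show "(\<lambda>x. complex_of_real (f x)) summable_on A \<longleftrightarrow> f summable_on A"
  proof
    assume "(\<lambda>x. complex_of_real (f x)) summable_on A"
    from summable_on_Re[OF this] show "f summable_on A" by simp
  next
    assume "f summable_on A"
    then show "(\<lambda>x. complex_of_real (f x)) summable_on A"
      by (rule summable_on_bounded_linear[OF bounded_linear_of_real])
  qed
qed (rule bounded_linear_of_real)

lemma KL_lattice_summable:
  assumes L: "2 \<le> L" and c: "\<And>v. norm (c v) \<le> 1"
  shows "(\<lambda>v::int. complex_of_real (KL L (y - 2 * pi * of_int v)) * c v) summable_on UNIV"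
proof -
  obtain C where C: "0 < C" "\<And>y v. \<bar>KL L (y - 2 * pi * real_of_int v)\<bar> \<le> C * (1 + \<bar>y\<bar>) ^ L * (1 / (1 + \<bar>real_of_int v\<bar>) ^ 2)"
    using KL_lattice_bound[OF L] by blast
  have "(\<lambda>v::int. C * (1 + \<bar>y\<bar>) ^ L * (1 / (1 + \<bar>real_of_int v\<bar>) ^ 2)) summable_on UNIV"
    by (intro summable_on_cmult_right summable_on_int_inverse_square)
  then have "(\<lambda>v::int. norm (complex_of_real (KL L (y - 2 * pi * of_int v)) * c v)) summable_on UNIV"
  proof (rule summable_on_comparison_test)
    fix v :: int
    have "norm (complex_of_real (KL L (y - 2 * pi * of_int v)) * c v) \<le> \<bar>KL L (y - 2 * pi * of_int v)\<bar> * 1"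
      unfolding norm_mult by (intro mult_mono c) auto
    then show "norm (complex_of_real (KL L (y - 2 * pi * of_int v)) * c v) \<le> C * (1 + \<bar>y\<bar>) ^ L * (1 / (1 + \<bar>real_of_int v\<bar>) ^ 2)"
      using C(2)[of y v] by simp
  qed simp
  then show ?thesis by (rule abs_summable_summable)
qed

text \<open>Both sides are continuous in \<open>\<beta>\<close> and have the same Fourier coefficients; this replaces
  Poisson summation and Fourier inversion.\<close>

lemma KL_lattice_series:
  assumes L: "2 \<le> L" and w: "window L \<psi>" and \<beta>: "\<beta> \<in> {-pi..pi}"
  shows "(\<Sum>\<^sub>\<infinity>v::int. complex_of_real (KL L (y - 2 * pi * of_int v)) * cis (of_int v * \<beta>)) =
    (\<Sum>l\<in>{-1..1::int}. complex_of_real (\<psi> (\<beta> / (2 * pi) + of_int l)) * cis ((\<beta> / (2 * pi) + of_int l) * y))"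
proof -
  define Z where "Z = (\<lambda>\<beta>. \<Sum>\<^sub>\<infinity>v::int. complex_of_real (KL L (y - 2 * pi * of_int v)) * cis (of_int v * \<beta>))"
  \<comment> \<open>For \<beta> in one period the argument \<open>\<beta> / (2 * pi)\<close> lies in
    \<open>[-1/2, 1/2]\<close>, and the window vanishes from modulus 1 on; hence only the translates
    by -1, 0 and 1 of the periodised window are present.\<close>
  define R where "R = (\<lambda>\<beta>. \<Sum>l\<in>{-1..1::int}. complex_of_real (\<psi> (\<beta> / (2 * pi) + of_int l)) * cis ((\<beta> / (2 * pi) + of_int l) * y))"
  obtain C where C: "0 < C" "\<And>y v. \<bar>KL L (y - 2 * pi * real_of_int v)\<bar> \<le> C * (1 + \<bar>y\<bar>) ^ L * (1 / (1 + \<bar>real_of_int v\<bar>) ^ 2)"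
    using KL_lattice_bound[OF L] by blast
  have c\<psi>: "continuous_on S \<psi>" for S using w unfolding window_def by (metis continuous_on_subset top_greatest)
  have \<psi>0: "\<psi> \<xi> = 0" if "1 \<le> \<bar>\<xi>\<bar>" for \<xi>
  proof -
    have "1 - 1 / 2 ^ L \<le> \<bar>\<xi>\<bar>" by (rule order_trans[OF _ that]) simp
    then show ?thesis using w unfolding window_def by blast
  qed
  have FT: "integral {-1..1} (\<lambda>\<xi>. \<psi> \<xi> * cis (\<xi> * y)) = complex_of_real (KL L y)" for y
    using w unfolding window_def by blast
  define M where "M = (\<lambda>v::int. C * (1 + \<bar>y\<bar>) ^ L * (1 / (1 + \<bar>real_of_int v\<bar>) ^ 2))"
  have M: "M summable_on UNIV" unfolding M_def
    by (intro summable_on_cmult_right summable_on_int_inverse_square)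
  have unif: "uniform_limit {-pi..pi} (\<lambda>X \<beta>. \<Sum>v\<in>X. complex_of_real (KL L (y - 2 * pi * of_int v)) * cis (of_int v * \<beta>) * cis (real_of_int k * \<beta>))
     (\<lambda>\<beta>. \<Sum>\<^sub>\<infinity>v\<in>UNIV. complex_of_real (KL L (y - 2 * pi * of_int v)) * cis (of_int v * \<beta>) * cis (real_of_int k * \<beta>)) (finite_subsets_at_top UNIV)" for k
    by (rule Weierstrass_m_test_general[OF _ M]) (simp add: norm_mult M_def C(2)[simplified])
  have Zk: "(\<Sum>\<^sub>\<infinity>v\<in>UNIV. complex_of_real (KL L (y - 2 * pi * of_int v)) * cis (of_int v * \<beta>) * cis (real_of_int k * \<beta>)) = Z \<beta> * cis (real_of_int k * \<beta>)" for \<beta> k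
    unfolding Z_def by (rule infsum_cmult_left')
  have "continuous_on {-pi..pi} (\<lambda>\<beta>. Z \<beta> * cis (real_of_int 0 * \<beta>))"
    using unif[of 0] unfolding Zk
    by (rule uniform_limit_theorem[rotated]) (auto intro!: always_eventually continuous_intros)
  then have cZ: "continuous_on {-pi..pi} Z" by simp
  have cR: "continuous_on S R" for S unfolding R_def
    by (intro continuous_intros continuous_on_compose2[OF c\<psi>]) auto
  have Zint: "pint (\<lambda>\<beta>. Z \<beta> * cis (real_of_int k * \<beta>)) = 2 * pi * complex_of_real (KL L (y + 2 * pi * of_int k))" for k
  proof -
    have cont: "continuous_on {-pi..pi} (\<lambda>\<beta>. \<Sum>v\<in>X. complex_of_real (KL L (y - 2 * pi * of_int v)) * cis (of_int v * \<beta>) * cis (real_of_int k * \<beta>))" for X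
      by (intro continuous_intros)
    obtain I J where IJ: "\<And>X. ((\<lambda>\<beta>. \<Sum>v\<in>X. complex_of_real (KL L (y - 2 * pi * of_int v)) * cis (of_int v * \<beta>) * cis (real_of_int k * \<beta>)) has_integral I X) {-pi..pi}"
      "((\<lambda>\<beta>. Z \<beta> * cis (real_of_int k * \<beta>)) has_integral J) {-pi..pi}" "(I \<longlongrightarrow> J) (finite_subsets_at_top UNIV)"
      by (rule uniform_limit_integral[OF unif[of k, unfolded Zk] cont finite_subsets_at_top_neq_bot]) (rule that)
    have I: "I X = 2 * pi * complex_of_real (KL L (y + 2 * pi * of_int k))" if X: "finite X" "- k \<in> X" for X
    proof -
      have "I X = pint (\<lambda>\<beta>. \<Sum>v\<in>X. complex_of_real (KL L (y - 2 * pi * of_int v)) * cis (real_of_int (v + k) * \<beta>))"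
        using integral_unique[OF IJ(1)[of X]] by (simp add: mult.assoc cis_mult distrib_right)
      also have "\<dots> = (\<Sum>v\<in>X. pint (\<lambda>\<beta>. complex_of_real (KL L (y - 2 * pi * of_int v)) * cis (real_of_int (v + k) * \<beta>)))"
        by (intro pint_sum continuous_intros X)
      also have "\<dots> = (\<Sum>v\<in>X. if v = - k then 2 * pi * complex_of_real (KL L (y + 2 * pi * of_int k)) else 0)"
        by (intro sum.cong refl) (simp only: Henstock_Kurzweil_Integration.integral_mult_right integral_cis_int, auto)
      also have "\<dots> = 2 * pi * complex_of_real (KL L (y + 2 * pi * of_int k))" using X by simp
      finally show ?thesis .
    qed
    have "\<forall>\<^sub>F X in finite_subsets_at_top UNIV. I X = 2 * pi * complex_of_real (KL L (y + 2 * pi * of_int k))"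
      by (subst eventually_finite_subsets_at_top, intro exI[of _ "{-k}"]) (use I in auto)
    then have "(I \<longlongrightarrow> 2 * pi * complex_of_real (KL L (y + 2 * pi * of_int k))) (finite_subsets_at_top UNIV)"
      by (rule tendsto_eventually)
    from tendsto_unique[OF _ IJ(3) this] have "J = 2 * pi * complex_of_real (KL L (y + 2 * pi * of_int k))" by simp
    then show ?thesis using IJ(2) integral_unique by blast
  qed
  \<comment> \<open>Substitution turns the three terms into integrals over adjacent unit intervals,
    together \<open>[-3/2, 3/2]\<close>. Integer translations leave the character unchanged, so the
    result is the defining Fourier integral of the window at
    \<open>y + 2 * pi * of_int k\<close>.\<close>
  have Rint: "pint (\<lambda>\<beta>. R \<beta> * cis (real_of_int k * \<beta>)) = 2 * pi * complex_of_real (KL L (y + 2 * pi * of_int k))" for k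
  proof -
    let ?q = "\<lambda>\<xi>. complex_of_real (\<psi> \<xi>) * cis (\<xi> * (y + 2 * pi * of_int k))"
    have cq: "continuous_on S ?q" for S by (intro continuous_intros c\<psi>)
    have l: "pint (\<lambda>\<beta>. complex_of_real (\<psi> (\<beta> / (2 * pi) + of_int l)) * cis ((\<beta> / (2 * pi) + of_int l) * y) * cis (real_of_int k * \<beta>))
        = 2 * pi * integral {-1/2 + of_int l..1/2 + of_int l} ?q" for l
    proof -
      have "(?q has_integral integral {-1/2 + of_int l..1/2 + of_int l} ?q) (cbox (-1/2 + of_int l) (1/2 + of_int l))"
        unfolding cbox_interval by (intro integrable_integral integrable_continuous_real cq)
      from has_integral_affinity[OF this, of "1 / (2 * pi)" "of_int l"]
      have "((\<lambda>\<beta>. ?q (\<beta> / (2 * pi) + of_int l)) has_integral (2 * pi) *\<^sub>R integral {-1/2 + of_int l..1/2 + of_int l} ?q)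
         ((\<lambda>x. 2 * pi * x + - (2 * pi * real_of_int l)) ` {-1/2 + of_int l..1/2 + of_int l})"
        by simp
      also have "(\<lambda>x. 2 * pi * x + - (2 * pi * real_of_int l)) ` {-1/2 + of_int l..1/2 + of_int l} = {-pi..pi}"
        by (subst image_affinity_atLeastAtMost) (auto simp: algebra_simps)
      also have "(\<lambda>\<beta>. ?q (\<beta> / (2 * pi) + of_int l)) = (\<lambda>\<beta>. complex_of_real (\<psi> (\<beta> / (2 * pi) + of_int l)) * cis ((\<beta> / (2 * pi) + of_int l) * y) * cis (real_of_int k * \<beta>))"
      proof
        fix \<beta>
        have "cis ((\<beta> / (2 * pi) + of_int l) * (y + 2 * pi * of_int k)) =
            cis ((\<beta> / (2 * pi) + of_int l) * y) * cis (real_of_int k * \<beta>) * cis (2 * pi * real_of_int (l * k))"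
          unfolding cis_mult by (intro arg_cong[where f = cis]) (simp add: field_simps)
        also have "cis (2 * pi * real_of_int (l * k)) = 1" by (rule cis_multiple_2pi) simp
        finally show "?q (\<beta> / (2 * pi) + of_int l) = complex_of_real (\<psi> (\<beta> / (2 * pi) + of_int l)) * cis ((\<beta> / (2 * pi) + of_int l) * y) * cis (real_of_int k * \<beta>)"
          by simp
      qed
      finally show ?thesis by (simp add: integral_unique scaleR_conv_of_real)
    qed
    have "pint (\<lambda>\<beta>. R \<beta> * cis (real_of_int k * \<beta>)) = (\<Sum>l\<in>{-1..1}. 2 * pi * integral {-1/2 + of_int l..1/2 + of_int l} ?q)"
      unfolding R_def sum_distrib_right l[symmetric]
      by (intro pint_sum continuous_intros continuous_on_compose2[OF c\<psi>]) auto
    also have "{-1..1::int} = {-1, 0, 1}" by auto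
    also have "(\<Sum>l\<in>{-1, 0, 1}. 2 * pi * integral {-1/2 + of_int l..1/2 + of_int l} ?q) =
        2 * pi * ((integral {-3/2..-1/2} ?q + integral {-1/2..1/2} ?q) + integral {1/2..3/2} ?q)"
      by (simp add: algebra_simps)
    also have "integral {-3/2..-1/2} ?q + integral {-1/2..1/2} ?q = integral {-3/2..1/2} ?q"
      by (intro Henstock_Kurzweil_Integration.integral_combine integrable_continuous_real cq) auto
    also have "integral {-3/2..1/2} ?q + integral {1/2..3/2} ?q = integral {-3/2..3/2} ?q"
      by (intro Henstock_Kurzweil_Integration.integral_combine integrable_continuous_real cq) auto
    also have "integral {-3/2..3/2} ?q = integral {-1..1} ?q"
    proof (rule integral_unique)
      have "(?q has_integral integral {-1..1} ?q) {-1..1}"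
        by (intro integrable_integral integrable_continuous_real cq)
      then have "((\<lambda>\<xi>. if \<xi> \<in> {-1..1} then ?q \<xi> else 0) has_integral integral {-1..1} ?q) UNIV"
        by (simp only: has_integral_restrict_UNIV)
      moreover have "(\<lambda>\<xi>. if \<xi> \<in> {-1..1} then ?q \<xi> else 0) = (\<lambda>\<xi>. if \<xi> \<in> {-3/2..3/2} then ?q \<xi> else 0)"
      proof
        fix \<xi> :: real
        show "(if \<xi> \<in> {-1..1} then ?q \<xi> else 0) = (if \<xi> \<in> {-3/2..3/2} then ?q \<xi> else 0)"
        proof (cases "\<bar>\<xi>\<bar> \<le> 1")
          case True
          then show ?thesis by auto
        next
          case False
          then have "\<psi> \<xi> = 0" by (intro \<psi>0) auto
          then show ?thesis by simp
        qed
      qed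
      ultimately show "(?q has_integral integral {-1..1} ?q) {-3/2..3/2}" by (simp only: has_integral_restrict_UNIV)
    qed
    also have "integral {-1..1} ?q = complex_of_real (KL L (y + 2 * pi * of_int k))" by (rule FT)
    finally show ?thesis .
  qed
  have "Z \<beta> - R \<beta> = 0"
  proof (rule fourier_unique_1[OF _ _ \<beta>])
    show "continuous_on {-pi..pi} (\<lambda>\<beta>. Z \<beta> - R \<beta>)" by (intro continuous_intros cZ cR)
    fix k :: int
    have "pint (\<lambda>t. (Z t - R t) * cis (real_of_int k * t)) = pint (\<lambda>t. Z t * cis (real_of_int k * t) - R t * cis (real_of_int k * t))"
      by (simp add: left_diff_distrib)
    also have "\<dots> = pint (\<lambda>t. Z t * cis (real_of_int k * t)) - pint (\<lambda>t. R t * cis (real_of_int k * t))"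
      by (intro Henstock_Kurzweil_Integration.integral_diff integrable_continuous_real continuous_intros cZ cR)
    finally show "pint (\<lambda>t. (Z t - R t) * cis (real_of_int k * t)) = 0" unfolding Zint Rint by simp
  qed
  then show ?thesis by (simp add: Z_def R_def)
qed

lemma discrete_orthogonality:
  "(\<Sum>u\<in>Uset j. cis (of_int v * node j u)) = (if 2 ^ j dvd v then 2 ^ j else 0)"
proof -
  define \<omega> where "\<omega> = cis (2 * pi * of_int v / 2 ^ j)"
  have root: "cis (of_int v * node j (U0 j + int i)) = cis (of_int v * node j (U0 j)) * \<omega> ^ i" for i
    unfolding \<omega>_def Complex.DeMoivre cis_mult node_def
    by (intro arg_cong[where f = cis]) (simp add: field_simps)
  have sum: "(\<Sum>u\<in>Uset j. cis (of_int v * node j u)) = cis (of_int v * node j (U0 j)) * (\<Sum>i<2^j. \<omega> ^ i)"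
    unfolding sum_Uset root by (simp add: sum_distrib_left)
  have \<omega>n: "\<omega> ^ (2 ^ j) = 1"
    unfolding \<omega>_def Complex.DeMoivre using cis_multiple_2pi[of "of_int v"] by simp
  show ?thesis
  proof (cases "2 ^ j dvd v")
    case True
    then obtain w where w: "v = 2 ^ j * w" by (auto simp: dvd_def)
    have "cis (of_int v * node j u) = 1" for u
    proof -
      have "of_int v * node j u = 2 * pi * of_int (w * u)" by (simp add: w node_def)
      then show ?thesis using cis_multiple_2pi[of "of_int (w * u)"] by simp
    qed
    then show ?thesis using True by (simp add: card_Uset)
  next
    case False
    have "\<omega> \<noteq> 1"
    proof
      assume "\<omega> = 1"
      then have "cos (2 * pi * of_int v / 2 ^ j) = 1" unfolding \<omega>_def by (metis cis.sel(1) one_complex.sel(1))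
      then obtain m :: int where "2 * pi * of_int v / 2 ^ j = of_int m * 2 * pi" unfolding cos_one_2pi_int by blast
      then have "real_of_int v = real_of_int (m * 2 ^ j)" by (simp add: field_simps)
      then have "v = m * 2 ^ j" by (simp only: of_int_eq_iff)
      then show False using False by simp
    qed
    then have "(\<Sum>i<2^j. \<omega> ^ i) = 0" using geometric_sum[of \<omega> "2 ^ j"] \<omega>n by simp
    then show ?thesis using False sum by simp
  qed
qed

lemma node_in_period: "u \<in> Uset j \<Longrightarrow> node j u \<in> {-pi..pi}"
proof -
  assume "u \<in> Uset j"
  then have "\<bar>real_of_int u\<bar> \<le> 2 ^ j / 2"
  proof (cases j)
    case (Suc i)
    assume "u \<in> Uset j"
    then have "\<bar>u\<bar> \<le> 2 ^ i" using Suc by (auto simp: Uset_def)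
    then have "real_of_int \<bar>u\<bar> \<le> real_of_int (2 ^ i)" by (simp only: of_int_le_iff)
    then show ?thesis using Suc by simp
  qed (auto simp: Uset_def)
  then have "\<bar>2 * pi * real_of_int u / 2 ^ j\<bar> \<le> pi" by (simp add: abs_mult field_simps)
  then show ?thesis unfolding node_def atLeastAtMost_iff abs_le_iff by linarith
qed

lemma Uset_shift_cover:
  assumes "\<bar>k\<bar> < 2 ^ j"
  shows "\<exists>u\<in>Uset j. \<exists>l\<in>{-1..1}. k = u + 2 ^ j * l"
proof (cases j)
  case 0
  then show ?thesis using assms by (auto simp: Uset_def)
next
  case (Suc i)
  consider "k < - (2 ^ i)" | "- (2 ^ i) \<le> k" "k < 2 ^ i" | "2 ^ i \<le> k" by linarith
  then show ?thesis
  proof cases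
    case 1
    then show ?thesis using assms Suc by (intro bexI[of _ "k + 2 ^ j"] bexI[of _ "-1"]) (auto simp: Uset_def)
  next
    case 2
    then show ?thesis using assms Suc by (intro bexI[of _ k] bexI[of _ 0]) (auto simp: Uset_def)
  next
    case 3
    then show ?thesis using assms Suc by (intro bexI[of _ "k - 2 ^ j"] bexI[of _ 1]) (auto simp: Uset_def)
  qed
qed

lemma Uset_cong_unique:
  assumes "u \<in> Uset j" "v \<in> Uset j" "2 ^ j dvd u - v"
  shows "u = v"
proof (rule ccontr)
  assume "u \<noteq> v"
  then have "2 ^ j \<le> \<bar>u - v\<bar>" using assms(3) by (intro zdvd_imp_le) auto
  then show False using assms(1,2) by (auto simp: Uset_eq)
qed

text \<open>The periodisation runs over a lattice that is \<open>2 ^ j\<close> times coarser than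
  the one in \<open>KL_lattice_series\<close>. Averaging that series over \<beta> in the set of
  nodes picks out the coarse lattice by discrete orthogonality. On the other side the frequencies
  \<open>u + 2 ^ j * l\<close> are distinct, they exhaust all \<open>k\<close> with
  \<open>\<bar>k\<bar> < 2 ^ j\<close>, and the window vanishes at the remaining ones.\<close>

lemma Kpi_window:
  assumes L: "2 \<le> L" and w: "window L \<psi>"
  shows "Kpi L j x = (1 / 2 ^ j) * (\<Sum>k\<in>{-(2^j)..2^j::int}. complex_of_real (\<psi> (of_int k / 2 ^ j)) * cis (of_int k * x))"
proof -
  define n :: int where "n = 2 ^ j"
  have n: "0 < n" "real_of_int n = 2 ^ j" "complex_of_int n = 2 ^ j" by (auto simp: n_def)
  define y where "y = 2 ^ j * x"
  have \<psi>0: "\<psi> \<xi> = 0" if "1 \<le> \<bar>\<xi>\<bar>" for \<xi>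
  proof -
    have "1 - 1 / 2 ^ L \<le> \<bar>\<xi>\<bar>" by (rule order_trans[OF _ that]) simp
    then show ?thesis using w unfolding window_def by blast
  qed
  let ?a = "\<lambda>v::int. complex_of_real (KL L (y - 2 * pi * of_int v))"
  have summ: "(\<lambda>v. ?a v * cis (of_int v * \<beta>)) summable_on UNIV" for \<beta>
    by (rule KL_lattice_summable[OF L]) simp
  have "(\<Sum>u\<in>Uset j. \<Sum>\<^sub>\<infinity>v::int. ?a v * cis (of_int v * node j u)) = (\<Sum>\<^sub>\<infinity>v::int. \<Sum>u\<in>Uset j. ?a v * cis (of_int v * node j u))"
    by (rule infsum_finite_sum[symmetric]) (rule summ)
  also have "\<dots> = (\<Sum>\<^sub>\<infinity>v::int. ?a v * (if n dvd v then 2 ^ j else 0))"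
    unfolding sum_distrib_left[symmetric] discrete_orthogonality n_def ..
  \<comment> \<open>The sign matches the two conventions: the series contains
    \<open>y - 2 * pi * v\<close>, the periodised kernel \<open>x + 2 * pi * k\<close>.\<close>
  also have "\<dots> = (\<Sum>\<^sub>\<infinity>v\<in>range (\<lambda>k. - n * k). 2 ^ j * ?a v)"
  proof (rule infsum_cong_neutral)
    show "?a v * (if n dvd v then 2 ^ j else 0) = 0" if "v \<in> UNIV - range (\<lambda>k. - n * k)" for v
    proof -
      have "\<not> n dvd v"
      proof
        assume "n dvd v"
        then obtain k where "v = - n * (- k)" by (auto simp: dvd_def)
        then show False using that by blast
      qed
      then show ?thesis by simp
    qed
  qed auto
  also have "\<dots> = (\<Sum>\<^sub>\<infinity>k\<in>UNIV. 2 ^ j * ?a (- n * k))"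
    by (subst infsum_reindex) (use n in \<open>auto simp: inj_on_def o_def\<close>)
  also have "\<dots> = 2 ^ j * (\<Sum>\<^sub>\<infinity>k\<in>UNIV. ?a (- n * k))" by (rule infsum_cmult_right')
  also have "(\<lambda>k. ?a (- n * k)) = (\<lambda>k. complex_of_real (KL L (2 ^ j * (x + 2 * pi * real_of_int k))))"
    by (intro ext arg_cong[where f = "\<lambda>z. complex_of_real (KL L z)"]) (simp add: y_def n algebra_simps)
  also have "(\<Sum>\<^sub>\<infinity>k\<in>UNIV. complex_of_real (KL L (2 ^ j * (x + 2 * pi * real_of_int k)))) = Kpi L j x"
    using L by (simp add: Kpi_def infsum_complex_of_real)
  finally have 1: "2 ^ j * Kpi L j x = (\<Sum>u\<in>Uset j. \<Sum>\<^sub>\<infinity>v::int. ?a v * cis (of_int v * node j u))" ..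
  have arg: "node j u / (2 * pi) + of_int l = of_int (u + n * l) / 2 ^ j" for u l
    by (simp add: node_def n field_simps)
  have "(\<Sum>\<^sub>\<infinity>v::int. ?a v * cis (of_int v * node j u)) =
     (\<Sum>l\<in>{-1..1::int}. complex_of_real (\<psi> (of_int (u + n * l) / 2 ^ j)) * cis (of_int (u + n * l) * x))" if "u \<in> Uset j" for u
    unfolding KL_lattice_series[OF L w node_in_period[OF that]] arg by (simp add: y_def)
  then have "2 ^ j * Kpi L j x = (\<Sum>u\<in>Uset j. \<Sum>l\<in>{-1..1}. complex_of_real (\<psi> (of_int (u + n * l) / 2 ^ j)) * cis (of_int (u + n * l) * x))"
    unfolding 1 by simp
  also have "\<dots> = (\<Sum>(u, l)\<in>Uset j \<times> {-1..1}. complex_of_real (\<psi> (of_int (u + n * l) / 2 ^ j)) * cis (of_int (u + n * l) * x))"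
    by (rule sum.cartesian_product)
  also have "\<dots> = (\<Sum>k\<in>(\<lambda>(u, l). u + n * l) ` (Uset j \<times> {-1..1}). complex_of_real (\<psi> (of_int k / 2 ^ j)) * cis (of_int k * x))"
  proof (subst sum.reindex)
    show "inj_on (\<lambda>(u, l). u + n * l) (Uset j \<times> {-1..1})"
    proof (rule inj_onI, clarify)
      fix u l u' l' assume *: "u \<in> Uset j" "u' \<in> Uset j" "u + n * l = u' + n * l'"
      then have "u - u' = n * (l' - l)" by (simp add: algebra_simps)
      then have "n dvd u - u'" by simp
      with * have "u = u'" using Uset_cong_unique unfolding n_def by blast
      then show "u = u' \<and> l = l'" using * n by simp
    qed
  qed (auto intro!: sum.cong)
  also have "\<dots> = (\<Sum>k\<in>{-(2^j)..2^j::int}. complex_of_real (\<psi> (of_int k / 2 ^ j)) * cis (of_int k * x))"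
  proof (rule sum.mono_neutral_cong)
    show "complex_of_real (\<psi> (of_int k / 2 ^ j)) * cis (of_int k * x) = 0"
      if k: "k \<in> {-(2^j)..2^j} - (\<lambda>(u, l). u + n * l) ` (Uset j \<times> {-1..1})" for k
    proof -
      have "\<not> \<bar>k\<bar> < 2 ^ j"
      proof
        assume "\<bar>k\<bar> < 2 ^ j"
        from Uset_shift_cover[OF this] show False using k by (auto simp: n_def image_iff)
      qed
      then have "real_of_int (2 ^ j) \<le> real_of_int \<bar>k\<bar>" unfolding of_int_le_iff by simp
      then have "1 \<le> \<bar>of_int k / 2 ^ j :: real\<bar>" by simp
      then show ?thesis by (simp add: \<psi>0)
    qed
    show "complex_of_real (\<psi> (of_int k / 2 ^ j)) * cis (of_int k * x) = 0"
      if k: "k \<in> (\<lambda>(u, l). u + n * l) ` (Uset j \<times> {-1..1}) - {-(2^j)..2^j}" for k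
    proof -
      have "2 ^ j \<le> \<bar>k\<bar>" using k by auto
      then have "real_of_int (2 ^ j) \<le> real_of_int \<bar>k\<bar>" unfolding of_int_le_iff by simp
      then have "1 \<le> \<bar>of_int k / 2 ^ j :: real\<bar>" by simp
      then show ?thesis by (simp add: \<psi>0)
    qed
  qed auto
  finally show ?thesis by (simp add: field_simps)
qed

text \<open>The properties of the kernels that the interpolation operators inherit: reproduction of low
  frequencies amounts to weight \<open>1\<close> there and weight \<open>0\<close> at their aliases.\<close>

definition kernel_weights :: "nat \<Rightarrow> (nat \<Rightarrow> int \<Rightarrow> real) \<Rightarrow> bool" where
  "kernel_weights L w \<longleftrightarrow>
     (\<forall>j x. Kpi L j x = (1 / 2 ^ j) * (\<Sum>k\<in>{-(2^j)..2^j}. complex_of_real (w j k) * cis (of_int k * x))) \<and>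
     (\<forall>j k. 0 \<le> w j k \<and> w j k \<le> 1) \<and>
     (\<forall>j k. \<bar>k\<bar> * 2 ^ L < 2 ^ j \<longrightarrow> w j k = 1) \<and>
     (\<forall>j k l. \<bar>k\<bar> * 2 ^ L < 2 ^ j \<longrightarrow> 2 ^ j dvd l - k \<longrightarrow> l \<noteq> k \<longrightarrow> w j l = 0)"

text \<open>The weights are the window values at \<open>k / 2 ^ j\<close>. An alias \<open>l\<close>
  of a low frequency \<open>k\<close> satisfies
  \<open>\<bar>l\<bar> \<ge> 2 ^ j - \<bar>k\<bar>\<close>, which places \<open>l / 2 ^ j\<close> in
  the zero margin; plateau and margin having the same width is what makes this work.\<close>

lemma kernel_weights_ge_2:
  assumes L: "2 \<le> L"
  shows "\<exists>w. kernel_weights L w"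
proof -
  obtain \<psi> where \<psi>: "window L \<psi>" using window_exists[OF L] by blast
  show ?thesis
  proof (intro exI[of _ "\<lambda>j k. \<psi> (of_int k / 2 ^ j)"], unfold kernel_weights_def, intro conjI allI impI)
    show "Kpi L j x = (1 / 2 ^ j) * (\<Sum>k\<in>{-(2^j)..2^j}. complex_of_real (\<psi> (of_int k / 2 ^ j)) * cis (of_int k * x))" for j x
      by (rule Kpi_window[OF L \<psi>])
    show "0 \<le> \<psi> (of_int k / 2 ^ j)" "\<psi> (of_int k / 2 ^ j) \<le> 1" for j :: nat and k :: int
      using \<psi> unfolding window_def by blast+
    fix j :: nat and k :: int assume "\<bar>k\<bar> * 2 ^ L < 2 ^ j"
    then have "real_of_int (\<bar>k\<bar> * 2 ^ L) < real_of_int (2 ^ j)" unfolding of_int_less_iff .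
    then have k: "\<bar>real_of_int k\<bar> / 2 ^ j < 1 / 2 ^ L" by (simp add: field_simps)
    then have "\<bar>real_of_int k / 2 ^ j\<bar> \<le> 1 / 2 ^ L" by simp
    then show "\<psi> (of_int k / 2 ^ j) = 1" using \<psi> unfolding window_def by blast
    fix l :: int assume l: "2 ^ j dvd l - k" "l \<noteq> k"
    then have "2 ^ j \<le> \<bar>l - k\<bar>" by (intro zdvd_imp_le) auto
    then have "2 ^ j \<le> \<bar>l\<bar> + \<bar>k\<bar>" by linarith
    then have "real_of_int (2 ^ j) \<le> real_of_int (\<bar>l\<bar> + \<bar>k\<bar>)" unfolding of_int_le_iff .
    then have "1 \<le> (\<bar>real_of_int l\<bar> + \<bar>real_of_int k\<bar>) / 2 ^ j" by simp
    then have "1 - 1 / 2 ^ L \<le> \<bar>real_of_int l / 2 ^ j\<bar>" using k by (simp add: add_divide_distrib)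
    then show "\<psi> (of_int l / 2 ^ j) = 0" using \<psi> unfolding window_def by blast
  qed
qed

text \<open>\<open>Uset j\<close> is a complete residue system modulo \<open>2 ^ j\<close>, so two
  distinct congruent frequencies are never both in it.\<close>

lemma kernel_weights_1: "kernel_weights 1 (\<lambda>j k. if k \<in> Uset j then 1 else 0)"
  unfolding kernel_weights_def
proof (intro conjI allI impI)
  have inU: "k \<in> Uset j" if "\<bar>k\<bar> * 2 ^ 1 < 2 ^ j" for j k
    using that by (cases j) (auto simp: Uset_def)
  fix j x
  show "Kpi 1 j x = (1 / 2 ^ j) * (\<Sum>k\<in>{-(2^j)..2^j}. complex_of_real (if k \<in> Uset j then 1 else 0) * cis (of_int k * x))"
  proof -
    have "(\<Sum>k\<in>{-(2^j)..2^j}. complex_of_real (if k \<in> Uset j then 1 else 0) * cis (of_int k * x)) = (\<Sum>k\<in>Uset j. cis (of_int k * x))"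
    proof (rule sum.mono_neutral_cong_right)
      show "Uset j \<subseteq> {-(2^j)..2^j}"
      proof
        fix u assume u: "u \<in> Uset j"
        show "u \<in> {-(2^j)..2^j}"
        proof (cases j)
          case (Suc i)
          have "(0::int) < 2 ^ i" by simp
          then show ?thesis using u Suc by (simp add: Uset_def)
        qed (use u in \<open>auto simp: Uset_def\<close>)
      qed
    qed auto
    then show ?thesis by (auto simp: Kpi_def Uset_def)
  qed
  fix k :: int
  show "0 \<le> (if k \<in> Uset j then 1 else 0 :: real)" "(if k \<in> Uset j then 1 else 0) \<le> (1::real)" by auto
  assume "\<bar>k\<bar> * 2 ^ 1 < 2 ^ j"
  then have k: "k \<in> Uset j" by (rule inU)
  then show "(if k \<in> Uset j then 1 else 0 :: real) = 1" by simp
  fix l assume "2 ^ j dvd l - k" "l \<noteq> k"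
  then show "(if l \<in> Uset j then 1 else 0 :: real) = 0" using Uset_cong_unique[OF _ k] by auto
qed

lemma kernel_weights_exists: "1 \<le> L \<Longrightarrow> \<exists>w. kernel_weights L w"
  using kernel_weights_1 kernel_weights_ge_2 by (cases "L = 1") auto

section \<open>Interpolation operators in one variable\<close>

lemma kernel_weightsD:
  assumes "kernel_weights L w"
  shows "Kpi L j x = (1 / 2 ^ j) * (\<Sum>k\<in>{-(2^j)..2^j}. complex_of_real (w j k) * cis (of_int k * x))"
    and "0 \<le> w j k" "w j k \<le> 1" "\<bar>k\<bar> * 2 ^ L < 2 ^ j \<Longrightarrow> w j k = 1"
    and "\<bar>k\<bar> * 2 ^ L < 2 ^ j \<Longrightarrow> 2 ^ j dvd l - k \<Longrightarrow> l \<noteq> k \<Longrightarrow> w j l = 0"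
  using assms unfolding kernel_weights_def by simp_all

lemma Kpi_periodic:
  assumes "1 \<le> L"
  shows "Kpi L j (x + 2 * pi) = Kpi L j x"
proof -
  obtain w where "kernel_weights L w" using kernel_weights_exists[OF assms] by blast
  note K = kernel_weightsD(1)[OF this]
  show ?thesis unfolding K cis_int_periodic ..
qed

lemma Kpi_tp:
  assumes "1 \<le> L"
  shows "Kpi L j \<in> tp (2 ^ j)"
proof -
  obtain w where "kernel_weights L w" using kernel_weights_exists[OF assms] by blast
  then have K: "Kpi L j = (\<lambda>x. (1 / 2 ^ j) * (\<Sum>k\<in>{-(2^j)..2^j}. complex_of_real (w j k) * cis (of_int k * x)))"
    by (intro ext kernel_weightsD(1))
  show ?thesis unfolding K by (intro tp_cmult tp_sum tp_cis) auto
qed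

lemma continuous_on_Kpi [continuous_intros]:
  assumes "1 \<le> L" "continuous_on S f"
  shows "continuous_on S (\<lambda>x. Kpi L j (f x))"
  using continuous_on_compose2[OF tp_continuous[OF Kpi_tp[OF assms(1)], of UNIV] assms(2)] by auto

text \<open>Within one period the term \<open>k = 0\<close> dominates: the others are smaller by the
  factor \<open>(1 + \<bar>k\<bar>) ^ 2\<close> up to a constant, whose reciprocals are summable.
  Periodicity of kernel and weight removes the restriction to one period.\<close>

lemma Kpi_decay:
  assumes L: "2 \<le> L"
  shows "\<exists>C>0. \<forall>j x. norm (Kpi L j x) \<le> C * wt (2 ^ j) x powr (- real L)"
proof -
  obtain C where C: "0 < C" "\<And>x. \<bar>KL L x\<bar> \<le> C / (1 + \<bar>x\<bar>) ^ L" using KL_decay by blast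
  define q where "q = (\<lambda>v::int. 1 / (1 + \<bar>real_of_int v\<bar>) ^ 2)"
  have q: "q summable_on UNIV" unfolding q_def by (rule summable_on_int_inverse_square)
  define S where "S = infsum q UNIV"
  have S0: "0 \<le> S" unfolding S_def by (rule infsum_nonneg) (simp add: q_def)
  have base: "norm (Kpi L j x) \<le> C * 4 ^ L * S * wt (2 ^ j) x powr (- real L)" if x: "\<bar>x\<bar> \<le> pi" for j x
  proof -
    define n :: real where "n = 2 ^ j"
    have n: "1 \<le> n" by (simp add: n_def)
    define E where "E = C * 4 ^ L / (1 + n * \<bar>x\<bar>) ^ L"
    have trm: "\<bar>KL L (n * (x + 2 * pi * real_of_int k))\<bar> \<le> E * q k" for k
    proof -
      let ?z = "n * (x + 2 * pi * real_of_int k)"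
      \<comment> \<open>For \<open>k \<noteq> 0\<close> and \<open>\<bar>x\<bar> \<le> pi\<close>,
        the point \<open>x + 2 * pi * k\<close> has modulus at least
        \<open>pi * \<bar>k\<bar>\<close>, which controls both factors on the left.\<close>
      have le: "(1 + n * \<bar>x\<bar>) * (1 + \<bar>real_of_int k\<bar>) \<le> 4 * (1 + \<bar>?z\<bar>)"
      proof (cases "k = 0")
        case True
        then show ?thesis using n by (simp add: abs_mult)
      next
        case False
        then have k1: "1 \<le> \<bar>real_of_int k\<bar>" by linarith
        have "2 * pi * \<bar>real_of_int k\<bar> = \<bar>2 * pi * real_of_int k\<bar>" by (simp add: abs_mult)
        also have "\<dots> \<le> \<bar>x + 2 * pi * real_of_int k\<bar> + \<bar>x\<bar>" by linarith
        also have "\<bar>x\<bar> \<le> pi * \<bar>real_of_int k\<bar>" using x mult_left_mono[OF k1, of pi] pi_ge_zero by linarith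
        finally have "pi * \<bar>real_of_int k\<bar> \<le> \<bar>x + 2 * pi * real_of_int k\<bar>" by simp
        then have "n * (pi * \<bar>real_of_int k\<bar>) \<le> n * \<bar>x + 2 * pi * real_of_int k\<bar>" using n by (intro mult_left_mono) auto
        then have z: "n * (pi * \<bar>real_of_int k\<bar>) \<le> \<bar>?z\<bar>" using n by (simp add: abs_mult)
        have npi: "1 \<le> n * pi" using mult_mono[of 1 n 1 pi] n pi_ge_two by simp
        have "n * \<bar>x\<bar> \<le> n * pi" using n x by (intro mult_left_mono) auto
        then have "1 + n * \<bar>x\<bar> \<le> 2 * (n * pi)" using npi by linarith
        then have "(1 + n * \<bar>x\<bar>) * (1 + \<bar>real_of_int k\<bar>) \<le> (2 * (n * pi)) * (2 * \<bar>real_of_int k\<bar>)"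
          using k1 n by (intro mult_mono) auto
        also have "\<dots> = 4 * (n * (pi * \<bar>real_of_int k\<bar>))" by simp
        also have "\<dots> \<le> 4 * \<bar>?z\<bar>" using z by (intro mult_left_mono) auto
        also have "\<dots> \<le> 4 * (1 + \<bar>?z\<bar>)" by simp
        finally show ?thesis .
      qed
      have "((1 + n * \<bar>x\<bar>) * (1 + \<bar>real_of_int k\<bar>)) ^ L \<le> (4 * (1 + \<bar>?z\<bar>)) ^ L"
        using n by (intro power_mono le) auto
      moreover have "(1 + \<bar>real_of_int k\<bar>) ^ 2 \<le> (1 + \<bar>real_of_int k\<bar>) ^ L" by (intro power_increasing L) auto
      then have "(1 + n * \<bar>x\<bar>) ^ L * (1 + \<bar>real_of_int k\<bar>) ^ 2 \<le> (1 + n * \<bar>x\<bar>) ^ L * (1 + \<bar>real_of_int k\<bar>) ^ L"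
        using n by (intro mult_left_mono) auto
      ultimately have "(1 + n * \<bar>x\<bar>) ^ L * (1 + \<bar>real_of_int k\<bar>) ^ 2 \<le> 4 ^ L * (1 + \<bar>?z\<bar>) ^ L"
        unfolding power_mult_distrib by (rule order_trans[rotated])
      then have "C * ((1 + n * \<bar>x\<bar>) ^ L * (1 + \<bar>real_of_int k\<bar>) ^ 2) \<le> C * (4 ^ L * (1 + \<bar>?z\<bar>) ^ L)"
        using C by (intro mult_left_mono) auto
      moreover have "0 < (1 + n * \<bar>x\<bar>) ^ L" using n by (intro zero_less_power add_pos_nonneg) auto
      moreover have "0 < (1 + \<bar>?z\<bar>) ^ L" "0 < (1 + \<bar>real_of_int k\<bar>) ^ 2" by (intro zero_less_power add_pos_nonneg; simp)+
      ultimately have "C / (1 + \<bar>?z\<bar>) ^ L \<le> E * q k"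
        unfolding E_def q_def by (simp add: divide_simps mult_ac)
      then show ?thesis using C(2)[of ?z] by linarith
    qed
    have "\<bar>\<Sum>\<^sub>\<infinity>k. KL L (n * (x + 2 * pi * real_of_int k))\<bar> \<le> E * S"
    proof -
      have sE: "(\<lambda>k. E * q k) summable_on UNIV" by (intro summable_on_cmult_right q)
      have sK: "(\<lambda>k. norm (KL L (n * (x + 2 * pi * real_of_int k)))) summable_on UNIV"
        by (rule summable_on_comparison_test[OF sE]) (use trm in auto)
      then have "norm (\<Sum>\<^sub>\<infinity>k. KL L (n * (x + 2 * pi * real_of_int k))) \<le> (\<Sum>\<^sub>\<infinity>k. norm (KL L (n * (x + 2 * pi * real_of_int k))))"
        by (rule norm_infsum_bound)
      also have "\<dots> \<le> (\<Sum>\<^sub>\<infinity>k. E * q k)"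
        by (rule infsum_mono[OF sK sE]) (use trm in auto)
      also have "\<dots> = E * S" unfolding S_def by (rule infsum_cmult_right')
      finally show ?thesis by simp
    qed
    then have "norm (Kpi L j x) \<le> E * S" using L by (simp add: Kpi_def n_def)
    also have "E \<le> C * 4 ^ L * wt n x powr (- real L)"
    proof -
      have "wt n x \<le> 1 + n * \<bar>x\<bar>"
      proof -
        have "\<bar>sin (x / 2)\<bar> \<le> \<bar>x\<bar>" using abs_sin_x_le_abs_x[of "x/2"] by simp
        then show ?thesis unfolding wt_def using n by (intro add_left_mono mult_left_mono) auto
      qed
      moreover have w: "0 < wt n x" using n by (intro wt_pos) auto
      ultimately have "(1 + n * \<bar>x\<bar>) powr (- real L) \<le> wt n x powr (- real L)" by (intro powr_mono2') auto
      moreover have "(1 + n * \<bar>x\<bar>) powr (- real L) = 1 / (1 + n * \<bar>x\<bar>) ^ L"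
        using n by (simp add: powr_minus_divide powr_realpow add_pos_nonneg)
      ultimately have "C * 4 ^ L * (1 / (1 + n * \<bar>x\<bar>) ^ L) \<le> C * 4 ^ L * wt n x powr (- real L)"
        using C by (intro mult_left_mono) auto
      then show ?thesis unfolding E_def by simp
    qed
    finally show ?thesis using S0 unfolding n_def by (simp add: mult_ac mult_right_mono)
  qed
  have "norm (Kpi L j x) \<le> (C * 4 ^ L * S + 1) * wt (2 ^ j) x powr (- real L)" for j x
  proof -
    define m where "m = \<lfloor>(x + pi) / (2 * pi)\<rfloor>"
    define x' where "x' = x + of_int (- m) *\<^sub>R (2 * pi)"
    have p: "0 < 2 * pi" by simp
    have "\<bar>x'\<bar> \<le> pi"
      using floor_divide_lower[OF p, of "x + pi"] floor_divide_upper[OF p, of "x + pi"]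
      unfolding x'_def m_def by (simp add: abs_le_iff algebra_simps)
    from base[OF this] have "norm (Kpi L j x') \<le> C * 4 ^ L * S * wt (2 ^ j) x' powr (- real L)" .
    moreover have "Kpi L j x' = Kpi L j x" unfolding x'_def
      by (rule periodic_int_multiple) (use L Kpi_periodic in simp)
    moreover have "wt (2 ^ j) x' = wt (2 ^ j) x" unfolding x'_def
      by (rule periodic_int_multiple) (rule wt_periodic)
    ultimately have "norm (Kpi L j x) \<le> C * 4 ^ L * S * wt (2 ^ j) x powr (- real L)" by simp
    also have "\<dots> \<le> (C * 4 ^ L * S + 1) * wt (2 ^ j) x powr (- real L)" by (intro mult_right_mono) auto
    finally show ?thesis .
  qed
  moreover have "0 < C * 4 ^ L * S + 1" using C S0 by (intro add_nonneg_pos) auto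
  ultimately show ?thesis by blast
qed

lemma interp_eq: "interp L j g x = (\<Sum>u\<in>Uset j. g (node j u) * Kpi L j (x - node j u))"
  by (simp add: interp_def node_def)

lemma interp_tp:
  assumes "1 \<le> L"
  shows "interp L j g \<in> tp (2 ^ j)"
proof -
  have "(\<lambda>x. \<Sum>u\<in>Uset j. g (node j u) * Kpi L j (x + - node j u)) \<in> tp (2 ^ j)"
    by (intro tp_sum tp_cmult tp_shift Kpi_tp assms)
  moreover have "interp L j g = (\<lambda>x. \<Sum>u\<in>Uset j. g (node j u) * Kpi L j (x + - node j u))"
    by (rule ext) (simp add: interp_eq)
  ultimately show ?thesis by simp
qed

lemma eta_tp:
  assumes "1 \<le> L"
  shows "eta L j g \<in> tp (2 ^ j)"
proof (cases "j = 0")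
  case False
  have "(\<lambda>x. interp L j g x + (- 1) * interp L (j - 1) g x) \<in> tp (2 ^ j)"
    by (intro tp_add tp_cmult interp_tp assms tp_mono[OF _ interp_tp[OF assms]]) auto
  then show ?thesis using False by (simp add: eta_def)
qed (simp add: eta_def interp_tp[OF assms, of 0, simplified])

text \<open>Sampling sees frequencies only modulo \<open>2 ^ j\<close>: the sum over the nodes keeps
  the kernel frequencies congruent to \<open>k\<close>, and the weights reduce these to
  \<open>k\<close> itself.\<close>

lemma interp_cis_general:
  assumes w: "kernel_weights L w" and k: "\<bar>k\<bar> \<le> 2 ^ j" and wk: "w j k = 1"
    and wl: "\<And>l. 2 ^ j dvd l - k \<Longrightarrow> l \<noteq> k \<Longrightarrow> w j l = 0"
  shows "interp L j (\<lambda>t. cis (of_int k * t)) x = cis (of_int k * x)"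
proof -
  note K = kernel_weightsD(1)[OF w]
  have "interp L j (\<lambda>t. cis (of_int k * t)) x =
     (\<Sum>u\<in>Uset j. \<Sum>l\<in>{-(2^j)..2^j}. (1 / 2 ^ j) * (complex_of_real (w j l) * cis (of_int l * x)) * cis (of_int (k - l) * node j u))"
    unfolding interp_eq K sum_distrib_left
  proof (intro sum.cong refl)
    fix u l
    have "cis (of_int k * node j u) * cis (of_int l * (x - node j u)) = cis (of_int l * x) * cis (of_int (k - l) * node j u)"
      unfolding cis_mult by (intro arg_cong[where f = cis]) (simp add: algebra_simps)
    then show "cis (of_int k * node j u) * (1 / 2 ^ j * (complex_of_real (w j l) * cis (of_int l * (x - node j u)))) =
       1 / 2 ^ j * (complex_of_real (w j l) * cis (of_int l * x)) * cis (of_int (k - l) * node j u)"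
      by (simp add: mult_ac)
  qed
  also have "\<dots> = (\<Sum>l\<in>{-(2^j)..2^j}. (1 / 2 ^ j) * (complex_of_real (w j l) * cis (of_int l * x)) * (\<Sum>u\<in>Uset j. cis (of_int (k - l) * node j u)))"
    by (subst sum.swap) (simp add: sum_distrib_left)
  also have "\<dots> = (\<Sum>l\<in>{-(2^j)..2^j}. if l = k then cis (of_int k * x) else 0)"
  proof (intro sum.cong refl)
    fix l
    have "w j l = 0" if "2 ^ j dvd k - l" "l \<noteq> k"
      by (rule wl) (use that in \<open>simp_all add: dvd_diff_commute\<close>)
    then show "(1 / 2 ^ j) * (complex_of_real (w j l) * cis (of_int l * x)) * (\<Sum>u\<in>Uset j. cis (of_int (k - l) * node j u)) = (if l = k then cis (of_int k * x) else 0)"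
      unfolding discrete_orthogonality using wk by auto
  qed
  also have "\<dots> = cis (of_int k * x)"
using k by auto
  finally show ?thesis .
qed

lemma interp_cis:
  assumes w: "kernel_weights L w" and k: "\<bar>k\<bar> * 2 ^ L < 2 ^ j"
  shows "interp L j (\<lambda>t. cis (of_int k * t)) x = cis (of_int k * x)"
proof (rule interp_cis_general[where w = w, OF w])
  have "\<bar>k\<bar> * 1 \<le> \<bar>k\<bar> * 2 ^ L" by (intro mult_left_mono) auto
  then show "\<bar>k\<bar> \<le> 2 ^ j" using k by auto
qed (use kernel_weightsD(4,5)[OF w k] in auto)

lemma interp_sum: "interp L j (\<lambda>t. \<Sum>i\<in>I. c i * f i t) x = (\<Sum>i\<in>I. c i * interp L j (f i) x)"
  unfolding interp_eq by (simp add: sum_distrib_right sum_distrib_left mult.assoc) (rule sum.swap)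

lemma interp_reproduces:
  assumes L: "1 \<le> L" and g: "g \<in> tp N" and N: "N * 2 ^ L < 2 ^ j"
  shows "interp L j g = g"
proof
  fix x
  obtain w where w: "kernel_weights L w" using kernel_weights_exists[OF L] by blast
  obtain c where g: "g = (\<lambda>x. \<Sum>k\<in>{-int N..int N}. c k * cis (real_of_int k * x))"
    using g unfolding tp_def by (blast elim: tspanE)
  have "interp L j (\<lambda>t. cis (of_int k * t)) x = cis (of_int k * x)" if "k \<in> {-int N..int N}" for k
  proof (rule interp_cis[OF w])
    have "\<bar>k\<bar> * 2 ^ L \<le> int N * 2 ^ L" using that by (intro mult_right_mono) auto
    also have "\<dots> = int (N * 2 ^ L)" by simp
    also have "\<dots> < int (2 ^ j)" using N by (simp only: of_nat_less_iff)
    finally show "\<bar>k\<bar> * 2 ^ L < 2 ^ j" by simp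
  qed
  then show "interp L j g x = g x" unfolding g interp_sum by (intro sum.cong) auto
qed

text \<open>The exponent is \<open>Suc L\<close> because the polynomial must be reproduced at the
  coarser level \<open>j - 1\<close> as well as at level \<open>j\<close>; the difference then
  cancels.\<close>

lemma eta_vanishes:
  assumes L: "1 \<le> L" and g: "g \<in> tp N" and N: "N * 2 ^ Suc L < 2 ^ j" and j: "1 \<le> j"
  shows "eta L j g = (\<lambda>x. 0)"
proof -
  obtain i where i: "j = Suc i" using j by (cases j) auto
  have "N * 2 ^ L < 2 ^ j" "N * 2 ^ L < 2 ^ (j - 1)" using N i by auto
  then have "interp L j g = g" "interp L (j - 1) g = g" by (auto intro!: interp_reproduces[OF L g])
  then show ?thesis using j by (simp add: eta_def)
qed

section \<open>Norms of samples and of interpolants for kernels of order at least 2\<close>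

lemma powr_sum_subadditive:
  fixes a :: "'i \<Rightarrow> real"
  assumes "0 < p" "p \<le> 1" "\<And>i. i \<in> I \<Longrightarrow> 0 \<le> a i"
  shows "(\<Sum>i\<in>I. a i) powr p \<le> (\<Sum>i\<in>I. a i powr p)"
proof -
  have two: "(x + y) powr p \<le> x powr p + y powr p" if "0 \<le> x" "0 \<le> y" for x y :: real
  proof (cases "x + y = 0")
    case True
    then show ?thesis using assms by simp
  next
    case False
    define s where "s = x + y"
    have s: "0 < s" using False that by (simp add: s_def)
    have frac: "z / s \<le> (z / s) powr p" if "0 \<le> z" "z \<le> s" for z
    proof (cases "z = 0")
      case False
      then have "(z / s) powr 1 \<le> (z / s) powr p"
        using that s assms by (intro powr_mono') (auto simp: divide_simps)
      then show ?thesis using that s False by simp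
    qed (use assms in simp)
    have "1 = x / s + y / s" using s by (simp add: s_def add_divide_distrib[symmetric])
    also have "\<dots> \<le> (x / s) powr p + (y / s) powr p"
      using that s by (intro add_mono frac) (auto simp: s_def)
    also have "\<dots> = (x powr p + y powr p) / s powr p" using that s by (simp add: powr_divide add_divide_distrib)
    finally show ?thesis using s by (simp add: s_def field_simps)
  qed
  show ?thesis using assms(3)
  proof (induction I rule: infinite_finite_induct)
    case (insert i I)
    have "(\<Sum>i\<in>insert i I. a i) powr p \<le> a i powr p + (\<Sum>i\<in>I. a i) powr p"
      using insert by (simp, intro two sum_nonneg) auto
    also have "\<dots> \<le> a i powr p + (\<Sum>i\<in>I. a i powr p)" using insert by auto
    finally show ?case using insert by simp
  qed (use assms in auto)
qed

text \<open>One half of a Marcinkiewicz-Zygmund inequality, for degrees that may exceed the number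
  of nodes. The local bound is applied at every node, and the weights summed over the nodes stay
  bounded at each point of integration.\<close>

lemma sampling_bound:
  assumes p: "0 < p"
  shows "\<exists>C>0. \<forall>j N g. 2 ^ j \<le> N \<longrightarrow> g \<in> tp N \<longrightarrow>
    (\<Sum>u\<in>Uset j. norm (g (node j u)) powr p) \<le> C * real N * pint (\<lambda>t. norm (g t) powr p)"
proof -
  obtain C where C: "0 < C" "\<And>N g x. 1 \<le> N \<Longrightarrow> g \<in> tp N \<Longrightarrow>
    norm (g x) powr p \<le> C * real N * pint (\<lambda>y. norm (g y) powr p * wt (real N) (x - y) powr (- 2))"
    using tp_local_bound[OF p, of 2] by auto
  obtain C' where C': "0 < C'" "\<And>j x. (\<Sum>u\<in>Uset j. wt (2 ^ j) (x - node j u) powr (- 2)) \<le> C'"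
    using sum_wt_nodes[of 2] by auto
  have "(\<Sum>u\<in>Uset j. norm (g (node j u)) powr p) \<le> (C * C') * real N * pint (\<lambda>t. norm (g t) powr p)"
    if N: "2 ^ j \<le> N" and g: "g \<in> tp N" for j N g
  proof -
    have n: "1 \<le> N" using N by (meson one_le_numeral one_le_power order_trans)
    have nr: "(2::real) ^ j \<le> real N" using N by (simp add: numeral_power_le_of_nat_cancel_iff)
    have cg: "continuous_on S g" for S by (rule tp_continuous[OF g])
    have "(\<Sum>u\<in>Uset j. norm (g (node j u)) powr p) \<le>
       (\<Sum>u\<in>Uset j. C * real N * pint (\<lambda>y. norm (g y) powr p * wt (2 ^ j) (y - node j u) powr (- 2)))"
    proof (rule sum_mono)
      fix u
      have "norm (g (node j u)) powr p \<le> C * real N * pint (\<lambda>y. norm (g y) powr p * wt (real N) (node j u - y) powr (- 2))"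
        by (rule C(2)[OF n g])
      also have "\<dots> \<le> C * real N * pint (\<lambda>y. norm (g y) powr p * wt (2 ^ j) (y - node j u) powr (- 2))"
      proof (intro mult_left_mono pint_le continuous_on_norm_wt p cg)
        fix y
        have "wt (2 ^ j) (y - node j u) \<le> wt (real N) (node j u - y)"
          using nr by (subst wt_commute, unfold wt_def, intro add_left_mono mult_right_mono) auto
        then show "wt (real N) (node j u - y) powr (- 2) \<le> wt (2 ^ j) (y - node j u) powr (- 2)"
          by (intro powr_mono2') (auto intro: wt_pos)
      qed (use C in \<open>auto intro!: continuous_intros\<close>)
      finally show "norm (g (node j u)) powr p \<le> C * real N * pint (\<lambda>y. norm (g y) powr p * wt (2 ^ j) (y - node j u) powr (- 2))" .
    qed
    also have "\<dots> = C * real N * (\<Sum>u\<in>Uset j. pint (\<lambda>y. norm (g y) powr p * wt (2 ^ j) (y - node j u) powr (- 2)))"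
      by (simp only: sum_distrib_left)
    also have "\<dots> = C * real N * pint (\<lambda>y. \<Sum>u\<in>Uset j. norm (g y) powr p * wt (2 ^ j) (y - node j u) powr (- 2))"
      by (subst pint_sum) (auto intro!: continuous_on_norm_wt continuous_intros p cg)
    also have "\<dots> \<le> C * real N * pint (\<lambda>y. C' * norm (g y) powr p)"
    proof (intro mult_left_mono pint_le continuous_on_sum continuous_on_norm_wt continuous_on_mult_left continuous_on_norm_powr p cg)
      fix y
      have "norm (g y) powr p * (\<Sum>u\<in>Uset j. wt (2 ^ j) (y - node j u) powr (- 2)) \<le> norm (g y) powr p * C'"
        by (intro mult_left_mono C') auto
      then show "(\<Sum>u\<in>Uset j. norm (g y) powr p * wt (2 ^ j) (y - node j u) powr (- 2)) \<le> C' * norm (g y) powr p"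
        by (simp add: sum_distrib_left mult.commute)
    qed (use C in \<open>auto intro!: continuous_intros\<close>)
    finally show ?thesis by (simp add: mult_ac)
  qed
  moreover have "0 < C * C'" using C C' by simp
  ultimately show ?thesis by blast
qed

text \<open>For p at most 1 the power of a sum is at most the sum of the powers, so the translates
  of the kernel may be treated separately. Each has a \<open>p\<close>-th power integral of order
  \<open>1 / 2 ^ j\<close>, finite decay being guaranteed by \<open>real L * p > 1\<close>, and
  \<open>sampling_bound\<close> collects the samples.\<close>

lemma interp_bound_small_p:
  assumes L: "2 \<le> L" and p: "0 < p" "p \<le> 1" and Lp: "1 < real L * p"
  shows "\<exists>C>0. \<forall>j N g. 2 ^ j \<le> N \<longrightarrow> g \<in> tp N \<longrightarrow>
    pint (\<lambda>t. norm (interp L j g t) powr p) \<le> C * (real N / 2 ^ j) * pint (\<lambda>t. norm (g t) powr p)"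
proof -
  have L1: "1 \<le> L" using L by simp
  obtain K where K: "0 < K" "\<And>j x. norm (Kpi L j x) \<le> K * wt (2 ^ j) x powr (- real L)"
    using Kpi_decay[OF L] by blast
  obtain C where C: "0 < C" "\<And>j N g. 2 ^ j \<le> N \<Longrightarrow> g \<in> tp N \<Longrightarrow>
    (\<Sum>u\<in>Uset j. norm (g (node j u)) powr p) \<le> C * real N * pint (\<lambda>t. norm (g t) powr p)"
    using sampling_bound[OF p(1)] by blast
  define E where "E = K powr p * (16 / (real L * p - 1))"
  have E: "0 < E" using K Lp by (simp add: E_def)
  have "pint (\<lambda>t. norm (interp L j g t) powr p) \<le> (E * C) * (real N / 2 ^ j) * pint (\<lambda>t. norm (g t) powr p)"
    if N: "2 ^ j \<le> N" and g: "g \<in> tp N" for j N g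
  proof -
    have cK0: "continuous_on UNIV (\<lambda>t. Kpi L j (t - node j u))" for u
      by (intro continuous_on_Kpi L1 continuous_intros)
    have cK: "continuous_on UNIV (\<lambda>t. norm (Kpi L j (t - node j u)) powr p)" for u
      by (intro continuous_on_norm_powr cK0 p)
    have one: "pint (\<lambda>t. norm (Kpi L j (t - node j u)) powr p) \<le> E / 2 ^ j" for u
    proof -
      have "pint (\<lambda>t. norm (Kpi L j (t - node j u)) powr p) \<le> pint (\<lambda>t. K powr p * wt (2 ^ j) (t - node j u) powr (- (real L * p)))"
      proof (intro pint_le cK continuous_on_mult_left continuous_on_wt_powr)
        fix t
        have "norm (Kpi L j (t - node j u)) powr p \<le> (K * wt (2 ^ j) (t - node j u) powr (- real L)) powr p"
          using p by (intro powr_mono2 K) auto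
        then show "norm (Kpi L j (t - node j u)) powr p \<le> K powr p * wt (2 ^ j) (t - node j u) powr (- (real L * p))"
          using K by (simp add: powr_mult powr_powr)
      qed (auto intro!: continuous_intros)
      also have "\<dots> = K powr p * pint (\<lambda>t. wt (2 ^ j) t powr (- (real L * p)))"
        unfolding Henstock_Kurzweil_Integration.integral_mult_right by (subst pint_wt_shift) auto
      also have "\<dots> \<le> K powr p * (16 / (real L * p - 1) / 2 ^ j)"
        by (intro mult_left_mono pint_wt_powr Lp) auto
      finally show ?thesis by (simp add: E_def)
    qed
    have "pint (\<lambda>t. norm (interp L j g t) powr p) \<le>
       pint (\<lambda>t. \<Sum>u\<in>Uset j. norm (g (node j u)) powr p * norm (Kpi L j (t - node j u)) powr p)"
    proof (intro pint_le continuous_on_norm_powr tp_continuous[OF interp_tp[OF L1]] p continuous_on_sum continuous_on_mult_left cK cK0)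
      fix t
      have "norm (interp L j g t) powr p \<le> (\<Sum>u\<in>Uset j. norm (g (node j u) * Kpi L j (t - node j u))) powr p"
        unfolding interp_eq using p by (intro powr_mono2 norm_sum) auto
      also have "\<dots> \<le> (\<Sum>u\<in>Uset j. norm (g (node j u) * Kpi L j (t - node j u)) powr p)"
        by (intro powr_sum_subadditive p) auto
      finally show "norm (interp L j g t) powr p \<le> (\<Sum>u\<in>Uset j. norm (g (node j u)) powr p * norm (Kpi L j (t - node j u)) powr p)"
        by (simp add: norm_mult powr_mult)
    qed
    also have "\<dots> = (\<Sum>u\<in>Uset j. norm (g (node j u)) powr p * pint (\<lambda>t. norm (Kpi L j (t - node j u)) powr p))"
      by (subst pint_sum) (auto intro!: continuous_on_mult_left cK)
    also have "\<dots> \<le> (\<Sum>u\<in>Uset j. norm (g (node j u)) powr p * (E / 2 ^ j))"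
      by (intro sum_mono mult_left_mono one) auto
    also have "\<dots> = (\<Sum>u\<in>Uset j. norm (g (node j u)) powr p) * (E / 2 ^ j)" by (simp only: sum_distrib_right)
    also have "\<dots> \<le> (C * real N * pint (\<lambda>t. norm (g t) powr p)) * (E / 2 ^ j)"
      using E by (intro mult_right_mono C N g) auto
    finally show ?thesis by (simp add: mult_ac)
  qed
  moreover have "0 < E * C" using E C by simp
  ultimately show ?thesis by blast
qed

text \<open>Subadditivity of the \<open>p\<close>-th power is lost for p > 1. Instead all samples
  are bounded through the Peetre majorant at the single point \<open>t\<close>, and the kernel pays
  for the resulting growth in the distance from \<open>t\<close> to the node.\<close>

lemma interp_bound_large_p:
  assumes L: "2 \<le> L" and p: "1 < p"
  shows "\<exists>C>0. \<forall>j N g. 2 ^ j \<le> N \<longrightarrow> g \<in> tp N \<longrightarrow>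
    pint (\<lambda>t. norm (interp L j g t) powr p) \<le> C * (real N / 2 ^ j) * pint (\<lambda>t. norm (g t) powr p)"
proof -
  have L1: "1 \<le> L" and p0: "0 < p" using L p by auto
  obtain K where K: "0 < K" "\<And>j x. norm (Kpi L j x) \<le> K * wt (2 ^ j) x powr (- real L)"
    using Kpi_decay[OF L] by blast
  \<comment> \<open>A number between 1 and \<open>p\<close>: the majorant needs
    \<open>A > 1\<close>, and \<open>A < p\<close> gives \<open>A / p < 1\<close>, so that already
    \<open>L = 2\<close> leaves a decay exponent larger than 1 for the sum over the nodes.\<close>
  define A where "A = (1 + p) / 2"
  have A: "1 < A" "1 < real L - A / p"
  proof -
    show "1 < A" using p by (simp add: A_def)
    have "A / p < 1" using p by (simp add: A_def field_simps)
    then show "1 < real L - A / p" using L by linarith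
  qed
  obtain P where P: "0 < P" "\<And>N n g. 1 \<le> N \<Longrightarrow> 0 < n \<Longrightarrow> n \<le> real N \<Longrightarrow> g \<in> tp N \<Longrightarrow>
    (\<exists>G. continuous_on UNIV G \<and> (\<forall>x. 0 \<le> G x) \<and> (\<forall>x y. norm (g y) powr p \<le> wt n (x - y) powr A * G x) \<and>
      pint G \<le> P * (real N / n) * pint (\<lambda>t. norm (g t) powr p))"
    using tp_peetre[OF p0 A(1)] by blast
  obtain C where C: "0 < C" "\<And>j x. (\<Sum>u\<in>Uset j. wt (2 ^ j) (x - node j u) powr (- (real L - A / p))) \<le> C"
    using sum_wt_nodes[OF A(2)] by auto
  have "pint (\<lambda>t. norm (interp L j g t) powr p) \<le> ((K * C) powr p * P) * (real N / 2 ^ j) * pint (\<lambda>t. norm (g t) powr p)"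
    if N: "2 ^ j \<le> N" and g: "g \<in> tp N" for j N g
  proof -
    have n: "1 \<le> N" using N by (meson one_le_numeral one_le_power order_trans)
    have nr: "(2::real) ^ j \<le> real N" using N by (simp add: numeral_power_le_of_nat_cancel_iff)
    obtain G where G: "continuous_on UNIV G" "\<And>x. 0 \<le> G x" "\<And>x y. norm (g y) powr p \<le> wt (2 ^ j) (x - y) powr A * G x"
      "pint G \<le> P * (real N / 2 ^ j) * pint (\<lambda>t. norm (g t) powr p)"
      using P(2)[OF n _ nr g] by auto
    have ptw: "norm (interp L j g t) powr p \<le> (K * C) powr p * G t" for t
    proof -
      have gle: "norm (g y) \<le> wt (2 ^ j) (t - y) powr (A / p) * G t powr (1 / p)" for y
      proof -
        have "(norm (g y) powr p) powr (1 / p) \<le> (wt (2 ^ j) (t - y) powr A * G t) powr (1 / p)"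
          by (rule powr_mono2) (use G(3)[of y t] p in auto)
        then show ?thesis using p0 G(2)[of t] wt_pos[of "2 ^ j" "t - y"]
          by (simp add: powr_powr powr_mult)
      qed
      have "norm (interp L j g t) \<le> (\<Sum>u\<in>Uset j. norm (g (node j u) * Kpi L j (t - node j u)))"
        unfolding interp_eq by (rule norm_sum)
      also have "\<dots> \<le> (\<Sum>u\<in>Uset j. K * G t powr (1 / p) * wt (2 ^ j) (t - node j u) powr (- (real L - A / p)))"
      proof (rule sum_mono)
        fix u
        have "norm (g (node j u) * Kpi L j (t - node j u)) \<le>
            (wt (2 ^ j) (t - node j u) powr (A / p) * G t powr (1 / p)) * (K * wt (2 ^ j) (t - node j u) powr (- real L))"
          unfolding norm_mult by (intro mult_mono gle K) auto
        also have "\<dots> = K * G t powr (1 / p) * (wt (2 ^ j) (t - node j u) powr (A / p) * wt (2 ^ j) (t - node j u) powr (- real L))"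
          by (simp add: mult_ac)
        also have "\<dots> = K * G t powr (1 / p) * wt (2 ^ j) (t - node j u) powr (- (real L - A / p))"
          by (simp flip: powr_add)
        finally show "norm (g (node j u) * Kpi L j (t - node j u)) \<le> K * G t powr (1 / p) * wt (2 ^ j) (t - node j u) powr (- (real L - A / p))" .
      qed
      also have "\<dots> = K * G t powr (1 / p) * (\<Sum>u\<in>Uset j. wt (2 ^ j) (t - node j u) powr (- (real L - A / p)))"
        by (simp only: sum_distrib_left)
      also have "\<dots> \<le> K * G t powr (1 / p) * C" using K by (intro mult_left_mono C) auto
      finally have "norm (interp L j g t) powr p \<le> ((K * C) * G t powr (1 / p)) powr p"
        using p0 by (intro powr_mono2) (auto simp: mult_ac)
      then show ?thesis using p0 K C G(2)[of t] by (simp add: powr_mult powr_powr)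
    qed
    have "pint (\<lambda>t. norm (interp L j g t) powr p) \<le> pint (\<lambda>t. (K * C) powr p * G t)"
      by (intro pint_le ptw continuous_on_norm_powr continuous_on_mult_left tp_continuous[OF interp_tp[OF L1]] p0 G(1))
    also have "\<dots> = (K * C) powr p * pint G" by simp
    also have "\<dots> \<le> (K * C) powr p * (P * (real N / 2 ^ j) * pint (\<lambda>t. norm (g t) powr p))"
      by (intro mult_left_mono G) auto
    finally show ?thesis by (simp add: mult_ac)
  qed
  moreover have "0 < (K * C) powr p * P" using K C P by simp
  ultimately show ?thesis by blast
qed

text \<open>Bounded Lebesgue constants: with decay of order at least 2 the moduli of the translated
  kernels have a uniformly bounded sum.\<close>

lemma interp_bound_sup:
  assumes L: "2 \<le> L"
  shows "\<exists>C>0. \<forall>j g S. (\<forall>t. norm (g t) \<le> S) \<longrightarrow> (\<forall>t. norm (interp L j g t) \<le> C * S)"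
proof -
  obtain K where K: "0 < K" "\<And>j x. norm (Kpi L j x) \<le> K * wt (2 ^ j) x powr (- real L)"
    using Kpi_decay[OF L] by blast
  obtain C where C: "0 < C" "\<And>j x. (\<Sum>u\<in>Uset j. wt (2 ^ j) (x - node j u) powr (- real L)) \<le> C"
    using sum_wt_nodes[of "real L"] L by auto
  have "norm (interp L j g t) \<le> K * C * S" if S: "\<And>t. norm (g t) \<le> S" for j g S t
  proof -
    have S0: "0 \<le> S" using S norm_ge_zero order_trans by blast
    have "norm (interp L j g t) \<le> (\<Sum>u\<in>Uset j. norm (g (node j u) * Kpi L j (t - node j u)))"
      unfolding interp_eq by (rule norm_sum)
    also have "\<dots> \<le> (\<Sum>u\<in>Uset j. S * (K * wt (2 ^ j) (t - node j u) powr (- real L)))"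
      unfolding norm_mult by (intro sum_mono mult_mono S K S0) auto
    also have "\<dots> = S * K * (\<Sum>u\<in>Uset j. wt (2 ^ j) (t - node j u) powr (- real L))"
      by (simp add: sum_distrib_left mult_ac)
    also have "\<dots> \<le> S * K * C" using S0 K by (intro mult_left_mono C) auto
    finally show ?thesis by (simp add: mult_ac)
  qed
  moreover have "0 < K * C" using K C by simp
  ultimately show ?thesis by blast
qed

section \<open>The theorem of M. Riesz for trigonometric polynomials\<close>

lemma mean_value_circle:
  assumes "continuous_on (cball 0 1) f" "f holomorphic_on ball 0 1"
  shows "pint (\<lambda>t. f (cis t)) = 2 * complex_of_real pi * f 0"
proof -
  have "((\<lambda>u. f u / (u - 0)) has_contour_integral 2 * of_real pi * \<i> * f 0) (circlepath 0 1)"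
    by (rule Cauchy_integral_circlepath) (use assms in auto)
  then have "((\<lambda>t. f (0 + 1 * cis t) / (0 + 1 * cis t - 0) * 1 * \<i> * cis t) has_integral 2 * of_real pi * \<i> * f 0) {0..2 * pi}"
    unfolding circlepath_def using has_contour_integral_part_circlepath_iff[of 0 "2 * pi" "\<lambda>u. f u / (u - 0)" _ 0 1]
    by simp
  then have "((\<lambda>t. \<i> * f (cis t)) has_integral \<i> * (2 * of_real pi * f 0)) {0..2 * pi}"
    by (simp add: mult_ac)
  from has_integral_mult_right[OF this, of "- \<i>"]
  have I: "((\<lambda>t. f (cis t)) has_integral 2 * of_real pi * f 0) {0..2 * pi}"
    by (simp add: mult.assoc[symmetric])
  have "continuous_on UNIV (\<lambda>t. f (cis t))"
    by (rule continuous_on_compose2[OF assms(1)]) (auto intro!: continuous_intros)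
  moreover have "f (cis (t + 2 * pi)) = f (cis t)" for t
    using cis_int_periodic[of 1 t] by simp
  ultimately have "pint (\<lambda>t. f (cis (t + pi))) = pint (\<lambda>t. f (cis t))"
    by (rule integral_period_shift)
  moreover have "pint (\<lambda>t. f (cis (t + pi))) = integral {0..2 * pi} (\<lambda>t. f (cis t))"
    using integral_shift_real_ivl[of 0 pi "2 * pi" "\<lambda>t. f (cis t)"] by simp
  ultimately show ?thesis using integral_unique[OF I] by simp
qed

text \<open>The minimum principle for the harmonic function \<open>Re (poly F z)\<close>, obtained
  from the maximum modulus principle for \<open>exp (- poly F z)\<close>.\<close>

lemma poly_Re_pos_disc:
  assumes pos: "\<And>t. 0 < Re (poly F (cis t))" and z: "z \<in> cball 0 1"
  shows "0 < Re (poly F z)"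
proof -
  have on_sphere: "0 < Re (poly F w)" if "w \<in> sphere 0 1" for w
  proof -
    have "w = cis (Arg w)" using that rcis_cmod_Arg[of w] by (simp add: rcis_def)
    then show ?thesis using pos by metis
  qed
  have "compact (sphere (0::complex) 1)" "sphere (0::complex) 1 \<noteq> {}" by auto
  moreover have "continuous_on (sphere 0 1) (\<lambda>w. Re (poly F w))" by (intro continuous_intros)
  ultimately obtain w0 where w0: "w0 \<in> sphere 0 1" "\<And>w. w \<in> sphere 0 1 \<Longrightarrow> Re (poly F w0) \<le> Re (poly F w)"
    using continuous_attains_inf by meson
  have "norm (exp (- poly F z)) \<le> exp (- Re (poly F w0))"
  proof (rule maximum_modulus_frontier[of "\<lambda>z. exp (- poly F z)" "cball 0 1"])
    show "(\<lambda>z. exp (- poly F z)) holomorphic_on interior (cball 0 1)" by (intro holomorphic_intros)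
    show "continuous_on (closure (cball 0 1)) (\<lambda>z. exp (- poly F z))" by (intro continuous_intros)
    show "norm (exp (- poly F w)) \<le> exp (- Re (poly F w0))" if "w \<in> frontier (cball 0 1)" for w
      using w0(2)[of w] that by simp
  qed (use z in auto)
  then have "Re (poly F w0) \<le> Re (poly F z)" by simp
  then show ?thesis using on_sphere[OF w0(1)] by linarith
qed

text \<open>The harmonic function \<open>Re (z powr p)\<close> is negative near the imaginary axis, so a multiple of it
  makes up for the degeneration of \<open>(Re z) powr p\<close> there.\<close>

lemma right_half_plane_inequality:
  assumes p: "1 < p" "p \<le> 2"
  shows "\<exists>A B. 0 < A \<and> 0 < B \<and> (\<forall>z. 0 < Re z \<longrightarrow>
    norm z powr p \<le> A * Re z powr p - B * Re (exp (of_real p * Ln z)))"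
proof -
  \<comment> \<open>The angle satisfies \<open>\<theta>0 < pi / 2 < p * \<theta>0\<close>. For
    arguments between \<open>\<theta>0\<close> and \<open>pi / 2\<close> the multiple
    \<open>p * \<theta>\<close> lies between \<open>p * \<theta>0\<close> and \<open>pi\<close>,
    since \<open>p\<close> is at most 2, so its cosine is at most \<open>- c\<close>.\<close>
  define \<theta>0 where "\<theta>0 = pi * (1 + p) / (4 * p)"
  have \<theta>0: "0 < \<theta>0" "\<theta>0 < pi / 2"
  proof -
    show "0 < \<theta>0" unfolding \<theta>0_def by (intro divide_pos_pos mult_pos_pos) (use p in auto)
    show "\<theta>0 < pi / 2" using p by (simp add: \<theta>0_def field_simps)
  qed
  have p\<theta>0: "p * \<theta>0 = pi * (1 + p) / 4" using p by (simp add: \<theta>0_def)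
  define c where "c = - cos (p * \<theta>0)"
  have range: "pi / 2 < p * \<theta>0" "p * \<theta>0 \<le> pi" using p unfolding p\<theta>0 by (auto simp: field_simps)
  have c: "0 < c"
  proof -
    have "cos (p * \<theta>0) < cos (pi / 2)" using range by (intro cos_monotone_0_pi) auto
    then show ?thesis by (simp add: c_def)
  qed
  define B where "B = 1 / c"
  have B: "0 < B" using c by (simp add: B_def)
  define \<kappa> where "\<kappa> = cos \<theta>0"
  have \<kappa>: "0 < \<kappa>" unfolding \<kappa>_def using \<theta>0 by (intro cos_gt_zero) auto
  \<comment> \<open>Near the imaginary axis \<open>B = 1 / c\<close> alone suffices. On the
    remaining cone the cosine is at least \<kappa>, and \<open>A\<close> is large enough to cover 1
    together with the worst case \<open>B\<close> of the second term.\<close>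
  define A where "A = (1 + B) / \<kappa> powr p"
  have A: "0 < A" using B \<kappa> by (simp add: A_def)
  have "norm z powr p \<le> A * Re z powr p - B * Re (exp (of_real p * Ln z))" if z: "0 < Re z" for z
  proof -
    have z0: "z \<noteq> 0" using z by auto
    define \<theta> where "\<theta> = Im (Ln z)"
    have \<theta>: "\<bar>\<theta>\<bar> < pi / 2" using z Re_Ln_pos_lt[OF z0] by (simp add: \<theta>_def)
    have zexp: "z = exp (Ln z)" using z0 by simp
    have Rez: "Re z = norm z * cos \<theta>"
      by (subst zexp, subst Re_exp) (use z0 in \<open>simp add: \<theta>_def\<close>)
    have Rep: "Re (exp (of_real p * Ln z)) = norm z powr p * cos (p * \<theta>)"
      using z0 by (simp add: Re_exp \<theta>_def powr_def)
    have cos_pos: "0 < cos \<theta>" using \<theta> by (intro cos_gt_zero_pi) auto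
    have "1 \<le> A * cos \<theta> powr p - B * cos (p * \<theta>)"
    proof (cases "\<theta>0 \<le> \<bar>\<theta>\<bar>")
      case True
      have "p * \<bar>\<theta>\<bar> \<le> 2 * (pi / 2)" using p \<theta> by (intro mult_mono) auto
      moreover have "p * \<theta>0 \<le> p * \<bar>\<theta>\<bar>" using True p by simp
      ultimately have "cos (p * \<bar>\<theta>\<bar>) \<le> cos (p * \<theta>0)" using p \<theta>0 by (intro cos_monotone_0_pi_le) auto
      moreover have "cos (p * \<bar>\<theta>\<bar>) = cos (p * \<theta>)" by (cases "\<theta> \<ge> 0") auto
      ultimately have "B * cos (p * \<theta>) \<le> B * (- c)" using B by (intro mult_left_mono) (auto simp: c_def)
      then have "B * cos (p * \<theta>) \<le> - 1" using c by (simp add: B_def)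
      moreover have "0 \<le> A * cos \<theta> powr p" using A by simp
      ultimately show ?thesis by linarith
    next
      case False
      have "cos \<bar>\<theta>\<bar> = cos \<theta>" by (cases "\<theta> \<ge> 0") auto
      moreover have "cos \<theta>0 \<le> cos \<bar>\<theta>\<bar>" using False \<theta>0 by (intro cos_monotone_0_pi_le) auto
      ultimately have "\<kappa> powr p \<le> cos \<theta> powr p" using \<kappa> p unfolding \<kappa>_def by (intro powr_mono2) auto
      then have "A * \<kappa> powr p \<le> A * cos \<theta> powr p" using A by (intro mult_left_mono) auto
      moreover have "A * \<kappa> powr p = 1 + B" using \<kappa> by (simp add: A_def)
      moreover have "B * cos (p * \<theta>) \<le> B * 1" using B by (intro mult_left_mono) auto
      ultimately show ?thesis by linarith
    qed
    then have "norm z powr p * 1 \<le> norm z powr p * (A * cos \<theta> powr p - B * cos (p * \<theta>))"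
      by (intro mult_left_mono) auto
    then show ?thesis unfolding Rep unfolding Rez using cos_pos by (simp add: powr_mult algebra_simps)
  qed
  with A B show ?thesis by blast
qed

text \<open>The polynomial maps the closed disc into the right half plane, so its
  \<open>p\<close>-th power is holomorphic with mean equal to its value at the centre. That value is
  positive because \<open>poly F 0\<close> is real and positive; integrating the half plane
  inequality, the subtracted term may be dropped.\<close>

lemma riesz_positive:
  assumes p: "1 < p" "p \<le> 2"
  shows "\<exists>A>0. \<forall>F. Im (poly F 0) = 0 \<longrightarrow> (\<forall>t. 0 < Re (poly F (cis t))) \<longrightarrow>
    pint (\<lambda>t. norm (poly F (cis t)) powr p) \<le> A * pint (\<lambda>t. Re (poly F (cis t)) powr p)"
proof -
  obtain A B where AB: "0 < A" "0 < B" "\<And>z. 0 < Re z \<Longrightarrow>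
    norm z powr p \<le> A * Re z powr p - B * Re (exp (of_real p * Ln z))"
    using right_half_plane_inequality[OF p] by blast
  have "pint (\<lambda>t. norm (poly F (cis t)) powr p) \<le> A * pint (\<lambda>t. Re (poly F (cis t)) powr p)"
    if im: "Im (poly F 0) = 0" and pos: "\<And>t. 0 < Re (poly F (cis t))" for F
  proof -
    have disc: "0 < Re (poly F z)" if "z \<in> cball 0 1" for z by (rule poly_Re_pos_disc[OF pos that])
    then have slit: "poly F z \<notin> \<real>\<^sub>\<le>\<^sub>0" if "z \<in> cball 0 1" for z
      using that complex_nonpos_Reals_iff by force
    have nz: "poly F z \<noteq> 0" if "z \<in> cball 0 1" for z using disc[OF that] by auto
    define f where "f = (\<lambda>z. exp (of_real p * Ln (poly F z)))"
    have cf: "continuous_on (cball 0 1) f" unfolding f_def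
      by (intro continuous_intros continuous_on_compose2[OF continuous_on_Ln[of "{z. z \<notin> \<real>\<^sub>\<le>\<^sub>0}"]]) (use slit in auto)
    have hf: "f holomorphic_on ball 0 1" unfolding f_def
      by (intro holomorphic_intros) (use slit in auto)
    have cft: "continuous_on S (\<lambda>t. f (cis t))" for S
      by (rule continuous_on_compose2[OF cf]) (auto intro!: continuous_intros)
    have mv: "pint (\<lambda>t. f (cis t)) = 2 * complex_of_real pi * f 0" by (rule mean_value_circle[OF cf hf])
    have "f 0 = of_real (exp (p * ln (Re (poly F 0))))"
    proof -
      have "poly F 0 = of_real (Re (poly F 0))" using im by (simp add: complex_eq_iff)
      moreover have "0 < Re (poly F 0)" by (rule disc) simp
      ultimately have "Ln (poly F 0) = of_real (ln (Re (poly F 0)))" by (metis Ln_of_real)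
      then show ?thesis by (simp add: f_def flip: exp_of_real)
    qed
    then have "0 \<le> Re (pint (\<lambda>t. f (cis t)))" unfolding mv by simp
    moreover have "Re (pint (\<lambda>t. f (cis t))) = pint (\<lambda>t. Re (f (cis t)))"
      using integral_linear[OF integrable_continuous_real[OF cft] bounded_linear_Re] by (simp add: o_def)
    ultimately have Re0: "0 \<le> pint (\<lambda>t. Re (f (cis t)))" by simp
    have cRe: "continuous_on S (\<lambda>t. Re (poly F (cis t)) powr p)" for S
      by (intro continuous_on_powr' continuous_intros) (use p pos in \<open>auto intro: less_imp_le\<close>)
    have "pint (\<lambda>t. norm (poly F (cis t)) powr p) \<le> pint (\<lambda>t. A * Re (poly F (cis t)) powr p - B * Re (f (cis t)))"
      unfolding f_def
      by (intro pint_le continuous_on_norm_powr continuous_on_diff continuous_on_mult_left cRe AB(3) pos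
            cft[unfolded f_def, THEN continuous_on_Re])
         (use p in \<open>auto intro!: continuous_intros\<close>)
    also have "\<dots> = A * pint (\<lambda>t. Re (poly F (cis t)) powr p) - B * pint (\<lambda>t. Re (f (cis t)))"
      by (subst Henstock_Kurzweil_Integration.integral_diff)
         (auto intro!: integrable_continuous_real continuous_on_mult_left cRe continuous_on_Re cft)
    also have "\<dots> \<le> A * pint (\<lambda>t. Re (poly F (cis t)) powr p)" using Re0 AB by simp
    finally show ?thesis .
  qed
  with AB show ?thesis by blast
qed

section \<open>Analytic completions and the conjugate function\<close>

lemma sum_int_symmetric:
  "(\<Sum>k\<in>{-int N..int N}. f k) = f 0 + (\<Sum>k=1..N. f (int k) + f (- int k))" for f :: "int \<Rightarrow> 'a::comm_monoid_add"
proof (induction N)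
  case (Suc N)
  have "{-int (Suc N)..int (Suc N)} = insert (int (Suc N)) (insert (- int (Suc N)) {-int N..int N})" by auto
  then show ?case using Suc by (simp add: add_ac)
qed simp

text \<open>The analytic polynomial u + iv on the circle, with u the real part of the trigonometric
  polynomial having coefficients \<open>c\<close> and v its conjugate function. Negative frequencies
  are folded onto positive ones by conjugation, and the value at 0 is made real.\<close>

definition completion :: "(int \<Rightarrow> complex) \<Rightarrow> nat \<Rightarrow> complex poly" where
  "completion c N = [:of_real (Re (c 0)):] + (\<Sum>k=1..N. monom (c (int k) + cnj (c (- int k))) k)"

lemma poly_completion:
  "poly (completion c N) z = of_real (Re (c 0)) + (\<Sum>k=1..N. (c (int k) + cnj (c (- int k))) * z ^ k)"
  by (simp add: completion_def poly_sum poly_monom)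

lemma Im_completion_0: "Im (poly (completion c N) 0) = 0"
  unfolding poly_completion by (simp add: power_0_left)

lemma Re_completion:
  "Re (poly (completion c N) (cis t)) = Re (\<Sum>k\<in>{-int N..int N}. c k * cis (of_int k * t))"
proof -
  have "Re ((c (int k) + cnj (c (- int k))) * cis t ^ k) =
    Re (c (int k) * cis (of_int (int k) * t) + c (- int k) * cis (of_int (- int k) * t))" for k
    by (simp add: Complex.DeMoivre algebra_simps)
  then show ?thesis unfolding poly_completion sum_int_symmetric by simp
qed

lemma poly_cis_tp: "(\<lambda>t. poly F (cis t)) \<in> tp (degree F)"
proof -
  have "(\<lambda>t. \<Sum>i\<le>degree F. coeff F i * cis (of_int (int i) * t)) \<in> tp (degree F)"
    by (intro tp_sum tp_cmult tp_cis) auto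
  then show ?thesis by (simp add: poly_altdef Complex.DeMoivre)
qed

lemma tp_cnj:
  assumes "g \<in> tp N"
  shows "(\<lambda>t. cnj (g t)) \<in> tp N"
proof -
  obtain c where g: "g = (\<lambda>x. \<Sum>k\<in>{-int N..int N}. c k * cis (real_of_int k * x))"
    using assms unfolding tp_def by (blast elim: tspanE)
  have "(\<lambda>t. \<Sum>k\<in>{-int N..int N}. cnj (c k) * cis (real_of_int (- k) * t)) \<in> tp N"
    by (intro tp_sum tp_cmult tp_cis) auto
  then show ?thesis unfolding g by (simp add: cis_cnj)
qed

text \<open>This makes approximants from the Stone-Weierstrass theorem usable: on the circle they
  are real parts of analytic polynomials. Only products require an idea: the product of two real
  parts is again a trigonometric polynomial, and \<open>completion\<close> restores
  analyticity.\<close>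

lemma real_polynomial_function_circle:
  fixes g :: "complex \<Rightarrow> real"
  assumes "real_polynomial_function g"
  shows "\<exists>G. Im (poly G 0) = 0 \<and> (\<forall>t. Re (poly G (cis t)) = g (cis t))"
  using assms
proof (induction rule: real_polynomial_function.induct)
  case (linear f)
  then interpret bounded_linear f .
  have "f (cis t) = Re (poly [:0, of_real (f 1) - \<i> * of_real (f \<i>):] (cis t))" for t
  proof -
    have "cis t = cos t *\<^sub>R 1 + sin t *\<^sub>R \<i>" by (simp add: complex_eq_iff)
    then have "f (cis t) = f (cos t *\<^sub>R 1 + sin t *\<^sub>R \<i>)" by simp
    also have "\<dots> = cos t * f 1 + sin t * f \<i>" by (simp only: add scaleR real_scaleR_def)
    finally show ?thesis by (simp add: algebra_simps)
  qed
  then show ?case by (intro exI[of _ "[:0, of_real (f 1) - \<i> * of_real (f \<i>):]"]) auto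
next
  case (const c)
  show ?case by (intro exI[of _ "[:of_real c:]"]) auto
next
  case (add f g)
  then obtain F G where "Im (poly F 0) = 0" "\<And>t. Re (poly F (cis t)) = f (cis t)"
    "Im (poly G 0) = 0" "\<And>t. Re (poly G (cis t)) = g (cis t)" by blast
  then show ?case by (intro exI[of _ "F + G"]) auto
next
  case (mult f g)
  then obtain F G where F: "\<And>t. Re (poly F (cis t)) = f (cis t)" and G: "\<And>t. Re (poly G (cis t)) = g (cis t)" by blast
  have Re_tp: "(\<lambda>t. complex_of_real (Re (poly H (cis t)))) \<in> tp (degree H)" for H
  proof -
    have "(\<lambda>t. 1/2 * (poly H (cis t) + cnj (poly H (cis t)))) \<in> tp (degree H)"
      by (intro tp_cmult tp_add tp_cnj poly_cis_tp)
    then show ?thesis by (simp add: complex_add_cnj)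
  qed
  obtain c where c: "(\<lambda>t. complex_of_real (Re (poly F (cis t))) * complex_of_real (Re (poly G (cis t)))) =
      (\<lambda>x. \<Sum>k\<in>{-int (degree F + degree G)..int (degree F + degree G)}. c k * cis (real_of_int k * x))"
    using tp_mult[OF Re_tp Re_tp, of F G] unfolding tp_def by (blast elim: tspanE)
  have "Re (poly (completion c (degree F + degree G)) (cis t)) = f (cis t) * g (cis t)" for t
    unfolding Re_completion fun_cong[OF c, symmetric] F G by simp
  then show ?case using Im_completion_0 by blast
qed

lemma powr_add_le:
  fixes a b :: real
  assumes "0 \<le> a" "0 \<le> b" "0 < p"
  shows "(a + b) powr p \<le> 2 powr p * (a powr p + b powr p)"
proof -
  have "(a + b) powr p \<le> (2 * max a b) powr p" using assms by (intro powr_mono2) auto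
  also have "\<dots> = 2 powr p * max a b powr p" using assms by (simp add: powr_mult)
  also have "\<dots> \<le> 2 powr p * (a powr p + b powr p)" by (intro mult_left_mono) (auto simp: max_def)
  finally show ?thesis .
qed

text \<open>The theorem of Riesz in analytic form: the real part on the circle controls the whole
  boundary function. The condition at 0 fixes the additive constant in the conjugate
  function.\<close>

definition riesz_bound :: "real \<Rightarrow> real \<Rightarrow> bool" where
  "riesz_bound p C \<longleftrightarrow> 0 < C \<and> (\<forall>F. Im (poly F 0) = 0 \<longrightarrow>
     pint (\<lambda>t. norm (poly F (cis t)) powr p) \<le> C * pint (\<lambda>t. \<bar>Re (poly F (cis t))\<bar> powr p))"

text \<open>A real trigonometric polynomial \<open>u\<close> is half the difference of \<open>v + u\<close> and \<open>v - u\<close>, both positive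
  when \<open>v\<close> is a polynomial slightly above \<open>|u|\<close>.\<close>

lemma riesz_bound_le_2:
  assumes p: "1 < p" "p \<le> 2"
  shows "\<exists>C. riesz_bound p C"
proof -
  obtain A where A: "0 < A" "\<And>F. Im (poly F 0) = 0 \<Longrightarrow> (\<And>t. 0 < Re (poly F (cis t))) \<Longrightarrow>
    pint (\<lambda>t. norm (poly F (cis t)) powr p) \<le> A * pint (\<lambda>t. Re (poly F (cis t)) powr p)"
    using riesz_positive[OF p] by blast
  define C where "C = 2 * A * 4 powr p"
  have p0: "0 < p" using p by simp
  have "pint (\<lambda>t. norm (poly F (cis t)) powr p) \<le> C * pint (\<lambda>t. \<bar>Re (poly F (cis t))\<bar> powr p)"
    if im: "Im (poly F 0) = 0" for F
  proof -
    define u where "u = (\<lambda>t. Re (poly F (cis t)))"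
    have cu: "continuous_on S (\<lambda>t. \<bar>u t\<bar> powr p)" for S
    proof -
      have "continuous_on S (\<lambda>t. norm (complex_of_real (u t)) powr p)" unfolding u_def
        by (intro continuous_on_norm_powr continuous_intros p0)
      then show ?thesis by simp
    qed
    have eps: "pint (\<lambda>t. norm (poly F (cis t)) powr p) \<le> C * pint (\<lambda>t. \<bar>u t\<bar> powr p) + C * (2 * pi) * \<epsilon> powr p" if \<epsilon>: "0 < \<epsilon>" for \<epsilon>
    proof -
      \<comment> \<open>Approximating \<open>\<bar>u\<bar> + \<epsilon>\<close> with error below
        \<epsilon> places the approximant strictly between \<open>\<bar>u\<bar>\<close> and
        \<open>\<bar>u\<bar> + 2 * \<epsilon>\<close>, which makes both combinations
        positive.\<close>
      have "continuous_on (sphere 0 1) (\<lambda>z. \<bar>Re (poly F z)\<bar> + \<epsilon>)" by (intro continuous_intros)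
      then obtain g where g: "real_polynomial_function g" "\<And>z. z \<in> sphere 0 1 \<Longrightarrow> \<bar>(\<bar>Re (poly F z)\<bar> + \<epsilon>) - g z\<bar> < \<epsilon>"
        using Stone_Weierstrass_real_polynomial_function[of "sphere (0::complex) 1" _ \<epsilon>] \<epsilon> by (metis compact_sphere)
      obtain G where G: "Im (poly G 0) = 0" "\<And>t. Re (poly G (cis t)) = g (cis t)"
        using real_polynomial_function_circle[OF g(1)] by blast
      have gb: "\<bar>u t\<bar> < g (cis t)" "g (cis t) < \<bar>u t\<bar> + 2 * \<epsilon>" for t
        using g(2)[of "cis t"] by (auto simp: u_def abs_if split: if_splits)
      define F1 where "F1 = G + F"
      define F2 where "F2 = G - F"
      have pos: "0 < Re (poly F1 (cis t))" "0 < Re (poly F2 (cis t))" for t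
        using gb(1)[of t] by (auto simp: F1_def F2_def G u_def)
      have le: "Re (poly F1 (cis t)) powr p \<le> 4 powr p * (\<bar>u t\<bar> powr p + \<epsilon> powr p)"
        "Re (poly F2 (cis t)) powr p \<le> 4 powr p * (\<bar>u t\<bar> powr p + \<epsilon> powr p)" for t
      proof -
        have r: "(2 * (\<bar>u t\<bar> + \<epsilon>)) powr p \<le> 4 powr p * (\<bar>u t\<bar> powr p + \<epsilon> powr p)"
        proof -
          have "(2 * (\<bar>u t\<bar> + \<epsilon>)) powr p = 2 powr p * (\<bar>u t\<bar> + \<epsilon>) powr p" using \<epsilon> by (subst powr_mult) auto
          also have "\<dots> \<le> 2 powr p * (2 powr p * (\<bar>u t\<bar> powr p + \<epsilon> powr p))"
            using \<epsilon> p0 by (intro mult_left_mono powr_add_le) auto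
          also have "\<dots> = (2 * 2) powr p * (\<bar>u t\<bar> powr p + \<epsilon> powr p)" by (subst powr_mult) auto
          finally show ?thesis by simp
        qed
        have "Re (poly F1 (cis t)) powr p \<le> (2 * (\<bar>u t\<bar> + \<epsilon>)) powr p"
          by (rule powr_mono2) (use gb[of t] pos(1)[of t] p0 in \<open>auto simp: F1_def G u_def\<close>)
        then show "Re (poly F1 (cis t)) powr p \<le> 4 powr p * (\<bar>u t\<bar> powr p + \<epsilon> powr p)" using r by linarith
        have "Re (poly F2 (cis t)) powr p \<le> (2 * (\<bar>u t\<bar> + \<epsilon>)) powr p"
          by (rule powr_mono2) (use gb[of t] pos(2)[of t] p0 in \<open>auto simp: F2_def G u_def\<close>)
        then show "Re (poly F2 (cis t)) powr p \<le> 4 powr p * (\<bar>u t\<bar> powr p + \<epsilon> powr p)" using r by linarith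
      qed
      have half: "pint (\<lambda>t. norm (poly H (cis t)) powr p) \<le> A * (4 powr p * (pint (\<lambda>t. \<bar>u t\<bar> powr p) + 2 * pi * \<epsilon> powr p))"
        if H: "Im (poly H 0) = 0" "\<And>t. 0 < Re (poly H (cis t))" "\<And>t. Re (poly H (cis t)) powr p \<le> 4 powr p * (\<bar>u t\<bar> powr p + \<epsilon> powr p)" for H
      proof -
        have "pint (\<lambda>t. norm (poly H (cis t)) powr p) \<le> A * pint (\<lambda>t. Re (poly H (cis t)) powr p)" by (rule A(2)[OF H(1,2)])
        also have "\<dots> \<le> A * pint (\<lambda>t. 4 powr p * (\<bar>u t\<bar> powr p + \<epsilon> powr p))"
        proof (intro mult_left_mono pint_le H(3))
          show "continuous_on UNIV (\<lambda>t. Re (poly H (cis t)) powr p)"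
            by (intro continuous_on_powr' continuous_intros) (use p H(2) in \<open>auto intro: less_imp_le\<close>)
          show "continuous_on UNIV (\<lambda>t. 4 powr p * (\<bar>u t\<bar> powr p + \<epsilon> powr p))" by (intro continuous_on_mult_left continuous_on_add cu continuous_on_const)
        qed (use A in auto)
        also have "pint (\<lambda>t. 4 powr p * (\<bar>u t\<bar> powr p + \<epsilon> powr p)) = 4 powr p * (pint (\<lambda>t. \<bar>u t\<bar> powr p) + 2 * pi * \<epsilon> powr p)"
          unfolding Henstock_Kurzweil_Integration.integral_mult_right by (subst pint_add[OF cu continuous_on_const]) simp
        finally show ?thesis .
      qed
      have "pint (\<lambda>t. norm (poly F (cis t)) powr p) \<le> pint (\<lambda>t. norm (poly F1 (cis t)) powr p + norm (poly F2 (cis t)) powr p)"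
      proof (intro pint_le continuous_on_add continuous_on_norm_powr p0)
        fix t
        have "norm (2 * poly F (cis t)) \<le> norm (poly F1 (cis t)) + norm (poly F2 (cis t))"
          using norm_triangle_ineq4[of "poly F1 (cis t)" "poly F2 (cis t)"] by (simp add: F1_def F2_def)
        then have "2 * norm (poly F (cis t)) \<le> norm (poly F1 (cis t)) + norm (poly F2 (cis t))"
          by (simp add: norm_mult)
        then have "norm (poly F (cis t)) \<le> max (norm (poly F1 (cis t))) (norm (poly F2 (cis t)))" by arith
        then have "norm (poly F (cis t)) powr p \<le> max (norm (poly F1 (cis t))) (norm (poly F2 (cis t))) powr p"
          using p0 by (intro powr_mono2) auto
        also have "\<dots> \<le> norm (poly F1 (cis t)) powr p + norm (poly F2 (cis t)) powr p" by (auto simp: max_def)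
        finally show "norm (poly F (cis t)) powr p \<le> norm (poly F1 (cis t)) powr p + norm (poly F2 (cis t)) powr p" .
      qed (intro continuous_intros)+
      also have "\<dots> = pint (\<lambda>t. norm (poly F1 (cis t)) powr p) + pint (\<lambda>t. norm (poly F2 (cis t)) powr p)"
        by (intro pint_add continuous_on_norm_powr continuous_intros p0)
      also have "\<dots> \<le> A * (4 powr p * (pint (\<lambda>t. \<bar>u t\<bar> powr p) + 2 * pi * \<epsilon> powr p)) + A * (4 powr p * (pint (\<lambda>t. \<bar>u t\<bar> powr p) + 2 * pi * \<epsilon> powr p))"
        by (intro add_mono half pos le) (auto simp: F1_def F2_def im G)
      finally show ?thesis by (simp add: C_def algebra_simps)
    qed
    \<comment> \<open>The constants do not depend on the degree of the approximant, so the error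
      term disappears in the limit.\<close>
    have "((\<lambda>\<epsilon>. C * pint (\<lambda>t. \<bar>u t\<bar> powr p) + C * (2 * pi) * \<epsilon> powr p) \<longlongrightarrow> C * pint (\<lambda>t. \<bar>u t\<bar> powr p) + C * (2 * pi) * 0 powr p) (at_right 0)"
      by (intro tendsto_intros tendsto_powr') (use p0 in \<open>auto simp: eventually_at_filter\<close>)
    then have "((\<lambda>\<epsilon>. C * pint (\<lambda>t. \<bar>u t\<bar> powr p) + C * (2 * pi) * \<epsilon> powr p) \<longlongrightarrow> C * pint (\<lambda>t. \<bar>u t\<bar> powr p)) (at_right 0)"
      using p0 by simp
    then have "pint (\<lambda>t. norm (poly F (cis t)) powr p) \<le> C * pint (\<lambda>t. \<bar>u t\<bar> powr p)"
      by (rule tendsto_lowerbound) (use eps in \<open>auto simp: eventually_at_filter\<close>)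
    then show ?thesis by (simp add: u_def)
  qed
  moreover have "0 < C" using A by (simp add: C_def)
  ultimately show ?thesis unfolding riesz_bound_def by blast
qed

text \<open>Jensen's inequality up to a constant. The pointwise bound
  \<open>x \<le> s / 2 + (s / 2) powr (1 - q) * x powr q\<close> distinguishes whether
  \<open>x\<close> exceeds \<open>s / 2\<close>; after integration the first term uses up only half
  of the assumed mean.\<close>

lemma mean_powr_le:
  fixes u :: "real \<Rightarrow> complex"
  assumes q: "1 \<le> q" and s: "0 \<le> s" "2 * pi * s \<le> pint (\<lambda>t. norm (u t))" and cu: "continuous_on UNIV u"
  shows "s powr q \<le> 2 powr q * pint (\<lambda>t. norm (u t) powr q)"
proof (cases "s = 0")
  case True
  have "0 \<le> pint (\<lambda>t. norm (u t) powr q)" using q by (intro pint_nonneg continuous_on_norm_powr cu) auto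
  then show ?thesis using True q by simp
next
  case False
  then have s0: "0 < s / 2" using s by simp
  have ptw: "x \<le> s / 2 + (s / 2) powr (1 - q) * x powr q" if "0 \<le> x" for x
  proof (cases "x \<le> s / 2")
    case True
    then show ?thesis by (simp add: add_increasing2)
  next
    case False
    then have x: "0 < x" "s / 2 \<le> x" using s0 by auto
    have "x = x powr (1 - q) * x powr q" using x by (simp flip: powr_add)
    also have "\<dots> \<le> (s / 2) powr (1 - q) * x powr q" using x s0 q by (intro mult_right_mono powr_mono2') auto
    finally show ?thesis using s0 by linarith
  qed
  have "pint (\<lambda>t. norm (u t)) \<le> pint (\<lambda>t. s / 2 + (s / 2) powr (1 - q) * norm (u t) powr q)"
    using q by (intro pint_le ptw continuous_intros continuous_on_norm_powr cu) auto
  also have "\<dots> = pi * s + (s / 2) powr (1 - q) * pint (\<lambda>t. norm (u t) powr q)"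
    using q by (subst pint_add) (auto intro!: continuous_on_mult_left continuous_on_norm_powr cu)
  finally have "pi * s \<le> (s / 2) powr (1 - q) * pint (\<lambda>t. norm (u t) powr q)" using s(2) by linarith
  then have "1 * s \<le> (s / 2) powr (1 - q) * pint (\<lambda>t. norm (u t) powr q)"
    using s pi_ge_two mult_right_mono[of 1 pi s] by linarith
  then have "(s / 2) powr (q - 1) * s \<le> (s / 2) powr (q - 1) * ((s / 2) powr (1 - q) * pint (\<lambda>t. norm (u t) powr q))"
    by (intro mult_left_mono) auto
  also have "\<dots> = ((s / 2) powr (q - 1) * (s / 2) powr (1 - q)) * pint (\<lambda>t. norm (u t) powr q)" by simp
  also have "(s / 2) powr (q - 1) * (s / 2) powr (1 - q) = 1" using s0 by (simp flip: powr_add)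
  finally have "(s / 2) powr (q - 1) * s \<le> pint (\<lambda>t. norm (u t) powr q)" by simp
  moreover have "(s / 2) powr q \<le> (s / 2) powr (q - 1) * s"
  proof -
    have "(s / 2) powr q = (s / 2) powr (q - 1) * (s / 2)" using s0 by (simp add: powr_mult_base' flip: powr_add) (simp add: powr_diff)
    then show ?thesis using powr_ge_zero[of "s / 2" q] by linarith
  qed
  ultimately have "(s / 2) powr q \<le> pint (\<lambda>t. norm (u t) powr q)" by linarith
  then show ?thesis using s by (simp add: powr_divide field_simps)
qed

lemma power2_powr: "0 \<le> x \<Longrightarrow> (x ^ 2) powr p = x powr (2 * p)" for x :: real
  by (simp add: powr_powr flip: powr_numeral)

text \<open>Cotlar's identity: for \<open>F = u + iv\<close> the real part of \<open>-iF\<^sup>2\<close> is \<open>2uv\<close>.\<close>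

lemma riesz_bound_double:
  assumes C: "riesz_bound p C" and p: "1 < p"
  shows "\<exists>C'. riesz_bound (2 * p) C'"
proof -
  have p0: "0 < p" "0 < 2 * p" using p by auto
  have C0: "0 < C" using C by (simp add: riesz_bound_def)
  \<comment> \<open>With this value the integral of the boundary function reappears on the right
    with coefficient exactly 1/2 and can be absorbed.\<close>
  define \<delta> where "\<delta> = 1 / (2 powr p * C * 2 powr p)"
  have \<delta>: "0 < \<delta>" using C0 by (simp add: \<delta>_def)
  define C' where "C' = 2 * (2 powr p * C * 2 powr p * (1 / (2 * \<delta>)) + 2 powr p * (2 * pi) * 2 powr (2 * p)) + 1"
  have "pint (\<lambda>t. norm (poly F (cis t)) powr (2 * p)) \<le> C' * pint (\<lambda>t. \<bar>Re (poly F (cis t))\<bar> powr (2 * p))"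
    if im: "Im (poly F 0) = 0" for F
  proof -
    define f where "f = (\<lambda>t. poly F (cis t))"
    define u where "u = (\<lambda>t. Re (f t))"
    define a where "a = Re (poly F 0)"
    have F0: "poly F 0 = of_real a" using im by (simp add: a_def complex_eq_iff)
    have cf: "continuous_on S f" for S unfolding f_def by (intro continuous_intros)
    have cu: "continuous_on S (\<lambda>t. complex_of_real (u t))" for S unfolding u_def by (intro continuous_intros cf)
    have cuq: "continuous_on S (\<lambda>t. \<bar>u t\<bar> powr q)" if "0 < q" for S q
      using continuous_on_norm_powr[OF cu that] by simp
    \<comment> \<open>Subtracting the square of \<open>a\<close> makes \<open>G\<close> vanish at 0,
      as the bound for exponent \<open>p\<close> demands. The correction is purely imaginary on the
      circle, so the real part is still twice the product of u and v.\<close>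
    define G where "G = smult (- \<i>) (F * F - [:of_real a ^ 2:])"
    have G: "poly G z = - \<i> * (poly F z ^ 2 - of_real a ^ 2)" for z by (simp add: G_def power2_eq_square)
    have "Im (poly G 0) = 0" unfolding G F0 by simp
    then have "pint (\<lambda>t. norm (poly G (cis t)) powr p) \<le> C * pint (\<lambda>t. \<bar>Re (poly G (cis t))\<bar> powr p)"
      using C unfolding riesz_bound_def by blast
    also have "\<dots> \<le> C * pint (\<lambda>t. 2 powr p * (\<delta> / 2 * norm (f t) powr (2 * p) + 1 / (2 * \<delta>) * \<bar>u t\<bar> powr (2 * p)))"
    proof (intro mult_left_mono pint_le)
      have "continuous_on UNIV (\<lambda>t. norm (complex_of_real (Re (poly G (cis t)))) powr p)"
        by (intro continuous_on_norm_powr continuous_intros p0)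
      then show "continuous_on UNIV (\<lambda>t. \<bar>Re (poly G (cis t))\<bar> powr p)" by simp
      show "continuous_on UNIV (\<lambda>t. 2 powr p * (\<delta> / 2 * norm (f t) powr (2 * p) + 1 / (2 * \<delta>) * \<bar>u t\<bar> powr (2 * p)))"
        by (intro continuous_on_mult_left continuous_on_add continuous_on_norm_powr cf cuq p0)
      fix t
      have "Re (poly G (cis t)) = 2 * u t * Im (f t)" unfolding G u_def f_def by (simp add: power2_eq_square)
      then have "\<bar>Re (poly G (cis t))\<bar> = 2 * (\<bar>u t\<bar> * \<bar>Im (f t)\<bar>)" by (simp add: abs_mult)
      also have "\<dots> \<le> 2 * (\<bar>u t\<bar> * norm (f t))" by (intro mult_left_mono abs_Im_le_cmod) auto
      finally have "\<bar>Re (poly G (cis t))\<bar> powr p \<le> (2 * (\<bar>u t\<bar> * norm (f t))) powr p" using p0 by (intro powr_mono2) auto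
      also have "\<dots> = 2 powr p * (\<bar>u t\<bar> powr p * norm (f t) powr p)" by (simp add: powr_mult)
      also have "\<dots> \<le> 2 powr p * (\<delta> / 2 * norm (f t) powr (2 * p) + 1 / (2 * \<delta>) * \<bar>u t\<bar> powr (2 * p))"
      proof (intro mult_left_mono)
        define x where "x = \<bar>u t\<bar> powr p"
        define y where "y = norm (f t) powr p"
        have "0 \<le> (\<delta> * y - x) ^ 2" by simp
        then have "2 * \<delta> * (x * y) \<le> \<delta> ^ 2 * y ^ 2 + x ^ 2" by (simp add: power2_eq_square algebra_simps)
        then have "x * y \<le> \<delta> / 2 * y ^ 2 + 1 / (2 * \<delta>) * x ^ 2" using \<delta> by (simp add: field_simps power2_eq_square)
        moreover have "y ^ 2 = norm (f t) powr (2 * p)" "x ^ 2 = \<bar>u t\<bar> powr (2 * p)"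
          unfolding x_def y_def power2_eq_square by (simp_all flip: powr_add)
        ultimately show "\<bar>u t\<bar> powr p * norm (f t) powr p \<le> \<delta> / 2 * norm (f t) powr (2 * p) + 1 / (2 * \<delta>) * \<bar>u t\<bar> powr (2 * p)"
          by (simp add: x_def y_def)
      qed simp
      finally show "\<bar>Re (poly G (cis t))\<bar> powr p \<le> 2 powr p * (\<delta> / 2 * norm (f t) powr (2 * p) + 1 / (2 * \<delta>) * \<bar>u t\<bar> powr (2 * p))" .
    qed (use C0 in auto)
    also have "pint (\<lambda>t. 2 powr p * (\<delta> / 2 * norm (f t) powr (2 * p) + 1 / (2 * \<delta>) * \<bar>u t\<bar> powr (2 * p)))
        = 2 powr p * (\<delta> / 2 * pint (\<lambda>t. norm (f t) powr (2 * p)) + 1 / (2 * \<delta>) * pint (\<lambda>t. \<bar>u t\<bar> powr (2 * p)))"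
      by (simp only: Henstock_Kurzweil_Integration.integral_mult_right, subst pint_add)
         (intro continuous_on_mult_left continuous_on_norm_powr cf cuq p0, intro continuous_on_mult_left continuous_on_norm_powr cf cuq p0,
          simp only: Henstock_Kurzweil_Integration.integral_mult_right)
    finally have GI: "pint (\<lambda>t. norm (poly G (cis t)) powr p) \<le>
       C * (2 powr p * (\<delta> / 2 * pint (\<lambda>t. norm (f t) powr (2 * p)) + 1 / (2 * \<delta>) * pint (\<lambda>t. \<bar>u t\<bar> powr (2 * p))))" .
    \<comment> \<open>The subtracted constant has to be added back. It is the mean of
      \<open>u\<close>, hence controlled by the integral of the power of \<open>u\<close>.\<close>
    have mean: "2 * pi * \<bar>a\<bar> \<le> pint (\<lambda>t. norm (complex_of_real (u t)))"
    proof -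
      have "pint f = 2 * complex_of_real pi * poly F 0" unfolding f_def
        by (rule mean_value_circle) (auto intro!: continuous_intros holomorphic_intros)
      then have "Re (pint f) = 2 * pi * a" by (simp add: F0)
      moreover have "Re (pint f) = pint u"
        using integral_linear[OF integrable_continuous_real[OF cf] bounded_linear_Re] by (simp add: o_def u_def[abs_def])
      ultimately have "norm (pint u) = 2 * pi * \<bar>a\<bar>" by (simp add: abs_mult)
      moreover have "norm (pint u) \<le> pint (\<lambda>t. norm (complex_of_real (u t)))"
        unfolding u_def by (intro pint_norm_le continuous_intros cf) auto
      ultimately show ?thesis by simp
    qed
    have aI: "\<bar>a\<bar> powr (2 * p) \<le> 2 powr (2 * p) * pint (\<lambda>t. \<bar>u t\<bar> powr (2 * p))"
      using mean_powr_le[of "2 * p" "\<bar>a\<bar>" "\<lambda>t. complex_of_real (u t)", OF _ _ mean cu] p by simp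
    have "pint (\<lambda>t. norm (f t) powr (2 * p)) \<le> pint (\<lambda>t. 2 powr p * (norm (poly G (cis t)) powr p + \<bar>a\<bar> powr (2 * p)))"
    proof (intro pint_le continuous_on_mult_left continuous_on_add continuous_on_norm_powr cf p0 continuous_on_const)
      fix t
      have "norm (f t) powr (2 * p) = (norm (f t) ^ 2) powr p" by (simp add: powr_powr flip: powr_numeral)
      also have "norm (f t) ^ 2 = norm ((f t ^ 2 - of_real a ^ 2) + of_real a ^ 2)" by (simp add: norm_power)
      also have "\<dots> powr p \<le> (norm (f t ^ 2 - of_real a ^ 2) + norm (complex_of_real a ^ 2)) powr p"
        using p0 by (intro powr_mono2 norm_triangle_ineq) auto
      also have "\<dots> \<le> 2 powr p * (norm (f t ^ 2 - of_real a ^ 2) powr p + norm (complex_of_real a ^ 2) powr p)"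
        using p0 by (intro powr_add_le) auto
      also have "norm (f t ^ 2 - of_real a ^ 2) = norm (poly G (cis t))" by (simp add: G f_def norm_mult)
      also have "norm (complex_of_real a ^ 2) powr p = \<bar>a\<bar> powr (2 * p)"
        unfolding norm_power norm_of_real by (rule power2_powr) simp
      finally show "norm (f t) powr (2 * p) \<le> 2 powr p * (norm (poly G (cis t)) powr p + \<bar>a\<bar> powr (2 * p))" .
    qed (intro continuous_intros)
    also have "\<dots> = 2 powr p * (pint (\<lambda>t. norm (poly G (cis t)) powr p) + 2 * pi * \<bar>a\<bar> powr (2 * p))"
      unfolding Henstock_Kurzweil_Integration.integral_mult_right
      by (subst pint_add) (auto intro!: continuous_on_norm_powr continuous_intros p0)
    also have "\<dots> \<le> 2 powr p * (C * (2 powr p * (\<delta> / 2 * pint (\<lambda>t. norm (f t) powr (2 * p)) + 1 / (2 * \<delta>) * pint (\<lambda>t. \<bar>u t\<bar> powr (2 * p))))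
        + 2 * pi * (2 powr (2 * p) * pint (\<lambda>t. \<bar>u t\<bar> powr (2 * p))))"
      by (intro mult_left_mono add_mono GI aI) auto
    also have "\<dots> = (2 powr p * C * 2 powr p * \<delta>) / 2 * pint (\<lambda>t. norm (f t) powr (2 * p)) + (C' - 1) / 2 * pint (\<lambda>t. \<bar>u t\<bar> powr (2 * p))"
      by (simp add: C'_def algebra_simps add_divide_distrib)
    also have "2 powr p * C * 2 powr p * \<delta> = 1" using C0 by (simp add: \<delta>_def)
    finally have "pint (\<lambda>t. norm (f t) powr (2 * p)) \<le> (C' - 1) * pint (\<lambda>t. \<bar>u t\<bar> powr (2 * p))" by simp
    also have "\<dots> \<le> C' * pint (\<lambda>t. \<bar>u t\<bar> powr (2 * p))" by (intro mult_right_mono pint_nonneg cuq p0) auto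
    finally show ?thesis by (simp add: f_def u_def)
  qed
  moreover have "0 < C'" using C0 \<delta> unfolding C'_def by (intro add_nonneg_pos) auto
  ultimately show ?thesis unfolding riesz_bound_def by blast
qed

text \<open>An exponent above 2 is halved, which keeps it above 1, until it lies in the range
  treated directly; doubling then leads back up.\<close>

lemma riesz_bound_exists:
  assumes "1 < p"
  shows "\<exists>C. riesz_bound p C"
proof -
  have "1 < p \<Longrightarrow> p \<le> 2 ^ Suc n \<Longrightarrow> \<exists>C. riesz_bound p C" for n p
  proof (induction n arbitrary: p)
    case 0
    then show ?case using riesz_bound_le_2 by simp
  next
    case (Suc n)
    show ?case
    proof (cases "p \<le> 2")
      case True
      then show ?thesis using riesz_bound_le_2 Suc by blast
    next
      case False
      then obtain C where "riesz_bound (p / 2) C" using Suc.IH[of "p / 2"] Suc.prems by auto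
      from riesz_bound_double[OF this] show ?thesis using False by auto
    qed
  qed
  moreover obtain n where "p < 2 ^ n" using real_arch_pow[of 2 p] by auto
  then have "p \<le> 2 ^ Suc n" using assms by simp
  ultimately show ?thesis using assms by blast
qed

section \<open>Projections onto half lines of frequencies\<close>

lemma powr_le_sum3:
  fixes x a b c :: real
  assumes "0 < p" "0 \<le> x" "0 \<le> a" "0 \<le> b" "0 \<le> c" "x \<le> K * max a (max b c)" "0 \<le> K"
  shows "x powr p \<le> K powr p * (a powr p + b powr p + c powr p)"
proof -
  have "x powr p \<le> (K * max a (max b c)) powr p" using assms by (intro powr_mono2) auto
  also have "\<dots> = K powr p * max a (max b c) powr p" using assms by (subst powr_mult) auto
  also have "\<dots> \<le> K powr p * (a powr p + b powr p + c powr p)"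
    by (intro mult_left_mono) (auto simp: max_def)
  finally show ?thesis .
qed

text \<open>The completions \<open>F\<close> and \<open>G\<close> belong to the real and the
  imaginary part of the given polynomial. In \<open>F + \<i> * G\<close> the conjugated negative
  frequencies cancel and the positive ones double, so that
  \<open>2 * h = c 0 + (F + \<i> * G)\<close> on the circle; the constant term is handled by
  \<open>mean_powr_le\<close>.\<close>

lemma riesz_projection_nonneg:
  assumes p: "1 < p"
  shows "\<exists>C>0. \<forall>N. \<forall>c::int \<Rightarrow> complex. pint (\<lambda>t. norm (\<Sum>k\<in>{0..int N}. c k * cis (of_int k * t)) powr p)
    \<le> C * pint (\<lambda>t. norm (\<Sum>k\<in>{-int N..int N}. c k * cis (of_int k * t)) powr p)"
proof -
  obtain R where R: "riesz_bound p R" using riesz_bound_exists[OF p] by blast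
  have p0: "0 < p" using p by simp
  have R0: "0 < R" using R by (simp add: riesz_bound_def)
  define C where "C = 2 powr p * (R + R + 2 * pi * 2 powr p)"
  have "pint (\<lambda>t. norm (\<Sum>k\<in>{0..int N}. c k * cis (of_int k * t)) powr p)
    \<le> C * pint (\<lambda>t. norm (\<Sum>k\<in>{-int N..int N}. c k * cis (of_int k * t)) powr p)" for N and c :: "int \<Rightarrow> complex"
  proof -
    define g where "g = (\<lambda>t. \<Sum>k\<in>{-int N..int N}. c k * cis (of_int k * t))"
    define h where "h = (\<lambda>t. \<Sum>k\<in>{0..int N}. c k * cis (of_int k * t))"
    have cg: "continuous_on S g" and ch: "continuous_on S h" for S
      unfolding g_def h_def by (intro continuous_intros)+
    define d where "d = (\<lambda>k. - \<i> * c k)"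
    define F where "F = completion c N"
    define G where "G = completion d N"
    have Re: "Re (poly F (cis t)) = Re (g t)" "Re (poly G (cis t)) = Im (g t)" for t
    proof -
      show "Re (poly F (cis t)) = Re (g t)" unfolding F_def g_def by (rule Re_completion)
      have "(\<Sum>k\<in>{-int N..int N}. d k * cis (of_int k * t)) = - \<i> * g t"
        unfolding g_def d_def by (simp add: sum_distrib_left mult.assoc)
      then show "Re (poly G (cis t)) = Im (g t)" unfolding G_def Re_completion by simp
    qed
    have I: "pint (\<lambda>t. norm (poly H (cis t)) powr p) \<le> R * pint (\<lambda>t. norm (g t) powr p)"
      if H: "Im (poly H 0) = 0" "\<And>t. \<bar>Re (poly H (cis t))\<bar> \<le> norm (g t)" for H
    proof -
      have "pint (\<lambda>t. norm (poly H (cis t)) powr p) \<le> R * pint (\<lambda>t. \<bar>Re (poly H (cis t))\<bar> powr p)"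
        using R H(1) unfolding riesz_bound_def by blast
      also have "\<dots> \<le> R * pint (\<lambda>t. norm (g t) powr p)"
      proof (intro mult_left_mono pint_le powr_mono2 H(2) continuous_on_norm_powr cg p0)
        have "continuous_on UNIV (\<lambda>t. norm (complex_of_real (Re (poly H (cis t)))) powr p)"
          by (intro continuous_on_norm_powr continuous_intros p0)
        then show "continuous_on UNIV (\<lambda>t. \<bar>Re (poly H (cis t))\<bar> powr p)" by simp
      qed (use R0 p0 in auto)
      finally show ?thesis .
    qed
    have c0: "2 * pi * norm (c 0) \<le> pint (\<lambda>t. norm (g t))" by (rule tp_coeff_bound[OF _ g_def]) simp
    have "1 \<le> p" using p by simp
    from mean_powr_le[OF this norm_ge_zero c0 cg]
    have cp: "norm (c 0) powr p \<le> 2 powr p * pint (\<lambda>t. norm (g t) powr p)" .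
    have dec: "2 * h t = c 0 + (poly F (cis t) + \<i> * poly G (cis t))" for t
    proof -
      have "{0..int N} = insert 0 (int ` {1..N})"
        unfolding image_int_atLeastAtMost by auto
      then have "h t = c 0 + (\<Sum>k\<in>int ` {1..N}. c k * cis (of_int k * t))" unfolding h_def by (simp only:) (subst sum.insert, auto)
      also have "(\<Sum>k\<in>int ` {1..N}. c k * cis (of_int k * t)) = (\<Sum>k=1..N. c (int k) * cis t ^ k)"
        by (subst sum.reindex) (auto simp: Complex.DeMoivre o_def)
      finally have h: "h t = c 0 + (\<Sum>k=1..N. c (int k) * cis t ^ k)" .
      have "poly F (cis t) + \<i> * poly G (cis t) = (of_real (Re (c 0)) + \<i> * of_real (Im (c 0))) +
        (\<Sum>k=1..N. (c (int k) + cnj (c (- int k))) * cis t ^ k + \<i> * ((d (int k) + cnj (d (- int k))) * cis t ^ k))"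
      proof -
        have "Re (d 0) = Im (c 0)" by (simp add: d_def)
        then show ?thesis unfolding F_def G_def poly_completion
          by (simp only: sum.distrib sum_distrib_left distrib_left add_ac)
      qed
      also have "of_real (Re (c 0)) + \<i> * of_real (Im (c 0)) = c 0" by (simp add: complex_eq_iff)
      also have "(\<Sum>k=1..N. (c (int k) + cnj (c (- int k))) * cis t ^ k + \<i> * ((d (int k) + cnj (d (- int k))) * cis t ^ k))
        = (\<Sum>k=1..N. 2 * (c (int k) * cis t ^ k))"
        by (intro sum.cong refl) (simp add: d_def algebra_simps)
      finally show ?thesis unfolding h by (simp add: sum_distrib_left)
    qed
    have "norm (h t) powr p \<le> 2 powr p * (norm (poly F (cis t)) powr p + norm (poly G (cis t)) powr p + norm (c 0) powr p)" for t
    proof (rule powr_le_sum3[OF p0])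
      have "norm (2 * h t) \<le> norm (c 0) + (norm (poly F (cis t)) + norm (\<i> * poly G (cis t)))"
        unfolding dec by (intro norm_triangle_le add_left_mono norm_triangle_ineq)
      then have "2 * norm (h t) \<le> norm (c 0) + norm (poly F (cis t)) + norm (poly G (cis t))" by (simp add: norm_mult)
      then show "norm (h t) \<le> 2 * max (norm (poly F (cis t))) (max (norm (poly G (cis t))) (norm (c 0)))"
        using norm_ge_zero[of "c 0"] norm_ge_zero[of "h t"] by (smt (verit))
    qed auto
    then have "pint (\<lambda>t. norm (h t) powr p) \<le> pint (\<lambda>t. 2 powr p * (norm (poly F (cis t)) powr p + norm (poly G (cis t)) powr p + norm (c 0) powr p))"
      by (intro pint_le continuous_on_mult_left continuous_on_add continuous_on_norm_powr ch p0 continuous_on_const) (auto intro!: continuous_intros)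
    also have "\<dots> = 2 powr p * (pint (\<lambda>t. norm (poly F (cis t)) powr p) + pint (\<lambda>t. norm (poly G (cis t)) powr p) + 2 * pi * norm (c 0) powr p)"
      unfolding Henstock_Kurzweil_Integration.integral_mult_right
      by (subst pint_add, (intro continuous_on_add continuous_on_norm_powr continuous_intros p0)+,
          subst pint_add, (intro continuous_on_norm_powr continuous_intros p0)+) simp
    also have "\<dots> \<le> 2 powr p * (R * pint (\<lambda>t. norm (g t) powr p) + R * pint (\<lambda>t. norm (g t) powr p) + 2 * pi * (2 powr p * pint (\<lambda>t. norm (g t) powr p)))"
    proof (intro mult_left_mono add_mono I cp)
      show "Im (poly F 0) = 0" "Im (poly G 0) = 0" unfolding F_def G_def by (rule Im_completion_0)+
      show "\<bar>Re (poly F (cis t))\<bar> \<le> norm (g t)" "\<bar>Re (poly G (cis t))\<bar> \<le> norm (g t)" for t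
        unfolding Re by (rule abs_Re_le_cmod abs_Im_le_cmod)+
    qed auto
    also have "\<dots> = C * pint (\<lambda>t. norm (g t) powr p)" by (simp add: C_def algebra_simps)
    finally show ?thesis by (simp add: g_def h_def)
  qed
  moreover have "0 < C" using R0 unfolding C_def by (intro mult_pos_pos add_pos_pos) auto
  ultimately show ?thesis by blast
qed

text \<open>Modulation by \<open>cis (of_int a * t)\<close> moves the cut from \<open>a\<close> to 0
  and changes no modulus, so the bound is uniform in the position of the cut and in the frequency
  set.\<close>

lemma riesz_projection:
  assumes p: "1 < p"
  shows "\<exists>C>0. \<forall>K a. \<forall>c::int \<Rightarrow> complex. finite K \<longrightarrow>
    pint (\<lambda>t. norm (\<Sum>k\<in>{k\<in>K. a \<le> k}. c k * cis (of_int k * t)) powr p)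
    \<le> C * pint (\<lambda>t. norm (\<Sum>k\<in>K. c k * cis (of_int k * t)) powr p)"
proof -
  obtain C where C: "0 < C" "\<And>N c. pint (\<lambda>t. norm (\<Sum>k\<in>{0..int N}. c k * cis (of_int k * t)) powr p)
    \<le> C * pint (\<lambda>t. norm (\<Sum>k\<in>{-int N..int N}. c k * cis (of_int k * t)) powr p)"
    using riesz_projection_nonneg[OF p] by blast
  have "pint (\<lambda>t. norm (\<Sum>k\<in>{k\<in>K. a \<le> k}. c k * cis (of_int k * t)) powr p)
    \<le> C * pint (\<lambda>t. norm (\<Sum>k\<in>K. c k * cis (of_int k * t)) powr p)"
    if K: "finite K" for K a and c :: "int \<Rightarrow> complex"
  proof -
    define N where "N = nat (Max (insert 0 ((\<lambda>k. \<bar>k - a\<bar>) ` K)))"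
    have N: "\<bar>k - a\<bar> \<le> int N" if "k \<in> K" for k
    proof -
      have "\<bar>k - a\<bar> \<le> Max (insert 0 ((\<lambda>k. \<bar>k - a\<bar>) ` K))" using K that by (intro Max_ge) auto
      then show ?thesis unfolding N_def by linarith
    qed
    define c' where "c' = (\<lambda>k. if k + a \<in> K then c (k + a) else 0)"
    have shift: "(\<Sum>k\<in>A. c k * cis (of_int k * t)) = cis (of_int a * t) * (\<Sum>k\<in>B. c' k * cis (of_int k * t))"
      if A: "A \<subseteq> K" "finite B" "\<And>k. k \<in> A \<Longrightarrow> k - a \<in> B" "\<And>k. k \<in> B \<Longrightarrow> k + a \<in> K \<Longrightarrow> k + a \<in> A" for A B t
    proof -
      have "(\<Sum>k\<in>A. c k * cis (of_int k * t)) = (\<Sum>k\<in>(\<lambda>k. k - a) ` A. c (k + a) * cis (of_int (k + a) * t))"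
        by (subst sum.reindex) (auto simp: inj_on_def)
      also have "\<dots> = (\<Sum>k\<in>(\<lambda>k. k - a) ` A. cis (of_int a * t) * (c' k * cis (of_int k * t)))"
      proof (intro sum.cong refl)
        fix k assume "k \<in> (\<lambda>k. k - a) ` A"
        then have "k + a \<in> K" using A(1) by auto
        moreover have "cis (of_int (k + a) * t) = cis (of_int a * t) * cis (of_int k * t)"
          by (simp add: cis_mult distrib_right add.commute)
        ultimately show "c (k + a) * cis (of_int (k + a) * t) = cis (of_int a * t) * (c' k * cis (of_int k * t))"
          by (simp add: c'_def mult_ac)
      qed
      also have "\<dots> = (\<Sum>k\<in>B. cis (of_int a * t) * (c' k * cis (of_int k * t)))"
      proof (rule sum.mono_neutral_left[OF A(2)])
        show "(\<lambda>k. k - a) ` A \<subseteq> B" using A(3) by auto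
        show "\<forall>k\<in>B - (\<lambda>k. k - a) ` A. cis (of_int a * t) * (c' k * cis (of_int k * t)) = 0"
        proof
          fix k assume k: "k \<in> B - (\<lambda>k. k - a) ` A"
          have "k + a \<notin> A"
          proof
            assume "k + a \<in> A"
            then have "k \<in> (\<lambda>k. k - a) ` A" by (rule image_eqI[rotated]) simp
            then show False using k by simp
          qed
          then have "k + a \<notin> K" using A(4)[of k] k by auto
          then show "cis (of_int a * t) * (c' k * cis (of_int k * t)) = 0" by (simp add: c'_def)
        qed
      qed
      finally show ?thesis by (simp add: sum_distrib_left)
    qed
    have 1: "(\<Sum>k\<in>{k\<in>K. a \<le> k}. c k * cis (of_int k * t)) = cis (of_int a * t) * (\<Sum>k\<in>{0..int N}. c' k * cis (of_int k * t))" for t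
      by (rule shift) (use N in force)+
    have 2: "(\<Sum>k\<in>K. c k * cis (of_int k * t)) = cis (of_int a * t) * (\<Sum>k\<in>{-int N..int N}. c' k * cis (of_int k * t))" for t
      by (rule shift) (use N in \<open>force simp: abs_le_iff\<close>)+
    show ?thesis unfolding 1 2 using C(2)[where c = c' and N = N] by (simp add: norm_mult)
  qed
  with C(1) show ?thesis by blast
qed

section \<open>Bounds for the interpolation operators\<close>

lemma Kpi_0:
  assumes "1 \<le> L"
  shows "Kpi L 0 x = 1"
proof -
  obtain w where w: "kernel_weights L w" using kernel_weights_exists[OF assms] by blast
  have "w 0 0 = 1" by (rule kernel_weightsD(4)[OF w]) simp
  moreover have "w 0 1 = 0" "w 0 (-1) = 0" by (rule kernel_weightsD(5)[OF w, of 0]; simp)+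
  moreover have "{-1..1::int} = {-1, 0, 1}" by auto
  ultimately show ?thesis using kernel_weightsD(1)[OF w, of 0 x] by simp
qed

text \<open>This allows the samples of a polynomial to be read off its interpolant, and is how the
  case \<open>L = 1\<close> is reduced to \<open>L = 2\<close>.\<close>

lemma interp_node:
  assumes L: "2 \<le> L" and v: "v \<in> Uset j"
  shows "interp L j g (node j v) = g (node j v)"
proof -
  have K: "Kpi L j (node j v - node j u) = (if u = v then 1 else 0)" if u: "u \<in> Uset j" for u
  proof -
    have arg: "2 ^ j * (node j v - node j u + 2 * pi * real_of_int k) = 2 * pi * real_of_int (v - u + 2 ^ j * k)" for k :: int
      by (simp add: node_def field_simps)
    have "Kpi L j (node j v - node j u) = complex_of_real (\<Sum>\<^sub>\<infinity>k::int. KL L (2 ^ j * (node j v - node j u + 2 * pi * real_of_int k)))"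
      using L by (simp add: Kpi_def)
    also have "(\<Sum>\<^sub>\<infinity>k::int. KL L (2 ^ j * (node j v - node j u + 2 * pi * real_of_int k))) = (\<Sum>\<^sub>\<infinity>k::int. if v - u + 2 ^ j * k = 0 then 1 else 0)"
      unfolding arg by (intro infsum_cong KL_at_2pi_int) (use L in simp)
    also have "(\<Sum>\<^sub>\<infinity>k::int. if v - u + 2 ^ j * k = 0 then 1 else 0 :: real) = (\<Sum>\<^sub>\<infinity>k\<in>(if u = v then {0::int} else {}). 1)"
    proof (rule infsum_cong_neutral)
      fix k :: int
      have z: "v = u \<and> k = 0" if "v - u + 2 ^ j * k = 0"
      proof -
        have "v - u = 2 ^ j * (- k)" using that by simp
        then have "2 ^ j dvd v - u" by simp
        from Uset_cong_unique[OF v u this] show ?thesis using that by simp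
      qed
      show "(if v - u + 2 ^ j * k = 0 then 1 else 0 :: real) = 0" if "k \<in> UNIV - (if u = v then {0} else {})"
        using z that by auto
      show "(if v - u + 2 ^ j * k = 0 then 1 else 0 :: real) = 1" if "k \<in> UNIV \<inter> (if u = v then {0} else {})"
        using that by (auto split: if_splits)
    qed auto
    finally show ?thesis by auto
  qed
  have "interp L j g (node j v) = (\<Sum>u\<in>Uset j. if u = v then g (node j v) else 0)"
    unfolding interp_eq by (intro sum.cong refl) (simp add: K)
  then show ?thesis using v by simp
qed

text \<open>Aliasing: frequencies congruent modulo \<open>2 ^ j\<close> have equal samples, and the
  representative in \<open>Uset j\<close> is reproduced exactly.\<close>

lemma interp_1_cis:
  assumes u: "u \<in> Uset j" and k: "2 ^ j dvd k - u"
  shows "interp 1 j (\<lambda>t. cis (of_int k * t)) x = cis (of_int u * x)"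
proof -
  obtain m where m: "k = u + 2 ^ j * m" using k by (metis add.commute diff_add_cancel dvd_def)
  have "cis (of_int k * node j v) = cis (of_int u * node j v)" for v
  proof -
    have "of_int k * node j v = of_int u * node j v + 2 * pi * of_int (m * v)"
      by (simp add: m node_def field_simps)
    then show ?thesis using cis_multiple_2pi[of "of_int (m * v)"] by (simp flip: cis_mult)
  qed
  then have "interp 1 j (\<lambda>t. cis (of_int k * t)) x = interp 1 j (\<lambda>t. cis (of_int u * t)) x"
    unfolding interp_eq by simp
  also have "\<dots> = cis (of_int u * x)"
  proof (rule interp_cis_general[OF kernel_weights_1])
    have "(0::int) < 2 ^ (j - 1)" "j \<noteq> 0 \<Longrightarrow> (2::int) ^ j = 2 * 2 ^ (j - 1)"
      by (simp, cases j, auto)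
    then show "\<bar>u\<bar> \<le> 2 ^ j" using u by (auto simp: Uset_def abs_le_iff split: if_splits)
    show "(if l \<in> Uset j then 1 else 0 :: real) = 0" if "2 ^ j dvd l - u" "l \<noteq> u" for l
      using Uset_cong_unique[OF _ u that(1)] that(2) by auto
  qed (use u in auto)
  finally show ?thesis .
qed

text \<open>The polynomial \<open>h = interp 2 j g\<close> has the samples of \<open>g\<close>,
  degree at most \<open>2 ^ j\<close>, and a norm already under control. Interpolating it with
  \<open>L = 1\<close> keeps the middle block of frequencies and moves the two outer blocks by
  \<open>2 * n\<close> in opposite directions into \<open>Uset j\<close>. Each block is a difference
  of at most two of the functions \<open>h\<close>, \<open>P (- n)\<close> and
  \<open>P n\<close>.\<close>

lemma interp_1_bound:
  assumes p: "1 < p"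
  shows "\<exists>C>0. \<forall>j N g. 2 ^ j \<le> N \<longrightarrow> g \<in> tp N \<longrightarrow>
    pint (\<lambda>t. norm (interp 1 j g t) powr p) \<le> C * (real N / 2 ^ j) * pint (\<lambda>t. norm (g t) powr p)"
proof -
  have p0: "0 < p" using p by simp
  obtain C2 where C2: "0 < C2" "\<And>j N g. 2 ^ j \<le> N \<Longrightarrow> g \<in> tp N \<Longrightarrow>
    pint (\<lambda>t. norm (interp 2 j g t) powr p) \<le> C2 * (real N / 2 ^ j) * pint (\<lambda>t. norm (g t) powr p)"
    using interp_bound_large_p[of 2, OF _ p] by blast
  obtain R where R: "0 < R" "\<And>K a c. finite K \<Longrightarrow>
    pint (\<lambda>t. norm (\<Sum>k\<in>{k\<in>K. a \<le> k}. c k * cis (of_int k * t)) powr p)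
    \<le> R * pint (\<lambda>t. norm (\<Sum>k\<in>K. c k * cis (of_int k * t)) powr p)"
    using riesz_projection[OF p] by blast
  \<comment> \<open>The 5 counts the norms in the triangle inequality: two for the left block, two
    for the middle block and one for the right block.\<close>
  define E where "E = 5 powr p * (R + R + 1)"
  have E: "0 < E" using R by (simp add: E_def)
  have one: "pint (\<lambda>t. norm (interp 1 j g t) powr p) \<le> E * pint (\<lambda>t. norm (interp 2 j g t) powr p)" if j: "j \<noteq> 0" for j g
  proof -
    define n :: int where "n = 2 ^ (j - 1)"
    have n: "0 < n" "2 ^ j = 2 * n" using j by (auto simp: n_def simp flip: power_Suc)
    have U: "u \<in> Uset j \<longleftrightarrow> - n \<le> u \<and> u < n" for u using j by (auto simp: Uset_def n_def)
    define h where "h = interp 2 j g"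
    have htp: "h \<in> tp (2 ^ j)" unfolding h_def by (rule interp_tp) simp
    obtain c where h: "h = (\<lambda>x. \<Sum>k\<in>{-int (2^j)..int (2^j)}. c k * cis (real_of_int k * x))"
      using htp unfolding tp_def by (blast elim: tspanE)
    define K where "K = {-(2 * n)..2 * n}"
    have K: "{-int (2^j)..int (2^j)} = K" "finite K" using n by (auto simp: K_def)
    have h: "h = (\<lambda>x. \<Sum>k\<in>K. c k * cis (real_of_int k * x))" using h unfolding K .
    have "h (node j u) = g (node j u)" if "u \<in> Uset j" for u
      unfolding h_def by (rule interp_node) (use that in auto)
    then have "interp 1 j g = interp 1 j h"
      by (intro ext) (simp add: interp_eq cong: sum.cong)
    then have gh: "interp 1 j g t = (\<Sum>k\<in>K. c k * interp 1 j (\<lambda>t. cis (of_int k * t)) t)" for t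
      unfolding h interp_sum by simp
    define P where "P = (\<lambda>a t. \<Sum>k\<in>{k\<in>K. a \<le> k}. c k * cis (of_int k * t))"
    have cP: "continuous_on S (P a)" for S a unfolding P_def by (intro continuous_intros)
    have split: "sum f K = sum f {k\<in>K. k < - n} + (sum f {k\<in>K. -n \<le> k \<and> k < n} + sum f {k\<in>K. n \<le> k})" for f :: "int \<Rightarrow> complex"
    proof -
      have "sum f K = sum f {k\<in>K. k < - n} + sum f {k\<in>K. - n \<le> k}"
        using K(2) by (subst sum.union_disjoint[symmetric]) (auto intro!: sum.cong)
      also have "sum f {k\<in>K. - n \<le> k} = sum f {k\<in>K. -n \<le> k \<and> k < n} + sum f {k\<in>K. n \<le> k}"
        using K(2) n by (subst sum.union_disjoint[symmetric]) (auto intro!: sum.cong)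
      finally show ?thesis .
    qed
    have Pn: "P (- n) t = (\<Sum>k\<in>{k\<in>K. -n \<le> k \<and> k < n}. c k * cis (of_int k * t)) + P n t" for t
      unfolding P_def using K(2) n by (subst sum.union_disjoint[symmetric]) (auto intro!: sum.cong)
    have A: "(\<Sum>k\<in>{k\<in>K. k < - n}. c k * interp 1 j (\<lambda>t. cis (of_int k * t)) t) = cis (of_int (2 * n) * t) * (h t - P (- n) t)" for t
    proof -
      have "(\<Sum>k\<in>{k\<in>K. k < - n}. c k * interp 1 j (\<lambda>t. cis (of_int k * t)) t) = (\<Sum>k\<in>{k\<in>K. k < - n}. cis (of_int (2 * n) * t) * (c k * cis (of_int k * t)))"
      proof (intro sum.cong refl)
        fix k assume k: "k \<in> {k\<in>K. k < - n}"
        have "interp 1 j (\<lambda>t. cis (of_int k * t)) t = cis (of_int (k + 2 * n) * t)"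
        proof (rule interp_1_cis)
          show "k + 2 * n \<in> Uset j" using k unfolding U K_def by auto
          show "2 ^ j dvd k - (k + 2 * n)" using n by simp
        qed
        moreover have "cis (of_int (k + 2 * n) * t) = cis (of_int (2 * n) * t) * cis (of_int k * t)"
          unfolding cis_mult by (simp add: algebra_simps)
        ultimately show "c k * interp 1 j (\<lambda>t. cis (of_int k * t)) t = cis (of_int (2 * n) * t) * (c k * cis (of_int k * t))" by simp
      qed
      moreover have "h t - P (- n) t = (\<Sum>k\<in>{k\<in>K. k < - n}. c k * cis (of_int k * t))"
        unfolding Pn h split[of "\<lambda>k. c k * cis (of_int k * t)"] by (simp add: P_def)
      ultimately show ?thesis by (simp add: sum_distrib_left)
    qed
    have B: "(\<Sum>k\<in>{k\<in>K. n \<le> k}. c k * interp 1 j (\<lambda>t. cis (of_int k * t)) t) = cis (of_int (- (2 * n)) * t) * P n t" for t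
    proof -
      have "(\<Sum>k\<in>{k\<in>K. n \<le> k}. c k * interp 1 j (\<lambda>t. cis (of_int k * t)) t) = (\<Sum>k\<in>{k\<in>K. n \<le> k}. cis (of_int (- (2 * n)) * t) * (c k * cis (of_int k * t)))"
      proof (intro sum.cong refl)
        fix k assume k: "k \<in> {k\<in>K. n \<le> k}"
        have "interp 1 j (\<lambda>t. cis (of_int k * t)) t = cis (of_int (k - 2 * n) * t)"
        proof (rule interp_1_cis)
          show "k - 2 * n \<in> Uset j" using k n unfolding U K_def by auto
          show "2 ^ j dvd k - (k - 2 * n)" using n by simp
        qed
        moreover have "cis (of_int (k - 2 * n) * t) = cis (of_int (- (2 * n)) * t) * cis (of_int k * t)"
          unfolding cis_mult by (simp add: algebra_simps)
        ultimately show "c k * interp 1 j (\<lambda>t. cis (of_int k * t)) t = cis (of_int (- (2 * n)) * t) * (c k * cis (of_int k * t))" by simp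
      qed
      then show ?thesis by (simp add: P_def sum_distrib_left)
    qed
    have M: "(\<Sum>k\<in>{k\<in>K. -n \<le> k \<and> k < n}. c k * interp 1 j (\<lambda>t. cis (of_int k * t)) t) = P (- n) t - P n t" for t
    proof -
      have "interp 1 j (\<lambda>t. cis (of_int k * t)) t = cis (of_int k * t)" if "-n \<le> k \<and> k < n" for k
        by (rule interp_1_cis) (use that U in auto)
      then have "(\<Sum>k\<in>{k\<in>K. -n \<le> k \<and> k < n}. c k * interp 1 j (\<lambda>t. cis (of_int k * t)) t) = (\<Sum>k\<in>{k\<in>K. -n \<le> k \<and> k < n}. c k * cis (of_int k * t))"
        by (intro sum.cong refl arg_cong2[where f = times]) blast
      then show ?thesis unfolding Pn by simp
    qed
    have "norm (interp 1 j g t) powr p \<le> 5 powr p * (norm (P (- n) t) powr p + norm (P n t) powr p + norm (h t) powr p)" for t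
    proof (rule powr_le_sum3[OF p0])
      have "interp 1 j g t = cis (of_int (2 * n) * t) * (h t - P (- n) t) + ((P (- n) t - P n t) + cis (of_int (- (2 * n)) * t) * P n t)"
        unfolding gh split A B M ..
      also have "norm \<dots> \<le> norm (h t - P (- n) t) + (norm (P (- n) t - P n t) + norm (P n t))"
        by (intro norm_triangle_le add_mono) (auto simp: norm_mult)
      also have "\<dots> \<le> (norm (h t) + norm (P (- n) t)) + ((norm (P (- n) t) + norm (P n t)) + norm (P n t))"
        by (intro add_mono norm_triangle_ineq4) auto
      also have "\<dots> \<le> 5 * max (norm (P (- n) t)) (max (norm (P n t)) (norm (h t)))" by linarith
      finally show "norm (interp 1 j g t) \<le> 5 * max (norm (P (- n) t)) (max (norm (P n t)) (norm (h t)))" .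
    qed auto
    then have "pint (\<lambda>t. norm (interp 1 j g t) powr p) \<le> pint (\<lambda>t. 5 powr p * (norm (P (- n) t) powr p + norm (P n t) powr p + norm (h t) powr p))"
      by (intro pint_le continuous_on_mult_left continuous_on_add continuous_on_norm_powr cP p0 tp_continuous[OF htp] tp_continuous[OF interp_tp]) auto
    also have "\<dots> = 5 powr p * (pint (\<lambda>t. norm (P (- n) t) powr p) + pint (\<lambda>t. norm (P n t) powr p) + pint (\<lambda>t. norm (h t) powr p))"
      unfolding Henstock_Kurzweil_Integration.integral_mult_right
      by (subst pint_add, (intro continuous_on_add continuous_on_norm_powr cP tp_continuous[OF htp] p0)+,
          subst pint_add, (intro continuous_on_norm_powr cP p0)+) simp
    also have "\<dots> \<le> 5 powr p * (R * pint (\<lambda>t. norm (h t) powr p) + R * pint (\<lambda>t. norm (h t) powr p) + pint (\<lambda>t. norm (h t) powr p))"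
    proof (intro mult_left_mono add_mono order_refl)
      have "pint (\<lambda>t. norm (P a t) powr p) \<le> R * pint (\<lambda>t. norm (h t) powr p)" for a
        using R(2)[OF K(2), where a = a and c = c] unfolding P_def h .
      then show "pint (\<lambda>t. norm (P (- n) t) powr p) \<le> R * pint (\<lambda>t. norm (h t) powr p)" "pint (\<lambda>t. norm (P n t) powr p) \<le> R * pint (\<lambda>t. norm (h t) powr p)" by blast+
    qed auto
    finally show ?thesis by (simp add: E_def h_def algebra_simps)
  qed
  have "pint (\<lambda>t. norm (interp 1 j g t) powr p) \<le> (E + 1) * C2 * (real N / 2 ^ j) * pint (\<lambda>t. norm (g t) powr p)"
    if N: "2 ^ j \<le> N" and g: "g \<in> tp N" for j N g
  proof -
    let ?I = "pint (\<lambda>t. norm (interp 2 j g t) powr p)"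
    have I0: "0 \<le> ?I" by (intro pint_nonneg continuous_on_norm_powr tp_continuous[OF interp_tp] p0) auto
    have "pint (\<lambda>t. norm (interp 1 j g t) powr p) \<le> (E + 1) * ?I"
    proof (cases "j = 0")
      case True
      have "interp 1 0 g = interp 2 0 g" unfolding interp_eq by (intro ext) (simp add: Kpi_0)
      then show ?thesis using True E I0 by (simp add: algebra_simps)
    next
      case False
      then show ?thesis using one[OF False, of g] I0 by (simp add: algebra_simps)
    qed
    also have "\<dots> \<le> (E + 1) * (C2 * (real N / 2 ^ j) * pint (\<lambda>t. norm (g t) powr p))"
      using E by (intro mult_left_mono C2 N g) auto
    finally show ?thesis by (simp add: mult_ac)
  qed
  moreover have "0 < (E + 1) * C2" using E C2 by simp
  ultimately show ?thesis by blast
qed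

lemma interp_bound_p:
  assumes L: "1 \<le> L" and p: "0 < p" and Lp: "1 < real L * p"
  shows "\<exists>C>0. \<forall>j N g. 2 ^ j \<le> N \<longrightarrow> g \<in> tp N \<longrightarrow>
    pint (\<lambda>t. norm (interp L j g t) powr p) \<le> C * (real N / 2 ^ j) * pint (\<lambda>t. norm (g t) powr p)"
proof (cases "L = 1")
  case True
  then show ?thesis using interp_1_bound Lp by simp
next
  case False
  then have "2 \<le> L" using L by simp
  then show ?thesis using interp_bound_small_p[of L p] interp_bound_large_p[of L p] p Lp
    by (cases "p \<le> 1") auto
qed

lemma eta_bound_p:
  assumes L: "1 \<le> L" and p: "0 < p" and Lp: "1 < real L * p"
  shows "\<exists>C>0. \<forall>j N g. 2 ^ j \<le> N \<longrightarrow> g \<in> tp N \<longrightarrow>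
    pint (\<lambda>t. norm (eta L j g t) powr p) \<le> C * (real N / 2 ^ j) * pint (\<lambda>t. norm (g t) powr p)"
proof -
  obtain C where C: "0 < C" "\<And>j N g. 2 ^ j \<le> N \<Longrightarrow> g \<in> tp N \<Longrightarrow>
    pint (\<lambda>t. norm (interp L j g t) powr p) \<le> C * (real N / 2 ^ j) * pint (\<lambda>t. norm (g t) powr p)"
    using interp_bound_p[OF assms] by blast
  \<comment> \<open>The factor 2 comes from level \<open>j - 1\<close>, where the ratio of degree to
    number of nodes is twice as large; the summand \<open>C\<close> at the end covers level
    0.\<close>
  define C' where "C' = 2 powr p * (C + C * 2) + C"
  have "pint (\<lambda>t. norm (eta L j g t) powr p) \<le> C' * (real N / 2 ^ j) * pint (\<lambda>t. norm (g t) powr p)"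
    if N: "2 ^ j \<le> N" and g: "g \<in> tp N" for j N g
  proof -
    have g0: "0 \<le> (real N / 2 ^ j) * pint (\<lambda>t. norm (g t) powr p)"
      by (intro mult_nonneg_nonneg pint_nonneg continuous_on_norm_powr tp_continuous[OF g] p) auto
    show ?thesis
    proof (cases "j = 0")
      case True
      then have "pint (\<lambda>t. norm (eta L j g t) powr p) \<le> C * ((real N / 2 ^ j) * pint (\<lambda>t. norm (g t) powr p))"
        using C(2)[OF N g] by (simp add: eta_def mult_ac)
      also have "\<dots> \<le> C' * ((real N / 2 ^ j) * pint (\<lambda>t. norm (g t) powr p))"
        using C by (intro mult_right_mono g0) (auto simp: C'_def)
      finally show ?thesis by (simp add: mult_ac)
    next
      case False
      have N': "2 ^ (j - 1) \<le> N" by (rule order_trans[OF _ N]) simp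
      have half: "(2::real) ^ j = 2 * 2 ^ (j - 1)" using False by (simp flip: power_Suc)
      have ci: "continuous_on S (interp L i g)" for S i by (rule tp_continuous[OF interp_tp[OF L]])
      have "pint (\<lambda>t. norm (eta L j g t) powr p) \<le> pint (\<lambda>t. 2 powr p * (norm (interp L j g t) powr p + norm (interp L (j - 1) g t) powr p))"
      proof (intro pint_le continuous_on_norm_powr continuous_on_mult_left continuous_on_add ci p tp_continuous[OF eta_tp[OF L]])
        fix t
        have "norm (eta L j g t) powr p \<le> (norm (interp L j g t) + norm (interp L (j - 1) g t)) powr p"
          using False p by (intro powr_mono2) (auto simp: eta_def norm_triangle_ineq4)
        also have "\<dots> \<le> 2 powr p * (norm (interp L j g t) powr p + norm (interp L (j - 1) g t) powr p)"
          by (intro powr_add_le p) auto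
        finally show "norm (eta L j g t) powr p \<le> 2 powr p * (norm (interp L j g t) powr p + norm (interp L (j - 1) g t) powr p)" .
      qed
      also have "\<dots> = 2 powr p * (pint (\<lambda>t. norm (interp L j g t) powr p) + pint (\<lambda>t. norm (interp L (j - 1) g t) powr p))"
        unfolding Henstock_Kurzweil_Integration.integral_mult_right by (subst pint_add) (intro continuous_on_norm_powr ci p refl)+
      also have "\<dots> \<le> 2 powr p * (C * (real N / 2 ^ j) * pint (\<lambda>t. norm (g t) powr p) + C * (real N / 2 ^ (j - 1)) * pint (\<lambda>t. norm (g t) powr p))"
        by (intro mult_left_mono add_mono C N N' g) auto
      also have "\<dots> = (C' - C) * ((real N / 2 ^ j) * pint (\<lambda>t. norm (g t) powr p))"
        unfolding C'_def half by (simp add: field_simps)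
      also have "\<dots> \<le> C' * ((real N / 2 ^ j) * pint (\<lambda>t. norm (g t) powr p))"
        using C by (intro mult_right_mono g0) auto
      finally show ?thesis by (simp add: mult_ac)
    qed
  qed
  moreover have "0 < C'" using C by (simp add: C'_def add_nonneg_pos)
  ultimately show ?thesis by blast
qed

lemma eta_bound_sup:
  assumes L: "2 \<le> L"
  shows "\<exists>C>0. \<forall>j g S. (\<forall>t. norm (g t) \<le> S) \<longrightarrow> (\<forall>t. norm (eta L j g t) \<le> C * S)"
proof -
  obtain C where C: "0 < C" "\<And>j g S t. (\<And>t. norm (g t) \<le> S) \<Longrightarrow> norm (interp L j g t) \<le> C * S"
    using interp_bound_sup[OF L] by blast
  have "norm (eta L j g t) \<le> (2 * C) * S" if S: "\<And>t. norm (g t) \<le> S" for j g S t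
  proof -
    have S0: "0 \<le> S" using S norm_ge_zero order_trans by blast
    have i: "norm (interp L i g t) \<le> C * S" for i by (rule C(2)[OF S])
    show ?thesis
    proof (cases "j = 0")
      case True
      have "0 \<le> C * S" using C S0 by simp
      then show ?thesis using True i[of 0] by (simp add: eta_def)
    next
      case False
      then show ?thesis using norm_triangle_ineq4[of "interp L j g t" "interp L (j - 1) g t"] i[of j] i[of "j - 1"]
        by (simp add: eta_def)
    qed
  qed
  moreover have "0 < 2 * C" using C by simp
  ultimately show ?thesis by blast
qed

section \<open>From one variable to the torus\<close>

text \<open>The real number 1/p, equal to 0 at infinity, so that growth factors
  \<open>R powr ip p\<close> can be stated for finite and infinite exponents together.\<close>

definition ip :: "ennreal \<Rightarrow> real" where
  "ip p = enn2real (inverse p)"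

text \<open>The one-dimensional counterpart of \<open>Lp_norm\<close>, kept real-valued so that
  operator bounds can be manipulated without extended reals. For infinite \<open>p\<close> the real
  supremum is meaningful for bounded functions, which is the only use made of it.\<close>

definition lp1 :: "ennreal \<Rightarrow> (real \<Rightarrow> complex) \<Rightarrow> real" where
  "lp1 p g = (if p = \<infinity> then (SUP t. norm (g t)) else pint (\<lambda>t. norm (g t) powr enn2real p) powr (1 / enn2real p))"

lemma finite_exponent:
  assumes "0 < p" "p < (\<infinity>::ennreal)"
  shows "0 < enn2real p" "p = ennreal (enn2real p)" "ip p = 1 / enn2real p" "inverse p = ennreal (1 / enn2real p)"
proof -
  show P: "0 < enn2real p" using assms by (simp add: enn2real_positive_iff)
  show p: "p = ennreal (enn2real p)" using assms by simp
  have "inverse p = inverse (ennreal (enn2real p))" using p by simp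
  then show inv: "inverse p = ennreal (1 / enn2real p)"
    using P by (simp add: inverse_ennreal inverse_eq_divide)
  show "ip p = 1 / enn2real p" unfolding ip_def inv using P by simp
qed

lemma ip_nonneg: "0 \<le> ip p"
  by (simp add: ip_def)

lemma ip_infinity: "ip top = 0"
  by (simp add: ip_def)

lemma exponent_times_order:
  assumes "0 < p" "p < (\<infinity>::ennreal)" "inverse p < of_nat L"
  shows "1 < real L * enn2real p" "1 \<le> L"
proof -
  have "ennreal (1 / enn2real p) < ennreal (real L)"
    using assms(3) finite_exponent(4)[OF assms(1,2)] by (simp add: ennreal_of_nat_eq_real_of_nat)
  then have "1 / enn2real p < real L" by (simp add: ennreal_less_iff)
  then show 1: "1 < real L * enn2real p" using finite_exponent(1)[OF assms(1,2)] by (simp add: field_simps)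
  show "1 \<le> L" using 1 by (cases L) auto
qed

lemma lp1_from_powr:
  assumes p: "0 < p" "p < \<infinity>" and cg: "continuous_on UNIV g" and cf: "continuous_on UNIV f"
    and C: "0 < C" and R: "0 \<le> R"
    and le: "pint (\<lambda>t. norm (f t) powr enn2real p) \<le> C * R * pint (\<lambda>t. norm (g t) powr enn2real p)"
  shows "lp1 p f \<le> C powr ip p * R powr ip p * lp1 p g"
proof -
  have P: "0 < enn2real p" by (rule finite_exponent[OF p])
  have nn: "0 \<le> pint (\<lambda>t. norm (h t) powr enn2real p)" if "continuous_on UNIV h" for h :: "real \<Rightarrow> complex"
    by (intro pint_nonneg continuous_on_norm_powr that P) auto
  have "pint (\<lambda>t. norm (f t) powr enn2real p) powr (1 / enn2real p) \<le>
      (C * R * pint (\<lambda>t. norm (g t) powr enn2real p)) powr (1 / enn2real p)"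
    using P by (intro powr_mono2 le nn cf) auto
  also have "\<dots> = C powr ip p * R powr ip p * pint (\<lambda>t. norm (g t) powr enn2real p) powr (1 / enn2real p)"
    unfolding finite_exponent(3)[OF p] using C R nn[OF cg] by (simp add: powr_mult)
  moreover have "p \<noteq> \<infinity>" using p by auto
  ultimately show ?thesis by (simp add: lp1_def)
qed

lemma lp1_infinity_le:
  assumes "\<And>t. norm (g t) \<le> S"
  shows "lp1 \<infinity> g \<le> S"
  unfolding lp1_def using assms by (auto intro: cSUP_least)

lemma norm_le_lp1_infinity:
  assumes "\<And>t. norm (g t) \<le> S"
  shows "norm (g t) \<le> lp1 \<infinity> g"
  unfolding lp1_def using assms by (auto intro!: cSUP_upper bdd_aboveI)

lemma eta_lp1:
  assumes p: "0 < p" and L: "inverse p < of_nat L" and L1: "L = 1 \<longrightarrow> p < \<infinity>"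
  shows "\<exists>C>0. \<forall>j N g. 2 ^ j \<le> N \<longrightarrow> g \<in> tp N \<longrightarrow> lp1 p (eta L j g) \<le> C * (real N / 2 ^ j) powr ip p * lp1 p g"
proof (cases "p = \<infinity>")
  case False
  then have pf: "p < \<infinity>" by (simp add: top.not_eq_extremum)
  note Lp = exponent_times_order[OF p pf L]
  obtain C where C: "0 < C" "\<And>j N g. 2 ^ j \<le> N \<Longrightarrow> g \<in> tp N \<Longrightarrow>
    pint (\<lambda>t. norm (eta L j g t) powr enn2real p) \<le> C * (real N / 2 ^ j) * pint (\<lambda>t. norm (g t) powr enn2real p)"
    using eta_bound_p[OF Lp(2) finite_exponent(1)[OF p pf] Lp(1)] by blast
  have "lp1 p (eta L j g) \<le> C powr ip p * (real N / 2 ^ j) powr ip p * lp1 p g" if "2 ^ j \<le> N" "g \<in> tp N" for j N g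
    by (intro lp1_from_powr[OF p pf _ _ C(1) _ C(2)] tp_continuous[OF that(2)] tp_continuous[OF eta_tp[OF Lp(2)]] that) auto
  moreover have "0 < C powr ip p" using C by simp
  ultimately show ?thesis by blast
next
  case True
  \<comment> \<open>At infinite \<open>p\<close> the assumption on \<open>inverse p\<close> excludes
    only \<open>L = 0\<close>; the value 1 is excluded by the additional hypothesis.\<close>
  have L2: "2 \<le> L" using L L1 True by (cases L; cases "L - 1") auto
  obtain C where C: "0 < C" "\<And>j g S t. (\<And>t. norm (g t) \<le> S) \<Longrightarrow> norm (eta L j g t) \<le> C * S"
    using eta_bound_sup[OF L2] by blast
  have "lp1 p (eta L j g) \<le> C * (real N / 2 ^ j) powr ip p * lp1 p g" if N: "2 ^ j \<le> N" and g: "g \<in> tp N" for j N g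
  proof -
    obtain B where B: "\<And>t. norm (g t) \<le> B" using tp_bounded[OF g] by blast
    have "0 < N" using N by (metis gr0I le_zero_eq power_not_zero zero_neq_numeral)
    then have "(real N / 2 ^ j) powr ip p = 1" using True by (simp add: ip_infinity)
    moreover have "lp1 \<infinity> (eta L j g) \<le> C * lp1 \<infinity> g"
      by (intro lp1_infinity_le C(2) norm_le_lp1_infinity[OF B])
    ultimately show ?thesis using True by simp
  qed
  with C(1) show ?thesis by blast
qed

lemma multiplier_lp1:
  assumes adm: "admissible \<phi>" and p: "0 < p"
  shows "\<exists>C>0. \<forall>m N. \<forall>c :: int \<Rightarrow> complex. 2 ^ m \<le> N \<longrightarrow>
    lp1 p (\<lambda>t. \<Sum>k\<in>{-int N..int N}. complex_of_real (\<phi> m (of_int k)) * c k * cis (of_int k * t))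
    \<le> C * (real N / 2 ^ m) powr ip p * lp1 p (\<lambda>t. \<Sum>k\<in>{-int N..int N}. c k * cis (of_int k * t))"
proof (cases "p = \<infinity>")
  case False
  then have pf: "p < \<infinity>" by (simp add: top.not_eq_extremum)
  obtain C where C: "0 < C" "\<And>m N c. 2 ^ m \<le> N \<Longrightarrow>
    pint (\<lambda>t. norm (\<Sum>k\<in>{-int N..int N}. complex_of_real (\<phi> m (of_int k)) * c k * cis (of_int k * t)) powr enn2real p)
    \<le> C * (real N / 2 ^ m) * pint (\<lambda>t. norm (\<Sum>k\<in>{-int N..int N}. c k * cis (of_int k * t)) powr enn2real p)"
    using multiplier_bound_p[OF adm finite_exponent(1)[OF p pf]] by blast
  have "lp1 p (\<lambda>t. \<Sum>k\<in>{-int N..int N}. complex_of_real (\<phi> m (of_int k)) * c k * cis (of_int k * t))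
    \<le> C powr ip p * (real N / 2 ^ m) powr ip p * lp1 p (\<lambda>t. \<Sum>k\<in>{-int N..int N}. c k * cis (of_int k * t))"
    if "2 ^ m \<le> N" for m N and c :: "int \<Rightarrow> complex"
    by (intro lp1_from_powr[OF p pf _ _ C(1) _ C(2)[OF that]] continuous_intros) auto
  moreover have "0 < C powr ip p" using C by simp
  ultimately show ?thesis by blast
next
  case True
  obtain C where C: "0 < C" "\<forall>m N S. \<forall>c::int \<Rightarrow> complex. (\<forall>t. norm (\<Sum>k\<in>{-int N..int N}. c k * cis (of_int k * t)) \<le> S) \<longrightarrow>
    (\<forall>t. norm (\<Sum>k\<in>{-int N..int N}. complex_of_real (\<phi> m (of_int k)) * c k * cis (of_int k * t)) \<le> C * S)"
    using multiplier_bound_sup[OF adm] by (elim exE conjE)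
  have "lp1 p (\<lambda>t. \<Sum>k\<in>{-int N..int N}. complex_of_real (\<phi> m (of_int k)) * c k * cis (of_int k * t))
    \<le> C * (real N / 2 ^ m) powr ip p * lp1 p (\<lambda>t. \<Sum>k\<in>{-int N..int N}. c k * cis (of_int k * t))"
    if N: "2 ^ m \<le> N" for m N and c :: "int \<Rightarrow> complex"
  proof -
    define g where "g = (\<lambda>t. \<Sum>k\<in>{-int N..int N}. c k * cis (of_int k * t))"
    have "g \<in> tp N" unfolding g_def by (intro tp_sum tp_cmult tp_cis) auto
    then obtain B where "\<And>t. norm (g t) \<le> B" using tp_bounded by blast
    then have B: "norm (g t) \<le> lp1 \<infinity> g" for t by (rule norm_le_lp1_infinity)
    have "0 < N" using N by (metis gr0I le_zero_eq power_not_zero zero_neq_numeral)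
    then have "(real N / 2 ^ m) powr ip p = 1" using True by (simp add: ip_infinity)
    moreover have "lp1 \<infinity> (\<lambda>t. \<Sum>k\<in>{-int N..int N}. complex_of_real (\<phi> m (of_int k)) * c k * cis (of_int k * t))
       \<le> C * lp1 \<infinity> (\<lambda>t. \<Sum>k\<in>{-int N..int N}. c k * cis (of_int k * t))"
      unfolding g_def[symmetric]
    proof (rule lp1_infinity_le)
      have "(\<forall>t. norm (\<Sum>k\<in>{-int N..int N}. c k * cis (of_int k * t)) \<le> lp1 \<infinity> g) \<longrightarrow>
        (\<forall>t. norm (\<Sum>k\<in>{-int N..int N}. complex_of_real (\<phi> m (of_int k)) * c k * cis (of_int k * t)) \<le> C * lp1 \<infinity> g)"
        using C(2) by - (drule spec[of _ m], drule spec[of _ N], drule spec[of _ "lp1 \<infinity> g"], drule spec[of _ c], assumption)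
      then show "norm (\<Sum>k\<in>{-int N..int N}. complex_of_real (\<phi> m (of_int k)) * c k * cis (of_int k * t)) \<le> C * lp1 \<infinity> g" for t
        using B unfolding g_def by simp
    qed
    ultimately show ?thesis using True by simp
  qed
  with C(1) show ?thesis by blast
qed

section \<open>Norms on the torus and restriction to coordinate lines\<close>

lemma torus_lmeasurable: "torus \<in> sets lebesgue"
  unfolding torus_eq_cbox by simp

lemma continuous_borel_measurable_torus:
  fixes g :: "real^'d::finite \<Rightarrow> 'b::topological_space"
  assumes "continuous_on UNIV g"
  shows "g \<in> borel_measurable (lebesgue_on torus)"
proof -
  have "g \<in> borel_measurable borel" using assms by (rule borel_measurable_continuous_onI)
  then have "g \<in> borel_measurable lebesgue" by (rule borel_measurable_subalgebra[rotated 2]) (auto simp: sets_completionI_sets)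
  then show ?thesis by (rule measurable_restrict_space1)
qed

lemma nn_integral_torus:
  fixes f :: "real^'d::finite \<Rightarrow> real"
  assumes "continuous_on UNIV f" "\<And>x. 0 \<le> f x"
  shows "(\<integral>\<^sup>+ x. ennreal (f x) \<partial>lebesgue_on torus) = ennreal (integral torus f)"
proof -
  have "(\<integral>\<^sup>+ x. ennreal (f x) \<partial>lebesgue_on torus) = (\<integral>\<^sup>+ x. ennreal (f x) * indicator torus x \<partial>lebesgue)"
    by (simp add: nn_integral_restrict_space torus_lmeasurable)
  also have "\<dots> = ennreal (integral torus f)"
    unfolding nn_integral_completion
    by (rule nn_integral_has_integral_lebesgue') (use assms integrable_on_torus in auto)
  finally show ?thesis .
qed

lemma enn_powr_ennreal: "0 \<le> x \<Longrightarrow> enn_powr (ennreal x) t = ennreal (x powr t)"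
  by (simp add: enn_powr_def)

lemma Lp_norm_finite_exponent:
  assumes p: "0 < p" "p < \<infinity>" and g: "continuous_on UNIV g"
  shows "Lp_norm p g = ennreal (integral torus (\<lambda>x. norm (g x) powr enn2real p) powr (1 / enn2real p))"
proof -
  have P: "0 < enn2real p" by (rule finite_exponent[OF p])
  have c: "continuous_on UNIV (\<lambda>x. norm (g x) powr enn2real p)" by (intro continuous_on_norm_powr g P)
  have "0 \<le> integral torus (\<lambda>x. norm (g x) powr enn2real p)" by (intro torus_int_nonneg c) auto
  then show ?thesis using p unfolding Lp_norm_def by (simp add: nn_integral_torus[OF c] enn_powr_ennreal)
qed

lemma Lp_norm_infinity_le:
  fixes g :: "real^'d::finite \<Rightarrow> complex"
  assumes g: "continuous_on UNIV g" and le: "\<And>x. x \<in> torus \<Longrightarrow> ennreal (norm (g x)) \<le> S"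
  shows "Lp_norm \<infinity> g \<le> S"
proof -
  have "(\<lambda>x. ennreal (norm (g x))) \<in> borel_measurable (lebesgue_on torus)"
    by (intro measurable_compose[OF _ measurable_ennreal] continuous_borel_measurable_torus continuous_intros g)
  then show ?thesis unfolding Lp_norm_def using le by (auto intro!: esssup_I AE_I2)
qed

text \<open>For a continuous function a value above the essential supremum would persist on a
  nonempty open subset of the interior of the torus, and such a set is not negligible.\<close>

lemma norm_le_Lp_norm_infinity:
  fixes g :: "real^'d::finite \<Rightarrow> complex"
  assumes g: "continuous_on UNIV g" and x: "x \<in> torus"
  shows "ennreal (norm (g x)) \<le> Lp_norm \<infinity> g"
proof (rule ccontr)
  assume "\<not> ennreal (norm (g x)) \<le> Lp_norm \<infinity> g"
  then have less: "Lp_norm \<infinity> g < ennreal (norm (g x))" by simp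
  then obtain S where S: "Lp_norm \<infinity> g = ennreal S" "0 \<le> S" by (cases "Lp_norm \<infinity> g") auto
  have Sx: "S < norm (g x)" using less S by (simp add: ennreal_less_iff)
  have "AE y in lebesgue_on torus. ennreal (norm (g y)) \<le> Lp_norm \<infinity> g"
    unfolding Lp_norm_def using esssup_AE by simp
  then have "AE y in lebesgue_on torus. norm (g y) \<le> S" unfolding S by (simp add: S(2))
  then have AE: "AE y in lebesgue. y \<in> torus \<longrightarrow> norm (g y) \<le> S"
    by (simp add: AE_restrict_space_iff torus_lmeasurable)
  have "open {y. S < norm (g y)}"
    by (intro open_Collect_less continuous_intros g)
  then have op: "open ({y. S < norm (g y)} \<inter> box torus_lo torus_hi)" by (rule open_Int[OF _ open_box])
  have bne: "box torus_lo torus_hi \<noteq> ({} :: (real^'d) set)"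
    by (simp add: interval_eq_empty_cart torus_lo_def torus_hi_def not_less not_le)
  have "x \<in> closure (box torus_lo torus_hi)" using x closure_box[OF bne] by (simp add: torus_eq_cbox)
  then have "{y. S < norm (g y)} \<inter> box torus_lo torus_hi \<noteq> {}"
    using \<open>open {y. S < norm (g y)}\<close> Sx by (auto simp: closure_iff_nhds_not_empty)
  with op have "\<not> negligible ({y. S < norm (g y)} \<inter> box torus_lo torus_hi)"
    using open_not_negligible by blast
  moreover have "negligible ({y. S < norm (g y)} \<inter> box torus_lo torus_hi)"
  proof -
    obtain N where N: "N \<in> null_sets lebesgue" "{y. \<not> (y \<in> torus \<longrightarrow> norm (g y) \<le> S)} \<subseteq> N"
      using AE unfolding eventually_ae_filter by auto
    then have "negligible N" by (simp add: negligible_iff_null_sets)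
    then show ?thesis
      by (rule negligible_subset) (use N(2) box_subset_cbox in \<open>auto simp: torus_eq_cbox not_le\<close>)
  qed
  ultimately show False by blast
qed

definition upd :: "real^'d \<Rightarrow> 'd \<Rightarrow> real \<Rightarrow> real^'d" where
  "upd x i t = (\<chi> k. if k = i then t else x $ k)"

lemma upd_nth [simp]: "upd x i t $ k = (if k = i then t else x $ k)"
  by (simp add: upd_def)

lemma upd_upd [simp]: "upd (upd x i s) i t = upd x i t"
  by (simp add: vec_eq_iff)

lemma upd_same [simp]: "upd x i (x $ i) = x"
  by (simp add: vec_eq_iff)

lemma add_axis_eq_upd: "x + axis i t = upd x i (x $ i + t)"
  by (simp add: vec_eq_iff axis_def)

lemma apply_in_eq: "apply_in i T f x = T (\<lambda>t. f (upd x i t)) (x $ i)"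
  by (simp add: apply_in_def upd_def)

lemma apply_in_upd: "apply_in i T f (upd x i s) = T (\<lambda>t. f (upd x i t)) s"
  by (simp add: apply_in_eq)

lemma continuous_on_upd: "continuous_on S (\<lambda>t. upd x i t)"
  unfolding upd_def
proof (intro continuous_on_vec_lambda)
  show "continuous_on S (\<lambda>t. if k = i then t else x $ k)" for k
    by (cases "k = i") (auto intro!: continuous_intros)
qed

lemma continuous_on_slice:
  fixes f :: "real^'d::finite \<Rightarrow> 'b::topological_space"
  assumes "continuous_on UNIV f"
  shows "continuous_on S (\<lambda>t. f (upd x i t))"
  by (rule continuous_on_compose2[OF assms continuous_on_upd]) auto

lemma periodic_slice:
  assumes "periodic_fun f"
  shows "f (upd x i (t + 2 * pi)) = f (upd x i t)"
  using assms add_axis_eq_upd[of "upd x i t" i "2 * pi"] unfolding periodic_fun_def by (metis upd_nth upd_upd)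

text \<open>The representative is found before the function is chosen, so a single point serves
  several periodic functions at once.\<close>

lemma periodic_torus_representative:
  fixes x :: "real^'d::finite"
  shows "\<exists>y\<in>torus. \<forall>f :: real^'d \<Rightarrow> complex. periodic_fun f \<longrightarrow> f x = f y"
proof -
  define m where "m = (\<lambda>i. - \<lfloor>(x $ i + pi) / (2 * pi)\<rfloor>)"
  define y where "y = (\<lambda>S. \<chi> i. if i \<in> S then x $ i + of_int (m i) * (2 * pi) else x $ i)"
  have "\<forall>f :: real^'d \<Rightarrow> complex. periodic_fun f \<longrightarrow> f (y S) = f x" if "finite S" for S
    using that
  proof (induction S)
    case empty
    show ?case by (simp add: y_def)
  next
    case (insert i S)
    have y': "y (insert i S) = upd (y S) i (y S $ i + of_int (m i) *\<^sub>R (2 * pi))"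
      using insert.hyps by (auto simp: y_def vec_eq_iff)
    show ?case
    proof (intro allI impI)
      fix f :: "real^'d \<Rightarrow> complex" assume f: "periodic_fun f"
      have "f (upd (y S) i (y S $ i + of_int (m i) *\<^sub>R (2 * pi))) = f (upd (y S) i (y S $ i))"
        by (rule periodic_int_multiple[of "\<lambda>t. f (upd (y S) i t)"]) (rule periodic_slice[OF f])
      then show "f (y (insert i S)) = f x" using insert.IH f unfolding y' by simp
    qed
  qed
  moreover have "y UNIV \<in> torus"
    unfolding torus_def
  proof (intro CollectI allI)
    fix i
    have p: "0 < 2 * pi" by simp
    show "- pi \<le> y UNIV $ i \<and> y UNIV $ i \<le> pi"
      using floor_divide_lower[OF p, of "x $ i + pi"] floor_divide_upper[OF p, of "x $ i + pi"]
      unfolding y_def m_def by (simp add: algebra_simps)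
  qed
  ultimately show ?thesis by (metis finite_class.finite)
qed

lemma periodic_bounded:
  fixes f :: "real^'d::finite \<Rightarrow> complex"
  assumes "continuous_on UNIV f" "periodic_fun f"
  obtains B where "\<And>x. norm (f x) \<le> B"
proof -
  have "compact (f ` torus)"
    by (intro compact_continuous_image compact_torus continuous_on_subset[OF assms(1)]) auto
  then obtain B where B: "\<And>y. y \<in> torus \<Longrightarrow> norm (f y) \<le> B"
    using compact_imp_bounded bounded_iff by (metis (no_types, lifting) image_eqI)
  have "norm (f x) \<le> B" for x
    using periodic_torus_representative[of x] B assms(2) by metis
  then show ?thesis using that by blast
qed

text \<open>Fubini's theorem without a product decomposition of the torus: integrate all shifts of
  \<open>f\<close> along direction \<open>i\<close> and exchange the integrals. By invariance under
  shifts the inner integral is constant, which gives \<open>2 * pi\<close>; by periodicity the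
  shifted slice may be replaced by the full coordinate line.\<close>

lemma torus_slice_integral:
  fixes f :: "real^'d::finite \<Rightarrow> real"
  assumes cf: "continuous_on UNIV f" and pf: "\<And>x. f (x + axis i (2 * pi)) = f x"
  shows "2 * pi * integral torus f = integral torus (\<lambda>x. pint (\<lambda>t. f (upd x i t)))"
    and "continuous_on UNIV (\<lambda>x. pint (\<lambda>t. f (upd x i t)))"
proof -
  have sl: "pint (\<lambda>t. f (x + axis i t)) = pint (\<lambda>t. f (upd x i t))" for x
  proof -
    have "pint (\<lambda>t. f (x + axis i t)) = pint (\<lambda>t. f (upd x i (t + x $ i)))"
      by (simp add: add_axis_eq_upd add.commute)
    also have "\<dots> = pint (\<lambda>t. f (upd x i t))"
    proof (rule integral_period_shift[of "\<lambda>t. f (upd x i t)"])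
      show "continuous_on UNIV (\<lambda>t. f (upd x i t))" by (rule continuous_on_slice[OF cf])
      show "f (upd x i (t + 2 * pi)) = f (upd x i t)" for t
        using pf[of "upd x i t"] unfolding add_axis_eq_upd by simp
    qed
    finally show ?thesis .
  qed
  have ax: "axis i t = t *\<^sub>R (axis i 1 :: real^'d)" for t
    by (simp add: axis_def vec_eq_iff)
  have "(\<lambda>(x, t). f (x + axis i t)) = (\<lambda>z. f (fst z + snd z *\<^sub>R axis i 1))"
  proof
    fix z :: "(real^'d) \<times> real"
    show "(case z of (x, t) \<Rightarrow> f (x + axis i t)) = f (fst z + snd z *\<^sub>R axis i 1)"
      using ax[of "snd z"] by (simp add: case_prod_beta)
  qed
  moreover have "continuous_on UNIV (\<lambda>z. f (fst z + snd z *\<^sub>R axis i 1))"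
    by (rule continuous_on_compose2[OF cf]) (auto intro!: continuous_intros)
  ultimately have cp: "continuous_on UNIV (\<lambda>(x, t). f (x + axis i t))" by simp
  have "integral torus (\<lambda>x. pint (\<lambda>t. f (x + axis i t))) = pint (\<lambda>t. integral torus (\<lambda>x. f (x + axis i t)))"
    using integral_swap_continuous[of torus_lo "-pi" torus_hi pi "\<lambda>x t. f (x + axis i t)"] continuous_on_subset[OF cp]
    by (simp add: torus_eq_cbox)
  also have "\<dots> = 2 * pi * integral torus f"
    by (subst integral_torus_shift[OF cf pf]) simp
  finally show "2 * pi * integral torus f = integral torus (\<lambda>x. pint (\<lambda>t. f (upd x i t)))" by (simp add: sl)
  have "continuous_on UNIV (\<lambda>x. pint (\<lambda>t. f (x + axis i t)))"
    using integral_continuous_on_param[of UNIV "-pi" pi "\<lambda>x t. f (x + axis i t)"] continuous_on_subset[OF cp] by auto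
  then show "continuous_on UNIV (\<lambda>x. pint (\<lambda>t. f (upd x i t)))" by (simp add: sl)
qed

text \<open>The passage from one variable to several: an estimate on every line parallel to one
  axis, with the same constant, yields the estimate on the torus. It is applied once per
  variable.\<close>

lemma Lp_norm_slice_bound:
  fixes F G :: "real^'d::finite \<Rightarrow> complex"
  assumes p: "0 < p" and F: "continuous_on UNIV F" "periodic_fun F" and G: "continuous_on UNIV G" "periodic_fun G"
    and K: "0 \<le> K" and le: "\<And>x. lp1 p (\<lambda>t. F (upd x i t)) \<le> K * lp1 p (\<lambda>t. G (upd x i t))"
  shows "Lp_norm p F \<le> ennreal K * Lp_norm p G"
proof (cases "p = \<infinity>")
  case True
  obtain BF where BF: "\<And>x. norm (F x) \<le> BF" using periodic_bounded[OF F] by blast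
  obtain BG where BG: "\<And>x. norm (G x) \<le> BG" using periodic_bounded[OF G] by blast
  have "Lp_norm \<infinity> G \<le> ennreal BG" by (rule Lp_norm_infinity_le[OF G(1)]) (use BG in \<open>auto intro: ennreal_leI\<close>)
  then obtain S where S: "Lp_norm \<infinity> G = ennreal S" "0 \<le> S" by (cases "Lp_norm \<infinity> G") (auto simp: top_unique)
  have GS: "norm (G y) \<le> S" for y
  proof -
    obtain z where "z \<in> torus" "G y = G z" using periodic_torus_representative[of y] G(2) by blast
    then show ?thesis using norm_le_Lp_norm_infinity[OF G(1), of z] S by simp
  qed
  have "norm (F x) \<le> K * S" for x
  proof -
    have "norm (F (upd x i (x $ i))) \<le> lp1 \<infinity> (\<lambda>t. F (upd x i t))"
      by (rule norm_le_lp1_infinity) (rule BF)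
    also have "\<dots> \<le> K * lp1 \<infinity> (\<lambda>t. G (upd x i t))" using le True by simp
    also have "\<dots> \<le> K * S" by (intro mult_left_mono lp1_infinity_le GS K)
    finally show ?thesis by simp
  qed
  then have "Lp_norm \<infinity> F \<le> ennreal (K * S)" by (intro Lp_norm_infinity_le[OF F(1)] ennreal_leI)
  then show ?thesis using True S K by (simp add: ennreal_mult)
next
  case False
  then have pf: "p < \<infinity>" by (simp add: top.not_eq_extremum)
  define P where "P = enn2real p"
  have P: "0 < P" unfolding P_def by (rule finite_exponent[OF p pf])
  have c: "continuous_on UNIV (\<lambda>x. norm (H x) powr P)" if "continuous_on UNIV H" for H :: "real^'d \<Rightarrow> complex"
    by (intro continuous_on_norm_powr that P)
  have per: "norm (H (x + axis i (2 * pi))) powr P = norm (H x) powr P" if "periodic_fun H" for H :: "real^'d \<Rightarrow> complex" and x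
    using that unfolding periodic_fun_def by simp
  have nn: "0 \<le> pint (\<lambda>t. norm (H (upd x i t)) powr P)" if "continuous_on UNIV H" for H :: "real^'d \<Rightarrow> complex" and x
    by (intro pint_nonneg continuous_on_norm_powr continuous_on_slice that P) auto
  have ptw: "pint (\<lambda>t. norm (F (upd x i t)) powr P) \<le> K powr P * pint (\<lambda>t. norm (G (upd x i t)) powr P)" for x
  proof -
    have "pint (\<lambda>t. norm (F (upd x i t)) powr P) powr (1 / P) \<le> K * pint (\<lambda>t. norm (G (upd x i t)) powr P) powr (1 / P)"
      using le[of x] False by (simp add: lp1_def P_def)
    then have "(pint (\<lambda>t. norm (F (upd x i t)) powr P) powr (1 / P)) powr P \<le> (K * pint (\<lambda>t. norm (G (upd x i t)) powr P) powr (1 / P)) powr P"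
      using P by (intro powr_mono2) auto
    then show ?thesis using P K nn[OF F(1), of x] nn[OF G(1), of x] by (simp add: powr_powr powr_mult)
  qed
  have "2 * pi * integral torus (\<lambda>x. norm (F x) powr P) \<le> integral torus (\<lambda>x. K powr P * pint (\<lambda>t. norm (G (upd x i t)) powr P))"
    unfolding torus_slice_integral(1)[OF c[OF F(1)] per[OF F(2)]]
    by (intro torus_int_le continuous_on_mult_left ptw torus_slice_integral(2)[OF c per] F G)
  also have "\<dots> = K powr P * (2 * pi * integral torus (\<lambda>x. norm (G x) powr P))"
    unfolding torus_slice_integral(1)[OF c[OF G(1)] per[OF G(2)]] by simp
  finally have "integral torus (\<lambda>x. norm (F x) powr P) \<le> K powr P * integral torus (\<lambda>x. norm (G x) powr P)" by simp
  moreover have IF: "0 \<le> integral torus (\<lambda>x. norm (F x) powr P)" "0 \<le> integral torus (\<lambda>x. norm (G x) powr P)"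
    by (intro torus_int_nonneg c F G; simp)+
  ultimately have "integral torus (\<lambda>x. norm (F x) powr P) powr (1 / P) \<le> (K powr P * integral torus (\<lambda>x. norm (G x) powr P)) powr (1 / P)"
    using P by (intro powr_mono2) auto
  also have "\<dots> = K * integral torus (\<lambda>x. norm (G x) powr P) powr (1 / P)" using P K IF by (simp add: powr_powr powr_mult)
  finally show ?thesis
    unfolding Lp_norm_finite_exponent[OF p pf F(1)] Lp_norm_finite_exponent[OF p pf G(1)] P_def[symmetric]
    using K by (simp add: ennreal_mult[symmetric] ennreal_leI)
qed

section \<open>Tensor products of one-dimensional operators\<close>

lemma delta_eq_sum:
  fixes f :: "real^'d::finite \<Rightarrow> complex"
  assumes "finite K" "\<And>k. k \<notin> K \<Longrightarrow> complex_of_real (\<Prod>i\<in>UNIV. \<phi> (m $ i) (real_of_int (k $ i))) * fourier_coeff f k = 0"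
  shows "delta \<phi> m f x = (\<Sum>k\<in>K. (complex_of_real (\<Prod>i\<in>UNIV. \<phi> (m $ i) (real_of_int (k $ i))) * fourier_coeff f k) * cis (idot k x))"
proof -
  have "delta \<phi> m f x = (\<Sum>\<^sub>\<infinity>k\<in>K. (complex_of_real (\<Prod>i\<in>UNIV. \<phi> (m $ i) (real_of_int (k $ i))) * fourier_coeff f k) * cis (idot k x))"
    unfolding delta_def by (rule infsum_cong_neutral) (use assms(2) in auto)
  then show ?thesis using assms(1) by simp
qed

definition level_support :: "(nat \<Rightarrow> real \<Rightarrow> real) \<Rightarrow> nat \<Rightarrow> bool" where
  "level_support \<phi> D \<longleftrightarrow> (\<forall>m \<xi>. \<phi> m \<xi> \<noteq> 0 \<longrightarrow> \<bar>\<xi>\<bar> \<le> real D * 2 ^ m)"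

lemma delta_coeff_support:
  fixes \<phi> :: "nat \<Rightarrow> real \<Rightarrow> real" and k :: "int^'d::finite"
  assumes D: "level_support \<phi> D"
    and k: "k \<notin> freq_box (\<lambda>i. D * 2 ^ (m $ i))"
  shows "(\<Prod>i\<in>UNIV. \<phi> (m $ i) (real_of_int (k $ i))) = 0"
proof -
  obtain i where i: "\<not> \<bar>k $ i\<bar> \<le> int (D * 2 ^ (m $ i))" using k by (auto simp: freq_box_def)
  have "\<phi> (m $ i) (real_of_int (k $ i)) = 0"
  proof (rule ccontr)
    assume "\<phi> (m $ i) (real_of_int (k $ i)) \<noteq> 0"
    with D have "real_of_int \<bar>k $ i\<bar> \<le> real_of_int (int (D * 2 ^ (m $ i)))" by (simp add: level_support_def)
    then show False using i by (simp only: of_int_le_iff)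
  qed
  then show ?thesis by (intro prod_zero) auto
qed

lemma delta_eq_freq_box:
  fixes \<phi> :: "nat \<Rightarrow> real \<Rightarrow> real" and f :: "real^'d::finite \<Rightarrow> complex"
  assumes D: "level_support \<phi> D"
  shows "delta \<phi> m f = (\<lambda>x. \<Sum>k\<in>freq_box (\<lambda>i. D * 2 ^ (m $ i)).
    (complex_of_real (\<Prod>i\<in>UNIV. \<phi> (m $ i) (real_of_int (k $ i))) * fourier_coeff f k) * cis (idot k x))"
proof
  fix x
  have "complex_of_real (\<Prod>i\<in>UNIV. \<phi> (m $ i) (real_of_int (k $ i))) * fourier_coeff f k = 0"
    if "k \<notin> freq_box (\<lambda>i. D * 2 ^ (m $ i))" for k
    by (simp only: delta_coeff_support[OF D that] of_real_0 mult_zero_left)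
  then show "delta \<phi> m f x = (\<Sum>k\<in>freq_box (\<lambda>i. D * 2 ^ (m $ i)).
    (complex_of_real (\<Prod>i\<in>UNIV. \<phi> (m $ i) (real_of_int (k $ i))) * fourier_coeff f k) * cis (idot k x))"
    by (rule delta_eq_sum[OF finite_freq_box])
qed

lemma delta_TP:
  fixes \<phi> :: "nat \<Rightarrow> real \<Rightarrow> real" and f :: "real^'d::finite \<Rightarrow> complex"
  assumes D: "level_support \<phi> D"
  shows "delta \<phi> m f \<in> TP (\<lambda>i. D * 2 ^ (m $ i))"
  unfolding delta_eq_freq_box[OF D] by (intro TP_sum TP_cmult TP_cis)

lemma fourier_coeff_delta:
  fixes \<phi> :: "nat \<Rightarrow> real \<Rightarrow> real" and f :: "real^'d::finite \<Rightarrow> complex"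
  assumes D: "level_support \<phi> D"
  shows "fourier_coeff (delta \<phi> m f) k = complex_of_real (\<Prod>i\<in>UNIV. \<phi> (m $ i) (real_of_int (k $ i))) * fourier_coeff f k"
proof -
  have "fourier_coeff (delta \<phi> m f) k = (if k \<in> freq_box (\<lambda>i. D * 2 ^ (m $ i))
    then complex_of_real (\<Prod>i\<in>UNIV. \<phi> (m $ i) (real_of_int (k $ i))) * fourier_coeff f k else 0)"
    unfolding delta_eq_freq_box[OF D] TP_coeff[OF finite_freq_box] ..
  also have "\<dots> = complex_of_real (\<Prod>i\<in>UNIV. \<phi> (m $ i) (real_of_int (k $ i))) * fourier_coeff f k"
    using delta_coeff_support[OF D, of k m] by (cases "k \<in> freq_box (\<lambda>i. D * 2 ^ (m $ i))") (simp_all only: if_True if_False of_real_0 mult_zero_left not_False_eq_True)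
  finally show ?thesis .
qed

text \<open>Frequencies are grouped by their \<open>i\<close>-th entry. The coefficients
  \<open>C\<close> do not depend on \<open>\<psi>\<close>, so a slice before and after the action of
  a multiplier in variable \<open>i\<close> is described by the same coefficients.\<close>

lemma slice_coefficients:
  fixes a :: "int^'d::finite \<Rightarrow> complex"
  shows "\<exists>C. \<forall>\<psi> t. (\<Sum>k\<in>freq_box N. \<psi> (k $ i) * a k * cis (idot k (upd x i t))) =
    (\<Sum>n\<in>{-int (N i)..int (N i)}. \<psi> n * C n * cis (of_int n * t))"
proof (intro exI allI)
  define C where "C = (\<lambda>n. \<Sum>k\<in>{k\<in>freq_box N. k $ i = n}. a k * cis (idot k (upd x i 0)))"
  fix \<psi> :: "int \<Rightarrow> complex" and t
  have cis: "cis (idot k (upd x i t)) = cis (idot k (upd x i 0)) * cis (of_int (k $ i) * t)" for k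
  proof -
    have "upd x i t = upd x i 0 + axis i t" by (simp add: add_axis_eq_upd)
    then show ?thesis by (simp add: idot_add_right idot_axis cis_mult)
  qed
  have "(\<Sum>k\<in>freq_box N. \<psi> (k $ i) * a k * cis (idot k (upd x i t))) =
     (\<Sum>n\<in>{-int (N i)..int (N i)}. \<Sum>k\<in>{k\<in>freq_box N. k $ i = n}. \<psi> (k $ i) * a k * cis (idot k (upd x i t)))"
    by (rule sum.group[symmetric, OF finite_freq_box]) (auto simp: freq_box_def abs_le_iff minus_le_iff)
  also have "\<dots> = (\<Sum>n\<in>{-int (N i)..int (N i)}. \<psi> n * C n * cis (of_int n * t))"
    unfolding C_def cis by (intro sum.cong refl) (simp add: sum_distrib_left sum_distrib_right mult_ac)
  finally show "(\<Sum>k\<in>freq_box N. \<psi> (k $ i) * a k * cis (idot k (upd x i t))) =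
     (\<Sum>n\<in>{-int (N i)..int (N i)}. \<psi> n * C n * cis (of_int n * t))" .
qed

lemma TP_slice:
  assumes "g \<in> TP N"
  shows "(\<lambda>t. g (upd x i t)) \<in> tp (N i)"
proof -
  obtain a where g: "g = (\<lambda>x. \<Sum>k\<in>freq_box N. a k * cis (idot k x))"
    using assms unfolding TP_def by (blast elim: tspanE)
  obtain C where C: "\<And>\<psi> t. (\<Sum>k\<in>freq_box N. \<psi> (k $ i) * a k * cis (idot k (upd x i t))) =
    (\<Sum>n\<in>{-int (N i)..int (N i)}. \<psi> n * C n * cis (of_int n * t))"
    using slice_coefficients[where N = N and i = i and a = a and x = x] by blast
  have "(\<lambda>t. g (upd x i t)) = (\<lambda>t. \<Sum>n\<in>{-int (N i)..int (N i)}. C n * cis (of_int n * t))"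
    unfolding g using C[of "\<lambda>_. 1"] by simp
  then show ?thesis by (simp only:) (intro tp_sum tp_cmult tp_cis, auto)
qed

text \<open>The one-dimensional multipliers are switched on one variable at a time, each costing one
  factor of the product.\<close>

lemma Lp_norm_delta_le:
  assumes adm: "admissible \<phi>" and p: "0 < p"
  shows "\<exists>C>0. \<forall>(m::nat^'d::finite) N g. g \<in> TP N \<longrightarrow> (\<forall>i. 2 ^ (m $ i) \<le> N i) \<longrightarrow>
    Lp_norm p (delta \<phi> m g) \<le> ennreal (\<Prod>i\<in>UNIV. C * (real (N i) / 2 ^ (m $ i)) powr ip p) * Lp_norm p g"
proof -
  obtain C where C: "0 < C" "\<forall>m N. \<forall>c :: int \<Rightarrow> complex. 2 ^ m \<le> N \<longrightarrow>
    lp1 p (\<lambda>t. \<Sum>k\<in>{-int N..int N}. complex_of_real (\<phi> m (of_int k)) * c k * cis (of_int k * t))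
    \<le> C * (real N / 2 ^ m) powr ip p * lp1 p (\<lambda>t. \<Sum>k\<in>{-int N..int N}. c k * cis (of_int k * t))"
    using multiplier_lp1[OF adm p] by (elim exE conjE)
  have "Lp_norm p (delta \<phi> m g) \<le> ennreal (\<Prod>i\<in>UNIV. C * (real (N i) / 2 ^ (m $ i)) powr ip p) * Lp_norm p g"
    if g: "g \<in> TP N" and N: "\<And>i. 2 ^ (m $ i) \<le> N i" for m :: "nat^'d" and N g
  proof -
    obtain a where ga: "g = (\<lambda>x. \<Sum>k\<in>freq_box N. a k * cis (idot k x))"
      using g unfolding TP_def by (blast elim: tspanE)
    \<comment> \<open>The polynomial on which only the multipliers in the variables of
      \<open>S\<close> have acted: \<open>g\<close> itself for the empty set,
      \<open>delta \<phi> m g\<close> for the full one.\<close>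
    define h where "h = (\<lambda>S x. \<Sum>k\<in>freq_box N. complex_of_real (\<Prod>i\<in>S. \<phi> (m $ i) (real_of_int (k $ i))) * a k * cis (idot k x))"
    have hTP: "h S \<in> TP N" for S unfolding h_def by (intro TP_sum TP_cmult TP_cis)
    have "Lp_norm p (h S) \<le> ennreal (\<Prod>i\<in>S. C * (real (N i) / 2 ^ (m $ i)) powr ip p) * Lp_norm p g" if "finite S" for S
      using that
    proof (induction S)
      case empty
      then show ?case by (simp add: h_def ga)
    next
      case (insert i S)
      have "Lp_norm p (h (insert i S)) \<le> ennreal (C * (real (N i) / 2 ^ (m $ i)) powr ip p) * Lp_norm p (h S)"
      proof (rule Lp_norm_slice_bound[OF p, of _ _ _ i])
        fix x
        obtain E where E: "\<And>\<psi> t. (\<Sum>k\<in>freq_box N. \<psi> (k $ i) * (complex_of_real (\<Prod>i\<in>S. \<phi> (m $ i) (real_of_int (k $ i))) * a k) * cis (idot k (upd x i t))) =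
          (\<Sum>n\<in>{-int (N i)..int (N i)}. \<psi> n * E n * cis (of_int n * t))"
          using slice_coefficients[where N = N and i = i and a = "\<lambda>k. complex_of_real (\<Prod>i\<in>S. \<phi> (m $ i) (real_of_int (k $ i))) * a k" and x = x] by blast
        have 1: "(\<lambda>t. h S (upd x i t)) = (\<lambda>t. \<Sum>n\<in>{-int (N i)..int (N i)}. E n * cis (of_int n * t))"
          unfolding h_def using E[of "\<lambda>_. 1"] by (simp add: mult.assoc del: of_real_prod)
        have 2: "(\<lambda>t. h (insert i S) (upd x i t)) = (\<lambda>t. \<Sum>n\<in>{-int (N i)..int (N i)}. complex_of_real (\<phi> (m $ i) (of_int n)) * E n * cis (of_int n * t))"
          unfolding h_def using E[of "\<lambda>n. complex_of_real (\<phi> (m $ i) (of_int n))"] insert.hyps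
          by (simp add: mult.assoc)
        show "lp1 p (\<lambda>t. h (insert i S) (upd x i t)) \<le> C * (real (N i) / 2 ^ (m $ i)) powr ip p * lp1 p (\<lambda>t. h S (upd x i t))"
          unfolding 1 2 using C(2) N[of i] by blast
      qed (use C(1) in \<open>auto intro!: TP_continuous[OF hTP] TP_periodic[OF hTP]\<close>)
      also have "\<dots> \<le> ennreal (C * (real (N i) / 2 ^ (m $ i)) powr ip p) * (ennreal (\<Prod>i\<in>S. C * (real (N i) / 2 ^ (m $ i)) powr ip p) * Lp_norm p g)"
        by (intro mult_left_mono insert.IH) auto
      also have "\<dots> = ennreal (\<Prod>i\<in>insert i S. C * (real (N i) / 2 ^ (m $ i)) powr ip p) * Lp_norm p g"
        using insert.hyps C(1) by (simp add: ennreal_mult[symmetric] prod_nonneg mult.assoc[symmetric] del: prod.insert_if)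
      finally show ?case .
    qed
    from this[of UNIV] have "Lp_norm p (h UNIV) \<le> ennreal (\<Prod>i\<in>UNIV. C * (real (N i) / 2 ^ (m $ i)) powr ip p) * Lp_norm p g" by simp
    moreover have "delta \<phi> m g = h UNIV"
    proof
      fix x
      have coeff: "fourier_coeff g k = (if k \<in> freq_box N then a k else 0)" for k
        unfolding ga by (rule TP_coeff[OF finite_freq_box])
      show "delta \<phi> m g x = h UNIV x"
        unfolding h_def by (subst delta_eq_sum[OF finite_freq_box[of N]]) (auto simp: coeff)
    qed
    ultimately show ?thesis by simp
  qed
  with C(1) show ?thesis by blast
qed

text \<open>Every factor samples at finitely many points and recombines the samples with fixed
  kernels. Iterating over distinct variables therefore gives a sum over tuples of points with
  product kernels, from which continuity, periodicity and degree can be read off.\<close>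

lemma foldr_apply_in:
  fixes x :: "real^'d::finite"
  assumes "distinct xs"
    and T: "\<And>i g x. i \<in> set xs \<Longrightarrow> T i g x = (\<Sum>v\<in>V i. g (\<tau> i v) * \<kappa> i v x)"
    and V: "\<And>i. finite (V i)"
  shows "foldr (\<lambda>i g. apply_in i (T i) g) xs f x =
    (\<Sum>v\<in>PiE (set xs) V. f (\<chi> k. if k \<in> set xs then \<tau> k (v k) else x $ k) * (\<Prod>k\<in>set xs. \<kappa> k (v k) (x $ k)))"
  using assms(1) T
proof (induction xs arbitrary: x)
  case Nil
  have "(\<chi> k. x $ k) = x" by (simp add: vec_eq_iff)
  then show ?case by simp
next
  case (Cons i xs)
  let ?S = "set xs"
  have i: "i \<notin> ?S" using Cons.prems by simp
  have IH: "foldr (\<lambda>i g. apply_in i (T i) g) xs f x =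
    (\<Sum>v\<in>PiE ?S V. f (\<chi> k. if k \<in> ?S then \<tau> k (v k) else x $ k) * (\<Prod>k\<in>?S. \<kappa> k (v k) (x $ k)))" for x
    by (rule Cons.IH) (use Cons.prems in auto)
  let ?w = "\<lambda>v. f (\<chi> k. if k \<in> insert i ?S then \<tau> k (v k) else x $ k) * (\<Prod>k\<in>insert i ?S. \<kappa> k (v k) (x $ k))"
  have "foldr (\<lambda>i g. apply_in i (T i) g) (i # xs) f x =
    (\<Sum>u\<in>V i. foldr (\<lambda>i g. apply_in i (T i) g) xs f (upd x i (\<tau> i u)) * \<kappa> i u (x $ i))"
    using Cons.prems by (simp add: apply_in_eq)
  also have "\<dots> = (\<Sum>u\<in>V i. \<Sum>v\<in>PiE ?S V. ?w (v(i := u)))"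
  proof (intro sum.cong refl)
    fix u assume "u \<in> V i"
    have eq: "f (\<chi> k. if k \<in> ?S then \<tau> k (v k) else upd x i (\<tau> i u) $ k) * (\<Prod>k\<in>?S. \<kappa> k (v k) (upd x i (\<tau> i u) $ k)) * \<kappa> i u (x $ i) = ?w (v(i := u))" for v
    proof -
      have "(\<chi> k. if k \<in> ?S then \<tau> k (v k) else upd x i (\<tau> i u) $ k) = (\<chi> k. if k \<in> insert i ?S then \<tau> k ((v(i := u)) k) else x $ k)"
        using i by (auto simp: vec_eq_iff)
      moreover have "(\<Prod>k\<in>?S. \<kappa> k (v k) (upd x i (\<tau> i u) $ k)) = (\<Prod>k\<in>?S. \<kappa> k ((v(i := u)) k) (x $ k))"
        using i by (intro prod.cong) auto
      ultimately show ?thesis using i by (simp add: mult_ac)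
    qed
    show "foldr (\<lambda>i g. apply_in i (T i) g) xs f (upd x i (\<tau> i u)) * \<kappa> i u (x $ i) = (\<Sum>v\<in>PiE ?S V. ?w (v(i := u)))"
      unfolding IH sum_distrib_right eq ..
  qed
  also have "\<dots> = (\<Sum>(u, v)\<in>V i \<times> PiE ?S V. ?w (v(i := u)))" by (rule sum.cartesian_product)
  also have "\<dots> = (\<Sum>v\<in>PiE (insert i ?S) V. ?w v)"
  proof -
    have "PiE (insert i ?S) V = (\<lambda>(u, v). v(i := u)) ` (V i \<times> PiE ?S V)" by (rule PiE_insert_eq)
    moreover have "inj_on (\<lambda>(u, v). v(i := u)) (V i \<times> PiE ?S V)" by (rule inj_combinator[OF i])
    ultimately have "(\<Sum>v\<in>PiE (insert i ?S) V. ?w v) = (\<Sum>z\<in>V i \<times> PiE ?S V. (?w \<circ> (\<lambda>(u, v). v(i := u))) z)"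
      by (simp only: sum.reindex)
    also have "\<dots> = (\<Sum>(u, v)\<in>V i \<times> PiE ?S V. ?w (v(i := u)))"
      by (rule sum.cong) (auto simp only: o_def split_def)
    finally show ?thesis by (rule sym)
  qed
  finally show ?case by simp
qed

definition eta_kernel :: "nat \<Rightarrow> nat \<Rightarrow> int \<Rightarrow> real \<Rightarrow> complex" where
  "eta_kernel L j u x = Kpi L j (x - node j u) - (if 1 \<le> j \<and> even u then Kpi L (j - 1) (x - node j u) else 0)"

text \<open>The coarse nodes are the even-numbered fine nodes.\<close>

lemma eta_eq: "eta L j g x = (\<Sum>u\<in>Uset j. g (node j u) * eta_kernel L j u x)"
proof (cases "j = 0")
  case True
  then show ?thesis by (simp add: eta_def interp_eq eta_kernel_def)
next
  case False
  then obtain i where i: "j = Suc i" by (cases j) auto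
  have node: "node j (2 * u) = node i u" for u by (simp add: node_def i)
  have "(\<Sum>u\<in>Uset j. if even u then g (node j u) * Kpi L i (x - node j u) else 0) =
     (\<Sum>u\<in>(\<lambda>u. 2 * u) ` Uset i. g (node j u) * Kpi L i (x - node j u))"
  proof (rule sum.mono_neutral_cong_right)
    have z: "(0::int) < 2 ^ i" "i \<noteq> 0 \<Longrightarrow> (2::int) ^ i = 2 * 2 ^ (i - 1)" by (simp, cases i, auto)
    show "(\<lambda>u. 2 * u) ` Uset i \<subseteq> Uset j" using z by (cases "i = 0") (auto simp: Uset_def i)
    show "\<forall>u\<in>Uset j - (\<lambda>u. 2 * u) ` Uset i. (if even u then g (node j u) * Kpi L i (x - node j u) else 0) = 0"
    proof
      fix u assume u: "u \<in> Uset j - (\<lambda>u. 2 * u) ` Uset i"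
      have "odd u"
      proof
        assume "even u"
        then obtain w where w: "u = 2 * w" by (rule evenE)
        have "w \<in> Uset i" using u w z by (cases "i = 0") (auto simp: Uset_def i)
        then show False using u w by auto
      qed
      then show "(if even u then g (node j u) * Kpi L i (x - node j u) else 0) = 0" by simp
    qed
  qed auto
  also have "\<dots> = interp L i g x"
    unfolding interp_eq by (subst sum.reindex) (auto simp: inj_on_def node)
  finally have "interp L i g x = (\<Sum>u\<in>Uset j. if even u then g (node j u) * Kpi L i (x - node j u) else 0)" ..
  then have "eta L j g x = (\<Sum>u\<in>Uset j. g (node j u) * Kpi L j (x - node j u) - (if even u then g (node j u) * Kpi L i (x - node j u) else 0))"
    by (simp add: eta_def i interp_eq[of L "Suc i"] sum_subtractf)
  also have "\<dots> = (\<Sum>u\<in>Uset j. g (node j u) * eta_kernel L j u x)"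
    by (intro sum.cong refl) (auto simp: eta_kernel_def i right_diff_distrib)
  finally show ?thesis .
qed

lemma eta_kernel_tp:
  assumes "1 \<le> L"
  shows "eta_kernel L j u \<in> tp (2 ^ j)"
proof -
  have "(\<lambda>x. Kpi L j (x + - node j u) + (if 1 \<le> j \<and> even u then -1 else 0) * Kpi L (j - 1) (x + - node j u)) \<in> tp (2 ^ j)"
    by (intro tp_add tp_cmult tp_shift Kpi_tp tp_mono[OF _ Kpi_tp] assms) auto
  also have "(\<lambda>x. Kpi L j (x + - node j u) + (if 1 \<le> j \<and> even u then -1 else 0) * Kpi L (j - 1) (x + - node j u)) = eta_kernel L j u"
    by (auto simp: eta_kernel_def)
  finally show ?thesis .
qed

section \<open>Interpolation operators acting on a list of variables\<close>

definition freeze :: "'d set \<Rightarrow> ('d \<Rightarrow> real) \<Rightarrow> real^'d \<Rightarrow> real^'d" where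
  "freeze S t x = (\<chi> k. if k \<in> S then t k else x $ k)"

lemma continuous_on_freeze: "continuous_on S (freeze A t)"
  unfolding freeze_def
proof (intro continuous_on_vec_lambda)
  show "continuous_on S (\<lambda>x. if k \<in> A then t k else x $ k)" for k
    by (cases "k \<in> A") (auto intro!: continuous_intros)
qed

lemma freeze_upd: "i \<notin> A \<Longrightarrow> freeze A t (upd x i s) = upd (freeze A t x) i s"
  by (auto simp: freeze_def vec_eq_iff)

lemma periodic_freeze:
  assumes "periodic_fun f"
  shows "f (freeze A t (x + axis i (2 * pi))) = f (freeze A t x)"
proof (cases "i \<in> A")
  case True
  then have "freeze A t (x + axis i (2 * pi)) = freeze A t x"
    by (auto simp: freeze_def vec_eq_iff axis_def)
  then show ?thesis by simp
next
  case False
  then have "freeze A t (x + axis i (2 * pi)) = freeze A t x + axis i (2 * pi)"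
    by (auto simp: freeze_def vec_eq_iff axis_def)
  then show ?thesis using assms unfolding periodic_fun_def by simp
qed

text \<open>The tensor product restricted to a list of variables. Induction over the variables
  passes through these partial products.\<close>

definition eta_list :: "nat \<Rightarrow> ('d \<Rightarrow> nat) \<Rightarrow> 'd list \<Rightarrow> (real^'d::finite \<Rightarrow> complex) \<Rightarrow> real^'d \<Rightarrow> complex" where
  "eta_list L j xs f = foldr (\<lambda>i g. apply_in i (eta L (j i)) g) xs f"

lemma eta_list_eq:
  assumes "distinct xs"
  shows "eta_list L j xs f x = (\<Sum>v\<in>PiE (set xs) (\<lambda>i. Uset (j i)).
    f (freeze (set xs) (\<lambda>k. node (j k) (v k)) x) * (\<Prod>k\<in>set xs. eta_kernel L (j k) (v k) (x $ k)))"
  unfolding eta_list_def freeze_def by (rule foldr_apply_in[OF assms]) (auto simp: eta_eq)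

lemma eta_list_Cons: "eta_list L j (i # xs) f = apply_in i (eta L (j i)) (eta_list L j xs f)"
  by (simp add: eta_list_def)

lemma eta_list_continuous:
  assumes L: "1 \<le> L" and xs: "distinct xs" and f: "continuous_on UNIV f"
  shows "continuous_on UNIV (eta_list L j xs f)"
proof -
  have "continuous_on UNIV (\<lambda>x. \<Sum>v\<in>PiE (set xs) (\<lambda>i. Uset (j i)).
    f (freeze (set xs) (\<lambda>k. node (j k) (v k)) x) * (\<Prod>k\<in>set xs. eta_kernel L (j k) (v k) (x $ k)))"
    by (intro continuous_intros continuous_on_compose2[OF f continuous_on_freeze]
          continuous_on_compose2[OF tp_continuous[OF eta_kernel_tp[OF L], of UNIV]]) auto
  then show ?thesis by (simp add: eta_list_eq[OF xs, abs_def])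
qed

lemma eta_list_periodic:
  assumes L: "1 \<le> L" and xs: "distinct xs" and f: "periodic_fun f"
  shows "periodic_fun (eta_list L j xs f)"
  unfolding periodic_fun_def
proof (intro allI)
  fix x :: "real^'a" and i
  have "eta_kernel L (j k) (v k) ((x + axis i (2 * pi)) $ k) = eta_kernel L (j k) (v k) (x $ k)" for k v
    using tp_periodic[OF eta_kernel_tp[OF L], of "j k" "v k" "x $ k"]
    by (cases "k = i") (auto simp: axis_def)
  then show "eta_list L j xs f (x + axis i (2 * pi)) = eta_list L j xs f x"
    unfolding eta_list_eq[OF xs] periodic_freeze[OF f] by simp
qed

text \<open>Operators in other variables only form combinations of slices of \<open>g\<close> in
  direction \<open>i\<close>, so the degree in a variable that is still to be treated is
  preserved.\<close>

lemma eta_list_slice_tp: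
  assumes L: "1 \<le> L" and xs: "distinct xs" and g: "g \<in> TP N" and i: "i \<notin> set xs"
  shows "(\<lambda>t. eta_list L j xs g (upd x i t)) \<in> tp (N i)"
proof -
  have "(\<lambda>t. \<Sum>v\<in>PiE (set xs) (\<lambda>i. Uset (j i)). (\<Prod>k\<in>set xs. eta_kernel L (j k) (v k) (x $ k)) *
      g (upd (freeze (set xs) (\<lambda>k. node (j k) (v k)) x) i t)) \<in> tp (N i)"
    by (intro tp_sum tp_cmult TP_slice[OF g])
  also have "(\<lambda>t. \<Sum>v\<in>PiE (set xs) (\<lambda>i. Uset (j i)). (\<Prod>k\<in>set xs. eta_kernel L (j k) (v k) (x $ k)) *
      g (upd (freeze (set xs) (\<lambda>k. node (j k) (v k)) x) i t)) = (\<lambda>t. eta_list L j xs g (upd x i t))"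
    unfolding eta_list_eq[OF xs] freeze_upd[OF i]
    by (intro ext sum.cong refl, subst mult.commute, intro arg_cong2[where f = times] refl prod.cong) (use i in auto)
  finally show ?thesis .
qed

lemma Lp_norm_eta_list_le:
  assumes p: "0 < p" and L: "1 \<le> L"
    and C: "0 < C" "\<And>j N g. 2 ^ j \<le> N \<Longrightarrow> g \<in> tp N \<Longrightarrow> lp1 p (eta L j g) \<le> C * (real N / 2 ^ j) powr ip p * lp1 p g"
    and g: "g \<in> TP N" and N: "\<And>i. 2 ^ (j i) \<le> N i" and xs: "distinct xs"
  shows "Lp_norm p (eta_list L j xs g) \<le> ennreal (\<Prod>i\<in>set xs. C * (real (N i) / 2 ^ (j i)) powr ip p) * Lp_norm p g"
  using xs
proof (induction xs)
  case Nil
  then show ?case by (simp add: eta_list_def)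
next
  case (Cons i xs)
  have dist: "distinct xs" "i \<notin> set xs" using Cons.prems by auto
  have "Lp_norm p (eta_list L j (i # xs) g) \<le> ennreal (C * (real (N i) / 2 ^ (j i)) powr ip p) * Lp_norm p (eta_list L j xs g)"
  proof (rule Lp_norm_slice_bound[OF p, of _ _ _ i])
    fix x
    show "lp1 p (\<lambda>t. eta_list L j (i # xs) g (upd x i t)) \<le> C * (real (N i) / 2 ^ (j i)) powr ip p * lp1 p (\<lambda>t. eta_list L j xs g (upd x i t))"
      unfolding eta_list_Cons apply_in_upd by (intro C(2) N eta_list_slice_tp[OF L dist(1) g dist(2)])
  qed (use C(1) in \<open>auto intro!: eta_list_continuous eta_list_periodic L Cons.prems dist(1) TP_continuous[OF g] TP_periodic[OF g] simp del: distinct.simps\<close>)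
  also have "\<dots> \<le> ennreal (C * (real (N i) / 2 ^ (j i)) powr ip p) * (ennreal (\<Prod>i\<in>set xs. C * (real (N i) / 2 ^ (j i)) powr ip p) * Lp_norm p g)"
    by (intro mult_left_mono Cons.IH dist) auto
  also have "\<dots> = ennreal (\<Prod>i\<in>set (i # xs). C * (real (N i) / 2 ^ (j i)) powr ip p) * Lp_norm p g"
    using dist C(1) by (simp add: ennreal_mult prod_nonneg mult.assoc)
  finally show ?case .
qed

lemma eta_zero: "eta L j (\<lambda>t. 0) x = 0"
  by (simp add: eta_eq)

text \<open>The variable \<open>i\<close> may stand anywhere in the list. When its operator is
  reached, the partial result still has degree \<open>N i\<close> in it and is annihilated; the
  operators applied afterwards preserve 0.\<close>

lemma eta_list_vanishes:
  assumes L: "1 \<le> L" and g: "g \<in> TP N" and i: "i \<in> set xs" "N i * 2 ^ Suc L < 2 ^ (j i)" "1 \<le> j i" and xs: "distinct xs"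
  shows "eta_list L j xs g = (\<lambda>x. 0)"
  using i(1) xs
proof (induction xs)
  case (Cons k xs)
  show ?case
  proof (cases "k = i")
    case True
    have "eta L (j i) (\<lambda>t. eta_list L j xs g (upd x i t)) = (\<lambda>t. 0)" for x
      by (rule eta_vanishes[OF L eta_list_slice_tp[OF L _ g] i(2,3)]) (use Cons.prems True in auto)
    then show ?thesis using True by (auto simp: eta_list_Cons apply_in_eq)
  next
    case False
    then have "eta_list L j xs g = (\<lambda>x. 0)" using Cons by auto
    then show ?thesis by (auto simp: eta_list_Cons apply_in_eq eta_zero)
  qed
qed simp

lemma TP_coordinate:
  fixes i :: "'d::finite"
  assumes "h \<in> tp n"
  shows "(\<lambda>x. h (x $ i)) \<in> TP (\<lambda>k. if k = i then n else 0)"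
proof -
  obtain c where h: "h = (\<lambda>x. \<Sum>k\<in>{-int n..int n}. c k * cis (real_of_int k * x))"
    using assms unfolding tp_def by (blast elim: tspanE)
  have idot: "idot (axis i l) x = of_int l * x $ i" for l x
  proof -
    have "idot (axis i l) x = (\<Sum>j\<in>UNIV. if j = i then of_int l * x $ i else 0)"
      unfolding idot_def by (intro sum.cong) (auto simp: axis_def)
    then show ?thesis by simp
  qed
  have "(\<lambda>x. \<Sum>k\<in>{-int n..int n}. c k * cis (idot (axis i k) x)) \<in> TP (\<lambda>k. if k = i then n else 0)"
    by (intro TP_sum TP_cmult TP_cis) (auto simp: freq_box_def axis_def)
  then show ?thesis by (simp add: h idot)
qed

lemma TP_prod_coordinates:
  fixes S :: "'d::finite set"
  assumes "\<And>i. h i \<in> tp (n i)"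
  shows "(\<lambda>x. \<Prod>i\<in>S. h i (x $ i)) \<in> TP (\<lambda>k. if k \<in> S then n k else 0)"
proof -
  have "finite S" by simp
  then show ?thesis
  proof (induction S)
    case empty
    then show ?case by (simp add: TP_const)
  next
    case (insert i S)
    have "(\<lambda>x. h i (x $ i) * (\<Prod>i\<in>S. h i (x $ i))) \<in> TP (\<lambda>k. (if k = i then n i else 0) + (if k \<in> S then n k else 0))"
      by (intro TP_mult TP_coordinate assms insert.IH)
    also have "(\<lambda>k. (if k = i then n i else 0) + (if k \<in> S then n k else 0)) = (\<lambda>k. if k \<in> insert i S then n k else 0)"
      using insert.hyps by auto
    finally show ?case using insert.hyps by simp
  qed
qed

lemma qL_eq_eta_list: "qL L j f = eta_list L (\<lambda>i. j $ i) Enum.enum f"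
  by (simp add: qL_def eta_list_def)

lemma distinct_enum: "distinct (Enum.enum :: 'd::enum list)"
  by (rule enum_distinct)

lemma set_enum: "set (Enum.enum :: 'd::enum list) = UNIV"
  by (rule enum_UNIV)

lemma qL_eq:
  fixes f :: "real^'d::enum \<Rightarrow> complex"
  shows "qL L j f x = (\<Sum>v\<in>PiE UNIV (\<lambda>i. Uset (j $ i)).
    f (\<chi> k. node (j $ k) (v k)) * (\<Prod>k\<in>UNIV. eta_kernel L (j $ k) (v k) (x $ k)))"
  unfolding qL_eq_eta_list eta_list_eq[OF distinct_enum] set_enum by (simp add: freeze_def)

lemma qL_TP:
  fixes f :: "real^'d::enum \<Rightarrow> complex"
  assumes "1 \<le> L"
  shows "qL L j f \<in> TP (\<lambda>i. 2 ^ (j $ i))"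
proof -
  have "(\<lambda>x. \<Sum>v\<in>PiE UNIV (\<lambda>i. Uset (j $ i)).
    f (\<chi> k. node (j $ k) (v k)) * (\<Prod>k\<in>UNIV. eta_kernel L (j $ k) (v k) (x $ k))) \<in> TP (\<lambda>k. if k \<in> UNIV then 2 ^ (j $ k) else 0)"
    by (intro TP_sum TP_cmult TP_prod_coordinates eta_kernel_tp assms)
  then show ?thesis by (simp add: qL_eq[abs_def])
qed

section \<open>Almost diagonal operators on the sequence spaces\<close>

text \<open>The finite exhaustion of the multi-indices along which all expansions are summed; over a
  cube, sums of products factorise into one-dimensional sums.\<close>

definition cube :: "nat \<Rightarrow> (nat^'d::finite) set" where
  "cube M = {j. \<forall>i. j $ i \<le> M}"

lemma cube_image: "cube M = vec_lambda ` (PiE UNIV (\<lambda>i::'d::finite. {..M}))"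
proof (intro set_eqI iffI)
  fix j :: "nat^'d" assume "j \<in> cube M"
  then show "j \<in> vec_lambda ` (PiE UNIV (\<lambda>i::'d. {..M}))"
    by (intro image_eqI[where x = "vec_nth j"]) (auto simp: cube_def PiE_def extensional_def vec_nth_inverse)
qed (auto simp: cube_def PiE_def Pi_iff)

lemma finite_cube: "finite (cube M)"
  unfolding cube_image by (intro finite_imageI finite_PiE) auto

lemma finite_subset_cube:
  fixes A :: "(nat^'d::finite) set"
  assumes "finite A"
  shows "\<exists>M. A \<subseteq> cube M"
proof
  show "A \<subseteq> cube (Max (insert 0 ((\<lambda>(j, i). j $ i) ` (A \<times> UNIV))))"
    using assms by (auto simp: cube_def intro!: Max_ge)
qed

lemma sum_cube_prod:
  fixes f :: "'d::finite \<Rightarrow> nat \<Rightarrow> 'a::comm_semiring_1"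
  shows "(\<Sum>j\<in>cube M. \<Prod>i\<in>UNIV. f i (j $ i)) = (\<Prod>i\<in>UNIV. \<Sum>n\<le>M. f i n)"
proof -
  have inj: "inj_on vec_lambda (PiE UNIV (\<lambda>i::'d. {..M}))"
    by (rule inj_onI) (metis vec_lambda_inverse iso_tuple_UNIV_I)
  have "(\<Sum>j\<in>cube M. \<Prod>i\<in>UNIV. f i (j $ i)) = (\<Sum>v\<in>PiE UNIV (\<lambda>i::'d. {..M}). \<Prod>i\<in>UNIV. f i (v i))"
    unfolding cube_image by (subst sum.reindex[OF inj]) simp
  also have "\<dots> = (\<Prod>i\<in>UNIV. \<Sum>n\<le>M. f i n)" by (subst prod_sum_PiE) auto
  finally show ?thesis .
qed

text \<open>The model entry of an almost diagonal matrix: it is zero unless \<open>m\<close> lies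
  below \<open>j + c\<close> in every coordinate, and decays geometrically in the total gap
  otherwise. The truncated subtraction is guarded by the condition.\<close>

definition gap_weight :: "real \<Rightarrow> nat \<Rightarrow> nat^'d::finite \<Rightarrow> nat^'d \<Rightarrow> real" where
  "gap_weight \<epsilon> c m j = (\<Prod>i\<in>UNIV. if m $ i \<le> j $ i + c then 2 powr (- \<epsilon> * real (j $ i + c - m $ i)) else 0)"

lemma gap_weight_nonneg: "0 \<le> gap_weight \<epsilon> c m j"
  unfolding gap_weight_def by (intro prod_nonneg) auto

lemma gap_weight_le_1:
  assumes "0 \<le> \<epsilon>"
  shows "gap_weight \<epsilon> c m j \<le> 1"
  unfolding gap_weight_def
proof (intro prod_le_1 conjI)
  fix i
  have "2 powr (- \<epsilon> * real (j $ i + c - m $ i)) \<le> 2 powr (0::real)"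
    using assms by (intro powr_mono) auto
  then have "2 powr (- \<epsilon> * real (j $ i + c - m $ i)) \<le> (1::real)" by simp
  then show "(if m $ i \<le> j $ i + c then 2 powr (- \<epsilon> * real (j $ i + c - m $ i)) else 0) \<le> 1"
    by (cases "m $ i \<le> j $ i + c") (simp_all only: if_True if_False zero_le_one simp_thms)
qed auto

lemma gap_weight_valid:
  fixes m j :: "nat^'d::finite"
  assumes "\<forall>i. m $ i \<le> j $ i + c"
  shows "gap_weight \<epsilon> c m j = (\<Prod>i\<in>UNIV. 2 powr (- \<epsilon> * real (j $ i + c - m $ i)))" "0 < gap_weight \<epsilon> c m j"
proof -
  show 1: "gap_weight \<epsilon> c m j = (\<Prod>i\<in>UNIV. 2 powr (- \<epsilon> * real (j $ i + c - m $ i)))"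
    using assms by (simp add: gap_weight_def)
  show "0 < gap_weight \<epsilon> c m j" unfolding 1 by (intro prod_pos) auto
qed

lemma gap_weight_powr:
  fixes m j :: "nat^'d::finite"
  assumes "0 < s"
  shows "gap_weight \<epsilon> c m j powr s = gap_weight (\<epsilon> * s) c m j"
proof (cases "\<forall>i. m $ i \<le> j $ i + c")
  case True
  show ?thesis unfolding gap_weight_valid(1)[OF True]
    by (simp add: prod_powr_distrib powr_powr mult_ac)
next
  case False
  then obtain i where i: "\<not> m $ i \<le> j $ i + c" by blast
  have "gap_weight e c m j = 0" for e
    unfolding gap_weight_def using i by (intro prod_zero) auto
  then show ?thesis by simp
qed

definition geo_sum :: "real \<Rightarrow> real" where
  "geo_sum \<epsilon> = 1 / (1 - 2 powr (- \<epsilon>))"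

lemma geo_sum_ge_1:
  assumes "0 < \<epsilon>"
  shows "1 \<le> geo_sum \<epsilon>"
proof -
  have "2 powr (- \<epsilon>) < 2 powr (0::real)" using assms by (intro powr_less_mono) auto
  then have "1 - 2 powr (- \<epsilon>) > 0" by simp
  then show ?thesis by (simp add: geo_sum_def)
qed

lemma sum_powr_inj_le:
  assumes \<epsilon>: "0 < \<epsilon>" and A: "finite A" "inj_on f A"
  shows "(\<Sum>n\<in>A. 2 powr (- \<epsilon> * real (f n))) \<le> geo_sum \<epsilon>"
proof -
  define q where "q = 2 powr (- \<epsilon>)"
  have q: "0 < q" "q < 1"
  proof -
    show "0 < q" by (simp add: q_def)
    have "2 powr (- \<epsilon>) < 2 powr (0::real)" using \<epsilon> by (intro powr_less_mono) auto
    then show "q < 1" by (simp add: q_def)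
  qed
  have sterm: "2 powr (- \<epsilon> * real n) = q ^ n" for n
    unfolding q_def by (simp only: powr_powr powr_realpow[symmetric] powr_gt_zero)
  have "(\<Sum>n\<in>A. 2 powr (- \<epsilon> * real (f n))) = (\<Sum>n\<in>f ` A. q ^ n)"
    by (subst sum.reindex[OF A(2)]) (simp only: sterm o_def)
  also have "\<dots> \<le> (\<Sum>n. q ^ n)" using q A by (intro sum_le_suminf) auto
  also have "\<dots> = geo_sum \<epsilon>" using q by (simp add: suminf_geometric geo_sum_def q_def)
  finally show ?thesis .
qed

text \<open>Row and column sums are both bounded. Enlarging the index set to a cube makes the sum a
  product of geometric series, one for each variable.\<close>

lemma sum_gap_weight_le:
  fixes A :: "(nat^'d::finite) set" and m j :: "nat^'d"
  assumes \<epsilon>: "0 < \<epsilon>" and A: "finite A"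
  shows "(\<Sum>j\<in>A. gap_weight \<epsilon> c m j) \<le> geo_sum \<epsilon> ^ CARD('d)"
    and "(\<Sum>m\<in>A. gap_weight \<epsilon> c m j) \<le> geo_sum \<epsilon> ^ CARD('d)"
proof -
  obtain M where M: "A \<subseteq> cube M" using finite_subset_cube[OF A] by blast
  have one: "(\<Sum>n\<le>M. if a \<le> n + c then 2 powr (- \<epsilon> * real (n + c - a)) else 0) \<le> geo_sum \<epsilon>" for a
  proof -
    have "(\<Sum>n\<le>M. if a \<le> n + c then 2 powr (- \<epsilon> * real (n + c - a)) else 0) = (\<Sum>n\<in>{n. n \<le> M \<and> a \<le> n + c}. 2 powr (- \<epsilon> * real (n + c - a)))"
      by (rule sum.mono_neutral_cong_right) auto
    also have "\<dots> \<le> geo_sum \<epsilon>" by (rule sum_powr_inj_le[OF \<epsilon>]) (auto simp: inj_on_def)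
    finally show ?thesis .
  qed
  have two: "(\<Sum>n\<le>M. if n \<le> a + c then 2 powr (- \<epsilon> * real (a + c - n)) else 0) \<le> geo_sum \<epsilon>" for a
  proof -
    have "(\<Sum>n\<le>M. if n \<le> a + c then 2 powr (- \<epsilon> * real (a + c - n)) else 0) = (\<Sum>n\<in>{n. n \<le> M \<and> n \<le> a + c}. 2 powr (- \<epsilon> * real (a + c - n)))"
      by (rule sum.mono_neutral_cong_right) auto
    also have "\<dots> \<le> geo_sum \<epsilon>" by (rule sum_powr_inj_le[OF \<epsilon>]) (auto simp: inj_on_def)
    finally show ?thesis .
  qed
  have "(\<Sum>j\<in>A. gap_weight \<epsilon> c m j) \<le> (\<Sum>j\<in>cube M. gap_weight \<epsilon> c m j)"
    by (rule sum_mono2[OF finite_cube M]) (rule gap_weight_nonneg)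
  also have "\<dots> = (\<Prod>i\<in>UNIV. \<Sum>n\<le>M. if m $ i \<le> n + c then 2 powr (- \<epsilon> * real (n + c - m $ i)) else 0)"
    unfolding gap_weight_def by (rule sum_cube_prod)
  also have "\<dots> \<le> (\<Prod>i\<in>(UNIV::'d set). geo_sum \<epsilon>)"
    by (intro prod_mono conjI one sum_nonneg) auto
  finally show "(\<Sum>j\<in>A. gap_weight \<epsilon> c m j) \<le> geo_sum \<epsilon> ^ CARD('d)" by simp
  have "(\<Sum>m\<in>A. gap_weight \<epsilon> c m j) \<le> (\<Sum>m\<in>cube M. gap_weight \<epsilon> c m j)"
    by (rule sum_mono2[OF finite_cube M]) (rule gap_weight_nonneg)
  also have "\<dots> = (\<Prod>i\<in>UNIV. \<Sum>n\<le>M. if n \<le> j $ i + c then 2 powr (- \<epsilon> * real (j $ i + c - n)) else 0)"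
    unfolding gap_weight_def by (rule sum_cube_prod)
  also have "\<dots> \<le> (\<Prod>i\<in>(UNIV::'d set). geo_sum \<epsilon>)"
    by (intro prod_mono conjI two sum_nonneg) auto
  finally show "(\<Sum>m\<in>A. gap_weight \<epsilon> c m j) \<le> geo_sum \<epsilon> ^ CARD('d)" by simp
qed

lemma enn_powr_mono:
  assumes "0 < t" "x \<le> y"
  shows "enn_powr x t \<le> enn_powr y t"
proof (cases "y = \<infinity>")
  case False
  then have "x \<noteq> \<infinity>" using assms(2) by (auto simp: top_unique)
  have "enn2real x \<le> enn2real y" using assms(2) False by (intro enn2real_mono) (auto simp: less_top)
  then show ?thesis using False \<open>x \<noteq> \<infinity>\<close> assms(1)
    unfolding enn_powr_def by (auto intro!: ennreal_leI powr_mono2)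
qed (simp add: enn_powr_def)

lemma enn_powr_mult:
  assumes "0 < t" "0 < a"
  shows "enn_powr (ennreal a * x) t = ennreal (a powr t) * enn_powr x t"
proof (cases "x = \<infinity>")
  case True
  then show ?thesis using assms by (simp add: enn_powr_def ennreal_mult_top)
next
  case False
  then obtain y where y: "x = ennreal y" "0 \<le> y" by (cases x) auto
  have "enn_powr (ennreal (a * y)) t = ennreal (a powr t * y powr t)"
    using assms y by (simp add: enn_powr_ennreal powr_mult)
  then show ?thesis using assms y by (simp add: enn_powr_ennreal ennreal_mult)
qed

lemma enn_powr_cancel: "0 < t \<Longrightarrow> enn_powr (enn_powr x t) (1 / t) = x"
  by (cases x) (auto simp: enn_powr_def powr_powr)

lemma enn_powr_cancel': "0 < t \<Longrightarrow> enn_powr (enn_powr x (1 / t)) t = x"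
  using enn_powr_cancel[of "1 / t" x] by simp

lemma sum_le_infsum_ennreal:
  fixes f :: "'a \<Rightarrow> ennreal"
  assumes "finite A"
  shows "sum f A \<le> infsum f UNIV"
  unfolding nonneg_infsum_complete[of UNIV f, simplified] using assms by (intro SUP_upper) auto

lemma infsum_le_ennreal:
  fixes f :: "'a \<Rightarrow> ennreal"
  assumes "\<And>A. finite A \<Longrightarrow> sum f A \<le> B"
  shows "infsum f UNIV \<le> B"
  unfolding nonneg_infsum_complete[of UNIV f, simplified] using assms by (intro SUP_least) auto

text \<open>A supremum over \<open>j\<close>, rather than a sum, is what makes every \<theta>
  accessible: the power of a supremum is at most the sum of the powers, without any convexity, and
  the weights are then summed over \<open>m\<close>.\<close>

lemma seq_norm_gap_le:
  fixes x b :: "nat^'d::finite \<Rightarrow> ennreal"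
  assumes \<theta>: "0 < \<theta>" and \<epsilon>: "0 < \<epsilon>" and C: "0 < C"
  shows "\<exists>C'>0. \<forall>x b :: nat^'d \<Rightarrow> ennreal.
    (\<forall>m. x m \<le> ennreal C * (SUP j. ennreal (gap_weight \<epsilon> c m j) * b j)) \<longrightarrow>
    seq_norm \<theta> x \<le> ennreal C' * seq_norm \<theta> b"
proof (cases "\<theta> = \<infinity>")
  case True
  have "seq_norm \<theta> x \<le> ennreal C * seq_norm \<theta> b"
    if le: "\<And>m. x m \<le> ennreal C * (SUP j. ennreal (gap_weight \<epsilon> c m j) * b j)" for x b :: "nat^'d \<Rightarrow> ennreal"
  proof -
    have "x m \<le> ennreal C * (SUP j. b j)" for m
    proof -
      have "ennreal (gap_weight \<epsilon> c m j) * b j \<le> 1 * b j" for j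
        using gap_weight_le_1[of \<epsilon> c m j] \<epsilon> by (intro mult_right_mono) (auto simp: ennreal_le_1)
      then have "(SUP j. ennreal (gap_weight \<epsilon> c m j) * b j) \<le> (SUP j. b j)" by (intro SUP_mono) auto
      then show ?thesis using le[of m] by (meson mult_left_mono order_trans zero_le)
    qed
    then show ?thesis using True by (auto simp: seq_norm_def intro: SUP_least)
  qed
  with C show ?thesis by blast
next
  case False
  define t where "t = enn2real \<theta>"
  have t: "0 < t" using \<theta> False unfolding t_def by (simp add: enn2real_positive_iff less_top)
  define S where "S = geo_sum (\<epsilon> * t) ^ CARD('d)"
  have S: "0 < S" unfolding S_def using geo_sum_ge_1[of "\<epsilon> * t"] \<epsilon> t by (intro zero_less_power) auto
  define C' where "C' = (C powr t * S) powr (1 / t)"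
  have "seq_norm \<theta> x \<le> ennreal C' * seq_norm \<theta> b"
    if le: "\<And>m. x m \<le> ennreal C * (SUP j. ennreal (gap_weight \<epsilon> c m j) * b j)" for x b :: "nat^'d \<Rightarrow> ennreal"
  proof -
    define \<beta> where "\<beta> = (\<lambda>j. enn_powr (b j) t)"
    let ?w = "\<lambda>m j. ennreal (gap_weight (\<epsilon> * t) c m j) * \<beta> j"
    have xm: "enn_powr (x m) t \<le> ennreal (C powr t) * infsum (?w m) UNIV" for m
    proof -
      have sterm: "ennreal (gap_weight \<epsilon> c m j) * b j \<le> enn_powr (infsum (?w m) UNIV) (1 / t)" for j
      proof (cases "gap_weight \<epsilon> c m j = 0")
        case False
        then have g: "0 < gap_weight \<epsilon> c m j" using gap_weight_nonneg[of \<epsilon> c m j] by simp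
        have "enn_powr (ennreal (gap_weight \<epsilon> c m j) * b j) t = ?w m j"
          unfolding enn_powr_mult[OF t g] gap_weight_powr[OF t] \<beta>_def ..
        also have "\<dots> \<le> infsum (?w m) UNIV" using sum_le_infsum_ennreal[of "{j}" "?w m"] by simp
        finally have "enn_powr (enn_powr (ennreal (gap_weight \<epsilon> c m j) * b j) t) (1 / t) \<le> enn_powr (infsum (?w m) UNIV) (1 / t)"
          using t by (intro enn_powr_mono) auto
        then show ?thesis unfolding enn_powr_cancel[OF t] .
      qed simp
      have "x m \<le> ennreal C * enn_powr (infsum (?w m) UNIV) (1 / t)"
        by (rule order_trans[OF le]) (intro mult_left_mono SUP_least sterm zero_le)
      then have "enn_powr (x m) t \<le> enn_powr (ennreal C * enn_powr (infsum (?w m) UNIV) (1 / t)) t"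
        by (rule enn_powr_mono[OF t])
      then show ?thesis unfolding enn_powr_mult[OF t C] enn_powr_cancel'[OF t] .
    qed
    have "(\<Sum>\<^sub>\<infinity>m. enn_powr (x m) t) \<le> ennreal (C powr t * S) * (\<Sum>\<^sub>\<infinity>j. \<beta> j)"
    proof (rule infsum_le_ennreal)
      fix A :: "(nat^'d) set" assume A: "finite A"
      have "(\<Sum>m\<in>A. enn_powr (x m) t) \<le> (\<Sum>m\<in>A. ennreal (C powr t) * infsum (?w m) UNIV)"
        by (intro sum_mono xm)
      also have "\<dots> = ennreal (C powr t) * (\<Sum>m\<in>A. infsum (?w m) UNIV)" by (simp only: sum_distrib_left)
      also have "(\<Sum>m\<in>A. infsum (?w m) UNIV) = (\<Sum>\<^sub>\<infinity>j. \<Sum>m\<in>A. ?w m j)"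
        by (rule infsum_finite_sum[symmetric]) (rule nonneg_summable_on_complete, simp)
      also have "\<dots> \<le> ennreal S * (\<Sum>\<^sub>\<infinity>j. \<beta> j)"
      proof (rule infsum_le_ennreal)
        fix B :: "(nat^'d) set" assume B: "finite B"
        have "(\<Sum>m\<in>A. ?w m j) \<le> ennreal S * \<beta> j" for j
        proof -
          have "(\<Sum>m\<in>A. ?w m j) = ennreal (\<Sum>m\<in>A. gap_weight (\<epsilon> * t) c m j) * \<beta> j"
            by (simp add: sum_distrib_right[symmetric] sum_ennreal gap_weight_nonneg)
          also have "\<dots> \<le> ennreal S * \<beta> j"
            unfolding S_def using \<epsilon> t by (intro mult_right_mono ennreal_leI sum_gap_weight_le(2) A) auto
          finally show ?thesis .
        qed
        then have "(\<Sum>j\<in>B. \<Sum>m\<in>A. ?w m j) \<le> (\<Sum>j\<in>B. ennreal S * \<beta> j)" by (intro sum_mono)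
        also have "\<dots> = ennreal S * (\<Sum>j\<in>B. \<beta> j)" by (simp only: sum_distrib_left)
        also have "\<dots> \<le> ennreal S * (\<Sum>\<^sub>\<infinity>j. \<beta> j)" by (intro mult_left_mono sum_le_infsum_ennreal B) auto
        finally show "(\<Sum>j\<in>B. \<Sum>m\<in>A. ?w m j) \<le> ennreal S * (\<Sum>\<^sub>\<infinity>j. \<beta> j)" .
      qed
      finally show "(\<Sum>m\<in>A. enn_powr (x m) t) \<le> ennreal (C powr t * S) * (\<Sum>\<^sub>\<infinity>j. \<beta> j)"
        using S by (simp add: ennreal_mult mult.assoc mult_left_mono)
    qed
    then have "enn_powr (\<Sum>\<^sub>\<infinity>m. enn_powr (x m) t) (1 / t) \<le> enn_powr (ennreal (C powr t * S) * (\<Sum>\<^sub>\<infinity>j. \<beta> j)) (1 / t)"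
      using t by (intro enn_powr_mono) auto
    also have "\<dots> = ennreal C' * enn_powr (\<Sum>\<^sub>\<infinity>j. \<beta> j) (1 / t)"
      unfolding C'_def using t C S by (intro enn_powr_mult) auto
    finally show ?thesis using False by (simp add: seq_norm_def t_def \<beta>_def)
  qed
  moreover have "0 < C'" using C S by (simp add: C'_def)
  ultimately show ?thesis by blast
qed

text \<open>A substitute for the triangle inequality that is valid for p < 1. With \<open>h\<close>
  the largest quotient of \<open>norm (G j x)\<close> by \<open>\<omega> j\<close>, the sum is at
  most \<open>S * h\<close>, and the \<open>p\<close>-th power of \<open>h\<close> is at most the
  sum of the powers of all quotients. The square in the hypothesis leaves one power of
  \<open>\<omega> j\<close> after the division, so the remaining series is again bounded by
  \<open>S\<close>; this produces the exponent \<open>1 + ip p\<close>.\<close>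

lemma Lp_norm_finite_sum_le:
  fixes G :: "'i \<Rightarrow> real^'d::finite \<Rightarrow> complex"
  assumes p: "0 < p" and Q: "finite Q" and G: "\<And>j. j \<in> Q \<Longrightarrow> continuous_on UNIV (G j)"
    and \<omega>: "\<And>j. j \<in> Q \<Longrightarrow> 0 < \<omega> j" "\<And>j. j \<in> Q \<Longrightarrow> \<omega> j \<le> 1"
    and S: "1 \<le> S" "(\<Sum>j\<in>Q. \<omega> j) \<le> S" "p < \<infinity> \<Longrightarrow> (\<Sum>j\<in>Q. \<omega> j powr enn2real p) \<le> S"
    and B: "0 \<le> B" "\<And>j. j \<in> Q \<Longrightarrow> Lp_norm p (G j) \<le> ennreal (\<omega> j ^ 2 * B)"
  shows "Lp_norm p (\<lambda>x. \<Sum>j\<in>Q. G j x) \<le> ennreal (S powr (1 + ip p) * B)"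
proof -
  have cF: "continuous_on UNIV (\<lambda>x. \<Sum>j\<in>Q. G j x)" by (intro continuous_intros G)
  show ?thesis
  proof (cases "p = \<infinity>")
    case True
    show ?thesis unfolding True
    proof (rule Lp_norm_infinity_le[OF cF])
      fix x :: "real^'d" assume x: "x \<in> torus"
      have "norm (G j x) \<le> \<omega> j * B" if j: "j \<in> Q" for j
      proof -
        have "ennreal (norm (G j x)) \<le> ennreal (\<omega> j ^ 2 * B)"
          using norm_le_Lp_norm_infinity[OF G[OF j] x] B(2)[OF j] True by (simp add: order_trans)
        then have "norm (G j x) \<le> \<omega> j ^ 2 * B" using B(1) by (simp add: ennreal_le_iff)
        also have "\<dots> \<le> \<omega> j * B" using \<omega>(1,2)[OF j] B(1) by (intro mult_right_mono) (auto simp: power2_eq_square mult_left_le)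
        finally show ?thesis .
      qed
      then have "norm (\<Sum>j\<in>Q. G j x) \<le> (\<Sum>j\<in>Q. \<omega> j * B)" by (rule sum_norm_le)
      also have "\<dots> = (\<Sum>j\<in>Q. \<omega> j) * B" by (simp only: sum_distrib_right)
      also have "\<dots> \<le> S * B" by (intro mult_right_mono S B)
      finally show "ennreal (norm (\<Sum>j\<in>Q. G j x)) \<le> ennreal (S powr (1 + ip \<infinity>) * B)"
        using S(1) by (intro ennreal_leI) (simp add: ip_infinity)
    qed
  next
    case False
    then have pf: "p < \<infinity>" by (simp add: top.not_eq_extremum)
    define P where "P = enn2real p"
    have P: "0 < P" unfolding P_def by (rule finite_exponent[OF p pf])
    have ipP: "ip p = 1 / P" unfolding P_def by (rule finite_exponent[OF p pf])
    have SP: "(\<Sum>j\<in>Q. \<omega> j powr P) \<le> S" using S(3)[OF pf] by (simp add: P_def)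
    have cG: "continuous_on UNIV (\<lambda>x. norm (G j x) powr P)" if "j \<in> Q" for j
      by (intro continuous_on_norm_powr G that P)
    have IG: "integral torus (\<lambda>x. norm (G j x) powr P) \<le> (\<omega> j ^ 2 * B) powr P" if j: "j \<in> Q" for j
    proof -
      have nn: "0 \<le> integral torus (\<lambda>x. norm (G j x) powr P)" by (intro torus_int_nonneg cG j) auto
      have "integral torus (\<lambda>x. norm (G j x) powr P) powr (1 / P) \<le> \<omega> j ^ 2 * B"
        using B(2)[OF j] B(1) unfolding Lp_norm_finite_exponent[OF p pf G[OF j]] P_def[symmetric]
        by (subst (asm) ennreal_le_iff) auto
      then have "(integral torus (\<lambda>x. norm (G j x) powr P) powr (1 / P)) powr P \<le> (\<omega> j ^ 2 * B) powr P"
        using P by (intro powr_mono2) auto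
      then show ?thesis using P nn by (simp add: powr_powr)
    qed
    have ptw: "norm (\<Sum>j\<in>Q. G j x) powr P \<le> S powr P * (\<Sum>j\<in>Q. \<omega> j powr (- P) * norm (G j x) powr P)" for x
    proof (cases "Q = {}")
      case False
      define h where "h = Max ((\<lambda>j. norm (G j x) / \<omega> j) ` Q)"
      have h: "norm (G j x) / \<omega> j \<le> h" if "j \<in> Q" for j unfolding h_def using Q that by (intro Max_ge) auto
      have "h \<in> (\<lambda>j. norm (G j x) / \<omega> j) ` Q" unfolding h_def using Q False by (intro Max_in) auto
      then obtain k where k: "k \<in> Q" "h = norm (G k x) / \<omega> k" by auto
      have h0: "0 \<le> h" unfolding k(2) using \<omega>(1)[OF k(1)] by simp
      have "norm (\<Sum>j\<in>Q. G j x) \<le> (\<Sum>j\<in>Q. \<omega> j * h)"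
      proof (rule sum_norm_le)
        fix j assume j: "j \<in> Q"
        show "norm (G j x) \<le> \<omega> j * h" using h[OF j] \<omega>(1)[OF j] by (simp add: field_simps)
      qed
      also have "\<dots> = (\<Sum>j\<in>Q. \<omega> j) * h" by (simp only: sum_distrib_right)
      also have "\<dots> \<le> S * h" by (intro mult_right_mono S h0)
      finally have "norm (\<Sum>j\<in>Q. G j x) powr P \<le> (S * h) powr P" using P by (intro powr_mono2) auto
      also have "\<dots> = S powr P * h powr P" using S(1) h0 by (subst powr_mult) auto
      also have "h powr P = \<omega> k powr (- P) * norm (G k x) powr P"
        unfolding k(2) using \<omega>(1)[OF k(1)] by (simp add: powr_divide powr_minus_divide)
      also have "\<dots> \<le> (\<Sum>j\<in>Q. \<omega> j powr (- P) * norm (G j x) powr P)"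
        by (rule member_le_sum[OF k(1)]) (use Q in auto)
      finally show ?thesis by (simp add: mult_left_mono)
    qed (use P in simp)
    have "integral torus (\<lambda>x. norm (\<Sum>j\<in>Q. G j x) powr P) \<le> integral torus (\<lambda>x. S powr P * (\<Sum>j\<in>Q. \<omega> j powr (- P) * norm (G j x) powr P))"
      by (intro torus_int_le continuous_on_norm_powr cF P continuous_on_mult_left continuous_on_sum cG ptw)
    also have "\<dots> = S powr P * (\<Sum>j\<in>Q. \<omega> j powr (- P) * integral torus (\<lambda>x. norm (G j x) powr P))"
      by (simp only: Henstock_Kurzweil_Integration.integral_mult_right, subst torus_int_sum[OF Q])
         (auto intro!: continuous_on_mult_left cG)
    also have "\<dots> \<le> S powr P * (\<Sum>j\<in>Q. \<omega> j powr P * B powr P)"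
    proof (intro mult_left_mono sum_mono)
      fix j assume j: "j \<in> Q"
      have w: "0 < \<omega> j" by (rule \<omega>(1)[OF j])
      have "\<omega> j powr (- P) * integral torus (\<lambda>x. norm (G j x) powr P) \<le> \<omega> j powr (- P) * (\<omega> j ^ 2 * B) powr P"
        by (intro mult_left_mono IG j) auto
      also have "(\<omega> j ^ 2 * B) powr P = \<omega> j powr (2 * P) * B powr P"
        using w B(1) by (simp add: powr_mult power2_powr)
      also have "\<omega> j powr (- P) * (\<omega> j powr (2 * P) * B powr P) = \<omega> j powr P * B powr P"
        by (simp add: mult.assoc[symmetric] flip: powr_add)
      finally show "\<omega> j powr (- P) * integral torus (\<lambda>x. norm (G j x) powr P) \<le> \<omega> j powr P * B powr P" .
    qed auto
    also have "\<dots> = S powr P * ((\<Sum>j\<in>Q. \<omega> j powr P) * B powr P)" by (simp only: sum_distrib_right)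
    also have "\<dots> \<le> S powr P * (S * B powr P)" by (intro mult_left_mono mult_right_mono SP) auto
    finally have "integral torus (\<lambda>x. norm (\<Sum>j\<in>Q. G j x) powr P) powr (1 / P) \<le> (S powr P * (S * B powr P)) powr (1 / P)"
      using P by (intro powr_mono2 torus_int_nonneg continuous_on_norm_powr cF) auto
    also have "\<dots> = S powr (1 + ip p) * B"
    proof -
      have "(S powr P * (S * B powr P)) powr (1 / P) = (S powr P) powr (1 / P) * (S powr (1 / P) * (B powr P) powr (1 / P))"
        using S(1) B(1) by (simp add: powr_mult)
      also have "\<dots> = S * (S powr (1 / P) * B)" using P S(1) B(1) by (simp add: powr_powr)
      also have "\<dots> = S powr (1 + ip p) * B" using S(1) by (simp add: ipP powr_add)
      finally show ?thesis .
    qed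
    finally show ?thesis unfolding Lp_norm_finite_exponent[OF p pf cF] P_def[symmetric] by (rule ennreal_leI)
  qed
qed

text \<open>Fatou's lemma for finite exponents. Pointwise convergence is all that is asked for, so
  norm bounds of partial sums pass to the limit directly.\<close>

lemma Lp_norm_limit_le:
  fixes F :: "real^'d::finite \<Rightarrow> complex"
  assumes p: "0 < p" and F: "continuous_on UNIV F" and H: "\<And>M::nat. continuous_on UNIV (H M)"
    and lim: "\<And>x. (\<lambda>M. H M x) \<longlonglongrightarrow> F x" and B: "\<And>M. Lp_norm p (H M) \<le> ennreal B" "0 \<le> B"
  shows "Lp_norm p F \<le> ennreal B"
proof (cases "p = \<infinity>")
  case True
  show ?thesis unfolding True
  proof (rule Lp_norm_infinity_le[OF F])
    fix x :: "real^'d" assume x: "x \<in> torus"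
    have "norm (H M x) \<le> B" for M
      using norm_le_Lp_norm_infinity[OF H x, of M] B True by (metis ennreal_le_iff order_trans)
    then have "norm (F x) \<le> B" by (intro tendsto_upperbound[OF tendsto_norm[OF lim]]) auto
    then show "ennreal (norm (F x)) \<le> ennreal B" by (rule ennreal_leI)
  qed
next
  case False
  then have pf: "p < \<infinity>" by (simp add: top.not_eq_extremum)
  define P where "P = enn2real p"
  have P: "0 < P" unfolding P_def by (rule finite_exponent[OF p pf])
  have c: "continuous_on UNIV (\<lambda>x. norm (K x) powr P)" if "continuous_on UNIV K" for K :: "real^'d \<Rightarrow> complex"
    by (intro continuous_on_norm_powr that P)
  have nn: "0 \<le> integral torus (\<lambda>x. norm (K x) powr P)" if "continuous_on UNIV K" for K :: "real^'d \<Rightarrow> complex"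
    by (intro torus_int_nonneg c that) auto
  have IH: "integral torus (\<lambda>x. norm (H M x) powr P) \<le> B powr P" for M
  proof -
    have "integral torus (\<lambda>x. norm (H M x) powr P) powr (1 / P) \<le> B"
      using B(1)[of M] B(2) unfolding Lp_norm_finite_exponent[OF p pf H] P_def[symmetric]
      by (subst (asm) ennreal_le_iff) auto
    then have "(integral torus (\<lambda>x. norm (H M x) powr P) powr (1 / P)) powr P \<le> B powr P"
      using P by (intro powr_mono2) auto
    then show ?thesis using P nn[OF H] by (simp add: powr_powr)
  qed
  have "(\<integral>\<^sup>+ x. ennreal (norm (F x) powr P) \<partial>lebesgue_on torus) =
     (\<integral>\<^sup>+ x. liminf (\<lambda>M. ennreal (norm (H M x) powr P)) \<partial>lebesgue_on torus)"
  proof (intro nn_integral_cong)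
    fix x
    have "(\<lambda>M. norm (H M x) powr P) \<longlonglongrightarrow> norm (F x) powr P"
      by (intro tendsto_powr' tendsto_norm lim tendsto_const) (use P in auto)
    then have "(\<lambda>M. ennreal (norm (H M x) powr P)) \<longlonglongrightarrow> ennreal (norm (F x) powr P)"
      by (intro tendsto_ennrealI)
    then show "ennreal (norm (F x) powr P) = liminf (\<lambda>M. ennreal (norm (H M x) powr P))"
      by (intro lim_imp_Liminf[symmetric]) auto
  qed
  also have "\<dots> \<le> liminf (\<lambda>M. \<integral>\<^sup>+ x. ennreal (norm (H M x) powr P) \<partial>lebesgue_on torus)"
    by (intro nn_integral_liminf measurable_compose[OF _ measurable_ennreal] continuous_borel_measurable_torus c H)
  also have "\<dots> \<le> ennreal (B powr P)"
    unfolding nn_integral_torus[OF c[OF H], simplified]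
    by (intro Liminf_le) (auto intro!: always_eventually ennreal_leI IH)
  finally have "integral torus (\<lambda>x. norm (F x) powr P) \<le> B powr P"
    unfolding nn_integral_torus[OF c[OF F], simplified] by (simp add: ennreal_le_iff)
  then have "integral torus (\<lambda>x. norm (F x) powr P) powr (1 / P) \<le> (B powr P) powr (1 / P)"
    using P nn[OF F] by (intro powr_mono2) auto
  then show ?thesis unfolding Lp_norm_finite_exponent[OF p pf F] P_def[symmetric]
    using P B(2) by (intro ennreal_leI) (simp add: powr_powr)
qed

section \<open>Transfer of weighted norms from one family of pieces to another\<close>

lemma powr_rdot: "2 powr rdot r j = (\<Prod>i\<in>UNIV. 2 powr (r $ i * real (j $ i)))"
  unfolding rdot_def by (rule powr_sum) auto

text \<open>With the gap \<open>n = j + c - m\<close> the weight at \<open>m\<close> is the weight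
  at \<open>j + c\<close> times \<open>2 powr (- s * n)\<close>, while the operator grows like
  \<open>2 powr (P * n)\<close>. The surplus \<open>s - P\<close> is at least three times
  \<epsilon>, which leaves the cube of the gap factor.\<close>

lemma besov_transfer_coordinate:
  fixes m j c :: nat
  assumes K: "0 < K" and s: "P + 3 * \<epsilon> \<le> s" and mj: "m \<le> j + c"
  shows "2 powr (s * real m) * (K * (2 ^ (j + c) / 2 ^ m) powr P)
    \<le> (K * 2 powr (s * real c)) * (2 powr (s * real j) * (2 powr (- \<epsilon> * real (j + c - m))) ^ 3)"
proof -
  define n where "n = j + c - m"
  have n: "real n = real j + real c - real m" using mj by (simp add: n_def of_nat_diff)
  have "j + c = n + m" using mj by (simp add: n_def)
  then have "(2::real) ^ (j + c) / 2 ^ m = 2 powr real n" by (simp add: power_add powr_realpow)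
  then have "2 powr (s * real m) * (K * (2 ^ (j + c) / 2 ^ m) powr P) = K * 2 powr (s * real m + P * real n)"
    by (simp add: powr_powr powr_add mult_ac)
  also have "\<dots> \<le> K * 2 powr (s * real c + s * real j - 3 * \<epsilon> * real n)"
  proof (intro mult_left_mono powr_mono)
    have "(P + 3 * \<epsilon>) * real n \<le> s * real n" by (intro mult_right_mono s) auto
    then show "s * real m + P * real n \<le> s * real c + s * real j - 3 * \<epsilon> * real n"
      unfolding n by (simp add: algebra_simps)
  qed (use K in auto)
  also have "2 powr (s * real c + s * real j - 3 * \<epsilon> * real n) = 2 powr (s * real c) * (2 powr (s * real j) * (2 powr (- \<epsilon> * real n)) ^ 3)"
    by (simp add: powr_add[symmetric] powr_power algebra_simps)
  finally show ?thesis by (simp add: n_def)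
qed

lemma besov_transfer_weight:
  fixes r :: "real^'d::finite" and m j :: "nat^'d"
  assumes K: "0 < K" and r: "\<And>i. P + 3 * \<epsilon> \<le> r $ i" and mj: "\<forall>i. m $ i \<le> j $ i + c"
  shows "2 powr rdot r m * (\<Prod>i\<in>UNIV. K * (2 ^ (j $ i + c) / 2 ^ (m $ i)) powr P)
    \<le> (\<Prod>i\<in>UNIV. K * 2 powr (r $ i * real c)) * (2 powr rdot r j * gap_weight \<epsilon> c m j ^ 3)"
  unfolding powr_rdot gap_weight_valid(1)[OF mj] prod_power_distrib prod.distrib[symmetric]
proof (rule prod_mono)
  fix i
  have "m $ i \<le> j $ i + c" using mj by blast
  moreover have "0 \<le> 2 powr (r $ i * real (m $ i)) * (K * (2 ^ (j $ i + c) / 2 ^ m $ i) powr P)" using K by simp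
  ultimately show "0 \<le> 2 powr (r $ i * real (m $ i)) * (K * (2 ^ (j $ i + c) / 2 ^ m $ i) powr P) \<and>
    2 powr (r $ i * real (m $ i)) * (K * (2 ^ (j $ i + c) / 2 ^ m $ i) powr P)
    \<le> K * 2 powr (r $ i * real c) * (2 powr (r $ i * real (j $ i)) * (2 powr (- \<epsilon> * real (j $ i + c - m $ i))) ^ 3)"
    by (intro conjI besov_transfer_coordinate K r)
qed

text \<open>The common form of both inequalities: \<open>G m j\<close> is the operator with index
  \<open>m\<close> applied to the piece with index \<open>j\<close>, \<open>a j\<close> is the norm
  of that piece, and \<open>F m\<close> is the sum of the \<open>G m j\<close> over
  \<open>j\<close>. The constant \<open>C\<close> depends on none of them.\<close>

definition transfer_bound :: "ennreal \<Rightarrow> ennreal \<Rightarrow> real^'d::finite \<Rightarrow> real \<Rightarrow> nat \<Rightarrow> real \<Rightarrow> bool" where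
  "transfer_bound p \<theta> r K c C \<longleftrightarrow> (\<forall>(F :: nat^'d \<Rightarrow> real^'d \<Rightarrow> complex) G a.
    (\<forall>m. continuous_on UNIV (F m)) \<longrightarrow> (\<forall>m j. continuous_on UNIV (G m j)) \<longrightarrow>
    (\<forall>m x. (\<lambda>M. \<Sum>j\<in>cube M. G m j x) \<longlonglongrightarrow> F m x) \<longrightarrow>
    (\<forall>m j. \<not> (\<forall>i. m $ i \<le> j $ i + c) \<longrightarrow> G m j = (\<lambda>x. 0)) \<longrightarrow>
    (\<forall>m j. (\<forall>i. m $ i \<le> j $ i + c) \<longrightarrow>
      Lp_norm p (G m j) \<le> ennreal (\<Prod>i\<in>UNIV. K * (2 ^ (j $ i + c) / 2 ^ (m $ i)) powr ip p) * a j) \<longrightarrow>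
    seq_norm \<theta> (\<lambda>m. ennreal (2 powr rdot r m) * Lp_norm p (F m)) \<le> ennreal C * seq_norm \<theta> (\<lambda>j. ennreal (2 powr rdot r j) * a j))"

lemma besov_transfer:
  fixes r :: "real^'d::finite"
  assumes p: "0 < p" and \<theta>: "0 < \<theta>" and r: "\<And>i. ip p < r $ i" and K: "0 < K"
  shows "\<exists>C>0. transfer_bound p \<theta> r K c C"
proof -
  \<comment> \<open>One third of the smallest margin. Of the three powers of
    \<open>gap_weight\<close>, two are spent in \<open>Lp_norm_finite_sum_le\<close> and one in
    \<open>seq_norm_gap_le\<close>.\<close>
  define \<epsilon> where "\<epsilon> = Min (range (\<lambda>i. r $ i - ip p)) / 3"
  have "\<forall>y\<in>range (\<lambda>i. r $ i - ip p). 0 < y" using r by auto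
  then have \<epsilon>: "0 < \<epsilon>" unfolding \<epsilon>_def by (simp add: Min_gr_iff)
  have "Min (range (\<lambda>i. r $ i - ip p)) \<le> r $ i - ip p" for i by (rule Min_le) auto
  then have r\<epsilon>: "ip p + 3 * \<epsilon> \<le> r $ i" for i unfolding \<epsilon>_def by (simp add: algebra_simps)
  \<comment> \<open>Bounds the sums of the weights and of their \<open>p\<close>-th powers. For
    infinite \<open>p\<close> the second entry is the default value 0, since
    \<open>enn2real p\<close> and hence \<open>geo_sum\<close> are 0 there, and the maximum ignores
    it.\<close>
  define S where "S = max (geo_sum \<epsilon> ^ CARD('d)) (geo_sum (\<epsilon> * enn2real p) ^ CARD('d))"
  have S: "1 \<le> S" unfolding S_def using one_le_power[OF geo_sum_ge_1[OF \<epsilon>]] by (simp add: le_max_iff_disj)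
  define K0 where "K0 = (\<Prod>i\<in>UNIV. K * 2 powr (r $ i * real c))"
  have K0: "0 < K0" unfolding K0_def using K by (intro prod_pos) auto
  define C where "C = S powr (1 + ip p) * K0"
  have C: "0 < C" unfolding C_def using S K0 by simp
  obtain C' where C': "0 < C'" and gap: "\<And>x b :: nat^'d \<Rightarrow> ennreal.
    (\<And>m. x m \<le> ennreal C * (SUP j. ennreal (gap_weight \<epsilon> c m j) * b j)) \<Longrightarrow>
    seq_norm \<theta> x \<le> ennreal C' * seq_norm \<theta> b"
    using seq_norm_gap_le[OF \<theta> \<epsilon> C, of c] by metis
  have "seq_norm \<theta> (\<lambda>m. ennreal (2 powr rdot r m) * Lp_norm p (F m)) \<le> ennreal C' * seq_norm \<theta> (\<lambda>j. ennreal (2 powr rdot r j) * a j)"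
    if F: "\<forall>m. continuous_on UNIV (F m)" and G: "\<forall>m j. continuous_on UNIV (G m j)"
      and lim: "\<forall>m x. (\<lambda>M. \<Sum>j\<in>cube M. G m j x) \<longlonglongrightarrow> F m x"
      and zero: "\<forall>m j. \<not> (\<forall>i. m $ i \<le> j $ i + c) \<longrightarrow> G m j = (\<lambda>x. 0)"
      and le: "\<forall>m j. (\<forall>i. m $ i \<le> j $ i + c) \<longrightarrow>
        Lp_norm p (G m j) \<le> ennreal (\<Prod>i\<in>UNIV. K * (2 ^ (j $ i + c) / 2 ^ (m $ i)) powr ip p) * a j"
    for F :: "nat^'d \<Rightarrow> real^'d \<Rightarrow> complex" and G :: "nat^'d \<Rightarrow> nat^'d \<Rightarrow> real^'d \<Rightarrow> complex" and a
  proof (rule gap)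
    fix m :: "nat^'d"
    define T where "T = (SUP j. ennreal (gap_weight \<epsilon> c m j) * (ennreal (2 powr rdot r j) * a j))"
    have T: "ennreal (gap_weight \<epsilon> c m j) * (ennreal (2 powr rdot r j) * a j) \<le> T" for j
      unfolding T_def by (rule SUP_upper) auto
    have "ennreal (2 powr rdot r m) * Lp_norm p (F m) \<le> ennreal C * T"
    proof (cases T)
      case (real t)
      \<comment> \<open>Finiteness of the supremum \<open>T\<close> bounds every weighted
        \<open>a j\<close> by \<open>t / gap_weight \<epsilon> c m j\<close>. Inserted into the
        cube, this leaves the square of the gap weight times the fixed number
        \<open>B\<close>.\<close>
      define B where "B = K0 * t / 2 powr rdot r m"
      have B: "0 \<le> B" unfolding B_def using K0 real by simp
      have bound: "Lp_norm p (G m j) \<le> ennreal (gap_weight \<epsilon> c m j ^ 2 * B)" if mj: "\<forall>i. m $ i \<le> j $ i + c" for j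
      proof -
        let ?g = "gap_weight \<epsilon> c m j"
        let ?\<Pi> = "\<Prod>i\<in>UNIV. K * (2 ^ (j $ i + c) / 2 ^ (m $ i)) powr ip p"
        have g: "0 < ?g" by (rule gap_weight_valid(2)[OF mj])
        obtain \<alpha> where \<alpha>: "a j = ennreal \<alpha>" "0 \<le> \<alpha>"
        proof (cases "a j")
          case top
          then have "T = top" using T[of j] g by (simp add: ennreal_mult_top top_unique)
          then show thesis using real by simp
        qed
        have "ennreal (?g * (2 powr rdot r j * \<alpha>)) \<le> ennreal t"
          using T[of j] g \<alpha> by (simp add: real ennreal_mult)
        then have t: "?g * (2 powr rdot r j * \<alpha>) \<le> t" using real by (simp add: ennreal_le_iff)
        have \<Pi>: "0 \<le> ?\<Pi>" using K by (intro prod_nonneg) auto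
        have "2 powr rdot r m * ?\<Pi> * \<alpha> \<le> K0 * (2 powr rdot r j * ?g ^ 3) * \<alpha>"
          unfolding K0_def by (intro mult_right_mono besov_transfer_weight K r\<epsilon> mj \<alpha>)
        also have "\<dots> = K0 * ?g ^ 2 * (?g * (2 powr rdot r j * \<alpha>))"
          by (simp add: power2_eq_square power3_eq_cube mult_ac)
        also have "\<dots> \<le> K0 * ?g ^ 2 * t" using K0 t by (intro mult_left_mono) auto
        finally have "?\<Pi> * \<alpha> \<le> ?g ^ 2 * B" unfolding B_def by (simp add: field_simps)
        then show ?thesis
          using le[rule_format, OF mj[rule_format]] \<Pi> \<alpha> by (auto simp: ennreal_mult[symmetric] intro: order_trans ennreal_leI)
      qed
      have "Lp_norm p (\<lambda>x. \<Sum>j\<in>cube M. G m j x) \<le> ennreal (S powr (1 + ip p) * B)" for M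
      proof -
        \<comment> \<open>The summation lemma divides by the weights, so only the indices with
          positive weight are kept; the other pieces vanish identically.\<close>
        let ?Q = "{j \<in> cube M. \<forall>i. m $ i \<le> j $ i + c}"
        have "(\<lambda>x. \<Sum>j\<in>cube M. G m j x) = (\<lambda>x. \<Sum>j\<in>?Q. G m j x)"
          by (intro ext sum.mono_neutral_right finite_cube) (use zero in auto)
        moreover have "Lp_norm p (\<lambda>x. \<Sum>j\<in>?Q. G m j x) \<le> ennreal (S powr (1 + ip p) * B)"
        proof (rule Lp_norm_finite_sum_le[OF p, where \<omega> = "gap_weight \<epsilon> c m"])
          show fin: "finite ?Q" by (rule finite_subset[OF _ finite_cube[of M]]) auto
          show "(\<Sum>j\<in>?Q. gap_weight \<epsilon> c m j) \<le> S"
            using sum_gap_weight_le(1)[OF \<epsilon> fin, of c m] by (simp add: S_def)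
          show "(\<Sum>j\<in>?Q. gap_weight \<epsilon> c m j powr enn2real p) \<le> S" if "p < \<infinity>"
          proof -
            have P: "0 < enn2real p" by (rule finite_exponent[OF p that])
            then show ?thesis unfolding gap_weight_powr[OF P]
              using sum_gap_weight_le(1)[OF mult_pos_pos[OF \<epsilon> P] fin, of c m] by (simp add: S_def)
          qed
        qed (use G S B bound \<epsilon> gap_weight_valid(2) in \<open>auto intro!: gap_weight_le_1\<close>)
        ultimately show ?thesis by simp
      qed
      then have "Lp_norm p (F m) \<le> ennreal (S powr (1 + ip p) * B)"
      proof (rule Lp_norm_limit_le[OF p, where H = "\<lambda>M x. \<Sum>j\<in>cube M. G m j x", rotated -2])
        show "0 \<le> S powr (1 + ip p) * B" using S B by simp
        show "continuous_on UNIV (\<lambda>x. \<Sum>j\<in>cube M. G m j x)" for M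
          using G by (intro continuous_on_sum) blast
      qed (use F lim in blast)+
      then have "ennreal (2 powr rdot r m) * Lp_norm p (F m) \<le> ennreal (2 powr rdot r m) * ennreal (S powr (1 + ip p) * B)"
        by (rule mult_left_mono) simp
      also have "\<dots> = ennreal (C * t)" unfolding C_def B_def using S K0 real by (simp add: ennreal_mult[symmetric])
      also have "\<dots> = ennreal C * T" using C real by (simp add: ennreal_mult)
      finally show ?thesis .
    next
      case top
      then show ?thesis using C by (simp add: ennreal_mult_top)
    qed
    then show "ennreal (2 powr rdot r m) * Lp_norm p (F m) \<le> ennreal C * (SUP j. ennreal (gap_weight \<epsilon> c m j) * (ennreal (2 powr rdot r j) * a j))"
      unfolding T_def .
  qed
  with C' show ?thesis unfolding transfer_bound_def by blast
qed

section \<open>Littlewood--Paley expansion\<close>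

lemma le_seq_norm:
  assumes "0 < \<theta>"
  shows "a j \<le> seq_norm \<theta> a"
proof (cases "\<theta> = \<infinity>")
  case True
  then show ?thesis by (simp add: seq_norm_def SUP_upper)
next
  case False
  then have t: "0 < enn2real \<theta>" using assms by (simp add: enn2real_positive_iff less_top)
  have "enn_powr (a j) (enn2real \<theta>) \<le> (\<Sum>\<^sub>\<infinity>j. enn_powr (a j) (enn2real \<theta>))"
    using sum_le_infsum_ennreal[of "{j}" "\<lambda>j. enn_powr (a j) (enn2real \<theta>)"] by simp
  then have "enn_powr (enn_powr (a j) (enn2real \<theta>)) (1 / enn2real \<theta>) \<le> seq_norm \<theta> a"
    using t False by (auto simp: seq_norm_def intro!: enn_powr_mono)
  then show ?thesis by (simp only: enn_powr_cancel[OF t])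
qed

lemma nikolskii_Lp:
  assumes p: "0 < p"
  shows "\<exists>C>0. \<forall>N (g :: real^'d::finite \<Rightarrow> complex) x. g \<in> TP N \<longrightarrow>
    ennreal (norm (g x)) \<le> ennreal (C * (\<Prod>i\<in>UNIV. real (N i) + 1) powr ip p) * Lp_norm p g"
proof (cases "p = \<infinity>")
  case True
  have "ennreal (norm (g x)) \<le> Lp_norm p g" if g: "g \<in> TP N" for N and g :: "real^'d \<Rightarrow> complex" and x
  proof -
    obtain y where y: "y \<in> torus" "g x = g y" using periodic_torus_representative[of x] TP_periodic[OF g] by blast
    then show ?thesis using norm_le_Lp_norm_infinity[OF TP_continuous[OF g] y(1)] True by simp
  qed
  moreover have "(\<Prod>i\<in>UNIV. real (N i) + 1) > 0" for N :: "'d \<Rightarrow> nat" by (intro prod_pos) auto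
  then have "1 * (\<Prod>i\<in>UNIV. real (N i) + 1) powr ip p = 1" for N :: "'d \<Rightarrow> nat"
    using True by (simp add: ip_infinity less_imp_neq[symmetric])
  ultimately show ?thesis by (intro exI[of _ 1]) simp
next
  case False
  then have pf: "p < \<infinity>" by (simp add: top.not_eq_extremum)
  define P where "P = enn2real p"
  have P: "0 < P" "ip p = 1 / P" unfolding P_def by (rule finite_exponent[OF p pf])+
  obtain C where C: "0 < C" "\<And>N g x. g \<in> TP N \<Longrightarrow> norm (g (x::real^'d)) powr P
    \<le> C * (\<Prod>i\<in>UNIV. real (N i) + 1) * integral torus (\<lambda>x. norm (g x) powr P)"
    using nikolskii_TP[OF P(1)] by metis
  have "ennreal (norm (g x)) \<le> ennreal (C powr (1 / P) * (\<Prod>i\<in>UNIV. real (N i) + 1) powr ip p) * Lp_norm p g"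
    if g: "g \<in> TP N" for N and g :: "real^'d \<Rightarrow> complex" and x
  proof -
    let ?\<Pi> = "\<Prod>i\<in>UNIV. real (N i) + 1" and ?I = "integral torus (\<lambda>x. norm (g x) powr P)"
    have \<Pi>: "0 \<le> ?\<Pi>" by (intro prod_nonneg) auto
    have I: "0 \<le> ?I" by (intro torus_int_nonneg continuous_on_norm_powr TP_continuous[OF g] P) auto
    have "(norm (g x) powr P) powr (1 / P) \<le> (C * ?\<Pi> * ?I) powr (1 / P)"
      using P by (intro powr_mono2 C(2) g) auto
    then have "norm (g x) \<le> C powr (1 / P) * ?\<Pi> powr (1 / P) * ?I powr (1 / P)"
      using P \<Pi> I C(1) by (simp add: powr_powr powr_mult)
    then show ?thesis
      unfolding Lp_norm_finite_exponent[OF p pf TP_continuous[OF g]] P_def[symmetric] P(2)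
      by (subst ennreal_mult[symmetric]) (auto intro: ennreal_leI)
  qed
  moreover have "0 < C powr (1 / P)" using C by simp
  ultimately show ?thesis by blast
qed

lemma fourier_coeff_sum:
  fixes h :: "'i \<Rightarrow> real^'d::finite \<Rightarrow> complex"
  assumes "finite A" "\<And>a. a \<in> A \<Longrightarrow> continuous_on UNIV (h a)"
  shows "fourier_coeff (\<lambda>x. \<Sum>a\<in>A. h a x) k = (\<Sum>a\<in>A. fourier_coeff (h a) k)"
proof -
  have "integral torus (\<lambda>x. (\<Sum>a\<in>A. h a x) * cis (- idot k x)) = (\<Sum>a\<in>A. integral torus (\<lambda>x. h a x * cis (- idot k x)))"
    unfolding sum_distrib_right by (intro torus_int_sum assms continuous_intros)
  then show ?thesis by (simp add: fourier_coeff_def sum_distrib_left)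
qed

lemma fourier_coeff_diff:
  fixes f g :: "real^'d::finite \<Rightarrow> complex"
  assumes "continuous_on UNIV f" "continuous_on UNIV g"
  shows "fourier_coeff (\<lambda>x. f x - g x) k = fourier_coeff f k - fourier_coeff g k"
proof -
  have "integral torus (\<lambda>x. (f x - g x) * cis (- idot k x)) =
    integral torus (\<lambda>x. f x * cis (- idot k x)) - integral torus (\<lambda>x. g x * cis (- idot k x))"
    unfolding left_diff_distrib
    by (intro Henstock_Kurzweil_Integration.integral_diff integrable_on_torus continuous_intros assms)
  then show ?thesis by (simp only: fourier_coeff_def right_diff_distrib)
qed

text \<open>Cubes eventually contain every finite set, so unordered sums over multi-indices may be
  evaluated along them.\<close>

lemma filterlim_cube: "filterlim cube (finite_subsets_at_top UNIV) sequentially"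
  unfolding filterlim_finite_subsets_at_top
proof (intro allI impI)
  fix X :: "(nat^'d) set" assume "finite X \<and> X \<subseteq> UNIV"
  then obtain M where M: "X \<subseteq> cube M" using finite_subset_cube by blast
  show "\<forall>\<^sub>F n in sequentially. finite (cube n) \<and> X \<subseteq> cube n \<and> cube n \<subseteq> UNIV"
    using eventually_ge_at_top[of M]
  proof eventually_elim
    case (elim n)
    then have "cube M \<subseteq> (cube n :: (nat^'d) set)" by (auto simp: cube_def intro: order_trans)
    then show ?case using M finite_cube by auto
  qed
qed

text \<open>The finite Besov norm gives L_p norms of order \<open>2 powr (- rdot r m)\<close>, and
  the Nikolskii inequality passes to the supremum at the cost of
  \<open>2 powr (ip p * real (m $ i))\<close> in each variable. With both lower arguments 0 the gap
  weight is simply the product of the factors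
  \<open>2 powr (- \<epsilon> * real (m $ i))\<close>.\<close>

lemma delta_sup_decay:
  fixes f :: "real^'d::finite \<Rightarrow> complex" and r :: "real^'d"
  assumes D: "level_support \<phi> D" "1 \<le> D" and p: "0 < p" and \<theta>: "0 < \<theta>" and r: "\<And>i. ip p + \<epsilon> \<le> r $ i"
    and f: "besov_norm \<phi> r p \<theta> f < \<infinity>"
  obtains E where "0 \<le> E" "\<And>m x. norm (delta \<phi> m f x) \<le> E * gap_weight \<epsilon> 0 0 m"
proof -
  obtain b where b: "besov_norm \<phi> r p \<theta> f = ennreal b" "0 \<le> b" using f by (cases "besov_norm \<phi> r p \<theta> f") auto
  obtain C where C: "0 < C" "\<And>N (g :: real^'d \<Rightarrow> complex) x. g \<in> TP N \<Longrightarrow>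
    ennreal (norm (g x)) \<le> ennreal (C * (\<Prod>i\<in>UNIV. real (N i) + 1) powr ip p) * Lp_norm p g"
    using nikolskii_Lp[OF p] by metis
  define E where "E = C * (\<Prod>i\<in>(UNIV::'d set). (2 * real D) powr ip p) * b"
  have "norm (delta \<phi> m f x) \<le> E * gap_weight \<epsilon> 0 0 m" for m x
  proof -
    let ?L = "Lp_norm p (delta \<phi> m f)" and ?R = "2 powr rdot r m"
    have R: "0 < ?R" by simp
    have "ennreal ?R * ?L \<le> ennreal b"
      using le_seq_norm[OF \<theta>, of "\<lambda>m. ennreal (2 powr rdot r m) * Lp_norm p (delta \<phi> m f)" m] b
      by (simp add: besov_norm_def)
    moreover obtain l where l: "?L = ennreal l" "0 \<le> l"
    proof (cases ?L)
      case top
      then show thesis using \<open>ennreal ?R * ?L \<le> ennreal b\<close> by (simp add: ennreal_mult_top top_unique)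
    qed
    ultimately have "?R * l \<le> b" using b by (simp add: ennreal_mult[symmetric] ennreal_le_iff)
    then have lb: "l \<le> b / ?R" by (simp add: field_simps)
    let ?\<Pi> = "\<Prod>i\<in>UNIV. real (D * 2 ^ (m $ i)) + 1"
    have "norm (delta \<phi> m f x) \<le> C * ?\<Pi> powr ip p * l"
      using C(2)[OF delta_TP[OF D(1)], of m f x] l C(1) by (simp add: ennreal_mult[symmetric] ennreal_le_iff)
    also have "\<dots> \<le> C * (\<Prod>i\<in>UNIV. 2 * real D * 2 powr real (m $ i)) powr ip p * (b / ?R)"
    proof (intro mult_mono mult_left_mono powr_mono2 lb ip_nonneg prod_mono prod_nonneg conjI)
      fix i
      have "1 \<le> real D * 2 ^ (m $ i)" using D(2) by (simp add: mult_ge1_I)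
      then show "real (D * 2 ^ (m $ i)) + 1 \<le> 2 * real D * 2 powr real (m $ i)" by (simp add: powr_realpow)
    qed (use C l in auto)
    also have "(\<Prod>i\<in>UNIV. 2 * real D * 2 powr real (m $ i)) powr ip p =
      (\<Prod>i\<in>(UNIV::'d set). (2 * real D) powr ip p) * (\<Prod>i\<in>UNIV. 2 powr (ip p * real (m $ i)))"
      by (subst prod_powr_distrib) (simp_all add: powr_mult powr_powr prod.distrib mult_ac del: prod_constant)
    also have "C * ((\<Prod>i\<in>(UNIV::'d set). (2 * real D) powr ip p) * (\<Prod>i\<in>UNIV. 2 powr (ip p * real (m $ i)))) * (b / ?R) =
      E * ((\<Prod>i\<in>UNIV. 2 powr (ip p * real (m $ i))) / ?R)"
      by (simp add: E_def)
    also have "(\<Prod>i\<in>UNIV. 2 powr (ip p * real (m $ i))) / ?R = (\<Prod>i\<in>UNIV. 2 powr (ip p * real (m $ i) - r $ i * real (m $ i)))"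
      unfolding powr_rdot prod_dividef[symmetric] powr_diff ..
    also have "E * \<dots> \<le> E * gap_weight \<epsilon> 0 0 m"
    proof (rule mult_left_mono)
      have "ip p * real (m $ i) - r $ i * real (m $ i) \<le> - \<epsilon> * real (m $ i)" for i
        using mult_right_mono[OF r, of "real (m $ i)" i] by (simp add: algebra_simps)
      then show "(\<Prod>i\<in>UNIV. 2 powr (ip p * real (m $ i) - r $ i * real (m $ i))) \<le> gap_weight \<epsilon> 0 0 m"
        unfolding gap_weight_def by (intro prod_mono conjI) auto
      show "0 \<le> E" unfolding E_def using C b by (intro mult_nonneg_nonneg prod_nonneg) auto
    qed
    finally show ?thesis .
  qed
  moreover have "0 \<le> E" unfolding E_def using C b by (intro mult_nonneg_nonneg prod_nonneg) auto
  ultimately show thesis using that by blast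
qed

text \<open>The decay just shown gives uniform convergence to some continuous periodic
  \<open>g\<close>. A Fourier coefficient of a partial sum over a cube is that of \<open>f\<close>
  times a product of partial sums of the partition of unity, which tends to 1; so \<open>g\<close>
  and \<open>f\<close> have equal coefficients and coincide.\<close>

lemma littlewood_paley_expansion:
  fixes f :: "real^'d::finite \<Rightarrow> complex" and r :: "real^'d"
  assumes adm: "admissible \<phi>" and D: "level_support \<phi> D" "1 \<le> D" and p: "0 < p" and \<theta>: "0 < \<theta>" and r: "\<And>i. ip p < r $ i"
    and f: "f \<in> besov_space \<phi> r p \<theta>"
  shows "uniform_limit UNIV (\<lambda>M x. \<Sum>m\<in>cube M. delta \<phi> m f x) f sequentially"
proof -
  have fc: "continuous_on UNIV f" and fp: "periodic_fun f" and fb: "besov_norm \<phi> r p \<theta> f < \<infinity>"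
    using f by (auto simp: besov_space_def)
  define \<epsilon> where "\<epsilon> = Min (range (\<lambda>i. r $ i - ip p))"
  have \<epsilon>: "0 < \<epsilon>" unfolding \<epsilon>_def using r by (simp add: Min_gr_iff)
  have "\<epsilon> \<le> r $ i - ip p" for i unfolding \<epsilon>_def by (rule Min_le) auto
  then have "ip p + \<epsilon> \<le> r $ i" for i by (simp add: algebra_simps)
  then obtain E where E: "0 \<le> E" "\<And>m x. norm (delta \<phi> m f x) \<le> E * gap_weight \<epsilon> 0 0 m"
    using delta_sup_decay[OF D p \<theta> _ fb] by metis
  have "gap_weight \<epsilon> 0 (0::nat^'d) summable_on UNIV"
    by (rule nonneg_bounded_partial_sums_imp_summable_on[where C = "geo_sum \<epsilon> ^ CARD('d)"])
       (simp_all add: gap_weight_nonneg eventually_finite_subsets_at_top_weakI sum_gap_weight_le(1)[OF \<epsilon>])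
  then have "(\<lambda>m. E * gap_weight \<epsilon> 0 (0::nat^'d) m) summable_on UNIV" by (rule summable_on_cmult_right)
  define g where "g = (\<lambda>x. \<Sum>\<^sub>\<infinity>m. delta \<phi> m f x)"
  have "uniform_limit UNIV (\<lambda>A x. \<Sum>m\<in>A. delta \<phi> m f x) g (finite_subsets_at_top UNIV)"
    unfolding g_def by (rule Weierstrass_m_test_general[OF E(2)]) fact
  then have lim: "uniform_limit UNIV (\<lambda>M x. \<Sum>m\<in>cube M. delta \<phi> m f x) g sequentially"
    by (rule filterlim_compose[OF _ filterlim_cube])
  have dc: "continuous_on UNIV (delta \<phi> m f)" for m by (rule TP_continuous[OF delta_TP[OF D(1)]])
  have gc: "continuous_on UNIV g"
    by (rule uniform_limit_theorem[OF _ lim]) (auto intro!: always_eventually continuous_on_sum dc)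
  have gp: "periodic_fun g"
  proof -
    have "delta \<phi> m f (x + axis i (2 * pi)) = delta \<phi> m f x" for m x i
      using TP_periodic[OF delta_TP[OF D(1)], of m f] by (simp add: periodic_fun_def)
    then show ?thesis by (simp add: periodic_fun_def g_def)
  qed
  have coeff: "fourier_coeff f k = fourier_coeff g k" for k
  proof -
    have "(\<lambda>M. fourier_coeff (\<lambda>x. \<Sum>m\<in>cube M. delta \<phi> m f x) k) \<longlonglongrightarrow> fourier_coeff g k"
    proof (rule tendstoI)
      fix e :: real assume e: "0 < e"
      have "\<forall>\<^sub>F M in sequentially. \<forall>x\<in>UNIV. dist (\<Sum>m\<in>cube M. delta \<phi> m f x) (g x) < e / 2"
        by (rule uniform_limitD[OF lim]) (use e in simp)
      then show "\<forall>\<^sub>F M in sequentially. dist (fourier_coeff (\<lambda>x. \<Sum>m\<in>cube M. delta \<phi> m f x) k) (fourier_coeff g k) < e"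
      proof eventually_elim
        case (elim M)
        have "norm (fourier_coeff (\<lambda>x. (\<Sum>m\<in>cube M. delta \<phi> m f x) - g x) k) \<le> e / 2"
          by (intro fourier_coeff_sup continuous_intros dc gc) (use elim in \<open>auto simp: dist_norm intro: less_imp_le\<close>)
        then show ?case
          using e by (subst (asm) fourier_coeff_diff) (auto simp: dist_norm intro!: continuous_on_sum dc gc)
      qed
    qed
    moreover have "fourier_coeff (\<lambda>x. \<Sum>m\<in>cube M. delta \<phi> m f x) k =
      complex_of_real (\<Prod>i\<in>UNIV. \<Sum>n\<le>M. \<phi> n (of_int (k $ i))) * fourier_coeff f k" for M
    proof -
      have "fourier_coeff (\<lambda>x. \<Sum>m\<in>cube M. delta \<phi> m f x) k = (\<Sum>m\<in>cube M. fourier_coeff (delta \<phi> m f) k)"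
        by (intro fourier_coeff_sum finite_cube dc)
      also have "\<dots> = complex_of_real (\<Sum>m\<in>cube M. \<Prod>i\<in>UNIV. \<phi> (m $ i) (of_int (k $ i))) * fourier_coeff f k"
        by (simp only: fourier_coeff_delta[OF D(1)] of_real_sum sum_distrib_right)
      finally show ?thesis by (simp only: sum_cube_prod[where f = "\<lambda>i n. \<phi> n (of_int (k $ i))"])
    qed
    moreover have "(\<lambda>M. \<Sum>n\<le>M. \<phi> n \<xi>) \<longlonglongrightarrow> 1" for \<xi>
    proof -
      have "(\<lambda>n. \<phi> n \<xi>) sums 1" using adm by (simp add: admissible_def)
      then show ?thesis by (simp add: sums_def_le)
    qed
    then have "(\<lambda>M. complex_of_real (\<Prod>i\<in>UNIV. \<Sum>n\<le>M. \<phi> n (of_int (k $ i))) * fourier_coeff f k)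
      \<longlonglongrightarrow> complex_of_real (\<Prod>i\<in>(UNIV::'d set). 1) * fourier_coeff f k"
      by (intro tendsto_intros)
    ultimately show ?thesis using LIMSEQ_unique by fastforce
  qed
  have "f x = g x" for x
  proof -
    obtain y where y: "y \<in> torus" "f x = f y" "g x = g y"
      using periodic_torus_representative[of x] fp gp by blast
    have "f y - g y = 0"
      by (rule fourier_unique_torus[OF _ _ y(1)]) (auto intro!: continuous_intros fc gc simp: fourier_coeff_diff[OF fc gc] coeff)
    then show ?thesis using y by simp
  qed
  then have "g = f" by auto
  then show ?thesis using lim by simp
qed

section \<open>Upper estimate\<close>

lemma q_norm_le_besov_norm:
  fixes r :: "real^'d::enum"
  assumes adm: "admissible \<phi>" and D: "level_support \<phi> D" "1 \<le> D" and p: "0 < p" and \<theta>: "0 < \<theta>"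
    and L: "inverse p < of_nat L" "L = 1 \<longrightarrow> p < \<infinity>" and r: "\<And>i. ip p < r $ i"
  shows "\<exists>C>0. \<forall>f\<in>besov_space \<phi> r p \<theta>. q_norm L r p \<theta> f \<le> ennreal C * besov_norm \<phi> r p \<theta> f"
proof -
  have L1: "1 \<le> L" using L(1) by (cases L) auto
  \<comment> \<open>Since \<open>D < 2 ^ D\<close>, this offset gives
    \<open>D * 2 ^ Suc L \<le> 2 ^ c\<close>. It is what the annihilation of low degrees requires,
    and it also makes \<open>2 ^ (m $ i + c)\<close> a valid degree bound for the piece with index
    \<open>m\<close>.\<close>
  define c where "c = D + Suc L"
  obtain K where K: "0 < K" "\<And>j N g. 2 ^ j \<le> N \<Longrightarrow> g \<in> tp N \<Longrightarrow> lp1 p (eta L j g) \<le> K * (real N / 2 ^ j) powr ip p * lp1 p g"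
    using eta_lp1[OF p L] by metis
  obtain C where C: "0 < C" "transfer_bound p \<theta> r K c C" using besov_transfer[OF p \<theta> r K(1)] by blast
  have "q_norm L r p \<theta> f \<le> ennreal C * besov_norm \<phi> r p \<theta> f" if f: "f \<in> besov_space \<phi> r p \<theta>" for f
    unfolding q_norm_def besov_norm_def
  \<comment> \<open>Rows are the interpolation levels \<open>j\<close> and columns the
    Littlewood-Paley levels \<open>m\<close>; the letters are interchanged compared with
    \<open>transfer_bound\<close>.\<close>
  proof (rule C(2)[unfolded transfer_bound_def, rule_format, where G = "\<lambda>j m. qL L j (delta \<phi> m f)"])
    fix j :: "nat^'d::enum"
    show "continuous_on UNIV (qL L j f)" by (rule TP_continuous[OF qL_TP[OF L1]])
    show "continuous_on UNIV (qL L j (delta \<phi> m f))" for m by (rule TP_continuous[OF qL_TP[OF L1]])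
    \<comment> \<open>The operator reads \<open>f\<close> at finitely many nodes only, so pointwise
      convergence of the expansion passes through it.\<close>
    show "(\<lambda>M. \<Sum>m\<in>cube M. qL L j (delta \<phi> m f) x) \<longlonglongrightarrow> qL L j f x" for x
    proof -
      have "(\<lambda>M. \<Sum>m\<in>cube M. delta \<phi> m f y) \<longlonglongrightarrow> f y" for y
        by (rule tendsto_uniform_limitI[OF littlewood_paley_expansion[OF adm D p \<theta> r f]]) simp
      then have "(\<lambda>M. \<Sum>v\<in>PiE UNIV (\<lambda>i. Uset (j $ i)). (\<Sum>m\<in>cube M. delta \<phi> m f (\<chi> k. node (j $ k) (v k))) *
        (\<Prod>k\<in>UNIV. eta_kernel L (j $ k) (v k) (x $ k))) \<longlonglongrightarrow> qL L j f x"
        unfolding qL_eq by (intro tendsto_intros)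
      moreover have "(\<Sum>v\<in>PiE UNIV (\<lambda>i. Uset (j $ i)). (\<Sum>m\<in>cube M. delta \<phi> m f (\<chi> k. node (j $ k) (v k))) *
        (\<Prod>k\<in>UNIV. eta_kernel L (j $ k) (v k) (x $ k))) = (\<Sum>m\<in>cube M. qL L j (delta \<phi> m f) x)" for M
        unfolding qL_eq sum_distrib_right by (rule sum.swap)
      ultimately show ?thesis by simp
    qed
    fix m :: "nat^'d::enum"
    have Dc: "D * 2 ^ Suc L \<le> 2 ^ c"
      unfolding c_def power_add by (intro mult_right_mono less_imp_le less_exp) auto
    show "qL L j (delta \<phi> m f) = (\<lambda>x. 0)" if "\<not> (\<forall>i. j $ i \<le> m $ i + c)"
    proof -
      obtain i where i: "m $ i + c < j $ i" using \<open>\<not> (\<forall>i. j $ i \<le> m $ i + c)\<close> not_le by blast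
      have "D * 2 ^ (m $ i) * 2 ^ Suc L \<le> 2 ^ (m $ i) * 2 ^ c"
        using mult_left_mono[OF Dc, of "2 ^ (m $ i)"] by (simp add: mult_ac)
      also have "\<dots> = 2 ^ (m $ i + c)" by (simp add: power_add)
      also have "\<dots> < 2 ^ (j $ i)" using i by (intro power_strict_increasing) auto
      finally show ?thesis unfolding qL_eq_eta_list
        using i by (intro eta_list_vanishes[OF L1 delta_TP[OF D(1)]]) (auto simp: set_enum distinct_enum)
    qed
    assume jm: "\<And>i. j $ i \<le> m $ i + c"
    have "D * 1 \<le> D * 2 ^ Suc L" by (intro mult_left_mono one_le_power) auto
    then have "D \<le> 2 ^ c" using Dc unfolding mult_1_right by (rule order_trans)
    then have "D * 2 ^ (m $ i) \<le> 2 ^ (m $ i + c)" for i by (simp add: power_add)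
    then have "delta \<phi> m f \<in> TP (\<lambda>i. 2 ^ (m $ i + c))" by (rule TP_mono[OF _ delta_TP[OF D(1)]])
    from Lp_norm_eta_list_le[OF p L1 K this _ distinct_enum, of "\<lambda>i. j $ i"]
    show "Lp_norm p (qL L j (delta \<phi> m f)) \<le> ennreal (\<Prod>i\<in>UNIV. K * (2 ^ (m $ i + c) / 2 ^ (j $ i)) powr ip p) * Lp_norm p (delta \<phi> m f)"
      using jm by (simp add: qL_eq_eta_list set_enum)
  qed
  with C(1) show ?thesis by blast
qed

section \<open>Interpolation on the full grid\<close>

lemma node_refine:
  assumes "a \<le> M" "u \<in> Uset a"
  shows "node a u \<in> node M ` Uset M"
  using assms
proof (induction M rule: dec_induct)
  case (step M)
  then obtain w where w: "w \<in> Uset M" "node a u = node M w" by blast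
  have "(0::int) < 2 ^ M" "M \<noteq> 0 \<Longrightarrow> (2::int) ^ M = 2 * 2 ^ (M - 1)" by (simp, cases M, auto)
  then have "2 * w \<in> Uset (Suc M)" using w(1) by (cases "M = 0") (auto simp: Uset_def)
  moreover have "node a u = node (Suc M) (2 * w)" using w(2) by (simp add: node_def)
  ultimately show ?case by blast
qed blast

lemma node_inject: "node M u = node M v \<longleftrightarrow> u = v"
  by (simp add: node_def)

text \<open>All levels up to \<open>M\<close> are written on the nodes of level \<open>M\<close>,
  with the response to a unit sample at one node as kernel. With common nodes the sum over the
  levels can be carried out for each tuple of nodes separately.\<close>

lemma eta_fine_nodes:
  assumes "a \<le> M"
  shows "eta L a g x = (\<Sum>u\<in>Uset M. g (node M u) * eta L a (\<lambda>t. if t = node M u then 1 else 0) x)"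
proof -
  have "(\<Sum>u\<in>Uset M. g (node M u) * eta L a (\<lambda>t. if t = node M u then 1 else 0) x) =
    (\<Sum>w\<in>Uset a. (\<Sum>u\<in>Uset M. g (node M u) * (if node a w = node M u then 1 else 0)) * eta_kernel L a w x)"
    unfolding eta_eq sum_distrib_left sum_distrib_right by (subst sum.swap) (simp only: mult.assoc)
  also have "\<dots> = (\<Sum>w\<in>Uset a. g (node a w) * eta_kernel L a w x)"
  proof (rule sum.cong[OF refl])
    fix w assume "w \<in> Uset a"
    then obtain z where z: "z \<in> Uset M" "node a w = node M z" using node_refine[OF assms] by blast
    have "(\<Sum>u\<in>Uset M. g (node M u) * (if node a w = node M u then 1 else 0)) = (\<Sum>u\<in>Uset M. if u = z then g (node M u) else 0)"
      by (intro sum.cong refl) (auto simp: z(2) node_inject)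
    then show "(\<Sum>u\<in>Uset M. g (node M u) * (if node a w = node M u then 1 else 0)) * eta_kernel L a w x = g (node a w) * eta_kernel L a w x"
      using z by simp
  qed
  finally show ?thesis by (simp add: eta_eq)
qed

lemma sum_eta: "(\<Sum>a\<le>M. eta L a g x) = interp L M g x"
  by (induction M) (auto simp: eta_def)

definition interp_grid :: "nat \<Rightarrow> nat \<Rightarrow> (real^'d::finite \<Rightarrow> complex) \<Rightarrow> real^'d \<Rightarrow> complex" where
  "interp_grid L M f x = (\<Sum>v\<in>PiE UNIV (\<lambda>_. Uset M). f (\<chi> k. node M (v k)) * (\<Prod>k\<in>UNIV. Kpi L M (x $ k - node M (v k))))"

text \<open>On the common grid the sum over a cube factorises, and in each variable the differences
  of consecutive interpolation operators telescope to the kernel of level \<open>M\<close>.\<close>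

lemma sum_qL:
  fixes f :: "real^'d::enum \<Rightarrow> complex"
  shows "(\<Sum>j\<in>cube M. qL L j f x) = interp_grid L M f x"
proof -
  define \<kappa> where "\<kappa> = (\<lambda>a u t. eta L a (\<lambda>t. if t = node M u then 1 else 0) t)"
  have "qL L j f x = (\<Sum>v\<in>PiE UNIV (\<lambda>_. Uset M). f (\<chi> k. node M (v k)) * (\<Prod>k\<in>UNIV. \<kappa> (j $ k) (v k) (x $ k)))"
    if "j \<in> cube M" for j
  proof -
    have "eta L (j $ i) g t = (\<Sum>v\<in>Uset M. g (node M v) * \<kappa> (j $ i) v t)" for i g t
      unfolding \<kappa>_def using that by (intro eta_fine_nodes) (simp add: cube_def)
    then have "foldr (\<lambda>i g. apply_in i (eta L (j $ i)) g) Enum.enum f x = (\<Sum>v\<in>PiE (set Enum.enum) (\<lambda>_. Uset M).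
      f (\<chi> k. if k \<in> set Enum.enum then node M (v k) else x $ k) * (\<Prod>k\<in>set Enum.enum. \<kappa> (j $ k) (v k) (x $ k)))"
      by (intro foldr_apply_in distinct_enum) auto
    then show ?thesis by (simp add: qL_def set_enum)
  qed
  then have "(\<Sum>j\<in>cube M. qL L j f x) = (\<Sum>v\<in>PiE UNIV (\<lambda>_. Uset M). f (\<chi> k. node M (v k)) * (\<Sum>j\<in>cube M. \<Prod>k\<in>UNIV. \<kappa> (j $ k) (v k) (x $ k)))"
    unfolding sum_distrib_left by (subst sum.swap) (rule sum.cong[OF refl], simp)
  also have "\<dots> = interp_grid L M f x"
    unfolding interp_grid_def
  proof (intro sum.cong refl arg_cong2[of _ _ _ _ times])
    fix v :: "'d \<Rightarrow> int" assume v: "v \<in> PiE UNIV (\<lambda>_. Uset M)"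
    have "(\<Sum>a\<le>M. \<kappa> a (v k) (x $ k)) = Kpi L M (x $ k - node M (v k))" for k
    proof -
      have "v k \<in> Uset M" using v by (auto simp: PiE_def Pi_iff)
      have "(\<Sum>a\<le>M. \<kappa> a (v k) (x $ k)) = (\<Sum>u\<in>Uset M. if u = v k then Kpi L M (x $ k - node M u) else 0)"
        unfolding \<kappa>_def sum_eta interp_eq by (intro sum.cong refl) (auto simp: node_inject)
      then show ?thesis using \<open>v k \<in> Uset M\<close> by simp
    qed
    then show "(\<Sum>j\<in>cube M. \<Prod>k\<in>UNIV. \<kappa> (j $ k) (v k) (x $ k)) = (\<Prod>k\<in>UNIV. Kpi L M (x $ k - node M (v k)))"
      using sum_cube_prod[of "\<lambda>k a. \<kappa> a (v k) (x $ k)" M] by simp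
  qed
  finally show ?thesis .
qed

section \<open>Fourier coefficients of interpolants on the full grid\<close>

lemma cis_sum: "finite S \<Longrightarrow> cis (\<Sum>i\<in>S. f i) = (\<Prod>i\<in>S. cis (f i))"
  by (induction S rule: finite_induct) (auto simp flip: cis_mult)

lemma cis_idot: "cis (idot k x) = (\<Prod>i\<in>UNIV. cis (of_int (k $ i) * x $ i))"
  by (simp add: idot_def cis_sum)

lemma norm_fourier_coeff_Kpi_prod:
  fixes t :: "'d::finite \<Rightarrow> real"
  assumes L: "1 \<le> L"
  shows "norm (fourier_coeff (\<lambda>x. \<Prod>k\<in>UNIV. Kpi L M (x $ k - t k)) l) \<le> (1 / 2 ^ M) ^ CARD('d)"
proof -
  obtain w where w: "kernel_weights L w" using kernel_weights_exists[OF L] by blast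
  define b where "b = (\<lambda>k n. 1 / 2 ^ M * complex_of_real (w M n) * cis (- (of_int n * t k)))"
  have b: "norm (b k n) \<le> 1 / 2 ^ M" for k n
    using kernel_weightsD(2,3)[OF w, of M n] by (simp add: b_def norm_mult norm_divide norm_power divide_right_mono)
  have inj: "inj_on vec_lambda (PiE UNIV (\<lambda>i::'d. {-int (2 ^ M)..int (2 ^ M)}))"
    by (rule inj_onI) (metis vec_lambda_inverse iso_tuple_UNIV_I)
  have "(\<Prod>k\<in>UNIV. Kpi L M (x $ k - t k)) = (\<Sum>l\<in>freq_box (\<lambda>_. 2 ^ M). (\<Prod>k\<in>UNIV. b k (l $ k)) * cis (idot l x))" for x :: "real^'d"
  proof -
    have "Kpi L M (x $ k - t k) = (\<Sum>n\<in>{-int (2 ^ M)..int (2 ^ M)}. b k n * cis (of_int n * x $ k))" for k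
      unfolding kernel_weightsD(1)[OF w] b_def sum_distrib_left
      by (intro sum.cong) (auto simp: right_diff_distrib mult.assoc cis_mult)
    then have "(\<Prod>k\<in>UNIV. Kpi L M (x $ k - t k)) = (\<Sum>v\<in>PiE UNIV (\<lambda>_. {-int (2 ^ M)..int (2 ^ M)}). \<Prod>k\<in>UNIV. b k (v k) * cis (of_int (v k) * x $ k))"
      by (simp only:) (subst prod_sum_PiE, auto)
    then show ?thesis
      unfolding freq_box_image by (subst sum.reindex[OF inj]) (simp add: cis_idot prod.distrib)
  qed
  then have "fourier_coeff (\<lambda>x. \<Prod>k\<in>UNIV. Kpi L M (x $ k - t k)) l = (if l \<in> freq_box (\<lambda>_. 2 ^ M) then \<Prod>k\<in>UNIV. b k (l $ k) else 0)"
    by (simp only: TP_coeff[OF finite_freq_box])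
  moreover have "norm (\<Prod>k\<in>UNIV. b k (l $ k)) \<le> (\<Prod>k\<in>(UNIV::'d set). 1 / 2 ^ M)"
    unfolding prod_norm[symmetric] by (intro prod_mono conjI b) auto
  ultimately show ?thesis by simp
qed

text \<open>Each of the \<open>(2 ^ M) ^ CARD('d)\<close> nodes contributes at most \<open>S\<close>
  divided by that number, because the kernel weights are at most 1. The bound is uniform in
  \<open>M\<close>, for \<open>L = 1\<close> as well.\<close>

lemma interp_grid_coeff_bound:
  fixes f :: "real^'d::finite \<Rightarrow> complex"
  assumes L: "1 \<le> L" and S: "\<And>x. norm (f x) \<le> S"
  shows "norm (fourier_coeff (interp_grid L M f) l) \<le> S"
proof -
  let ?V = "PiE UNIV (\<lambda>_::'d. Uset M)"
  have c: "continuous_on UNIV (\<lambda>x::real^'d. \<Prod>k\<in>UNIV. Kpi L M (x $ k - t k))" for t by (intro continuous_intros L)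
  have fin: "finite ?V" by (intro finite_PiE) auto
  have cmult: "fourier_coeff (\<lambda>x. a * h x) l = a * fourier_coeff h l" for a h
    by (simp add: fourier_coeff_def mult.assoc)
  have "fourier_coeff (interp_grid L M f) l = (\<Sum>v\<in>?V. f (\<chi> k. node M (v k)) * fourier_coeff (\<lambda>x. \<Prod>k\<in>UNIV. Kpi L M (x $ k - node M (v k))) l)"
    unfolding interp_grid_def[abs_def] by (subst fourier_coeff_sum[OF fin]) (auto simp: cmult intro!: continuous_on_mult_left c)
  also have "norm \<dots> \<le> (\<Sum>v\<in>?V. S * (1 / 2 ^ M) ^ CARD('d))"
  proof (rule sum_norm_le)
    fix v
    show "norm (f (\<chi> k. node M (v k)) * fourier_coeff (\<lambda>x. \<Prod>k\<in>UNIV. Kpi L M (x $ k - node M (v k))) l) \<le> S * (1 / 2 ^ M) ^ CARD('d)"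
      unfolding norm_mult by (intro mult_mono S norm_fourier_coeff_Kpi_prod L order_trans[OF norm_ge_zero S[of 0]] norm_ge_zero)
  qed
  also have "\<dots> = S" by (simp add: card_PiE card_Uset power_divide)
  finally show ?thesis .
qed

lemma interp_grid_reproduces:
  fixes g :: "real^'d::finite \<Rightarrow> complex"
  assumes L: "1 \<le> L" and g: "g \<in> TP N" and N: "\<And>i. N i * 2 ^ L < 2 ^ M"
  shows "interp_grid L M g = g"
proof
  fix x
  obtain w where w: "kernel_weights L w" using kernel_weights_exists[OF L] by blast
  obtain c where g: "g = (\<lambda>x. \<Sum>k\<in>freq_box N. c k * cis (idot k x))"
    using g unfolding TP_def by (blast elim: tspanE)
  have "interp_grid L M (\<lambda>x. cis (idot l x)) x = cis (idot l x)" if l: "l \<in> freq_box N" for l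
  proof -
    have "interp_grid L M (\<lambda>x. cis (idot l x)) x = (\<Prod>k\<in>UNIV. interp L M (\<lambda>t. cis (of_int (l $ k) * t)) (x $ k))"
      unfolding interp_grid_def interp_eq by (subst prod_sum_PiE) (simp_all add: cis_idot prod.distrib)
    also have "\<dots> = (\<Prod>k\<in>UNIV. cis (of_int (l $ k) * x $ k))"
    proof (intro prod.cong refl interp_cis[OF w])
      fix k
      have "\<bar>l $ k\<bar> \<le> int (N k)" using l by (simp add: freq_box_def)
      then have "\<bar>l $ k\<bar> * 2 ^ L \<le> int (N k * 2 ^ L)" by simp
      also have "\<dots> < int (2 ^ M)" by (simp only: of_nat_less_iff N)
      finally show "\<bar>l $ k\<bar> * 2 ^ L < 2 ^ M" by simp
    qed
    finally show ?thesis by (simp only: cis_idot)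
  qed
  then have "(\<Sum>l\<in>freq_box N. c l * interp_grid L M (\<lambda>x. cis (idot l x)) x) = g x"
    unfolding g by (intro sum.cong) auto
  moreover have "interp_grid L M g x = (\<Sum>l\<in>freq_box N. c l * interp_grid L M (\<lambda>x. cis (idot l x)) x)"
    unfolding g interp_grid_def sum_distrib_right sum_distrib_left by (subst sum.swap) (simp only: mult.assoc)
  ultimately show "interp_grid L M g x = g x" by simp
qed

lemma interp_grid_diff: "interp_grid L M (\<lambda>x. f x - g x) x = interp_grid L M f x - interp_grid L M g x"
  unfolding interp_grid_def by (simp add: left_diff_distrib sum_subtractf)

lemma continuous_on_interp_grid:
  fixes f :: "real^'d::finite \<Rightarrow> complex"
  assumes "1 \<le> L"
  shows "continuous_on UNIV (interp_grid L M f)"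
  unfolding interp_grid_def[abs_def] by (intro continuous_intros assms)

text \<open>A density argument: polynomials are reproduced from some level on, and the coefficients
  of the error \<open>f - g\<close> are controlled by its supremum, before and after
  interpolation.\<close>

lemma interp_grid_coeff_tendsto:
  fixes f :: "real^'d::finite \<Rightarrow> complex"
  assumes L: "1 \<le> L" and f: "continuous_on UNIV f"
    and approx: "\<And>e. 0 < e \<Longrightarrow> \<exists>N. \<exists>g\<in>TP N. \<forall>x. norm (f x - g x) \<le> e"
  shows "(\<lambda>M. fourier_coeff (interp_grid L M f) k) \<longlonglongrightarrow> fourier_coeff f k"
proof (rule tendstoI)
  fix e :: real assume e: "0 < e"
  obtain N g where g: "g \<in> TP N" and fg: "\<And>x. norm (f x - g x) \<le> e / 3"
    using approx[of "e / 3"] e by auto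
  have gc: "continuous_on UNIV g" by (rule TP_continuous[OF g])
  \<comment> \<open>A generous choice: it dominates every \<open>N i * 2 ^ L\<close>, and
    \<open>M < 2 ^ M\<close> then gives the strict inequality for all larger levels.\<close>
  define M0 where "M0 = (\<Sum>i\<in>UNIV. N i * 2 ^ L)"
  show "\<forall>\<^sub>F M in sequentially. dist (fourier_coeff (interp_grid L M f) k) (fourier_coeff f k) < e"
    using eventually_ge_at_top[of M0]
  proof eventually_elim
    case (elim M)
    have "N i * 2 ^ L < 2 ^ M" for i
    proof -
      have "N i * 2 ^ L \<le> M0" unfolding M0_def by (rule member_le_sum) auto
      also have "\<dots> < 2 ^ M" using elim less_exp[of M] by linarith
      finally show ?thesis .
    qed
    then have A: "interp_grid L M g = g" by (rule interp_grid_reproduces[OF L g])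
    have ic: "continuous_on UNIV (interp_grid L M f)" by (rule continuous_on_interp_grid[OF L])
    have "interp_grid L M (\<lambda>x. f x - g x) = (\<lambda>x. interp_grid L M f x - g x)"
      by (simp add: interp_grid_diff[abs_def] A)
    then have "norm (fourier_coeff (interp_grid L M f) k - fourier_coeff g k) \<le> e / 3"
      using interp_grid_coeff_bound[OF L, where f = "\<lambda>x. f x - g x", OF fg, where M = M and l = k] fourier_coeff_diff[OF ic gc, where k = k] by simp
    moreover have "norm (fourier_coeff f k - fourier_coeff g k) \<le> e / 3"
      unfolding fourier_coeff_diff[OF f gc, symmetric] by (intro fourier_coeff_sup[OF _ fg] continuous_intros f gc)
    ultimately have "norm ((fourier_coeff (interp_grid L M f) k - fourier_coeff g k) - (fourier_coeff f k - fourier_coeff g k)) \<le> e / 3 + e / 3"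
      by (intro norm_triangle_le_diff) simp
    then show ?case using e by (simp add: dist_norm)
  qed
qed

section \<open>Lower estimate\<close>

lemma fourier_coeff_TP_zero:
  assumes "g \<in> TP N" "k \<notin> freq_box N"
  shows "fourier_coeff g k = 0"
proof -
  obtain c where g: "g = (\<lambda>x. \<Sum>k\<in>freq_box N. c k * cis (idot k x))"
    using assms unfolding TP_def by (blast elim: tspanE)
  show ?thesis unfolding g TP_coeff[OF finite_freq_box] using assms(2) by simp
qed

text \<open>The operator depends on the finitely many Fourier coefficients in the support of its
  symbol, so convergence of the individual coefficients yields convergence at every point.\<close>

lemma delta_sum_qL_tendsto:
  fixes f :: "real^'d::enum \<Rightarrow> complex"
  assumes L: "1 \<le> L" and D: "level_support \<phi> D" and f: "continuous_on UNIV f"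
    and approx: "\<And>e. 0 < e \<Longrightarrow> \<exists>N. \<exists>g\<in>TP N. \<forall>x. norm (f x - g x) \<le> e"
  shows "(\<lambda>M. \<Sum>j\<in>cube M. delta \<phi> m (qL L j f) x) \<longlonglongrightarrow> delta \<phi> m f x"
proof -
  let ?\<phi> = "\<lambda>k. complex_of_real (\<Prod>i\<in>UNIV. \<phi> (m $ i) (real_of_int (k $ i)))"
  have "(\<lambda>M. \<Sum>k\<in>freq_box (\<lambda>i. D * 2 ^ (m $ i)). ?\<phi> k * fourier_coeff (interp_grid L M f) k * cis (idot k x)) \<longlonglongrightarrow> delta \<phi> m f x"
    unfolding delta_eq_freq_box[OF D] by (intro tendsto_intros interp_grid_coeff_tendsto L f approx)
  moreover have "(\<Sum>k\<in>freq_box (\<lambda>i. D * 2 ^ (m $ i)). ?\<phi> k * fourier_coeff (interp_grid L M f) k * cis (idot k x)) =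
    (\<Sum>j\<in>cube M. delta \<phi> m (qL L j f) x)" for M
  proof -
    have "fourier_coeff (interp_grid L M f) k = (\<Sum>j\<in>cube M. fourier_coeff (qL L j f) k)" for k
      unfolding sum_qL[symmetric, abs_def] by (intro fourier_coeff_sum finite_cube TP_continuous[OF qL_TP[OF L]])
    then show ?thesis
      unfolding delta_eq_freq_box[OF D] by (subst sum.swap) (simp only: sum_distrib_left sum_distrib_right)
  qed
  ultimately show ?thesis by simp
qed

lemma besov_norm_le_q_norm:
  fixes r :: "real^'d::enum"
  assumes adm: "admissible \<phi>" and D: "level_support \<phi> D" "1 \<le> D"
    and B: "0 < B" "\<And>m \<xi>. 1 \<le> m \<Longrightarrow> \<phi> m \<xi> \<noteq> 0 \<Longrightarrow> B * 2 ^ m \<le> \<bar>\<xi>\<bar>"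
    and p: "0 < p" and \<theta>: "0 < \<theta>" and L: "1 \<le> L" and r: "\<And>i. ip p < r $ i"
  shows "\<exists>C>0. \<forall>f\<in>besov_space \<phi> r p \<theta>. besov_norm \<phi> r p \<theta> f \<le> ennreal C * q_norm L r p \<theta> f"
proof -
  obtain K where K: "0 < K" "\<forall>(m::nat^'d::enum) N g. g \<in> TP N \<longrightarrow> (\<forall>i. 2 ^ (m $ i) \<le> N i) \<longrightarrow>
    Lp_norm p (delta \<phi> m g) \<le> ennreal (\<Prod>i\<in>UNIV. K * (real (N i) / 2 ^ (m $ i)) powr ip p) * Lp_norm p g"
    using Lp_norm_delta_le[OF adm p, where 'd = 'd] by (elim exE conjE)
  \<comment> \<open>For \<open>m $ i > j $ i + c\<close> the lower edge
    \<open>B * 2 ^ (m $ i)\<close> of the symbol lies above the degree \<open>2 ^ (j $ i)\<close> of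
    the interpolated piece. Such an \<open>m $ i\<close> is at least 1, so the lower support bound
    applies to it.\<close>
  obtain c where c: "1 / B < 2 ^ c" using real_arch_pow[of 2 "1 / B"] by auto
  obtain C where C: "0 < C" "transfer_bound p \<theta> r K c C" using besov_transfer[OF p \<theta> r K(1)] by blast
  have "besov_norm \<phi> r p \<theta> f \<le> ennreal C * q_norm L r p \<theta> f" if f: "f \<in> besov_space \<phi> r p \<theta>" for f
    unfolding q_norm_def besov_norm_def
  proof (rule C(2)[unfolded transfer_bound_def, rule_format, where G = "\<lambda>m j. delta \<phi> m (qL L j f)"])
    fix m :: "nat^'d::enum"
    show "continuous_on UNIV (delta \<phi> m f)" by (rule TP_continuous[OF delta_TP[OF D(1)]])
    show "continuous_on UNIV (delta \<phi> m (qL L j f))" for j by (rule TP_continuous[OF delta_TP[OF D(1)]])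
    show "(\<lambda>M. \<Sum>j\<in>cube M. delta \<phi> m (qL L j f) x) \<longlonglongrightarrow> delta \<phi> m f x" for x
    proof (rule delta_sum_qL_tendsto[OF L D(1)])
      show "continuous_on UNIV f" using f by (simp add: besov_space_def)
      fix e :: real assume "0 < e"
      from uniform_limitD[OF littlewood_paley_expansion[OF adm D p \<theta> r f] this]
      obtain M where M: "\<And>x. dist (\<Sum>m\<in>cube M. delta \<phi> m f x) (f x) < e"
        by (auto simp: eventually_sequentially)
      \<comment> \<open>The approximating polynomials are the partial sums of the expansion; over a
        cube they share the degree bound \<open>D * 2 ^ M\<close> in every variable.\<close>
      have "(\<lambda>x. \<Sum>m\<in>cube M. delta \<phi> m f x) \<in> TP (\<lambda>i. D * 2 ^ M)"
        by (intro TP_sum TP_mono[OF _ delta_TP[OF D(1)]]) (auto simp: cube_def)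
      then show "\<exists>N. \<exists>g\<in>TP N. \<forall>x. norm (f x - g x) \<le> e"
        using M by (auto simp: dist_norm norm_minus_commute intro!: exI bexI less_imp_le)
    qed
    fix j :: "nat^'d::enum"
    have q: "qL L j f \<in> TP (\<lambda>i. 2 ^ (j $ i))" by (rule qL_TP[OF L])
    show "delta \<phi> m (qL L j f) = (\<lambda>x. 0)" if "\<not> (\<forall>i. m $ i \<le> j $ i + c)"
    proof -
      obtain i where i: "j $ i + c < m $ i" using \<open>\<not> (\<forall>i. m $ i \<le> j $ i + c)\<close> not_le by blast
      have "complex_of_real (\<Prod>i\<in>UNIV. \<phi> (m $ i) (real_of_int (k $ i))) * fourier_coeff (qL L j f) k = 0" for k
      proof (cases "k \<in> freq_box (\<lambda>i. 2 ^ (j $ i))")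
        case True
        have "\<phi> (m $ i) (real_of_int (k $ i)) = 0"
        proof (rule ccontr)
          assume "\<phi> (m $ i) (real_of_int (k $ i)) \<noteq> 0"
          then have "B * 2 ^ (m $ i) \<le> \<bar>real_of_int (k $ i)\<bar>" using B(2)[of "m $ i"] i by auto
          also have "\<dots> \<le> 2 ^ (j $ i)"
          proof -
            have "\<bar>k $ i\<bar> \<le> 2 ^ (j $ i)" using True by (simp add: freq_box_def)
            then have "real_of_int \<bar>k $ i\<bar> \<le> real_of_int (2 ^ (j $ i))" by (simp only: of_int_le_iff)
            then show ?thesis by simp
          qed
          also have "\<dots> < 2 ^ (j $ i) * (B * 2 ^ c)" using c B(1) by (simp add: field_simps)
          also have "\<dots> = B * 2 ^ (j $ i + c)" by (simp add: power_add mult_ac)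
          also have "\<dots> \<le> B * 2 ^ (m $ i)" using i B(1) by (intro mult_left_mono power_increasing) auto
          finally show False by simp
        qed
        then have "(\<Prod>i\<in>UNIV. \<phi> (m $ i) (real_of_int (k $ i))) = 0" by (intro prod_zero) auto
        then show ?thesis by simp
      qed (simp add: fourier_coeff_TP_zero[OF q])
      then show ?thesis unfolding delta_eq_freq_box[OF D(1)] by (simp only: mult_zero_left sum.neutral_const)
    qed
    assume mj: "\<And>i. m $ i \<le> j $ i + c"
    have "qL L j f \<in> TP (\<lambda>i. 2 ^ (j $ i + c))" by (rule TP_mono[OF _ q]) (rule power_increasing, auto)
    from K(2)[rule_format, OF this, of m]
    show "Lp_norm p (delta \<phi> m (qL L j f)) \<le> ennreal (\<Prod>i\<in>UNIV. K * (2 ^ (j $ i + c) / 2 ^ (m $ i)) powr ip p) * Lp_norm p (qL L j f)"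
      using mj by simp
  qed
  with C(1) show ?thesis by blast
qed

theorem theorem5p2:
  fixes \<phi> :: "nat \<Rightarrow> real \<Rightarrow> real" and p \<theta> :: ennreal and L :: nat
    and r :: "real^'d::enum"
  assumes "admissible \<phi>"
    and "0 < p" and "0 < \<theta>"
    and "inverse p < of_nat L"
    and "L = 1 \<longrightarrow> p < \<infinity>"
    and "\<forall>i. inverse p < ennreal (r $ i)"
  shows "\<exists>c C :: real. 0 < c \<and> 0 < C \<and>
           (\<forall>f \<in> besov_space \<phi> r p \<theta>.
              ennreal c * besov_norm \<phi> r p \<theta> f \<le> q_norm L r p \<theta> f \<and>
              q_norm L r p \<theta> f \<le> ennreal C * besov_norm \<phi> r p \<theta> f)"
proof -
  have L: "1 \<le> L" using assms(4) by (cases L) auto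
  obtain D B where D: "1 \<le> D" and B: "0 < B"
    and "\<And>m \<xi>. \<phi> m \<xi> \<noteq> 0 \<Longrightarrow> \<bar>\<xi>\<bar> \<le> real D * 2 ^ m"
    and low: "\<And>m \<xi>. 1 \<le> m \<Longrightarrow> \<phi> m \<xi> \<noteq> 0 \<Longrightarrow> B * 2 ^ m \<le> \<bar>\<xi>\<bar>"
    by (rule admissible_support[OF assms(1)]) blast
  then have supp: "level_support \<phi> D" by (simp add: level_support_def)
  have r: "ip p < r $ i" for i
  proof (cases "inverse p")
    case (real x)
    then show ?thesis using assms(6)[rule_format, of i] by (simp add: ip_def ennreal_less_iff)
  next
    case top
    then show ?thesis using assms(6)[rule_format, of i] by simp
  qed
  obtain C where C: "0 < C" "\<forall>f\<in>besov_space \<phi> r p \<theta>. q_norm L r p \<theta> f \<le> ennreal C * besov_norm \<phi> r p \<theta> f"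
    using q_norm_le_besov_norm[OF assms(1) supp D assms(2-5) r] by blast
  obtain c where c: "0 < c" "\<forall>f\<in>besov_space \<phi> r p \<theta>. besov_norm \<phi> r p \<theta> f \<le> ennreal c * q_norm L r p \<theta> f"
    using besov_norm_le_q_norm[OF assms(1) supp D B low assms(2,3) L r] by blast
  have "ennreal (1 / c) * besov_norm \<phi> r p \<theta> f \<le> q_norm L r p \<theta> f" if "f \<in> besov_space \<phi> r p \<theta>" for f
  proof -
    have "ennreal (1 / c) * besov_norm \<phi> r p \<theta> f \<le> ennreal (1 / c) * (ennreal c * q_norm L r p \<theta> f)"
      using c(2) that by (intro mult_left_mono) auto
    also have "\<dots> = q_norm L r p \<theta> f" using c(1) by (simp add: mult.assoc[symmetric] flip: ennreal_mult)
    finally show ?thesis .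
  qed
  then show ?thesis using C c(1) by (intro exI[of _ "1 / c"] exI[of _ C]) auto
qed

end
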